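(* Let $I\subset\mathbb{R}$ be an interval, let $e:I\to\mathbb{R}$ be a continuous, strictly increasing, convex function which is twice continuously differentiable with $e''>0$ on the interior of $I$, and let $\ell:e(I)\to I$ be its inverse function. Assume that the function $\ell'/\ell''$ is convex (on the interior of $e(I)$). Let $f$ be a continuous function defined on a cube $\underline{I}=I_1\times\cdots\times I_n$ in $\mathbb{R}^n$ (each $I_i$ an interval) which is $\ell$-convex. Let $A_1,\dots,A_n$ be mutually commuting $C^*$-subalgebras of a $C^*$-algebra $A$ and let $\tau$ be a tracial state on $A$. Then the function $$(x_1,\dots,x_n)\mapsto \tau\bigl(f(x_1,\dots,x_n)\bigr),$$ defined on $n$-tuples with $x_i\in (A_i)_{\mathrm{sa}}^{I_i}$ for each $i$, is also $\ell$-convex on $\bigoplus_{i=1}^n (A_i)_{\mathrm{sa}}^{I_i}$. If moreover $\ell'/\ell''$ is homogeneous and $f\ge 0$, the result holds for any densely defined, lower semi-continuous trace $\tau$ on $A$.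
   Context: A function $f$ on a convex set is $\ell$-convex if it takes values in $e(I)$ and $f=e\circ g$ for some convex function $g$ with values in $I$; equivalently, $\ell\circ f$ is convex. Thus the conclusion says that $\underline{x}\mapsto \ell(\tau(f(\underline{x})))$ is convex; when $\tau$ is unbounded, $\tau(f(\underline{x}))$ may be infinite, and $\ell$ at endpoints of its domain (including $+\infty$) is understood as the corresponding limit in $[-\infty,\infty]$. Homogeneous means $(\ell'/\ell'')(st)=s\,(\ell'/\ell'')(t)$ for all $s>0$, i.e. the domain of $\ell'/\ell''$ is a half-axis and $\ell'(t)/\ell''(t)=\gamma t$ for some non-zero number $\gamma$. $A$ is a $C^*$-algebra of operators on a Hilbert space. Mutually commuting means $ab=ba$ for all $a\in A_i$, $b\in A_j$, $i\neq j$. $(A_i)_{\mathrm{sa}}^{I_i}$ is the set of self-adjoint elements of $A_i$ with spectrum contained in $I_i$, and $\bigoplus_i (A_i)_{\mathrm{sa}}^{I_i}$ is the convex set of $n$-tuples $\underline{x}=(x_1,\dots,x_n)$ with $x_i\in (A_i)_{\mathrm{sa}}^{I_i}$. If $E_i$ is the spectral measure of $x_i$ and $E$ the product spectral measure on $\underline{I}$, $E(S_1\times\cdots\times S_n)=E_1(S_1)\cdots E_n(S_n)$, then $f(\underline{x})=\int f\,dE$, regarded as an element of $A$. A trace on $A$ is an additive, positively homogeneous functional $\tau:A_+\to[0,\infty]$ with $\tau(x^*x)=\tau(xx^* )$ for all $x\in A$; it is densely defined if it is finite on a dense subset of $A_+$. A tracial state is a trace with $\tau(\mathbf{1})=1$.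 *)

theory Defs
  imports "HOL-Analysis.Analysis"
begin

section \<open>Complex Hilbert spaces and bounded operators\<close>

text \<open>
  The norm, metric and topology are those of the underlying real inner product space, whose inner
  product is the real part of the complex one. The complex inner product is linear in its first
  argument.
\<close>

class complex_hilbert_space = real_inner + complete_space +
  fixes scaleC :: "complex \<Rightarrow> 'a \<Rightarrow> 'a" (infixr "*\<^sub>C" 75)
    and cinner :: "'a \<Rightarrow> 'a \<Rightarrow> complex"
  assumes scaleC_add_right: "c *\<^sub>C (x + y) = c *\<^sub>C x + c *\<^sub>C y"
    and scaleC_add_left: "(c + d) *\<^sub>C x = c *\<^sub>C x + d *\<^sub>C x"
    and scaleC_scaleC: "c *\<^sub>C d *\<^sub>C x = (c * d) *\<^sub>C x"
    and scaleC_of_real: "complex_of_real r *\<^sub>C x = r *\<^sub>R x"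
    and cinner_add_left: "cinner (x + y) z = cinner x z + cinner y z"
    and cinner_scaleC_left: "cinner (c *\<^sub>C x) y = c * cinner x y"
    and cinner_commute: "cinner x y = cnj (cinner y x)"
    and inner_eq_Re_cinner: "inner x y = Re (cinner x y)"

text \<open>
  Operators are elements of the real Banach space of bounded real-linear maps; the bounded
  complex-linear ones are singled out by a predicate. The operator norm is the same either way.
\<close>

type_synonym 'h op = "'h \<Rightarrow>\<^sub>L 'h"

definition clinear_op :: "'h::complex_hilbert_space op \<Rightarrow> bool" where
  "clinear_op a \<longleftrightarrow> (\<forall>c v. a (c *\<^sub>C v) = c *\<^sub>C a v)"

definition scaleC_op :: "complex \<Rightarrow> 'h::complex_hilbert_space op \<Rightarrow> 'h op" where
  "scaleC_op c a = Blinfun (\<lambda>v. c *\<^sub>C a v)"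

definition adj :: "'h::complex_hilbert_space op \<Rightarrow> 'h op" where
  "adj a = (THE b :: 'h op. \<forall>u v. cinner (a u) v = cinner u (b v))"

definition selfadjoint :: "'h::complex_hilbert_space op \<Rightarrow> bool" where
  "selfadjoint a \<longleftrightarrow> clinear_op a \<and> adj a = a"

definition positive_op :: "'h::complex_hilbert_space op \<Rightarrow> bool" where
  "positive_op a \<longleftrightarrow> selfadjoint a \<and> (\<forall>v. 0 \<le> Re (cinner (a v) v))"

definition spectrum :: "'h::complex_hilbert_space op \<Rightarrow> complex set" where
  "spectrum a = {z. \<not> (\<exists>b. clinear_op b \<and>
     b o\<^sub>L (a - scaleC_op z id_blinfun) = id_blinfun \<and>
     (a - scaleC_op z id_blinfun) o\<^sub>L b = id_blinfun)}"


section \<open>Concrete C*-algebras and traces\<close>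

definition cstar_algebra :: "'h::complex_hilbert_space op set \<Rightarrow> bool" where
  "cstar_algebra A \<longleftrightarrow>
     (\<forall>a\<in>A. clinear_op a) \<and> 0 \<in> A \<and>
     (\<forall>a\<in>A. \<forall>b\<in>A. a + b \<in> A \<and> a o\<^sub>L b \<in> A) \<and>
     (\<forall>a\<in>A. \<forall>c. scaleC_op c a \<in> A) \<and>
     (\<forall>a\<in>A. adj a \<in> A) \<and>
     closed A"

definition positive_part :: "'h::complex_hilbert_space op set \<Rightarrow> 'h op set" where
  "positive_part A = {a \<in> A. positive_op a}"

definition trace_on :: "'h::complex_hilbert_space op set \<Rightarrow> ('h op \<Rightarrow> ennreal) \<Rightarrow> bool" where
  "trace_on A \<tau> \<longleftrightarrow>
     (\<forall>a\<in>positive_part A. \<forall>b\<in>positive_part A. \<tau> (a + b) = \<tau> a + \<tau> b) \<and>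
     (\<forall>a\<in>positive_part A. \<forall>r\<ge>0. \<tau> (r *\<^sub>R a) = ennreal r * \<tau> a) \<and>
     (\<forall>a\<in>A. \<tau> (adj a o\<^sub>L a) = \<tau> (a o\<^sub>L adj a))"

text \<open>
  A unital algebra is represented on the Hilbert space so that its unit is the identity operator.
\<close>

definition tracial_state :: "'h::complex_hilbert_space op set \<Rightarrow> ('h op \<Rightarrow> ennreal) \<Rightarrow> bool" where
  "tracial_state A \<tau> \<longleftrightarrow> trace_on A \<tau> \<and> id_blinfun \<in> A \<and> \<tau> id_blinfun = 1"

definition densely_defined :: "'h::complex_hilbert_space op set \<Rightarrow> ('h op \<Rightarrow> ennreal) \<Rightarrow> bool" where
  "densely_defined A \<tau> \<longleftrightarrow> positive_part A \<subseteq> closure {a \<in> positive_part A. \<tau> a < \<infinity>}"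

definition lower_semicontinuous :: "'h::complex_hilbert_space op set \<Rightarrow> ('h op \<Rightarrow> ennreal) \<Rightarrow> bool" where
  "lower_semicontinuous A \<tau> \<longleftrightarrow>
     (\<forall>r. closedin (top_of_set (positive_part A)) {a \<in> positive_part A. \<tau> a \<le> r})"

text \<open>
  The real-linear extension of a trace to the differences of positive elements of finite trace.
  By additivity the value does not depend on the decomposition. For a tracial state the extension
  is defined on all self-adjoint elements of the algebra.
\<close>

definition trace_sa :: "'h::complex_hilbert_space op set \<Rightarrow> ('h op \<Rightarrow> ennreal) \<Rightarrow> 'h op \<Rightarrow> real" where
  "trace_sa A \<tau> a = (THE r. \<exists>b\<in>positive_part A. \<exists>c\<in>positive_part A.
     a = b - c \<and> \<tau> b < \<infinity> \<and> \<tau> c < \<infinity> \<and> r = enn2real (\<tau> b) - enn2real (\<tau> c))"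


section \<open>Spectral measures and functions of several commuting operators\<close>

text \<open>
  Projection-valued Borel measures. The value on non-Borel sets is fixed to be 0 so that a
  spectral measure is uniquely determined as a function on all sets.
\<close>

definition proj_measure ::
    "('a::topological_space set \<Rightarrow> 'h::complex_hilbert_space op) \<Rightarrow> bool" where
  "proj_measure E \<longleftrightarrow>
     (\<forall>S. S \<notin> sets borel \<longrightarrow> E S = 0) \<and>
     (\<forall>S\<in>sets borel. selfadjoint (E S) \<and> E S o\<^sub>L E S = E S) \<and>
     E UNIV = id_blinfun \<and>
     (\<forall>S\<in>sets borel. \<forall>T\<in>sets borel. E (S \<inter> T) = E S o\<^sub>L E T) \<and>
     (\<forall>F::nat \<Rightarrow> 'a set. range F \<subseteq> sets borel \<longrightarrow> disjoint_family F \<longrightarrow>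
        (\<forall>v. (\<lambda>k. E (F k) v) sums E (\<Union>k. F k) v))"

definition scalar_measure ::
    "('a::topological_space set \<Rightarrow> 'h::complex_hilbert_space op) \<Rightarrow> 'h \<Rightarrow> 'a measure" where
  "scalar_measure E v = measure_of UNIV (sets borel) (\<lambda>S. ennreal (Re (cinner (E S v) v)))"

text \<open>
  The operator \<open>T\<close> is the integral of the real function \<open>f\<close> over \<open>S\<close> with respect to \<open>E\<close>. On a
  complex Hilbert space an operator is determined by its quadratic form.
\<close>

definition has_proj_integral ::
    "('a::topological_space set \<Rightarrow> 'h::complex_hilbert_space op) \<Rightarrow> 'a set \<Rightarrow> ('a \<Rightarrow> real)
      \<Rightarrow> 'h op \<Rightarrow> bool" where
  "has_proj_integral E S f T \<longleftrightarrow> clinear_op T \<and>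
     (\<forall>v. set_integrable (scalar_measure E v) S f \<and>
          cinner (T v) v = complex_of_real (LINT t:S|scalar_measure E v. f t))"

definition spectral_measure :: "'h::complex_hilbert_space op \<Rightarrow> real set \<Rightarrow> 'h op" where
  "spectral_measure x = (THE E. proj_measure E \<and> (\<exists>r. E {-r..r} = id_blinfun) \<and>
     has_proj_integral E UNIV (\<lambda>t. t) x)"

text \<open>
  The product is taken along every enumeration \<open>ks\<close> of the index type, because operator
  composition is not a commutative monoid; the projections involved commute.
\<close>

definition is_product_measure ::
    "('n::finite \<Rightarrow> real set \<Rightarrow> 'h::complex_hilbert_space op) \<Rightarrow> ((real^'n) set \<Rightarrow> 'h op) \<Rightarrow> bool" where
  "is_product_measure Es E \<longleftrightarrow> proj_measure E \<and>
     (\<forall>S ks. (\<forall>i. S i \<in> sets borel) \<longrightarrow> distinct ks \<longrightarrow> set ks = UNIV \<longrightarrow>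
        E {t. \<forall>i. t $ i \<in> S i} = foldr (o\<^sub>L) (map (\<lambda>i. Es i (S i)) ks) id_blinfun)"

definition joint_spectral_measure ::
    "('h::complex_hilbert_space op)^'n::finite \<Rightarrow> (real^'n) set \<Rightarrow> 'h op" where
  "joint_spectral_measure x = (THE E. is_product_measure (\<lambda>i. spectral_measure (x $ i)) E)"

definition cube :: "('n::finite \<Rightarrow> real set) \<Rightarrow> (real^'n) set" where
  "cube Is = {t. \<forall>i. t $ i \<in> Is i}"

text \<open>
  The operator $f(x_1,\dots,x_n)$ for a function \<open>f\<close> on \<open>cube Is\<close>; the values of \<open>f\<close> elsewhere are
  irrelevant.
\<close>

definition fun_op ::
    "('n::finite \<Rightarrow> real set) \<Rightarrow> (real^'n \<Rightarrow> real) \<Rightarrow> ('h::complex_hilbert_space op)^'n \<Rightarrow> 'h op" where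
  "fun_op Is f x = (THE T. has_proj_integral (joint_spectral_measure x) (cube Is) f T)"

definition sa_tuples ::
    "('n::finite \<Rightarrow> 'h::complex_hilbert_space op set) \<Rightarrow> ('n \<Rightarrow> real set) \<Rightarrow> ('h op^'n) set" where
  "sa_tuples As Is = {x. \<forall>i. x $ i \<in> As i \<and> selfadjoint (x $ i) \<and>
     spectrum (x $ i) \<subseteq> complex_of_real ` Is i}"


section \<open>\<open>\<ell>\<close>-convexity\<close>

definition l_convex_on ::
    "real set \<Rightarrow> (real \<Rightarrow> real) \<Rightarrow> 'a::real_vector set \<Rightarrow> ('a \<Rightarrow> real) \<Rightarrow> bool" where
  "l_convex_on I e S f \<longleftrightarrow>
     (\<exists>g. convex_on S g \<and> g ` S \<subseteq> I \<and> (\<forall>x\<in>S. f x = e (g x)))"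

text \<open>
  Convexity of extended-real functions. In \<^typ>\<open>ereal\<close> one has \<open>\<infinity> + (- \<infinity>) = \<infinity>\<close> and \<open>0 * \<infinity> = 0\<close>,
  so this is convexity of the epigraph.
\<close>

definition ereal_convex_on :: "'a::real_vector set \<Rightarrow> ('a \<Rightarrow> ereal) \<Rightarrow> bool" where
  "ereal_convex_on S F \<longleftrightarrow> convex S \<and>
     (\<forall>x\<in>S. \<forall>y\<in>S. \<forall>u\<ge>0. \<forall>v\<ge>0. u + v = 1 \<longrightarrow>
        F (u *\<^sub>R x + v *\<^sub>R y) \<le> ereal u * F x + ereal v * F y)"

text \<open>
  Extension of \<open>l\<close>, a monotone function on the interval \<open>J\<close>, to the endpoints of \<open>J\<close> in
  $[-\infty,\infty]$ by its limits there.
\<close>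

definition ext_endpoints :: "real set \<Rightarrow> (real \<Rightarrow> real) \<Rightarrow> ereal \<Rightarrow> ereal" where
  "ext_endpoints J l t = (if t \<in> ereal ` J then ereal (l (real_of_ereal t))
     else Lim (at t within ereal ` J) (\<lambda>s. ereal (l (real_of_ereal s))))"

definition ereal_l_convex_on ::
    "real set \<Rightarrow> (real \<Rightarrow> real) \<Rightarrow> 'a::real_vector set \<Rightarrow> ('a \<Rightarrow> ereal) \<Rightarrow> bool" where
  "ereal_l_convex_on J l S F \<longleftrightarrow>
     F ` S \<subseteq> closure (ereal ` J) \<and> ereal_convex_on S (\<lambda>x. ext_endpoints J l (F x))"

definition homogeneous_on :: "real set \<Rightarrow> (real \<Rightarrow> real) \<Rightarrow> bool" where
  "homogeneous_on D q \<longleftrightarrow> D \<noteq> {} \<and> (\<forall>s>0. \<forall>t\<in>D. s * t \<in> D \<and> q (s * t) = s * q t)"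

end

theory Submission
  imports Defs
begin

text \<open>
  Write \<open>q = \<ell>' / \<ell>''\<close>, so that \<open>q (e t) = - e'(t)^2 / e''(t)\<close>. By convexity of \<open>q\<close> and the Cauchy-Schwarz
  inequality, the map taking \<open>(s_k)\<close> to \<open>\<ell> (\<Sum>k. w_k e(s_k))\<close> is convex for all probability weights \<open>w\<close>, and for
  all positive weights if \<open>q\<close> is linear.

  The trace is compared with such sums as follows. Let \<open>Z = u X + v Y\<close> and let the squares of the
  functions \<open>g_p\<close> form a fine partition of unity on a box containing all spectra. The positive functionals
  \<open>T \<mapsto> \<tau> (g_p(Z) T g_p(Z))\<close> have masses \<open>w_p\<close> and barycentres \<open>a_p\<close> of \<open>X\<close>, \<open>b_p\<close> of \<open>Y\<close>, hence \<open>u a_p + v b_p\<close> of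
  \<open>Z\<close>. The last point is close to \<open>p\<close>, so \<open>\<tau> (f(Z))\<close> is nearly \<open>\<Sum>p. w_p f(u a_p + v b_p)\<close>, while Jensen's
  inequality and the trace property give \<open>\<Sum>p. w_p f(a_p) \<le> \<tau> (f(X))\<close>, and likewise for \<open>Y\<close>. If \<open>\<tau>\<close> is not
  finite, \<open>g_p\<close> is multiplied by a cut-off \<open>\<omega>\<close> such that \<open>\<omega>(Z)^2\<close> has finite trace, and \<open>\<omega>\<close> is removed by
  lower semicontinuity.

  The operators \<open>f(X)\<close>, defined by spectral integrals, agree with a continuous functional calculus that
  is obtained from the positivity of Bernstein sums; the joint spectral measure then comes from the Riesz
  representation theorem.
\<close>

section \<open>Bounded operators on a complex Hilbert space\<close>

text \<open>The obstacle is that \<open>X\<close>, \<open>Y\<close> and \<open>Z\<close> do not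
  commute with one another, so no joint spectral decomposition carries all three. What they share is
  linear: every positive functional has barycentres for all of them, and these satisfy the relation
  between the operators. Localising in \<open>Z\<close> alone makes the estimate for
  \<open>Z\<close> nearly exact, while for \<open>X\<close> and \<open>Y\<close> a one-sided
  estimate suffices. Nonnegativity of \<open>f\<close> is essential to that estimate, because the
  trace property moves a square root of \<open>f(X)\<close> across \<open>g_p(Z)\<close>. For a
  tracial state it is achieved by adding a constant, which total mass one makes harmless. In the
  scalar inequality let \<open>y\<close> be the weighted sum along a segment. Convexity of
  \<open>\<ell> y\<close> means \<open>y'^2 \<le> - q(y) y''\<close>, whereas Cauchy-Schwarz gives
  \<open>y'^2 \<le> (\<Sum>k. w_k (- q(y_k))) y''\<close>; convexity of \<open>q\<close> is exactly
  the comparison of the two factors. If the trace is not normalised, the total weight is arbitrary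
  and the comparison holds because \<open>q\<close> is linear on its half-axis. On the negative
  half-axis a nonnegative \<open>f\<close> vanishes.\<close>

instance complex_hilbert_space \<subseteq> banach ..

lemma inner_scaleC_left:
  fixes u v :: "'h::complex_hilbert_space"
  shows "inner (c *\<^sub>C u) v = inner u (cnj c *\<^sub>C v)"
proof -
  have "cinner (c *\<^sub>C u) v = cinner u (cnj c *\<^sub>C v)"
    by (subst (2) cinner_commute) (simp add: cinner_scaleC_left cinner_commute[of v u])
  then show ?thesis by (simp add: inner_eq_Re_cinner)
qed

text \<open>Lets the development work with the real inner product throughout; identities for the
  complex one are recovered by inserting \<open>\<i> *\<^sub>C v\<close>.\<close>

lemma cinner_eq_Complex:
  fixes u v :: "'h::complex_hilbert_space"
  shows "cinner u v = Complex (inner u v) (inner u (\<i> *\<^sub>C v))"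
proof -
  have "cinner u (\<i> *\<^sub>C v) = - \<i> * cinner u v"
    by (subst cinner_commute) (simp add: cinner_scaleC_left cinner_commute[of v u])
  then show ?thesis by (simp add: inner_eq_Re_cinner complex_eq_iff)
qed

text \<open>\<open>Blinfun\<close> is meaningful only for bounded linear maps, so the scaling law
  \<open>norm (c *\<^sub>C w) = cmod c * norm w\<close> has to come first.\<close>

lemma scaleC_op_apply: "blinfun_apply (scaleC_op c a) v = c *\<^sub>C blinfun_apply a v"
  for a :: "'h::complex_hilbert_space op"
proof -
  have n: "norm (c *\<^sub>C w) = cmod c * norm w" for w :: 'h
  proof -
    have "inner (c *\<^sub>C w) (c *\<^sub>C w) = inner w ((cnj c * c) *\<^sub>C w)"
      by (simp add: inner_scaleC_left scaleC_scaleC)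
    also have "cnj c * c = complex_of_real ((cmod c)^2)"
      by (metis complex_norm_square mult.commute)
    finally have "(norm (c *\<^sub>C w))^2 = (cmod c * norm w)^2"
      by (simp add: scaleC_of_real power2_norm_eq_inner power_mult_distrib)
    then show ?thesis by (simp add: power2_eq_iff_nonneg)
  qed
  have "bounded_linear (\<lambda>w. c *\<^sub>C w :: 'h)"
  proof (rule bounded_linear_intro[where K = "cmod c"])
    fix x y :: 'h and r :: real
    show "c *\<^sub>C (x + y) = c *\<^sub>C x + c *\<^sub>C y" by (rule scaleC_add_right)
    show "c *\<^sub>C r *\<^sub>R x = r *\<^sub>R c *\<^sub>C x"
      by (simp add: scaleC_of_real[symmetric] scaleC_scaleC mult.commute)
    show "norm (c *\<^sub>C x) \<le> norm x * cmod c" by (simp add: n)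
  qed
  then have "bounded_linear (\<lambda>w. c *\<^sub>C a w)"
    by (rule bounded_linear_compose) (rule blinfun.bounded_linear_right)
  then show ?thesis by (simp add: scaleC_op_def bounded_linear_Blinfun_apply)
qed

text \<open>For the representing vector \<open>w\<close> one has
  \<open>J u = (norm (u - w))^2 - (norm w)^2\<close>, so \<open>w\<close> is sought as the minimiser
  of \<open>J\<close>. The parallelogram law at the midpoint makes minimising sequences
  Cauchy.\<close>

lemma riesz_representation:
  fixes f :: "'h::{real_inner,complete_space} \<Rightarrow> real"
  assumes f: "bounded_linear f"
  shows "\<exists>w. \<forall>u. f u = inner u w"
proof -
  interpret f: bounded_linear f by fact
  define J where "J u = (norm u)^2 - 2 * f u" for u
  obtain k where k: "\<And>u. norm (f u) \<le> norm u * k" using f.bounded by blast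
  have lb: "- (k^2) \<le> J u" for u
  proof -
    have "f u \<le> norm u * k" using k[of u] by simp
    moreover have "0 \<le> (norm u - k)^2" by simp
    ultimately show ?thesis by (simp add: J_def power2_eq_square algebra_simps)
  qed
  define d where "d = (INF u. J u)"
  have bdd: "bdd_below (range J)" by (rule bdd_belowI2[OF lb])
  have d: "d \<le> J u" for u unfolding d_def by (rule cINF_lower[OF bdd]) simp
  have par: "(norm (u - v))^2 \<le> 2 * J u + 2 * J v - 4 * d" for u v
  proof -
    have "d \<le> J ((1/2) *\<^sub>R (u + v))" by (rule d)
    also have "\<dots> = (norm (u+v))^2 / 4 - f u - f v"
      by (simp add: J_def power_mult_distrib power2_eq_square f.scaleR f.add add_divide_distrib)
    finally have "4 * d \<le> (norm (u+v))^2 - 4 * f u - 4 * f v" by simp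
    moreover have "(norm (u+v))^2 + (norm (u-v))^2 = 2 * (norm u)^2 + 2 * (norm v)^2"
      by (simp add: power2_norm_eq_inner inner_add inner_diff inner_commute)
    ultimately show ?thesis by (simp add: J_def)
  qed
  define q where "q n = inverse (real (Suc n))" for n
  have q: "q \<longlonglongrightarrow> 0" "\<And>n. 0 < q n" "\<And>m n. m \<le> n \<Longrightarrow> q n \<le> q m"
    using LIMSEQ_inverse_real_of_nat by (auto simp: q_def[abs_def] field_simps)
  have "\<exists>u. J u < d + q n" for n
    using cInf_lessD[of "range J" "d + q n"] q(2)[of n] unfolding d_def by auto
  then obtain U where U: "\<And>n. J (U n) < d + q n" by metis
  have "Cauchy U"
  proof (rule CauchyI)
    fix e :: real assume e: "0 < e"
    then have "0 < e^2 / 4" by simp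
    from order_tendstoD(2)[OF q(1) this] obtain N where N: "q N < e^2 / 4"
      by (auto simp: eventually_sequentially)
    show "\<exists>M. \<forall>m\<ge>M. \<forall>n\<ge>M. norm (U m - U n) < e"
    proof (intro exI allI impI)
      fix m n assume "N \<le> m" "N \<le> n"
      then have "q m \<le> q N" "q n \<le> q N" by (auto intro: q(3))
      then have "(norm (U m - U n))^2 < e^2" using par[of "U m" "U n"] U[of m] U[of n] N by linarith
      then show "norm (U m - U n) < e" using e by (simp add: power_less_imp_less_base)
    qed
  qed
  then obtain w where w: "U \<longlonglongrightarrow> w" using Cauchy_convergent[of U] by (auto simp: convergent_def)
  have Jw: "J w \<le> d"
  proof (rule LIMSEQ_le)
    show "(\<lambda>n. J (U n)) \<longlonglongrightarrow> J w" unfolding J_def by (intro tendsto_intros f.tendsto w)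
    show "(\<lambda>n. d + q n) \<longlonglongrightarrow> d" using tendsto_add[OF tendsto_const q(1), of d] by simp
    show "\<exists>N. \<forall>n\<ge>N. J (U n) \<le> d + q n" using U less_imp_le by blast
  qed
  have "f u = inner u w" for u
  proof (rule ccontr)
    assume ne: "f u \<noteq> inner u w"
    define c where "c = f u - inner u w"
    have c: "c \<noteq> 0" using ne by (simp add: c_def)
    then have nu: "norm u \<noteq> 0" by (auto simp: c_def f.zero)
    \<comment> \<open>The minimiser of the quadratic \<open>t^2 * (norm u)^2 - 2 * t * c\<close>,
      whose minimum \<open>- c^2 / (norm u)^2\<close> would be strictly negative.\<close>
    define t where "t = c / (norm u)^2"
    have "J w \<le> J (w + t *\<^sub>R u)" using Jw d[of "w + t *\<^sub>R u"] by simp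
    also have "J (w + t *\<^sub>R u) = J w + t^2 * (norm u)^2 - 2 * t * c"
      unfolding J_def c_def power2_norm_eq_inner
      by (simp add: inner_add f.add f.scaleR inner_commute power2_eq_square[of t] algebra_simps)
    finally have "2 * t * c \<le> t^2 * (norm u)^2" by simp
    also have "\<dots> = c^2 / (norm u)^2" using nu by (simp add: t_def power2_eq_square)
    finally have "c^2 / (norm u)^2 \<le> 0" by (simp add: t_def power2_eq_square)
    moreover have "0 < c^2 / (norm u)^2" using c nu by simp
    ultimately show False by linarith
  qed
  then show ?thesis by blast
qed

text \<open>The device by which operators are produced from forms, both for adjoints and for weak
  limits.\<close>

lemma bilinear_form_representation:
  fixes B :: "'h::{real_inner,complete_space} \<Rightarrow> 'h \<Rightarrow> real"
  assumes B: "bounded_bilinear B"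
  shows "\<exists>b::'h \<Rightarrow>\<^sub>L 'h. \<forall>u v. B u v = inner u (b v)"
proof -
  interpret B: bounded_bilinear B by fact
  have "\<exists>w. \<forall>u. B u v = inner u w" for v
    by (rule riesz_representation) (rule B.bounded_linear_left)
  then obtain b where b: "\<And>u v. B u v = inner u (b v)" by metis
  obtain k where k: "\<And>u v. norm (B u v) \<le> norm u * norm v * k" and K0: "0 \<le> k"
    using B.nonneg_bounded by blast
  have "bounded_linear b"
  proof (rule bounded_linear_intro[where K = k])
    fix x y :: 'h and r :: real
    have "inner u (b (x + y)) = inner u (b x + b y)" for u
      by (simp add: inner_add b[symmetric] B.add_right)
    then show "b (x + y) = b x + b y" by (metis inner_commute vector_eq_rdot)
    have "inner u (b (r *\<^sub>R x)) = inner u (r *\<^sub>R b x)" for u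
      by (simp add: b[symmetric] B.scaleR_right)
    then show "b (r *\<^sub>R x) = r *\<^sub>R b x" by (metis inner_commute vector_eq_rdot)
    have "norm (b x) * norm (b x) = B (b x) x" by (simp add: b dot_square_norm power2_eq_square)
    also have "\<dots> \<le> norm (b x) * (norm x * k)" using k[of "b x" x] by (simp add: mult.assoc)
    finally show "norm (b x) \<le> norm x * k"
      using K0 by (cases "norm (b x) = 0") (simp_all add: mult_le_cancel_left_pos)
  qed
  then show ?thesis using b by (metis bounded_linear_Blinfun_apply)
qed

lemmas blinfun_compose_linear =
  bounded_bilinear.add_left[OF bounded_bilinear_blinfun_compose]
  bounded_bilinear.add_right[OF bounded_bilinear_blinfun_compose]
  bounded_bilinear.diff_left[OF bounded_bilinear_blinfun_compose]
  bounded_bilinear.diff_right[OF bounded_bilinear_blinfun_compose]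
  bounded_bilinear.scaleR_left[OF bounded_bilinear_blinfun_compose]
  bounded_bilinear.scaleR_right[OF bounded_bilinear_blinfun_compose]
  bounded_bilinear.sum_left[OF bounded_bilinear_blinfun_compose]
  bounded_bilinear.sum_right[OF bounded_bilinear_blinfun_compose]
  bounded_bilinear.minus_left[OF bounded_bilinear_blinfun_compose]
  bounded_bilinear.minus_right[OF bounded_bilinear_blinfun_compose]
  bounded_bilinear.zero_left[OF bounded_bilinear_blinfun_compose]
  bounded_bilinear.zero_right[OF bounded_bilinear_blinfun_compose]

lemma clinear_op_scaleC: "clinear_op a \<Longrightarrow> a (c *\<^sub>C v) = c *\<^sub>C a v" for a :: "'h::complex_hilbert_space op"
  by (simp add: clinear_op_def)

lemma clinear_op_simps [simp]:
  fixes a b :: "'h::complex_hilbert_space op"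
  shows "clinear_op (0::'h op)" "clinear_op (id_blinfun::'h op)"
    "clinear_op a \<Longrightarrow> clinear_op b \<Longrightarrow> clinear_op (a + b)"
    "clinear_op a \<Longrightarrow> clinear_op b \<Longrightarrow> clinear_op (a - b)"
    "clinear_op a \<Longrightarrow> clinear_op b \<Longrightarrow> clinear_op (a o\<^sub>L b)"
    "clinear_op a \<Longrightarrow> clinear_op (r *\<^sub>R a)"
    "clinear_op a \<Longrightarrow> clinear_op (- a)"
proof -
  have z: "c *\<^sub>C 0 = (0::'h)" for c
    using scaleC_add_right[of c "0::'h" 0] by simp
  have m: "c *\<^sub>C (- v) = - (c *\<^sub>C v)" for c and v :: 'h
    using scaleC_add_right[of c v "- v"] z by (simp add: eq_neg_iff_add_eq_0 add.commute)
  have d: "c *\<^sub>C (u - v) = c *\<^sub>C u - c *\<^sub>C v" for c and u v :: 'h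
    using scaleC_add_right[of c u "- v"] m by simp
  have r: "c *\<^sub>C (r *\<^sub>R v) = r *\<^sub>R c *\<^sub>C v" for c r and v :: 'h
    by (simp add: scaleC_of_real[symmetric] scaleC_scaleC mult.commute)
  show "clinear_op (0::'h op)" "clinear_op (id_blinfun::'h op)" by (auto simp: clinear_op_def z)
  show "clinear_op (r *\<^sub>R a)" "clinear_op (- a)" if "clinear_op a"
    using that by (auto simp: clinear_op_def blinfun.scaleR_left blinfun.minus_left r m)
  show "clinear_op (a + b)" "clinear_op (a - b)" "clinear_op (a o\<^sub>L b)" if "clinear_op a" "clinear_op b"
    using that by (auto simp: clinear_op_def blinfun.add_left blinfun.diff_left scaleC_add_right d)
qed

lemma inner_ext: "(\<And>w. inner u w = inner v w) \<Longrightarrow> u = v" for u v :: "'h::real_inner"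
  by (metis vector_eq_rdot inner_commute)

lemma cinner_ext: "(\<And>w. cinner w u = cinner w v) \<Longrightarrow> u = v" for u v :: "'h::complex_hilbert_space"
  by (rule inner_ext) (metis inner_commute inner_eq_Re_cinner)

text \<open>The real identity already forces the complex one: the imaginary part is the real
  identity at \<open>\<i> *\<^sub>C v\<close>, and \<open>b\<close> commutes with that
  factor.\<close>

lemma adj_eqI:
  fixes a b :: "'h::complex_hilbert_space op"
  assumes b: "clinear_op b" and ab: "\<And>u v. inner (a u) v = inner u (b v)"
  shows "adj a = b"
  unfolding adj_def
proof (rule the_equality)
  show c: "\<forall>u v. cinner (a u) v = cinner u (b v)"
    using ab by (simp add: cinner_eq_Complex) (metis b clinear_op_scaleC)
  fix b' :: "'h op" assume b': "\<forall>u v. cinner (a u) v = cinner u (b' v)"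
  show "b' = b"
    by (rule blinfun_eqI, rule cinner_ext) (metis b' c)
qed

lemma inner_adj_right:
  fixes a :: "'h::complex_hilbert_space op"
  assumes a: "clinear_op a"
  shows "inner (a u) v = inner u (adj a v)" "clinear_op (adj a)"
proof -
  have "bounded_bilinear (\<lambda>u v. inner (a u) v)"
    by (rule bounded_bilinear.comp1[OF bounded_bilinear_inner blinfun.bounded_linear_right])
  then obtain b :: "'h op" where b: "\<And>u v. inner (a u) v = inner u (b v)"
    using bilinear_form_representation by blast
  have cb: "clinear_op b"
    unfolding clinear_op_def
  proof (intro allI, rule inner_ext)
    fix c v w
    have "inner (b (c *\<^sub>C v)) w = inner (a w) (c *\<^sub>C v)" by (simp add: b inner_commute)
    also have "\<dots> = inner (cnj c *\<^sub>C a w) v" by (simp add: inner_scaleC_left)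
    also have "\<dots> = inner (cnj c *\<^sub>C w) (b v)" by (simp add: b[symmetric] clinear_op_scaleC[OF a])
    also have "\<dots> = inner (c *\<^sub>C b v) w" by (simp add: inner_scaleC_left[of "cnj c" w] inner_commute[of w])
    finally show "inner (b (c *\<^sub>C v)) w = inner (c *\<^sub>C b v) w" .
  qed
  have "adj a = b" by (rule adj_eqI[OF cb b])
  then show "inner (a u) v = inner u (adj a v)" "clinear_op (adj a)" using b cb by auto
qed

lemma selfadjoint_iff:
  fixes a :: "'h::complex_hilbert_space op"
  shows "selfadjoint a \<longleftrightarrow> clinear_op a \<and> (\<forall>u v. inner (a u) v = inner u (a v))"
  unfolding selfadjoint_def using adj_eqI[of a a] inner_adj_right[of a] by metis

lemma selfadjointD:
  fixes a :: "'h::complex_hilbert_space op"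
  assumes "selfadjoint a" shows "clinear_op a" "inner (a u) v = inner u (a v)"
  using assms by (auto simp: selfadjoint_iff)

text \<open>The imaginary part \<open>inner (a v) (\<i> *\<^sub>C v)\<close> equals its own
  negative.\<close>

lemma cinner_selfadjoint:
  fixes a :: "'h::complex_hilbert_space op"
  assumes a: "selfadjoint a"
  shows "cinner (a v) v = complex_of_real (inner (a v) v)"
proof -
  have "inner (a v) (\<i> *\<^sub>C v) = inner v (\<i> *\<^sub>C a v)"
    using selfadjointD[OF a] by (simp add: clinear_op_scaleC)
  also have "\<dots> = inner (a v) (cnj \<i> *\<^sub>C v)" by (metis inner_commute inner_scaleC_left)
  also have "cnj \<i> *\<^sub>C v = - (\<i> *\<^sub>C v)"
    using scaleC_add_left[of \<i> "- \<i>" v] scaleC_of_real[of 0 v] by (simp add: eq_neg_iff_add_eq_0 add.commute)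
  finally have "inner (a v) (\<i> *\<^sub>C v) = 0" by simp
  then show ?thesis by (simp add: cinner_eq_Complex complex_eq_iff)
qed

lemma positive_op_iff:
  fixes a :: "'h::complex_hilbert_space op"
  shows "positive_op a \<longleftrightarrow> selfadjoint a \<and> (\<forall>v. 0 \<le> inner (a v) v)"
  by (simp add: positive_op_def inner_eq_Re_cinner)

lemma selfadjoint_simps [simp]:
  fixes a b :: "'h::complex_hilbert_space op"
  shows "selfadjoint (0::'h op)" "selfadjoint (id_blinfun::'h op)"
    "selfadjoint a \<Longrightarrow> selfadjoint b \<Longrightarrow> selfadjoint (a + b)"
    "selfadjoint a \<Longrightarrow> selfadjoint b \<Longrightarrow> selfadjoint (a - b)"
    "selfadjoint a \<Longrightarrow> selfadjoint (r *\<^sub>R a)"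
    "selfadjoint a \<Longrightarrow> selfadjoint (- a)"
  by (auto simp: selfadjoint_iff blinfun.add_left blinfun.diff_left blinfun.scaleR_left blinfun.minus_left
      inner_add inner_diff)

lemma selfadjoint_sum [simp]:
  fixes a :: "'i \<Rightarrow> 'h::complex_hilbert_space op"
  shows "(\<And>i. i \<in> J \<Longrightarrow> selfadjoint (a i)) \<Longrightarrow> selfadjoint (\<Sum>i\<in>J. a i)"
  by (induction J rule: infinite_finite_induct) auto

lemma selfadjoint_compose:
  fixes a b :: "'h::complex_hilbert_space op"
  assumes "selfadjoint a" "selfadjoint b" "a o\<^sub>L b = b o\<^sub>L a"
  shows "selfadjoint (a o\<^sub>L b)"
proof -
  have "a (b u) = b (a u)" for u using assms(3) by (metis blinfun_apply_blinfun_compose)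
  then show ?thesis using assms(1,2) by (auto simp: selfadjoint_iff)
qed

lemma selfadjoint_limit:
  fixes a :: "nat \<Rightarrow> 'h::complex_hilbert_space op"
  assumes a: "\<And>n. selfadjoint (a n)" and l: "a \<longlonglongrightarrow> b"
  shows "selfadjoint b"
proof -
  have lim: "(\<lambda>n. a n u) \<longlonglongrightarrow> b u" for u
    by (intro blinfun.tendsto l tendsto_const)
  have sym: "inner (b u) v = inner u (b v)" for u v
  proof (rule LIMSEQ_unique)
    show "(\<lambda>n. inner (a n u) v) \<longlonglongrightarrow> inner (b u) v" by (intro tendsto_intros lim)
    show "(\<lambda>n. inner (a n u) v) \<longlonglongrightarrow> inner u (b v)"
      using selfadjointD(2)[OF a] by simp (intro tendsto_intros lim)
  qed
  have "clinear_op b"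
    unfolding clinear_op_def
  proof (intro allI, rule inner_ext)
    fix c v w
    have "(\<lambda>n. inner (a n v) (cnj c *\<^sub>C w)) \<longlonglongrightarrow> inner (b v) (cnj c *\<^sub>C w)" by (intro tendsto_intros lim)
    moreover have "(\<lambda>n. inner (a n v) (cnj c *\<^sub>C w)) = (\<lambda>n. inner (a n (c *\<^sub>C v)) w)"
      using selfadjointD(1)[OF a] by (simp add: clinear_op_scaleC inner_scaleC_left)
    moreover have "(\<lambda>n. inner (a n (c *\<^sub>C v)) w) \<longlonglongrightarrow> inner (b (c *\<^sub>C v)) w" by (intro tendsto_intros lim)
    ultimately have "inner (b v) (cnj c *\<^sub>C w) = inner (b (c *\<^sub>C v)) w" by (metis LIMSEQ_unique)
    then show "inner (b (c *\<^sub>C v)) w = inner (c *\<^sub>C b v) w" by (simp add: inner_scaleC_left)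
  qed
  with sym show ?thesis by (simp add: selfadjoint_iff)
qed

lemma inner_polarization:
  fixes a :: "'h::complex_hilbert_space op"
  assumes a: "selfadjoint a"
  shows "inner (a u) v = (inner (a (u + v)) (u + v) - inner (a (u - v)) (u - v)) / 4"
proof -
  have "inner (a v) u = inner (a u) v" using selfadjointD(2)[OF a, of v u] by (simp add: inner_commute)
  then show ?thesis by (simp add: blinfun.add_right blinfun.diff_right inner_add inner_diff)
qed

lemma selfadjoint_eqI:
  fixes a b :: "'h::complex_hilbert_space op"
  assumes "selfadjoint a" "selfadjoint b" "\<And>v. inner (a v) v = inner (b v) v"
  shows "a = b"
  by (rule blinfun_eqI, rule inner_ext) (metis inner_polarization assms)

text \<open>Polarisation is applied to \<open>u\<close> and to the multiple \<open>v\<close> of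
  \<open>a u\<close> that has the length of \<open>u\<close>; the parallelogram law then bounds
  \<open>norm u * norm (a u)\<close> by \<open>c * (norm u)^2\<close>.\<close>

lemma norm_selfadjoint_le:
  fixes a :: "'h::complex_hilbert_space op"
  assumes a: "selfadjoint a" and b: "\<And>v. \<bar>inner (a v) v\<bar> \<le> c * (norm v)^2" and c: "0 \<le> c"
  shows "norm a \<le> c"
proof (rule norm_blinfun_bound[OF c])
  fix u
  show "norm (a u) \<le> c * norm u"
  proof (cases "norm (a u) = 0 \<or> norm u = 0")
    case True then show ?thesis using c by auto
  next
    case False
    define v where "v = (norm u / norm (a u)) *\<^sub>R a u"
    have nv: "norm v = norm u" using False by (simp add: v_def)
    have "norm u * norm (a u) = inner (a u) v"
      using False by (simp add: v_def dot_square_norm power2_eq_square)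
    also have "inner (a u) v \<le> (c * (norm (u+v))^2 + c * (norm (u-v))^2) / 4"
      unfolding inner_polarization[OF a, of u v] using b[of "u+v"] b[of "u-v"] by simp
    also have "(norm (u+v))^2 = 2 * (norm u)^2 + 2 * (norm v)^2 - (norm (u-v))^2"
      by (simp add: power2_norm_eq_inner inner_add inner_diff inner_commute)
    finally have "norm u * norm (a u) \<le> norm u * (c * norm u)"
      by (simp add: nv power2_eq_square algebra_simps)
    then show ?thesis using False by (simp add: mult_le_cancel_left_pos)
  qed
qed

text \<open>Square roots are not yet available. The recursion \<open>s (n+1) = s n - (s n)^2\<close>
  keeps every \<open>s n\<close> between 0 and 1 and telescopes to the strong expansion of
  \<open>a\<close> as the sum of the squares \<open>(s j)^2\<close>. Hence the form of
  \<open>b a\<close> is the sum of the nonnegative numbers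
  \<open>inner (b (s j v)) (s j v)\<close>.\<close>

lemma positive_compose_aux:
  fixes a b :: "'h::complex_hilbert_space op"
  assumes a: "positive_op a" and b: "positive_op b" and ab: "a o\<^sub>L b = b o\<^sub>L a"
    and a1: "\<And>v. inner (a v) v \<le> (norm v)^2"
  shows "0 \<le> inner (b (a v)) v"
proof -
  define s where "s = rec_nat a (\<lambda>_ t. t - (t o\<^sub>L t))"
  have s0: "s 0 = a" and sS: "s (Suc n) = s n - (s n o\<^sub>L s n)" for n by (auto simp: s_def)
  have inv: "selfadjoint (s n) \<and> (\<forall>u. b (s n u) = s n (b u)) \<and>
     (\<forall>v. 0 \<le> inner (s n v) v \<and> inner (s n v) v \<le> (norm v)^2)" for n
  proof (induction n)
    case 0
    then show ?case using a a1 ab unfolding s0 positive_op_iff by (metis blinfun_apply_blinfun_compose)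
  next
    case (Suc n)
    let ?s = "s n"
    have sa: "selfadjoint ?s" and cm: "\<And>u. b (?s u) = ?s (b u)"
      and p: "\<And>v. 0 \<le> inner (?s v) v" "\<And>v. inner (?s v) v \<le> (norm v)^2" using Suc by auto
    note sy = selfadjointD(2)[OF sa]
    have q: "inner (s (Suc n) v) v = inner (?s v) v - (norm (?s v))^2" for v
      by (simp add: sS blinfun.diff_left inner_diff sy power2_norm_eq_inner)
    have "0 \<le> inner (s (Suc n) v) v" for v
    proof -
      \<comment> \<open>The identity \<open>s (1 - s)^2 + s^2 (1 - s) = s - s^2\<close>, in which
        both summands on the left are nonnegative.\<close>
      have "inner (?s (v - ?s v)) (v - ?s v) + ((norm (?s v))^2 - inner (?s (?s v)) (?s v))
         = inner (?s v) v - (norm (?s v))^2"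
        by (simp add: blinfun.diff_right inner_diff sy power2_norm_eq_inner inner_commute)
      then show ?thesis using p(1)[of "v - ?s v"] p(2)[of "?s v"] q[of v] by linarith
    qed
    moreover have "inner (s (Suc n) v) v \<le> (norm v)^2" for v
      using q[of v] p(2)[of v] zero_le_power2[of "norm (?s v)"] by linarith
    moreover have "selfadjoint (s (Suc n))" unfolding sS by (intro selfadjoint_simps selfadjoint_compose sa) simp
    moreover have "b (s (Suc n) u) = s (Suc n) (b u)" for u
      by (simp add: sS blinfun.diff_left blinfun.diff_right cm)
    ultimately show ?case by blast
  qed
  note sy = selfadjointD(2)[OF conjunct1[OF inv]]
  have sum: "(\<Sum>j<n. (norm (s j v))^2) = inner (a v) v - inner (s n v) v" for n
    by (induction n) (auto simp: s0 sS blinfun.diff_left inner_diff sy power2_norm_eq_inner)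
  have sumb: "(\<Sum>j<n. inner (b (s j v)) (s j v)) = inner (b (a v)) v - inner (b (s n v)) v" for n
  proof (induction n)
    case (Suc n)
    have "inner (b (s n v)) (s n v) = inner (b (s n (s n v))) v"
      using inv[of n] by (metis selfadjointD(2))
    then show ?case using Suc by (simp add: sS blinfun.diff_left blinfun.diff_right inner_diff)
  qed (simp add: s0)
  have "summable (\<lambda>j. (norm (s j v))^2)"
    by (rule bounded_imp_summable[where B = "inner (a v) v"]) (use sum[of "Suc _"] inv in \<open>auto simp: lessThan_Suc_atMost\<close>)
  then have "(\<lambda>j. (norm (s j v))^2) \<longlonglongrightarrow> 0" by (rule summable_LIMSEQ_zero)
  then have "(\<lambda>j. norm (s j v)) \<longlonglongrightarrow> 0"
    using tendsto_real_sqrt by fastforce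
  then have s0lim: "(\<lambda>j. s j v) \<longlonglongrightarrow> 0" by (simp add: tendsto_norm_zero_iff)
  have "(\<lambda>j. inner (b (a v)) v - inner (b (s j v)) v) \<longlonglongrightarrow> inner (b (a v)) v - inner (b 0) v"
    by (intro tendsto_intros blinfun.tendsto s0lim)
  moreover have "0 \<le> inner (b (a v)) v - inner (b (s j v)) v" for j
    unfolding sumb[symmetric] using b by (auto simp: positive_op_iff intro!: sum_nonneg)
  ultimately show ?thesis by (simp add: LIMSEQ_le_const)
qed

lemma inner_op_le_norm:
  fixes a :: "'h::real_inner \<Rightarrow>\<^sub>L 'h"
  shows "\<bar>inner (a v) v\<bar> \<le> norm a * (norm v)^2"
proof -
  have "\<bar>inner (a v) v\<bar> \<le> norm (a v) * norm v" by (rule Cauchy_Schwarz_ineq2)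
  also have "\<dots> \<le> norm a * norm v * norm v" by (intro mult_right_mono norm_blinfun) auto
  finally show ?thesis by (simp add: power2_eq_square mult.assoc)
qed

lemma positive_op_compose:
  fixes a b :: "'h::complex_hilbert_space op"
  assumes a: "positive_op a" and b: "positive_op b" and ab: "a o\<^sub>L b = b o\<^sub>L a"
  shows "positive_op (a o\<^sub>L b)"
proof -
  \<comment> \<open>Normalises \<open>a\<close> so that its form is at most that of the identity;
    the summand 1 covers \<open>a = 0\<close>.\<close>
  define r where "r = inverse (norm a + 1)"
  have "0 < norm a + 1" by (simp add: add_nonneg_pos)
  then have r: "0 < r" "r * norm a \<le> 1" by (auto simp: r_def field_simps)
  have pr: "positive_op (r *\<^sub>R a)" using a r by (auto simp: positive_op_iff blinfun.scaleR_left)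
  have "inner ((r *\<^sub>R a) v) v \<le> (norm v)^2" for v
  proof -
    have "inner (a v) v \<le> norm a * (norm v)^2" using inner_op_le_norm[of a v] by linarith
    then have "r * inner (a v) v \<le> (r * norm a) * (norm v)^2" using r by (simp add: mult.assoc)
    also have "\<dots> \<le> 1 * (norm v)^2" by (intro mult_right_mono r) auto
    finally show ?thesis by (simp add: blinfun.scaleR_left)
  qed
  moreover have "(r *\<^sub>R a) o\<^sub>L b = b o\<^sub>L (r *\<^sub>R a)"
    using ab by (simp add: blinfun_compose_linear)
  ultimately have "0 \<le> inner (b ((r *\<^sub>R a) v)) v" for v by (intro positive_compose_aux[OF pr b])
  then have "0 \<le> inner (b (a v)) v" for v
    using r by (simp add: blinfun.scaleR_left blinfun.scaleR_right zero_le_mult_iff)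
  moreover have "selfadjoint (a o\<^sub>L b)" using a b ab by (intro selfadjoint_compose) (auto simp: positive_op_iff)
  ultimately show ?thesis by (simp add: positive_op_iff ab)
qed

section \<open>Continuous functional calculus of commuting tuples\<close>

lemma comm_apply: "a o\<^sub>L b = b o\<^sub>L a \<Longrightarrow> a (b v) = b (a v)"
  for a b :: "'h::real_normed_vector \<Rightarrow>\<^sub>L 'h"
  by (metis blinfun_apply_blinfun_compose)

lemma comm_iff: "a o\<^sub>L b = b o\<^sub>L a \<longleftrightarrow> (\<forall>v. a (b v) = b (a v))"
  for a b :: "'h::real_normed_vector \<Rightarrow>\<^sub>L 'h"
  using comm_apply blinfun_eqI[of "a o\<^sub>L b" "b o\<^sub>L a"] by auto

lemmas blinfun_linear = blinfun.add_left blinfun.add_right blinfun.diff_left blinfun.diff_right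
  blinfun.scaleR_left blinfun.scaleR_right blinfun.minus_left blinfun.minus_right

text \<open>
  For \<open>f k\<close> commuting with \<open>x\<close> this is the sum of \<open>(N choose k) x^k (1 - x)^(N - k) f k\<close>. The recursive
  form makes positivity for \<open>0 \<le> x \<le> 1\<close> an induction.
\<close>

primrec bernstein :: "('h::real_normed_vector \<Rightarrow>\<^sub>L 'h) \<Rightarrow> nat \<Rightarrow> (nat \<Rightarrow> 'h \<Rightarrow>\<^sub>L 'h) \<Rightarrow> 'h \<Rightarrow>\<^sub>L 'h" where
  "bernstein x 0 f = f 0"
| "bernstein x (Suc N) f = (x o\<^sub>L bernstein x N (\<lambda>k. f (Suc k))) + ((id_blinfun - x) o\<^sub>L bernstein x N f)"

lemma bernstein_add: "bernstein x N (\<lambda>k. f k + g k) = bernstein x N f + bernstein x N g"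
proof (induction N arbitrary: f g)
  case (Suc N)
  show ?case by (simp add: Suc[of "\<lambda>k. f (Suc k)" "\<lambda>k. g (Suc k)"] Suc[of f g] blinfun_compose_linear)
qed simp

lemma bernstein_scaleR: "bernstein x N (\<lambda>k. c *\<^sub>R f k) = c *\<^sub>R bernstein x N f"
proof (induction N arbitrary: f)
  case (Suc N)
  show ?case by (simp add: Suc[of "\<lambda>k. f (Suc k)"] Suc[of f] blinfun_compose_linear scaleR_add_right)
qed simp

lemma bernstein_const: "bernstein x N (\<lambda>k. a) = a"
  by (induction N) (simp_all add: blinfun_compose_linear blinfun_eqI blinfun_linear)

lemma bernstein_compose: "bernstein x N (\<lambda>k. f k o\<^sub>L a) = bernstein x N f o\<^sub>L a"
proof (induction N arbitrary: f)
  case (Suc N)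
  show ?case
    by (rule blinfun_eqI) (simp add: Suc[of "\<lambda>k. f (Suc k)"] Suc[of f] blinfun_linear)
qed simp

lemma bernstein_positive:
  fixes x :: "'h::complex_hilbert_space op"
  assumes x: "positive_op x" "positive_op (id_blinfun - x)"
    and f: "\<And>k. k \<le> N \<Longrightarrow> positive_op (f k)" "\<And>k. k \<le> N \<Longrightarrow> x o\<^sub>L f k = f k o\<^sub>L x"
  shows "positive_op (bernstein x N f) \<and> x o\<^sub>L bernstein x N f = bernstein x N f o\<^sub>L x"
  using f
proof (induction N arbitrary: f)
  case (Suc N)
  let ?a = "bernstein x N (\<lambda>k. f (Suc k))" and ?b = "bernstein x N f"
  have a: "positive_op ?a" "x o\<^sub>L ?a = ?a o\<^sub>L x" using Suc.IH[of "\<lambda>k. f (Suc k)"] Suc.prems by auto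
  have b: "positive_op ?b" "x o\<^sub>L ?b = ?b o\<^sub>L x" using Suc.IH[of f] Suc.prems by auto
  have "positive_op (x o\<^sub>L ?a)" by (rule positive_op_compose[OF x(1) a])
  moreover have "positive_op ((id_blinfun - x) o\<^sub>L ?b)"
    using b by (intro positive_op_compose[OF x(2) b(1)]) (simp add: comm_iff blinfun_linear)
  ultimately have "positive_op (bernstein x (Suc N) f)"
    by (simp add: positive_op_iff blinfun_linear inner_add inner_diff add_nonneg_nonneg)
  moreover have "x o\<^sub>L bernstein x (Suc N) f = bernstein x (Suc N) f o\<^sub>L x"
    using a(2) b(2) by (simp add: comm_iff blinfun_linear)
  ultimately show ?case by blast
qed simp

lemma positive_scaleR_id [simp]: "0 \<le> c \<Longrightarrow> positive_op (c *\<^sub>R id_blinfun :: 'h::complex_hilbert_space op)"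
  by (simp add: positive_op_iff blinfun_linear)

text \<open>Bernstein sums of the nonnegative functions \<open>c + g\<close> and
  \<open>c - g\<close> are positive and reproduce the constant \<open>c\<close>, which bounds the
  quadratic form on both sides.\<close>

lemma norm_bernstein_le:
  fixes x :: "'h::complex_hilbert_space op" and g :: "nat \<Rightarrow> real"
  assumes x: "positive_op x" "positive_op (id_blinfun - x)"
    and g: "\<And>k. k \<le> N \<Longrightarrow> \<bar>g k\<bar> \<le> c"
  shows "norm (bernstein x N (\<lambda>k. g k *\<^sub>R id_blinfun)) \<le> c"
proof -
  let ?G = "bernstein x N (\<lambda>k. g k *\<^sub>R id_blinfun)"
  have comm: "x o\<^sub>L (r *\<^sub>R id_blinfun) = (r *\<^sub>R id_blinfun) o\<^sub>L x" for r
    by (simp add: comm_iff blinfun_linear)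
  have p: "positive_op (bernstein x N (\<lambda>k. (c + s * g k) *\<^sub>R id_blinfun))" if s: "\<bar>s\<bar> = 1" for s
  proof -
    have "0 \<le> c + s * g k" if "k \<le> N" for k using g[OF that] s by (auto simp: abs_if split: if_splits)
    then show ?thesis using bernstein_positive[OF x, of N "\<lambda>k. (c + s * g k) *\<^sub>R id_blinfun"] comm by simp
  qed
  have e: "bernstein x N (\<lambda>k. (c + s * g k) *\<^sub>R id_blinfun) = c *\<^sub>R id_blinfun + s *\<^sub>R ?G" for s
    by (simp add: scaleR_add_left bernstein_add bernstein_const bernstein_scaleR flip: scaleR_scaleR)
  have p1: "positive_op (c *\<^sub>R id_blinfun + ?G)" using p[of 1] e[of 1] by simp
  have p2: "positive_op (c *\<^sub>R id_blinfun - ?G)" using p[of "-1"] e[of "-1"] by simp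
  have "?G = (c *\<^sub>R id_blinfun + ?G) - c *\<^sub>R id_blinfun" by simp
  then have "selfadjoint ?G" using p1 by (metis positive_op_iff selfadjoint_simps(2,4,5))
  moreover have "\<bar>inner (?G v) v\<bar> \<le> c * (norm v)^2" for v
    using p1 p2 by (auto simp: positive_op_iff blinfun_linear inner_add inner_diff power2_norm_eq_inner abs_le_iff
      dest!: spec[of _ v])
  moreover have "0 \<le> c" using g[of 0] by simp
  ultimately show ?thesis by (rule norm_selfadjoint_le)
qed

text \<open>Operator form of the binomial identity
  \<open>k (N+1 choose k) = (N+1) (N choose k-1)\<close>.\<close>

lemma bernstein_shift:
  "bernstein x (Suc N) (\<lambda>k. real k *\<^sub>R f k) = real (Suc N) *\<^sub>R (x o\<^sub>L bernstein x N (\<lambda>k. f (Suc k)))"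
proof (induction N arbitrary: f)
  case 0
  show ?case by (rule blinfun_eqI) (simp add: blinfun_linear)
next
  case (Suc N)
  let ?g = "\<lambda>k. f (Suc k)"
  let ?A = "bernstein x N (\<lambda>k. f (Suc (Suc k)))" and ?B = "bernstein x N ?g"
  let ?C = "bernstein x (Suc N) ?g"
  have "bernstein x (Suc N) (\<lambda>k. real (Suc k) *\<^sub>R f (Suc k)) = ?C + bernstein x (Suc N) (\<lambda>k. real k *\<^sub>R ?g k)"
    by (simp only: bernstein_add[symmetric] of_nat_Suc scaleR_add_left scaleR_one)
  also have "\<dots> = ?C + real (Suc N) *\<^sub>R (x o\<^sub>L ?A)" by (simp only: Suc)
  finally have "bernstein x (Suc (Suc N)) (\<lambda>k. real k *\<^sub>R f k)
     = (x o\<^sub>L (?C + real (Suc N) *\<^sub>R (x o\<^sub>L ?A))) + ((id_blinfun - x) o\<^sub>L (real (Suc N) *\<^sub>R (x o\<^sub>L ?B)))"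
    by (simp only: bernstein.simps(2)[of x "Suc N"] Suc)
  also have "\<dots> = (1 + real (Suc N)) *\<^sub>R (x o\<^sub>L ?C)"
    unfolding bernstein.simps(2)
    by (rule blinfun_eqI) (simp add: blinfun_linear algebra_simps del: of_nat_Suc bernstein.simps)
  also have "1 + real (Suc N) = real (Suc (Suc N))" by simp
  finally show ?case .
qed

primrec opow :: "('h::real_normed_vector \<Rightarrow>\<^sub>L 'h) \<Rightarrow> nat \<Rightarrow> 'h \<Rightarrow>\<^sub>L 'h" where
  "opow x 0 = id_blinfun"
| "opow x (Suc j) = x o\<^sub>L opow x j"

lemma opow_comm: "x o\<^sub>L a = a o\<^sub>L x \<Longrightarrow> opow x j o\<^sub>L a = a o\<^sub>L opow x j"
  by (induction j) (auto simp: comm_iff)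

lemma opow_add: "opow x (j + k) = opow x j o\<^sub>L opow x k"
  by (induction j) (auto simp: blinfun_eqI)

text \<open>The shift identity turns degree \<open>j + 1\<close> at order \<open>N + 1\<close> into
  \<open>x\<close> times a Bernstein sum of degree \<open>j\<close> with nodes
  \<open>(k+1)/(N+1)\<close>. These differ from \<open>k/N\<close> by at most
  \<open>1/(N+1)\<close>, so the change of nodes costs at most \<open>j/(N+1)\<close> in
  norm.\<close>

lemma bernstein_monomial_tendsto:
  fixes x :: "'h::complex_hilbert_space op"
  assumes x: "positive_op x" "positive_op (id_blinfun - x)"
  shows "(\<lambda>N. bernstein x N (\<lambda>k. (real k / real N)^j *\<^sub>R id_blinfun)) \<longlonglongrightarrow> opow x j"
proof (induction j)
  case 0
  show ?case by (simp add: bernstein_const)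
next
  case (Suc j)
  let ?X = "\<lambda>j N. bernstein x N (\<lambda>k. (real k / real N)^j *\<^sub>R id_blinfun)"
  let ?Y = "\<lambda>N. bernstein x N (\<lambda>k. (real (Suc k) / real (Suc N))^j *\<^sub>R id_blinfun)"
  have eq: "?X (Suc j) (Suc N) = x o\<^sub>L ?Y N" for N
  proof -
    have "?X (Suc j) (Suc N) = bernstein x (Suc N) (\<lambda>k. real k *\<^sub>R ((inverse (real (Suc N)) * (real k / real (Suc N))^j) *\<^sub>R id_blinfun))"
      by (simp add: divide_inverse mult_ac)
    also have "\<dots> = real (Suc N) *\<^sub>R (x o\<^sub>L bernstein x N (\<lambda>k. inverse (real (Suc N)) *\<^sub>R ((real (Suc k) / real (Suc N))^j *\<^sub>R id_blinfun)))"
      by (subst bernstein_shift) (simp only: scaleR_scaleR)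
    also have "\<dots> = x o\<^sub>L ?Y N"
      unfolding bernstein_scaleR blinfun_compose_linear by (simp del: of_nat_Suc)
    finally show ?thesis .
  qed
  have diff: "norm (?Y N - ?X j N) \<le> real j * inverse (real (Suc N))" if N: "0 < N" for N
  proof -
    have "?Y N - ?X j N = bernstein x N (\<lambda>k. ((real (Suc k) / real (Suc N))^j - (real k / real N)^j) *\<^sub>R id_blinfun)"
    proof -
      have "?Y N = bernstein x N (\<lambda>k. ((real (Suc k) / real (Suc N))^j - (real k / real N)^j) *\<^sub>R id_blinfun) + ?X j N"
        unfolding bernstein_add[symmetric] scaleR_add_left[symmetric] by (simp del: of_nat_Suc)
      then show ?thesis by simp
    qed
    moreover have "norm (bernstein x N (\<lambda>k. ((real (Suc k) / real (Suc N))^j - (real k / real N)^j) *\<^sub>R id_blinfun))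
       \<le> real j * inverse (real (Suc N))"
    proof (rule norm_bernstein_le[OF x])
      fix k assume k: "k \<le> N"
      have "norm ((real (Suc k) / real (Suc N))^j - (real k / real N)^j)
        \<le> real j * norm (real (Suc k) / real (Suc N) - real k / real N)"
        using k N by (intro norm_power_diff) auto
      also have "real (Suc k) / real (Suc N) - real k / real N = (real N - real k) / (real N * real (Suc N))"
        using N by (simp add: field_simps)
      also have "norm \<dots> \<le> inverse (real (Suc N))"
      proof -
        have "(real N - real k) / (real N * real (Suc N)) = (real N - real k) / real N * inverse (real (Suc N))"
          by (simp add: divide_inverse mult_ac del: of_nat_Suc)
        also have "norm \<dots> \<le> 1 * inverse (real (Suc N))"
          unfolding norm_mult using k N by (intro mult_mono) (auto simp: divide_le_eq_1)
        finally show ?thesis by simp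
      qed
      finally show "\<bar>(real (Suc k) / real (Suc N))^j - (real k / real N)^j\<bar> \<le> real j * inverse (real (Suc N))"
        by (simp add: mult_left_mono)
    qed
    ultimately show ?thesis by simp
  qed
  have "(\<lambda>N. ?Y N - ?X j N) \<longlonglongrightarrow> 0"
  proof (rule Lim_null_comparison)
    show "\<forall>\<^sub>F N in sequentially. norm (?Y N - ?X j N) \<le> real j * inverse (real (Suc N))"
      using diff by (auto simp: eventually_sequentially intro!: exI[of _ 1])
    show "(\<lambda>N. real j * inverse (real (Suc N))) \<longlonglongrightarrow> 0"
      using tendsto_mult_right_zero[OF LIMSEQ_inverse_real_of_nat] by blast
  qed
  from tendsto_add[OF this Suc] have "?Y \<longlonglongrightarrow> opow x j" by simp
  then have "(\<lambda>N. x o\<^sub>L ?Y N) \<longlonglongrightarrow> (x o\<^sub>L opow x j)"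
    by (intro bounded_bilinear.tendsto[OF bounded_bilinear_blinfun_compose] tendsto_const)
  then have "(\<lambda>N. ?X (Suc j) (Suc N)) \<longlonglongrightarrow> opow x (Suc j)" by (simp only: eq opow.simps)
  then show ?case by (rule LIMSEQ_imp_Suc)
qed

text \<open>
  \<open>F\<close> is a polynomial in a scalar variable whose operator coefficients commute with \<open>x\<close>, and the last
  argument is its value at \<open>x\<close>.
\<close>

inductive polyfam :: "('h::real_normed_vector \<Rightarrow>\<^sub>L 'h) \<Rightarrow> (real \<Rightarrow> 'h \<Rightarrow>\<^sub>L 'h) \<Rightarrow> 'h \<Rightarrow>\<^sub>L 'h \<Rightarrow> bool" for x where
  mono: "x o\<^sub>L a = a o\<^sub>L x \<Longrightarrow> polyfam x (\<lambda>s. s^j *\<^sub>R a) (opow x j o\<^sub>L a)"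
| add: "polyfam x F a \<Longrightarrow> polyfam x G b \<Longrightarrow> polyfam x (\<lambda>s. F s + G s) (a + b)"

lemma polyfam_mult_mono:
  assumes "polyfam x G b" "x o\<^sub>L a = a o\<^sub>L x"
  shows "polyfam x (\<lambda>s. (s^j *\<^sub>R a) o\<^sub>L G s) ((opow x j o\<^sub>L a) o\<^sub>L b)"
  using assms(1)
proof induction
  case (mono c k)
  have "polyfam x (\<lambda>s. s^(j+k) *\<^sub>R (a o\<^sub>L c)) (opow x (j+k) o\<^sub>L (a o\<^sub>L c))"
    by (rule polyfam.mono) (use mono assms(2) in \<open>simp add: comm_iff\<close>)
  moreover have "(opow x j o\<^sub>L a) o\<^sub>L (opow x k o\<^sub>L c) = opow x (j+k) o\<^sub>L (a o\<^sub>L c)"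
    by (rule blinfun_eqI) (simp add: opow_add comm_apply[OF opow_comm[OF assms(2)]])
  moreover have "(s^j *\<^sub>R a) o\<^sub>L (s^k *\<^sub>R c) = s^(j+k) *\<^sub>R (a o\<^sub>L c)" for s
    by (rule blinfun_eqI) (simp add: blinfun_linear power_add)
  ultimately show ?case by simp
next
  case (add F c G d)
  then show ?case by (simp add: blinfun_compose_linear polyfam.add)
qed

lemma polyfam_mult:
  assumes "polyfam x F a" "polyfam x G b"
  shows "polyfam x (\<lambda>s. F s o\<^sub>L G s) (a o\<^sub>L b)"
  using assms
proof (induction rule: polyfam.induct)
  case (mono c j)
  from polyfam_mult_mono[OF mono(2,1)] show ?case .
qed (simp add: blinfun_compose_linear polyfam.add)

lemma polyfam_bernstein_tendsto:
  fixes x :: "'h::complex_hilbert_space op"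
  assumes x: "positive_op x" "positive_op (id_blinfun - x)" and "polyfam x F a"
  shows "(\<lambda>N. bernstein x N (\<lambda>k. F (real k / real N))) \<longlonglongrightarrow> a"
  using assms(3)
proof induction
  case (mono c j)
  have "bernstein x N (\<lambda>k. (real k / real N)^j *\<^sub>R c) = bernstein x N (\<lambda>k. (real k / real N)^j *\<^sub>R id_blinfun) o\<^sub>L c" for N
  proof -
    have "(\<lambda>k. (real k / real N)^j *\<^sub>R c) = (\<lambda>k. ((real k / real N)^j *\<^sub>R id_blinfun) o\<^sub>L c)"
      by (intro ext blinfun_eqI) (simp add: blinfun_linear)
    then show ?thesis by (simp only: bernstein_compose)
  qed
  then show ?case
    by simp (intro bounded_bilinear.tendsto[OF bounded_bilinear_blinfun_compose] tendsto_const
        bernstein_monomial_tendsto[OF x])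
next
  case (add F a G b)
  then show ?case by (simp add: bernstein_add tendsto_add)
qed

text \<open>
  Syntax of polynomials, so that one polynomial can be evaluated at points and at operators.
\<close>

datatype 'n pexp = PConst real | PVar 'n | PAdd "'n pexp" "'n pexp" | PMult "'n pexp" "'n pexp"

primrec peval :: "'n::finite pexp \<Rightarrow> real^'n \<Rightarrow> real" where
  "peval (PConst c) t = c"
| "peval (PVar i) t = t $ i"
| "peval (PAdd p q) t = peval p t + peval q t"
| "peval (PMult p q) t = peval p t * peval q t"

primrec oeval :: "'n pexp \<Rightarrow> ('n \<Rightarrow> 'h::complex_hilbert_space op) \<Rightarrow> 'h op" where
  "oeval (PConst c) x = c *\<^sub>R id_blinfun"
| "oeval (PVar i) x = x i"
| "oeval (PAdd p q) x = oeval p x + oeval q x"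
| "oeval (PMult p q) x = (oeval p x o\<^sub>L oeval q x)"

lemma oeval_comm_right:
  assumes "\<And>i. x i o\<^sub>L b = b o\<^sub>L x i"
  shows "oeval p x o\<^sub>L b = b o\<^sub>L oeval p x"
  using assms by (induction p) (auto simp: comm_iff blinfun_linear)

lemma oeval_comm:
  assumes "\<And>i j. x i o\<^sub>L x j = x j o\<^sub>L x i"
  shows "oeval p x o\<^sub>L oeval q x = oeval q x o\<^sub>L oeval p x"
  by (rule oeval_comm_right, rule oeval_comm_right[symmetric]) (rule assms)

lemma selfadjoint_oeval:
  assumes "\<And>i j. x i o\<^sub>L x j = x j o\<^sub>L x i" "\<And>i. selfadjoint (x i)"
  shows "selfadjoint (oeval p x)"
  by (induction p) (simp_all add: assms selfadjoint_compose oeval_comm)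

text \<open>Frees a single coordinate, so that one-variable Bernstein convergence applies to a
  polynomial in several operators.\<close>

lemma polyfam_oeval:
  fixes y :: "'n \<Rightarrow> 'h::complex_hilbert_space op"
  assumes y: "\<And>j. x o\<^sub>L y j = y j o\<^sub>L x"
  shows "polyfam x (\<lambda>s. oeval p (y(i := s *\<^sub>R id_blinfun))) (oeval p (y(i := x)))"
proof (induction p)
  case (PConst c)
  have "polyfam x (\<lambda>s. s^0 *\<^sub>R (c *\<^sub>R id_blinfun)) (opow x 0 o\<^sub>L c *\<^sub>R id_blinfun)"
    by (rule polyfam.mono) (simp add: comm_iff blinfun_linear)
  moreover have "(opow x 0 o\<^sub>L c *\<^sub>R id_blinfun) = c *\<^sub>R id_blinfun" by (rule blinfun_eqI) simp
  ultimately show ?case by simp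
next
  case (PVar j)
  have "polyfam x (\<lambda>s. s^1 *\<^sub>R id_blinfun) (opow x 1 o\<^sub>L id_blinfun)"
    by (rule polyfam.mono) (simp add: comm_iff)
  moreover have "(opow x 1 o\<^sub>L id_blinfun) = x" by (rule blinfun_eqI) simp
  moreover have "polyfam x (\<lambda>s. s^0 *\<^sub>R y j) (opow x 0 o\<^sub>L y j)"
    by (rule polyfam.mono) (rule y)
  moreover have "(opow x 0 o\<^sub>L y j) = y j" by (rule blinfun_eqI) simp
  ultimately show ?case by (cases "j = i") simp_all
next
  case (PAdd p q)
  then show ?case by (simp add: polyfam.add)
next
  case (PMult p q)
  then show ?case by (simp add: polyfam_mult)
qed

lemma oeval_scalar: "oeval p (\<lambda>i. (t $ i) *\<^sub>R id_blinfun) = peval p t *\<^sub>R id_blinfun"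
  by (induction p) (auto simp: blinfun_linear scaleR_add_left intro!: blinfun_eqI)

text \<open>
  One operator at a time is replaced by scalars: a polynomial that is positive for every scalar value in
  the unit interval has positive Bernstein sums, and these converge to its value at the operator.
\<close>

lemma oeval_positive_unit:
  fixes y :: "'n::finite \<Rightarrow> 'h::complex_hilbert_space op"
  assumes p: "\<And>t. (\<forall>i. 0 \<le> t $ i \<and> t $ i \<le> 1) \<Longrightarrow> 0 \<le> peval p t"
    and comm: "\<And>i j. y i o\<^sub>L y j = y j o\<^sub>L y i"
    and y: "\<And>i. positive_op (y i)" "\<And>i. positive_op (id_blinfun - y i)"
  shows "positive_op (oeval p y)"
proof -
  have "positive_op (oeval p z)"
    if "finite S" and z: "\<And>i j. z i o\<^sub>L z j = z j o\<^sub>L z i" "\<And>i. positive_op (z i)" "\<And>i. positive_op (id_blinfun - z i)"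
      and sc: "\<And>i. i \<notin> S \<Longrightarrow> \<exists>s. 0 \<le> s \<and> s \<le> 1 \<and> z i = s *\<^sub>R id_blinfun" for S and z :: "'n \<Rightarrow> 'h op"
    using that
  proof (induction S arbitrary: z rule: finite_induct)
    case empty
    then obtain s where s: "\<And>i. 0 \<le> s i \<and> s i \<le> 1 \<and> z i = s i *\<^sub>R id_blinfun" by (metis empty_iff)
    then have "z = (\<lambda>i. ((\<chi> i. s i) $ i) *\<^sub>R id_blinfun)" by auto
    then have "oeval p z = peval p (\<chi> i. s i) *\<^sub>R id_blinfun" by (simp only: oeval_scalar)
    moreover have "0 \<le> peval p (\<chi> i. s i)" using p[of "\<chi> i. s i"] s by simp
    ultimately show ?case by (metis positive_scaleR_id)
  next
    case (insert i S)
    note z = insert.prems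
    let ?F = "\<lambda>s. oeval p (z(i := s *\<^sub>R id_blinfun))"
    have F: "positive_op (?F s)" if s: "0 \<le> s" "s \<le> 1" for s
    proof (rule insert.IH)
      fix j k
      let ?w = "z(i := s *\<^sub>R id_blinfun)"
      show "?w j o\<^sub>L ?w k = ?w k o\<^sub>L ?w j" using z(1)[of j k] by (auto simp: comm_iff blinfun_linear)
      show "positive_op (?w j)" using z(2) s by simp
      have "id_blinfun - s *\<^sub>R id_blinfun = (1 - s) *\<^sub>R (id_blinfun::'h op)" by (simp add: scaleR_diff_left)
      then have "positive_op (id_blinfun - s *\<^sub>R (id_blinfun::'h op))"
        using s positive_scaleR_id[of "1 - s"] by (metis diff_ge_0_iff_ge)
      then show "positive_op (id_blinfun - ?w j)" using z(3)[of j] by simp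
      show "\<exists>s. 0 \<le> s \<and> s \<le> 1 \<and> ?w j = s *\<^sub>R id_blinfun" if "j \<notin> S"
        using z(4)[of j] that s by auto
    qed
    have pf: "polyfam (z i) ?F (oeval p z)"
      using polyfam_oeval[of "z i" z p i] z(1) by simp
    have lim: "(\<lambda>N. bernstein (z i) N (\<lambda>k. ?F (real k / real N))) \<longlonglongrightarrow> oeval p z"
      by (rule polyfam_bernstein_tendsto[OF z(2) z(3) pf])
    have pos: "positive_op (bernstein (z i) N (\<lambda>k. ?F (real k / real N)))" for N
    proof (rule conjunct1[OF bernstein_positive[OF z(2) z(3)]])
      fix k assume "k \<le> N"
      then show "positive_op (?F (real k / real N))" by (intro F) (auto simp: divide_le_eq_1)
      show "z i o\<^sub>L ?F (real k / real N) = ?F (real k / real N) o\<^sub>L z i"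
        by (rule oeval_comm_right[symmetric]) (use z(1) in \<open>auto simp: comm_iff blinfun_linear\<close>)
    qed
    have "selfadjoint (oeval p z)" by (rule selfadjoint_limit[OF _ lim]) (use pos in \<open>auto simp: positive_op_iff\<close>)
    moreover have "0 \<le> inner (oeval p z v) v" for v
    proof (rule LIMSEQ_le_const)
      show "(\<lambda>N. inner (bernstein (z i) N (\<lambda>k. ?F (real k / real N)) v) v) \<longlonglongrightarrow> inner (oeval p z v) v"
        by (intro tendsto_intros blinfun.tendsto lim)
    qed (use pos in \<open>auto simp: positive_op_iff\<close>)
    ultimately show ?case by (simp add: positive_op_iff)
  qed
  from this[of UNIV y] show ?thesis using comm y by auto
qed

primrec psubst :: "(real^'n) \<Rightarrow> (real^'n) \<Rightarrow> 'n::finite pexp \<Rightarrow> 'n pexp" where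
  "psubst m d (PConst c) = PConst c"
| "psubst m d (PVar i) = PAdd (PConst (m $ i)) (PMult (PConst (d $ i)) (PVar i))"
| "psubst m d (PAdd p q) = PAdd (psubst m d p) (psubst m d q)"
| "psubst m d (PMult p q) = PMult (psubst m d p) (psubst m d q)"

lemma peval_psubst: "peval (psubst m d p) t = peval p (\<chi> i. m $ i + d $ i * t $ i)"
  by (induction p) auto

lemma oeval_psubst: "oeval (psubst m d p) x = oeval p (\<lambda>i. m $ i *\<^sub>R id_blinfun + d $ i *\<^sub>R x i)"
  by (induction p) (auto simp: blinfun_linear intro!: blinfun_eqI)

lemma oeval_positive:
  fixes x :: "'n::finite \<Rightarrow> 'h::complex_hilbert_space op"
  assumes p: "\<And>t. t \<in> cbox m M \<Longrightarrow> 0 \<le> peval p t"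
    and comm: "\<And>i j. x i o\<^sub>L x j = x j o\<^sub>L x i" and sa: "\<And>i. selfadjoint (x i)"
    and mM: "\<And>i. m $ i \<le> M $ i"
    and x: "\<And>i v. m $ i * (norm v)^2 \<le> inner (x i v) v" "\<And>i v. inner (x i v) v \<le> M $ i * (norm v)^2"
  shows "positive_op (oeval p x)"
proof -
  define d where "d = M - m"
  \<comment> \<open>Rescaling of the box to the unit cube. On a degenerate side \<open>x i\<close>
    is the scalar \<open>m $ i\<close>, and the default 0 is consistent with
    \<open>x i = m $ i + d $ i * y i\<close>.\<close>
  define y where "y i = (if d $ i = 0 then 0 else inverse (d $ i) *\<^sub>R (x i - m $ i *\<^sub>R id_blinfun))" for i
  have d: "0 \<le> d $ i" for i using mM by (simp add: d_def)
  have xy: "x i = m $ i *\<^sub>R id_blinfun + d $ i *\<^sub>R y i" for i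
  proof (cases "d $ i = 0")
    case True
    then have "x i = m $ i *\<^sub>R id_blinfun"
      by (intro selfadjoint_eqI) (use sa x[of i] in \<open>auto simp: d_def blinfun_linear power2_norm_eq_inner intro: antisym\<close>)
    then show ?thesis using True by simp
  qed (simp add: y_def)
  have say: "selfadjoint (y i)" for i using sa by (simp add: y_def)
  have yv: "inner (y i v) v = (if d $ i = 0 then 0 else inverse (d $ i) * (inner (x i v) v - m $ i * (norm v)^2))" for i v
    by (simp add: y_def blinfun_linear inner_diff power2_norm_eq_inner)
  have "positive_op (oeval (psubst m d p) y)"
  proof (rule oeval_positive_unit)
    fix t :: "real^'n" assume "\<forall>i. 0 \<le> t $ i \<and> t $ i \<le> 1"
    then have "0 \<le> d $ i * t $ i \<and> d $ i * t $ i \<le> d $ i" for i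
      using d[of i] by (simp add: mult_left_le)
    then have "(\<chi> i. m $ i + d $ i * t $ i) \<in> cbox m M"
      by (simp add: mem_box_cart d_def) (metis add.commute le_diff_eq)
    then show "0 \<le> peval (psubst m d p) t" by (simp add: peval_psubst p)
  next
    fix i j
    show "y i o\<^sub>L y j = y j o\<^sub>L y i" using comm[of i j] by (auto simp: y_def comm_iff blinfun_linear)
    show "positive_op (y i)" using say d x(1) by (auto simp: positive_op_iff yv)
    have "inverse (d $ i) * (inner (x i v) v - m $ i * (norm v)^2) \<le> (norm v)^2" if "d $ i \<noteq> 0" for v
    proof -
      have "inner (x i v) v - m $ i * (norm v)^2 \<le> d $ i * (norm v)^2" using x(2)[of i v] by (simp add: d_def algebra_simps)
      then show ?thesis using that d[of i] by (simp add: field_simps)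
    qed
    then show "positive_op (id_blinfun - y i)" using say
      by (auto simp: positive_op_iff blinfun_linear inner_diff yv power2_norm_eq_inner)
  qed
  then show ?thesis by (simp add: oeval_psubst xy[symmetric])
qed

lemma peval_simps_ext:
  "peval (PAdd p q) = (\<lambda>t. peval p t + peval q t)" "peval (PMult p q) = (\<lambda>t. peval p t * peval q t)"
  "peval (PConst c) = (\<lambda>t. c)" "peval (PVar i) = (\<lambda>t. t $ i)"
  by (auto simp: fun_eq_iff)

lemma real_polynomial_function_peval:
  fixes g :: "real^'n::finite \<Rightarrow> real"
  assumes "real_polynomial_function g"
  shows "\<exists>p. peval p = g"
  using assms
proof induction
  case (linear f)
  have fin: "\<exists>p. \<forall>t. peval p t = (\<Sum>i\<in>S. t $ i * f (axis i 1))" if "finite S" for S :: "'n set"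
    using that
  proof (induction S rule: finite_induct)
    case empty show ?case by (rule exI[of _ "PConst 0"]) simp
  next
    case (insert i S)
    then obtain p where "\<forall>t. peval p t = (\<Sum>i\<in>S. t $ i * f (axis i 1))" by blast
    with insert(1,2) show ?case
      by (intro exI[of _ "PAdd (PMult (PVar i) (PConst (f (axis i 1)))) p"]) simp
  qed
  interpret f: bounded_linear f by fact
  obtain p where p: "\<And>t. peval p t = (\<Sum>i\<in>UNIV. t $ i * f (axis i 1))" using fin[of UNIV] by auto
  have ft: "f t = (\<Sum>i\<in>UNIV. t $ i * f (axis i 1))" for t
  proof -
    have "t = (\<Sum>i\<in>UNIV. t $ i *\<^sub>R axis i 1)"
      using basis_expansion[of t] by (simp add: scalar_mult_eq_scaleR)
    then have "f t = f (\<Sum>i\<in>UNIV. t $ i *\<^sub>R axis i 1)" by simp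
    then show ?thesis by (simp add: f.sum f.scaleR)
  qed
  show ?case by (rule exI[of _ p], rule ext, rule trans[OF p ft[symmetric]])
next
  case (const c) show ?case by (rule exI[of _ "PConst c"]) auto
next
  case (add f g)
  then obtain p q where "peval p = f" "peval q = g" by blast
  then show ?case by (intro exI[of _ "PAdd p q"]) auto
next
  case (mult f g)
  then obtain p q where "peval p = f" "peval q = g" by blast
  then show ?case by (intro exI[of _ "PMult p q"]) auto
qed

lemma pexp_approx:
  fixes f :: "real^'n::finite \<Rightarrow> real"
  assumes "compact K" "continuous_on K f"
  shows "\<exists>P. uniform_limit K (\<lambda>n. peval (P n)) f sequentially"
proof -
  have "\<exists>p. \<forall>t\<in>K. \<bar>f t - peval p t\<bar> < inverse (real (Suc n))" for n
    using Stone_Weierstrass_real_polynomial_function[OF assms, of "inverse (real (Suc n))"]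
      real_polynomial_function_peval by (metis inverse_positive_iff_positive of_nat_0_less_iff zero_less_Suc)
  then obtain P where P: "\<And>n t. t \<in> K \<Longrightarrow> \<bar>f t - peval (P n) t\<bar> < inverse (real (Suc n))" by metis
  have "uniform_limit K (\<lambda>n. peval (P n)) f sequentially"
  proof (rule uniform_limitI)
    fix e :: real assume "0 < e"
    from order_tendstoD(2)[OF LIMSEQ_inverse_real_of_nat this]
    show "\<forall>\<^sub>F n in sequentially. \<forall>t\<in>K. dist (peval (P n) t) (f t) < e"
    proof eventually_elim
      case (elim n)
      show ?case
      proof
        fix t assume "t \<in> K"
        from P[OF this, of n] elim show "dist (peval (P n) t) (f t) < e"
          by (simp only: dist_real_def abs_minus_commute[of "peval (P n) t"])
      qed
    qed
  qed
  then show ?thesis by blast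
qed

section \<open>Closure properties of C*-algebras and the continuous functional calculus on a
  box\<close>

lemma cstar_algebra_scaleR:
  assumes "cstar_algebra A" "a \<in> A"
  shows "r *\<^sub>R a \<in> A"
proof -
  have "scaleC_op (complex_of_real r) a = r *\<^sub>R a"
    by (rule blinfun_eqI) (simp add: scaleC_op_apply scaleC_of_real blinfun_linear)
  then show ?thesis using assms unfolding cstar_algebra_def by metis
qed

lemma cstar_algebraD:
  assumes "cstar_algebra A"
  shows "0 \<in> A" "a \<in> A \<Longrightarrow> b \<in> A \<Longrightarrow> a + b \<in> A" "a \<in> A \<Longrightarrow> b \<in> A \<Longrightarrow> a - b \<in> A"
    "a \<in> A \<Longrightarrow> b \<in> A \<Longrightarrow> (a o\<^sub>L b) \<in> A" "closed A" "a \<in> A \<Longrightarrow> clinear_op a" "a \<in> A \<Longrightarrow> r *\<^sub>R a \<in> A"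
proof -
  show "0 \<in> A" "a \<in> A \<Longrightarrow> b \<in> A \<Longrightarrow> a + b \<in> A" "a \<in> A \<Longrightarrow> b \<in> A \<Longrightarrow> (a o\<^sub>L b) \<in> A" "closed A"
    "a \<in> A \<Longrightarrow> clinear_op a" "a \<in> A \<Longrightarrow> r *\<^sub>R a \<in> A"
    using assms by (auto simp: cstar_algebra_def intro: cstar_algebra_scaleR)
  show "a - b \<in> A" if "a \<in> A" "b \<in> A"
  proof -
    have "a + (-1) *\<^sub>R b \<in> A" using that assms by (metis cstar_algebra_def cstar_algebra_scaleR)
    then show ?thesis by simp
  qed
qed

text \<open>The box bounds the numerical ranges and need not be the joint spectrum. Different tuples
  can therefore share one box, and with it one domain for functions.\<close>

locale comm_tuple =
  fixes x :: "'n::finite \<Rightarrow> 'h::complex_hilbert_space op" and m M :: "real^'n"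
  assumes comm: "x i o\<^sub>L x j = x j o\<^sub>L x i" and sa: "selfadjoint (x i)"
    and mM: "m $ i \<le> M $ i"
    and lower: "m $ i * (norm v)^2 \<le> inner (x i v) v"
    and upper: "inner (x i v) v \<le> M $ i * (norm v)^2"
begin

abbreviation "K \<equiv> cbox m M"

lemma K_ne: "m \<in> K" using mM by (auto simp: mem_box_cart)

text \<open>Positivity of the polynomial \<open>c^2 - p^2\<close> on the box passes to the
  operators, where the form of \<open>(oeval p x)^2\<close> is
  \<open>(norm (oeval p x v))^2\<close>.\<close>

lemma norm_oeval_le:
  assumes c: "\<And>t. t \<in> K \<Longrightarrow> \<bar>peval p t\<bar> \<le> c"
  shows "norm (oeval p x) \<le> c"
proof -
  have c0: "0 \<le> c" using c[OF K_ne] by simp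
  have sp: "selfadjoint (oeval p x)" by (rule selfadjoint_oeval) (rule comm sa)+
  have "positive_op (oeval (PAdd (PConst (c^2)) (PMult (PConst (-1)) (PMult p p))) x)"
  proof (rule oeval_positive[of m M])
    fix t assume "t \<in> K"
    then have "\<bar>peval p t\<bar>^2 \<le> c^2" by (intro power_mono c) auto
    then show "0 \<le> peval (PAdd (PConst (c^2)) (PMult (PConst (-1)) (PMult p p))) t"
      by (simp add: power2_eq_square)
  qed (rule comm sa mM lower upper)+
  then have "(norm (oeval p x v))^2 \<le> (c * norm v)^2" for v
    by (auto simp: positive_op_iff blinfun_linear inner_diff inner_add selfadjointD(2)[OF sp]
      power_mult_distrib power2_norm_eq_inner)
  then have "norm (oeval p x v) \<le> c * norm v" for v
    by (rule power2_le_imp_le) (use c0 in simp)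
  then show ?thesis by (intro norm_blinfun_bound c0)
qed

text \<open>Limit along an arbitrarily chosen approximating sequence; any other one gives the same
  limit. For functions without a uniform polynomial approximation on \<open>K\<close> the value is
  arbitrary.\<close>

definition cfc :: "(real^'n \<Rightarrow> real) \<Rightarrow> 'h op" where
  "cfc f = lim (\<lambda>n. oeval ((SOME P. uniform_limit K (\<lambda>n. peval (P n)) f sequentially) n) x)"

lemma oeval_diff_tendsto:
  assumes P: "uniform_limit K (\<lambda>n. peval (P n)) f sequentially" and Q: "uniform_limit K (\<lambda>n. peval (Q n)) f sequentially"
  shows "(\<lambda>n. oeval (P n) x - oeval (Q n) x) \<longlonglongrightarrow> 0"
proof (rule tendstoI)
  fix e :: real assume e: "0 < e"
  then have e4: "0 < e / 4" by simp
  from uniform_limitD[OF P e4] uniform_limitD[OF Q e4]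
  show "\<forall>\<^sub>F n in sequentially. dist (oeval (P n) x - oeval (Q n) x) 0 < e"
  proof eventually_elim
    case (elim n)
    have "norm (oeval (PAdd (P n) (PMult (PConst (-1)) (Q n))) x) \<le> e/2"
    proof (rule norm_oeval_le)
      fix t assume "t \<in> K"
      then have "\<bar>peval (P n) t - f t\<bar> < e/4" "\<bar>peval (Q n) t - f t\<bar> < e/4"
        using elim by (auto simp: dist_real_def)
      then have "\<bar>peval (P n) t - peval (Q n) t\<bar> \<le> e/2" by arith
      then show "\<bar>peval (PAdd (P n) (PMult (PConst (-1)) (Q n))) t\<bar> \<le> e/2" by simp
    qed
    moreover have "oeval (PAdd (P n) (PMult (PConst (-1)) (Q n))) x = oeval (P n) x - oeval (Q n) x"
      by (rule blinfun_eqI) (simp add: blinfun_linear)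
    ultimately show ?case using e by simp
  qed
qed

lemma oeval_Cauchy:
  assumes P: "uniform_limit K (\<lambda>n. peval (P n)) f sequentially"
  shows "convergent (\<lambda>n. oeval (P n) x)"
proof -
  have "Cauchy (\<lambda>n. oeval (P n) x)"
  proof (rule CauchyI)
    fix e :: real assume e: "0 < e"
    then have "0 < e / 4" by simp
    from uniform_limitD[OF P this] obtain N where N: "\<And>n t. N \<le> n \<Longrightarrow> t \<in> K \<Longrightarrow> \<bar>peval (P n) t - f t\<bar> < e/4"
      by (auto simp: eventually_sequentially dist_real_def)
    show "\<exists>N. \<forall>k\<ge>N. \<forall>n\<ge>N. norm (oeval (P k) x - oeval (P n) x) < e"
    proof (intro exI allI impI)
      fix k n assume kn: "N \<le> k" "N \<le> n"
      have "norm (oeval (PAdd (P k) (PMult (PConst (-1)) (P n))) x) \<le> e/2"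
      proof (rule norm_oeval_le)
        fix t assume "t \<in> K"
        then have "\<bar>peval (P k) t - peval (P n) t\<bar> \<le> e/2" using N[OF kn(1), of t] N[OF kn(2), of t] by arith
        then show "\<bar>peval (PAdd (P k) (PMult (PConst (-1)) (P n))) t\<bar> \<le> e/2" by simp
      qed
      moreover have "oeval (PAdd (P k) (PMult (PConst (-1)) (P n))) x = oeval (P k) x - oeval (P n) x"
        by (rule blinfun_eqI) (simp add: blinfun_linear)
      ultimately show "norm (oeval (P k) x - oeval (P n) x) < e" using e by simp
    qed
  qed
  then show ?thesis by (rule Cauchy_convergent)
qed

lemma cfc_tendsto:
  assumes P: "uniform_limit K (\<lambda>n. peval (P n)) f sequentially"
  shows "(\<lambda>n. oeval (P n) x) \<longlonglongrightarrow> cfc f"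
proof -
  define Q where "Q = (SOME P. uniform_limit K (\<lambda>n. peval (P n)) f sequentially)"
  have Q: "uniform_limit K (\<lambda>n. peval (Q n)) f sequentially" unfolding Q_def by (rule someI[of _ P]) (rule P)
  have "(\<lambda>n. oeval (Q n) x) \<longlonglongrightarrow> cfc f"
    using oeval_Cauchy[OF Q] unfolding cfc_def Q_def[symmetric] by (simp add: convergent_LIMSEQ_iff)
  from tendsto_add[OF oeval_diff_tendsto[OF P Q] this] show ?thesis by simp
qed

lemma cfcE:
  assumes "continuous_on K f"
  obtains P where "uniform_limit K (\<lambda>n. peval (P n)) f sequentially" "(\<lambda>n. oeval (P n) x) \<longlonglongrightarrow> cfc f"
  using pexp_approx[OF compact_cbox assms] cfc_tendsto by blast

lemma cfc_selfadjoint [simp]: "continuous_on K f \<Longrightarrow> selfadjoint (cfc f)"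
  by (erule cfcE, rule selfadjoint_limit[rotated], assumption, rule selfadjoint_oeval) (rule comm sa)+

lemma cfc_add:
  assumes f: "continuous_on K f" and g: "continuous_on K g"
  shows "cfc (\<lambda>t. f t + g t) = cfc f + cfc g"
proof -
  obtain P where P: "uniform_limit K (\<lambda>n. peval (P n)) f sequentially" "(\<lambda>n. oeval (P n) x) \<longlonglongrightarrow> cfc f"
    using f by (rule cfcE)
  obtain Q where Q: "uniform_limit K (\<lambda>n. peval (Q n)) g sequentially" "(\<lambda>n. oeval (Q n) x) \<longlonglongrightarrow> cfc g"
    using g by (rule cfcE)
  have "uniform_limit K (\<lambda>n. peval (PAdd (P n) (Q n))) (\<lambda>t. f t + g t) sequentially"
    using uniform_limit_add[OF P(1) Q(1)] by (simp only: peval_simps_ext)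
  from cfc_tendsto[OF this] have "(\<lambda>n. oeval (P n) x + oeval (Q n) x) \<longlonglongrightarrow> cfc (\<lambda>t. f t + g t)" by simp
  then show ?thesis by (rule LIMSEQ_unique[OF _ tendsto_add[OF P(2) Q(2)]])
qed

lemma cfc_mult:
  assumes f: "continuous_on K f" and g: "continuous_on K g"
  shows "cfc (\<lambda>t. f t * g t) = (cfc f o\<^sub>L cfc g)"
proof -
  have b: "bounded (f ` K)" "bounded (g ` K)"
    using f g by (auto intro!: compact_imp_bounded compact_continuous_image)
  obtain P where P: "uniform_limit K (\<lambda>n. peval (P n)) f sequentially" "(\<lambda>n. oeval (P n) x) \<longlonglongrightarrow> cfc f"
    using f by (rule cfcE)
  obtain Q where Q: "uniform_limit K (\<lambda>n. peval (Q n)) g sequentially" "(\<lambda>n. oeval (Q n) x) \<longlonglongrightarrow> cfc g"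
    using g by (rule cfcE)
  have "uniform_limit K (\<lambda>n. peval (PMult (P n) (Q n))) (\<lambda>t. f t * g t) sequentially"
    using uniform_lim_mult[OF P(1) Q(1) b] by (simp only: peval_simps_ext)
  from cfc_tendsto[OF this] have "(\<lambda>n. oeval (P n) x o\<^sub>L oeval (Q n) x) \<longlonglongrightarrow> cfc (\<lambda>t. f t * g t)" by simp
  then show ?thesis
    by (rule LIMSEQ_unique[OF _ bounded_bilinear.tendsto[OF bounded_bilinear_blinfun_compose P(2) Q(2)]])
qed

lemma cfc_peval: "cfc (peval p) = oeval p x"
proof -
  have "uniform_limit K (\<lambda>n::nat. peval p) (peval p) sequentially"
    by (rule uniform_limitI) simp
  from cfc_tendsto[OF this] show ?thesis by (simp add: LIMSEQ_const_iff)
qed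

lemma cfc_const [simp]: "cfc (\<lambda>t. c) = c *\<^sub>R id_blinfun"
proof -
  show ?thesis using cfc_peval[of "PConst c"] by (simp add: peval_simps_ext del: peval.simps)
qed

lemma cfc_var [simp]: "cfc (\<lambda>t. t $ i) = x i"
proof -
  show ?thesis using cfc_peval[of "PVar i"] by (simp add: peval_simps_ext del: peval.simps)
qed

lemma cfc_cmult: "continuous_on K f \<Longrightarrow> cfc (\<lambda>t. c * f t) = c *\<^sub>R cfc f"
  by (subst cfc_mult) (auto intro!: blinfun_eqI simp: blinfun_linear)

lemma cfc_diff:
  assumes f: "continuous_on K f" and g: "continuous_on K g"
  shows "cfc (\<lambda>t. f t - g t) = cfc f - cfc g"
proof -
  have "cfc (\<lambda>t. f t + (-1) * g t) = cfc f + (-1) *\<^sub>R cfc g"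
    by (subst cfc_add) (auto intro!: continuous_intros f g simp only: cfc_cmult[OF g])
  then show ?thesis by simp
qed

lemma cfc_sum:
  assumes "finite J" "\<And>j. j \<in> J \<Longrightarrow> continuous_on K (f j)"
  shows "cfc (\<lambda>t. \<Sum>j\<in>J. f j t) = (\<Sum>j\<in>J. cfc (f j))"
  using assms by (induction J rule: finite_induct) (auto simp: cfc_add continuous_on_sum)

text \<open>Functions that agree on \<open>K\<close> have the same approximating sequences, so
  \<open>SOME\<close> selects the same one for both.\<close>

lemma cfc_cong: "(\<And>t. t \<in> K \<Longrightarrow> f t = g t) \<Longrightarrow> cfc f = cfc g"
proof -
  assume "\<And>t. t \<in> K \<Longrightarrow> f t = g t"
  then have "uniform_limit K (\<lambda>n. peval (P n)) f sequentially = uniform_limit K (\<lambda>n. peval (P n)) g sequentially" for P :: "nat \<Rightarrow> 'n pexp"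
    by (intro uniform_limit_cong) auto
  then show ?thesis by (simp add: cfc_def)
qed

lemma cfc_positive:
  assumes f: "continuous_on K f" and p: "\<And>t. t \<in> K \<Longrightarrow> 0 \<le> f t"
  shows "positive_op (cfc f)"
proof -
  have c: "continuous_on K (\<lambda>t. sqrt (f t))" by (intro continuous_intros f)
  have "cfc f = cfc (\<lambda>t. sqrt (f t) * sqrt (f t))" by (rule cfc_cong) (use p in simp)
  also have "\<dots> = (cfc (\<lambda>t. sqrt (f t)) o\<^sub>L cfc (\<lambda>t. sqrt (f t)))" by (rule cfc_mult[OF c c])
  finally have "inner (cfc f v) v = inner (cfc (\<lambda>t. sqrt (f t)) v) (cfc (\<lambda>t. sqrt (f t)) v)" for v
    by (simp add: selfadjointD(2)[OF cfc_selfadjoint[OF c]])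
  then show ?thesis using cfc_selfadjoint[OF f] by (simp add: positive_op_iff)
qed

lemma norm_cfc_le:
  assumes f: "continuous_on K f" and b: "\<And>t. t \<in> K \<Longrightarrow> \<bar>f t\<bar> \<le> c"
  shows "norm (cfc f) \<le> c"
proof (rule norm_selfadjoint_le)
  show "0 \<le> c" using b[OF K_ne] by simp
  fix v
  have b': "0 \<le> c - f t" "0 \<le> c + f t" if "t \<in> K" for t using b[OF that] by auto
  have "positive_op (cfc (\<lambda>t. c - f t))" "positive_op (cfc (\<lambda>t. c + f t))"
    by (intro cfc_positive continuous_intros f b'; assumption)+
  then have "0 \<le> inner (cfc (\<lambda>t. c - f t) v) v" "0 \<le> inner (cfc (\<lambda>t. c + f t) v) v"
    by (auto simp: positive_op_iff)
  then show "\<bar>inner (cfc f v) v\<bar> \<le> c * (norm v)^2"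
    by (simp add: cfc_add cfc_diff f blinfun_linear inner_diff inner_add power2_norm_eq_inner abs_le_iff)
qed (rule cfc_selfadjoint[OF f])

lemma cfc_comm:
  assumes f: "continuous_on K f" and g: "continuous_on K g"
  shows "cfc f o\<^sub>L cfc g = cfc g o\<^sub>L cfc f"
  by (simp only: cfc_mult[OF f g, symmetric] cfc_mult[OF g f, symmetric] mult.commute)

text \<open>Without a unit in \<open>A\<close>, the operator \<open>cfc f\<close> itself may lie
  outside \<open>A\<close>. Products with elements of \<open>A\<close> stay inside, because constant
  terms then act as scalars.\<close>

lemma cfc_ideal:
  assumes A: "cstar_algebra A" and x: "\<And>i. x i \<in> A" and f: "continuous_on K f" and a: "a \<in> A"
  shows "(cfc f o\<^sub>L a) \<in> A" "(a o\<^sub>L cfc f) \<in> A"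
proof -
  note [intro] = cstar_algebraD[OF A]
  obtain P where P: "(\<lambda>n. oeval (P n) x) \<longlonglongrightarrow> cfc f" using f by (rule cfcE)
  have *: "(oeval p x o\<^sub>L b) \<in> A \<and> (b o\<^sub>L oeval p x) \<in> A" if "b \<in> A" for p b
    using that
  proof (induction p arbitrary: b)
    case (PConst c)
    have "(c *\<^sub>R id_blinfun o\<^sub>L b) = c *\<^sub>R b" "(b o\<^sub>L c *\<^sub>R id_blinfun) = c *\<^sub>R b"
      by (rule blinfun_eqI, simp add: blinfun_linear)+
    then show ?case using PConst by auto
  next
    case (PVar i) then show ?case using x by auto
  next
    case (PAdd p q)
    then have "(oeval p x o\<^sub>L b) + (oeval q x o\<^sub>L b) \<in> A" "(b o\<^sub>L oeval p x) + (b o\<^sub>L oeval q x) \<in> A"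
      by blast+
    then show ?case by (simp add: blinfun_compose_linear)
  next
    case (PMult p q)
    then have "(oeval p x o\<^sub>L (oeval q x o\<^sub>L b)) \<in> A" "((b o\<^sub>L oeval p x) o\<^sub>L oeval q x) \<in> A"
      by blast+
    moreover have "(oeval p x o\<^sub>L (oeval q x o\<^sub>L b)) = (oeval (PMult p q) x o\<^sub>L b)"
      "((b o\<^sub>L oeval p x) o\<^sub>L oeval q x) = (b o\<^sub>L oeval (PMult p q) x)"
      by (rule blinfun_eqI, simp)+
    ultimately show ?case by simp
  qed
  have l: "(\<lambda>n. oeval (P n) x o\<^sub>L a) \<longlonglongrightarrow> (cfc f o\<^sub>L a)" "(\<lambda>n. a o\<^sub>L oeval (P n) x) \<longlonglongrightarrow> (a o\<^sub>L cfc f)"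
    by (intro bounded_bilinear.tendsto[OF bounded_bilinear_blinfun_compose] tendsto_const P)+
  show "(cfc f o\<^sub>L a) \<in> A"
    by (rule closed_sequentially[OF cstar_algebraD(5)[OF A] _ l(1)]) (use * a in auto)
  show "(a o\<^sub>L cfc f) \<in> A"
    by (rule closed_sequentially[OF cstar_algebraD(5)[OF A] _ l(2)]) (use * a in auto)
qed

end

section \<open>Riesz representation on a compact metric space\<close>

lemma suminf_ennreal_le_partial:
  fixes f :: "nat \<Rightarrow> real"
  assumes f: "\<And>i. 0 \<le> f i" and b: "\<And>n. (\<Sum>i<n. f i) \<le> c"
  shows "(\<Sum>i. ennreal (f i)) \<le> ennreal c"
proof (rule suminf_le_const)
  fix n
  show "(\<Sum>i<n. ennreal (f i)) \<le> ennreal c" using b[of n] by (simp add: f ennreal_leI)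
qed simp

text \<open>For closed \<open>C\<close> these decrease to the indicator of \<open>C\<close>. The
  empty set is treated separately because \<open>infdist t {}\<close> is 0, which would give the
  constant 1.\<close>

definition urysohn :: "'a::metric_space set \<Rightarrow> nat \<Rightarrow> 'a \<Rightarrow> real" where
  "urysohn C k t = (if C = {} then 0 else max 0 (1 - real k * infdist t C))"

lemma urysohn: "continuous_on UNIV (urysohn C k)" "0 \<le> urysohn C k t" "urysohn C k t \<le> 1"
    "t \<in> C \<Longrightarrow> urysohn C k t = 1" "k \<le> l \<Longrightarrow> urysohn C l t \<le> urysohn C k t"
proof -
  show "continuous_on UNIV (urysohn C k)"
    by (cases "C = {}") (auto simp: urysohn_def[abs_def] intro!: continuous_intros)
  show "k \<le> l \<Longrightarrow> urysohn C l t \<le> urysohn C k t"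
    using mult_right_mono[of "real k" "real l" "infdist t C"] by (auto simp: urysohn_def infdist_nonneg)
qed (auto simp: urysohn_def infdist_nonneg)

lemma urysohn_eventually_0:
  assumes "closed C" "t \<notin> C"
  shows "\<exists>N. \<forall>k\<ge>N. urysohn C k t = 0"
proof (cases "C = {}")
  case False
  have d: "0 < infdist t C" by (rule infdist_pos_not_in_closed[OF assms(1) False assms(2)])
  then obtain N where N: "1 < real N * infdist t C" using ex_less_of_nat_mult by blast
  show ?thesis
  proof (intro exI allI impI)
    fix k assume "N \<le> k"
    then have "real N * infdist t C \<le> real k * infdist t C" using d by simp
    then show "urysohn C k t = 0" using N by (simp add: urysohn_def)
  qed
qed (simp add: urysohn_def)

lemma urysohn_tendsto:
  assumes "closed C" shows "(\<lambda>k. urysohn C k t) \<longlonglongrightarrow> indicator C t"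
proof (cases "t \<in> C")
  case False
  then obtain N where "\<forall>k\<ge>N. urysohn C k t = 0" using urysohn_eventually_0[OF assms] by blast
  then show ?thesis using False by (intro tendsto_eventually) (auto simp: eventually_sequentially)
qed (simp add: urysohn)

text \<open>Functions live on the whole space while nonnegativity is tested on \<open>K\<close>
  only; this is what makes the representing measure vanish off \<open>K\<close>.\<close>

locale pos_functional =
  fixes K :: "'a::metric_space set" and \<phi> :: "('a \<Rightarrow> real) \<Rightarrow> real"
  assumes K: "compact K"
    and phi_add: "continuous_on UNIV f \<Longrightarrow> continuous_on UNIV g \<Longrightarrow> \<phi> (\<lambda>t. f t + g t) = \<phi> f + \<phi> g"
    and phi_cmult: "continuous_on UNIV f \<Longrightarrow> \<phi> (\<lambda>t. c * f t) = c * \<phi> f"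
    and phi_nonneg: "continuous_on UNIV f \<Longrightarrow> (\<And>t. t \<in> K \<Longrightarrow> 0 \<le> f t) \<Longrightarrow> 0 \<le> \<phi> f"
begin

lemma phi_diff:
  assumes f: "continuous_on UNIV f" and g: "continuous_on UNIV g"
  shows "\<phi> (\<lambda>t. f t - g t) = \<phi> f - \<phi> g"
proof -
  have "\<phi> (\<lambda>t. f t + (-1) * g t) = \<phi> f + (-1) * \<phi> g"
    by (simp only: phi_add[OF f continuous_on_mult_left[OF g]] phi_cmult[OF g])
  then show ?thesis by simp
qed

lemma phi_mono:
  assumes f: "continuous_on UNIV f" and g: "continuous_on UNIV g" and "\<And>t. t \<in> K \<Longrightarrow> f t \<le> g t"
  shows "\<phi> f \<le> \<phi> g"
  using phi_nonneg[of "\<lambda>t. g t - f t"] assms by (simp add: phi_diff continuous_on_diff)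

lemma phi_cong:
  assumes f: "continuous_on UNIV f" and g: "continuous_on UNIV g" and "\<And>t. t \<in> K \<Longrightarrow> f t = g t"
  shows "\<phi> f = \<phi> g"
  by (intro antisym phi_mono f g) (simp_all add: assms(3))

lemma phi_zero: "\<phi> (\<lambda>t. 0) = 0"
  using phi_cmult[of "\<lambda>t. 0" 0] by (simp add: continuous_on_const)

lemma phi_sum:
  assumes "\<And>j. continuous_on UNIV (f j)"
  shows "\<phi> (\<lambda>t. \<Sum>j<n. f j t) = (\<Sum>j<(n::nat). \<phi> (f j))"
  by (induction n) (simp_all add: phi_zero phi_add assms continuous_on_sum)

definition cover :: "'a set \<Rightarrow> (nat \<Rightarrow> 'a \<Rightarrow> real) \<Rightarrow> bool" where
  "cover S h \<longleftrightarrow> (\<forall>j. continuous_on UNIV (h j)) \<and> (\<forall>j t. 0 \<le> h j t) \<and> (\<forall>t\<in>S. 1 \<le> (\<Sum>j. ennreal (h j t)))"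

text \<open>
  Covers by continuous functions in place of open sets: the outer measure is then computed from \<open>\<phi>\<close>
  directly, without approximating indicator functions from below.
\<close>

definition om :: "'a set \<Rightarrow> ennreal" where
  "om S = (INF h\<in>{h. cover S h}. \<Sum>j. ennreal (\<phi> (h j)))"

lemma om_le: "cover S h \<Longrightarrow> om S \<le> (\<Sum>j. ennreal (\<phi> (h j)))"
  unfolding om_def by (rule INF_lower) simp

lemma om_le_double:
  assumes c: "\<And>j k. continuous_on UNIV (h j k)" and p: "\<And>j k t. 0 \<le> h j k t"
    and s: "\<And>t. t \<in> S \<Longrightarrow> 1 \<le> (\<Sum>j. \<Sum>k. ennreal (h j k t))"
  shows "om S \<le> (\<Sum>j. \<Sum>k. ennreal (\<phi> (h j k)))"
proof -
  define g where "g i = h (fst (prod_decode i)) (snd (prod_decode i))" for i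
  have e: "(\<Sum>i. ennreal (F (fst (prod_decode i)) (snd (prod_decode i)))) = (\<Sum>j. \<Sum>k. ennreal (F j k))" for F :: "nat \<Rightarrow> nat \<Rightarrow> real"
    using suminf_ennreal_2dimen[of "\<lambda>j. \<Sum>k. ennreal (F j k)" "\<lambda>(j,k). ennreal (F j k)"]
    by (simp add: case_prod_beta)
  have "cover S g" unfolding cover_def g_def
    using c p s by (auto simp: e[of "\<lambda>j k. h j k _"])
  from om_le[OF this] show ?thesis by (simp add: g_def e[of "\<lambda>j k. \<phi> (h j k)"])
qed

lemma om_le_phi:
  assumes g: "continuous_on UNIV g" "\<And>t. 0 \<le> g t" "\<And>t. t \<in> S \<Longrightarrow> 1 \<le> g t"
  shows "om S \<le> ennreal (\<phi> g)"
proof -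
  define h where "h j = (if j = 0 then g else (\<lambda>t. 0))" for j :: nat
  have e: "(\<Sum>j. ennreal (F (h j))) = ennreal (F g)" if "F (\<lambda>t. 0) = 0" for F :: "('a \<Rightarrow> real) \<Rightarrow> real"
  proof -
    have "(\<Sum>j. ennreal (F (h j))) = (\<Sum>j\<in>{0}. ennreal (F (h j)))"
      by (rule suminf_finite) (auto simp: h_def that)
    then show ?thesis by (simp add: h_def)
  qed
  have "cover S h"
    unfolding cover_def
  proof (intro conjI allI ballI)
    fix j t
    show "continuous_on UNIV (h j)" "0 \<le> h j t" using g by (auto simp: h_def)
  next
    fix t assume "t \<in> S"
    from ennreal_leI[OF g(3)[OF this]] show "1 \<le> (\<Sum>j. ennreal (h j t))" by (simp add: e[of "\<lambda>f. f t"])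
  qed
  from om_le[OF this] show ?thesis by (simp add: e[of \<phi>] phi_zero)
qed

lemma om_finite: "om S < top"
  by (rule le_less_trans[OF om_le_phi[of "\<lambda>t. 1"]]) auto

lemma om_coverE:
  assumes "0 < e"
  obtains h where "cover S h" "(\<Sum>j. ennreal (\<phi> (h j))) \<le> om S + ennreal e"
proof -
  have "om S < om S + ennreal e" using om_finite[of S] assms by (cases "om S") (auto simp flip: ennreal_plus intro!: ennreal_lessI)
  then obtain h where "cover S h" "(\<Sum>j. ennreal (\<phi> (h j))) < om S + ennreal e"
    by (subst (asm) (1) om_def) (auto simp: INF_less_iff)
  then show ?thesis using that less_imp_le by blast
qed

lemma om_outer_measure: "outer_measure_space (Pow UNIV) om"
  unfolding outer_measure_space_def
proof (intro conjI)
  show "positive (Pow UNIV) om"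
    using om_le_phi[of "\<lambda>t. 0" "{}"] by (simp add: positive_def phi_zero continuous_on_const)
  show "increasing (Pow UNIV) om"
    unfolding increasing_def om_def
  proof (intro ballI impI INF_superset_mono subsetI)
    fix x y h assume "x \<subseteq> y" "h \<in> {h. cover y h}"
    then show "h \<in> {h. cover x h}" by (simp add: cover_def subset_iff)
  qed simp
  show "countably_subadditive (Pow UNIV) om"
    unfolding countably_subadditive_def
  proof (intro allI impI)
    fix A :: "nat \<Rightarrow> 'a set"
    show "om (\<Union>i. A i) \<le> (\<Sum>i. om (A i))"
    proof (rule ennreal_le_epsilon)
      fix e :: real assume e: "0 < e"
      have "\<exists>h. cover (A i) h \<and> (\<Sum>j. ennreal (\<phi> (h j))) \<le> om (A i) + ennreal (e * (1/2)^Suc i)" for i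
        using om_coverE[of "e * (1/2)^Suc i" "A i"] e by (metis mult_pos_pos zero_less_power half_gt_zero_iff zero_less_one)
      then obtain h where h: "\<And>i. cover (A i) (h i)"
        "\<And>i. (\<Sum>j. ennreal (\<phi> (h i j))) \<le> om (A i) + ennreal (e * (1/2)^Suc i)" by metis
      have "om (\<Union>i. A i) \<le> (\<Sum>i. \<Sum>j. ennreal (\<phi> (h i j)))"
      proof (rule om_le_double)
        fix t assume "t \<in> (\<Union>i. A i)"
        then obtain i where "t \<in> A i" by blast
        then have "1 \<le> (\<Sum>j. ennreal (h i j t))" using h(1)[of i] by (auto simp: cover_def)
        also have "\<dots> = (\<Sum>i\<in>{i}. \<Sum>j. ennreal (h i j t))" by simp
        also have "\<dots> \<le> (\<Sum>i. \<Sum>j. ennreal (h i j t))" by (rule sum_le_suminf) auto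
        finally show "1 \<le> (\<Sum>i. \<Sum>j. ennreal (h i j t))" .
      qed (use h(1) in \<open>auto simp: cover_def\<close>)
      also have "\<dots> \<le> (\<Sum>i. om (A i) + ennreal (e * (1/2)^Suc i))" by (rule suminf_le[OF h(2)]) auto
      also have "\<dots> = (\<Sum>i. om (A i)) + (\<Sum>i. ennreal (e * (1/2)^Suc i))" by (rule suminf_add[symmetric]) auto
      also have "(\<Sum>i. ennreal (e * (1/2)^Suc i)) = ennreal e"
        by (rule suminf_ennreal_eq) (use e sums_mult[OF power_half_series, of e] in auto)
      finally show "om (\<Union>i. A i) \<le> (\<Sum>i. om (A i)) + ennreal e" .
    qed
  qed
qed

text \<open>A nearly optimal cover \<open>h\<close> of \<open>S\<close> is split between
  \<open>C\<close> and its complement. The functions \<open>h j * urysohn C k\<close> cover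
  \<open>C \<inter> S\<close>, but the remainders \<open>h j * (1 - urysohn C k)\<close> for one
  fixed \<open>k\<close> are too small near \<open>C\<close>. The complement is therefore covered by
  all telescoping differences at once, which add up to \<open>h j\<close> off
  \<open>C\<close>.\<close>

lemma om_closed:
  assumes C: "closed C"
  shows "C \<in> lambda_system UNIV (Pow UNIV) om"
proof -
  have sub: "subadditive (Pow UNIV) om"
    using om_outer_measure unfolding outer_measure_space_def
    by (metis ring_of_sets.countably_subadditive_subadditive ring_of_sets_Pow)
  have "om (C \<inter> S) + om ((UNIV - C) \<inter> S) \<le> om S" for S
  proof (rule ennreal_le_epsilon)
    fix e :: real assume e: "0 < e"
    then have e2: "0 < e / 2" by simp
    obtain h where h: "cover S h" "(\<Sum>j. ennreal (\<phi> (h j))) \<le> om S + ennreal (e/2)" using om_coverE[OF e2] .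
    note hc = h(1)[unfolded cover_def]
    let ?a = "\<lambda>j k. \<phi> (\<lambda>t. h j t * urysohn C k t)"
    have c: "continuous_on UNIV (\<lambda>t. h j t * urysohn C k t)" for j k
      by (intro continuous_intros urysohn) (use hc in auto)
    have a0: "0 \<le> ?a j k" for j k by (rule phi_nonneg[OF c]) (use hc in \<open>auto simp: urysohn\<close>)
    have bdd: "bdd_below (range (?a j))" for j by (rule bdd_belowI2) (rule a0)
    \<comment> \<open>The share of \<open>h j\<close> that belongs to \<open>C\<close>. The level
      \<open>m j\<close> approximates it within the \<open>j\<close>-th term of a series of sum
      \<open>e/2\<close>.\<close>
    define L where "L j = (INF k. ?a j k)" for j
    have L: "L j \<le> ?a j k" for j k unfolding L_def by (rule cINF_lower[OF bdd]) simp
    have "\<exists>k. ?a j k < L j + e/2 * (1/2)^Suc j" for j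
      using cInf_lessD[of "range (?a j)" "L j + e/2 * (1/2)^Suc j"] e unfolding L_def by auto
    then obtain m where m: "\<And>j. ?a j (m j) < L j + e/2 * (1/2)^Suc j" by metis
    have 1: "om (C \<inter> S) \<le> (\<Sum>j. ennreal (?a j (m j)))"
      by (rule om_le) (use hc c in \<open>auto simp: cover_def urysohn\<close>)
    \<comment> \<open>Starting at \<open>\<psi> j 0 = 1\<close> makes the differences telescope from
      \<open>h j\<close> itself, and off \<open>C\<close> they telescope down to 0.\<close>
    define \<psi> where "\<psi> j k t = (case k of 0 \<Rightarrow> 1 | Suc k' \<Rightarrow> urysohn C (m j + k') t)" for j k t
    have psi: "\<psi> j (Suc k) t \<le> \<psi> j k t" for j k t by (cases k) (auto simp: \<psi>_def urysohn)
    have cpsi: "continuous_on UNIV (\<psi> j k)" for j k by (cases k) (auto simp: \<psi>_def[abs_def] urysohn)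
    let ?g = "\<lambda>j k t. h j t * (\<psi> j k t - \<psi> j (Suc k) t)"
    have cg: "continuous_on UNIV (?g j k)" for j k
      by (intro continuous_intros cpsi) (use hc in auto)
    have g0: "0 \<le> ?g j k t" for j k t using hc psi by (simp add: mult_nonneg_nonneg)
    have 2: "om ((UNIV - C) \<inter> S) \<le> (\<Sum>j. \<Sum>k. ennreal (\<phi> (?g j k)))"
    proof (rule om_le_double[OF cg g0])
      fix t assume t: "t \<in> (UNIV - C) \<inter> S"
      have "(\<Sum>k. ennreal (?g j k t)) = ennreal (h j t)" for j
      proof (rule suminf_ennreal_eq[OF g0])
        obtain N where N: "\<forall>k\<ge>N. urysohn C k t = 0" using urysohn_eventually_0[OF C] t by blast
        have "(\<lambda>k. \<psi> j k t) \<longlonglongrightarrow> 0"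
        proof (rule LIMSEQ_imp_Suc[OF tendsto_eventually])
          show "\<forall>\<^sub>F k in sequentially. \<psi> j (Suc k) t = 0"
            using N by (auto simp: \<psi>_def eventually_sequentially intro!: exI[of _ N])
        qed
        from sums_mult[OF telescope_sums'[OF this], of "h j t"]
        show "(\<lambda>k. ?g j k t) sums h j t" by (simp add: \<psi>_def[of j 0])
      qed
      then show "1 \<le> (\<Sum>j. \<Sum>k. ennreal (?g j k t))" using hc t by simp
    qed
    have 3: "(\<Sum>k. ennreal (\<phi> (?g j k))) \<le> ennreal (\<phi> (h j) - L j)" for j
    proof (rule suminf_ennreal_le_partial)
      show "0 \<le> \<phi> (?g j k)" for k by (rule phi_nonneg[OF cg g0])
      fix n
      have "(\<Sum>k<n. ?g j k t) = h j t - h j t * \<psi> j n t" for t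
        by (induction n) (auto simp: \<psi>_def[of j 0] algebra_simps)
      then have "(\<Sum>k<n. \<phi> (?g j k)) = \<phi> (\<lambda>t. h j t - h j t * \<psi> j n t)"
        using phi_sum[of "?g j" n, OF cg] by simp
      also have "\<dots> = \<phi> (h j) - \<phi> (\<lambda>t. h j t * \<psi> j n t)"
        by (rule phi_diff) (use hc in \<open>auto intro!: continuous_intros cpsi\<close>)
      finally have eq: "(\<Sum>k<n. \<phi> (?g j k)) = \<phi> (h j) - \<phi> (\<lambda>t. h j t * \<psi> j n t)" .
      have "L j \<le> \<phi> (\<lambda>t. h j t * \<psi> j n t)"
      proof (cases n)
        case 0
        have "L j \<le> ?a j 0" by (rule L)
        also have "\<dots> \<le> \<phi> (\<lambda>t. h j t * \<psi> j n t)"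
          unfolding 0 by (rule phi_mono[OF c]) (use hc in \<open>auto simp: \<psi>_def mult_left_le urysohn\<close>)
        finally show ?thesis .
      next
        case (Suc k) then show ?thesis using L[of j "m j + k"] by (simp add: \<psi>_def)
      qed
      then show "(\<Sum>k<n. \<phi> (?g j k)) \<le> \<phi> (h j) - L j" by (simp only: eq)
    qed
    have "om (C \<inter> S) + om ((UNIV - C) \<inter> S) \<le> (\<Sum>j. ennreal (?a j (m j))) + (\<Sum>j. ennreal (\<phi> (h j) - L j))"
      using 1 order_trans[OF 2 suminf_le[OF 3]] by (intro add_mono) auto
    also have "\<dots> = (\<Sum>j. ennreal (?a j (m j)) + ennreal (\<phi> (h j) - L j))" by (rule suminf_add) auto
    also have "\<dots> \<le> (\<Sum>j. ennreal (\<phi> (h j)) + ennreal (e/2 * (1/2)^Suc j))"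
    proof (rule suminf_le)
      fix j
      have p0: "0 \<le> \<phi> (h j)" by (rule phi_nonneg) (use hc in auto)
      have "L j \<le> \<phi> (h j)"
        by (rule order_trans[OF L[of j 0] phi_mono[OF c]]) (use hc in \<open>auto simp: mult_left_le urysohn\<close>)
      then have "ennreal (?a j (m j)) + ennreal (\<phi> (h j) - L j) = ennreal (?a j (m j) + (\<phi> (h j) - L j))"
        using a0 by (intro ennreal_plus[symmetric]) auto
      also have "\<dots> \<le> ennreal (\<phi> (h j) + e/2 * (1/2)^Suc j)" using m[of j] by (intro ennreal_leI) linarith
      also have "\<dots> = ennreal (\<phi> (h j)) + ennreal (e/2 * (1/2)^Suc j)" using e p0 by (intro ennreal_plus) auto
      finally show "ennreal (?a j (m j)) + ennreal (\<phi> (h j) - L j) \<le> ennreal (\<phi> (h j)) + ennreal (e/2 * (1/2)^Suc j)" .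
    qed auto
    also have "\<dots> = (\<Sum>j. ennreal (\<phi> (h j))) + (\<Sum>j. ennreal (e/2 * (1/2)^Suc j))" by (rule suminf_add[symmetric]) auto
    also have "(\<Sum>j. ennreal (e/2 * (1/2)^Suc j)) = ennreal (e/2)"
      by (rule suminf_ennreal_eq) (use e sums_mult[OF power_half_series, of "e/2"] in auto)
    also have "(\<Sum>j. ennreal (\<phi> (h j))) + ennreal (e/2) \<le> om S + ennreal (e/2) + ennreal (e/2)" by (rule add_right_mono[OF h(2)])
    also have "\<dots> = om S + ennreal e" using e by (simp add: add.assoc flip: ennreal_plus)
    finally show "om (C \<inter> S) + om ((UNIV - C) \<inter> S) \<le> om S + ennreal e" .
  qed
  moreover have "om S \<le> om (C \<inter> S) + om ((UNIV - C) \<inter> S)" for S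
  proof -
    have "S = (C \<inter> S) \<union> ((UNIV - C) \<inter> S)" "(C \<inter> S) \<inter> ((UNIV - C) \<inter> S) = {}" by blast+
    then show ?thesis using sub unfolding subadditive_def by (metis Pow_UNIV UNIV_I)
  qed
  ultimately show ?thesis unfolding lambda_system_def by (auto intro: antisym)
qed

definition riesz_measure :: "'a measure" where "riesz_measure = measure_of UNIV (sets borel) om"

lemma riesz_measure: "sets riesz_measure = sets borel" "space riesz_measure = UNIV"
    "S \<in> sets borel \<Longrightarrow> emeasure riesz_measure S = om S"
proof -
  let ?L = "lambda_system UNIV (Pow UNIV) om"
  have ms: "measure_space UNIV ?L om"
    using sigma_algebra.caratheodory_lemma[OF sigma_algebra_Pow om_outer_measure] .
  then have sL: "sigma_algebra UNIV ?L" by (simp add: measure_space_def)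
  have sub: "sets borel \<subseteq> ?L"
    unfolding borel_eq_closed using sigma_algebra.sigma_sets_subset[OF sL, of "Collect closed"] om_closed
    by (simp add: subset_iff)
  have ms': "measure_space UNIV (sets borel) om"
    by (rule measure_down[OF ms _ sub]) (metis sets.sigma_algebra_axioms space_borel)
  show s: "sets riesz_measure = sets borel" "space riesz_measure = UNIV"
    using sets.sigma_sets_eq[of borel] by (simp_all add: riesz_measure_def)
  show "S \<in> sets borel \<Longrightarrow> emeasure riesz_measure S = om S"
    by (rule emeasure_measure_of[OF riesz_measure_def]) (use ms' s in \<open>auto simp: measure_space_def\<close>)
qed

text \<open>Compactness of \<open>K\<close> replaces a countable cover by a finite partial sum: the
  increasing open sets on which the partial sums exceed \<open>g - d\<close> exhaust
  \<open>K\<close>. The number \<open>d\<close> is chosen so that subtracting it costs at most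
  \<open>e\<close> under \<open>\<phi>\<close>.\<close>

lemma phi_le_om:
  assumes g: "continuous_on UNIV g" and g1: "\<And>t. t \<in> K \<Longrightarrow> g t \<le> 1" and g0: "\<And>t. t \<in> K \<Longrightarrow> t \<notin> S \<Longrightarrow> g t \<le> 0"
  shows "ennreal (\<phi> g) \<le> om S"
  unfolding om_def
proof (rule INF_greatest)
  fix h assume "h \<in> {h. cover S h}"
  then have hc: "\<And>j. continuous_on UNIV (h j)" "\<And>j t. 0 \<le> h j t" "\<And>t. t \<in> S \<Longrightarrow> 1 \<le> (\<Sum>j. ennreal (h j t))"
    by (auto simp: cover_def)
  show "ennreal (\<phi> g) \<le> (\<Sum>j. ennreal (\<phi> (h j)))"
  proof (rule ennreal_le_epsilon)
    fix e :: real assume e: "0 < e"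
    have p1: "0 \<le> \<phi> (\<lambda>t. 1)" by (rule phi_nonneg) auto
    define d where "d = e / (\<phi> (\<lambda>t. 1) + 1)"
    have d: "0 < d" using e p1 by (simp add: d_def)
    define U where "U n = {t. g t - d < (\<Sum>j<n. h j t)}" for n
    have oU: "open (U n)" for n unfolding U_def
      by (intro open_Collect_less continuous_intros g hc)
    have mU: "U n \<subseteq> U n'" if "n \<le> n'" for n n'
    proof -
      have le: "(\<Sum>j<n. h j t) \<le> (\<Sum>j<n'. h j t)" for t by (rule sum_mono2) (use that in \<open>auto simp: hc(2)\<close>)
      show ?thesis
      proof
        fix t assume "t \<in> U n"
        then show "t \<in> U n'" using le[of t] by (simp add: U_def)
      qed
    qed
    have "t \<in> (\<Union>n. U n)" if t: "t \<in> K" for t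
    proof (cases "t \<in> S")
      case False
      then have "t \<in> U 0" using g0[OF t] d by (simp add: U_def)
      then show ?thesis by blast
    next
      case True
      show ?thesis
      proof (rule ccontr)
        assume "t \<notin> (\<Union>n. U n)"
        then have "\<And>n. (\<Sum>j<n. h j t) \<le> g t - d" by (auto simp: U_def not_less)
        then have "(\<Sum>j. ennreal (h j t)) \<le> ennreal (g t - d)" by (rule suminf_ennreal_le_partial[OF hc(2)])
        also have "\<dots> < 1" using g1[OF t] d by (simp add: ennreal_less_one_iff)
        finally show False using hc(3)[OF True] by simp
      qed
    qed
    then have "K \<subseteq> (\<Union>n\<in>UNIV. U n)" by blast
    then obtain I where I: "finite I" "K \<subseteq> (\<Union>n\<in>I. U n)" using compactE_image[OF K, of UNIV U] oU by metis
    obtain n where n: "K \<subseteq> U n"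
    proof
      show "K \<subseteq> U (Max (insert 0 I))"
      proof
        fix t assume "t \<in> K"
        then obtain i where i: "i \<in> I" "t \<in> U i" using I(2) by blast
        then have "i \<le> Max (insert 0 I)" using I(1) by simp
        then show "t \<in> U (Max (insert 0 I))" using mU i(2) by blast
      qed
    qed
    have "\<phi> g - d * \<phi> (\<lambda>t. 1) = \<phi> (\<lambda>t. g t - d * 1)"
      by (simp only: phi_diff[OF g continuous_on_mult_left[OF continuous_on_const]] phi_cmult[OF continuous_on_const])
    also have "\<dots> \<le> \<phi> (\<lambda>t. \<Sum>j<n. h j t)"
      by (rule phi_mono) (use n in \<open>auto simp: U_def intro!: continuous_intros g hc less_imp_le\<close>)
    also have "\<dots> = (\<Sum>j<n. \<phi> (h j))" by (rule phi_sum[OF hc(1)])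
    finally have "\<phi> g \<le> (\<Sum>j<n. \<phi> (h j)) + e"
    proof -
      assume *: "\<phi> g - d * \<phi> (\<lambda>t. 1) \<le> (\<Sum>j<n. \<phi> (h j))"
      have "d * \<phi> (\<lambda>t. 1) \<le> e" using p1 e by (simp add: d_def field_simps)
      with * show ?thesis by linarith
    qed
    then have "ennreal (\<phi> g) \<le> ennreal ((\<Sum>j<n. \<phi> (h j)) + e)" by (rule ennreal_leI)
    also have "ennreal ((\<Sum>j<n. \<phi> (h j)) + e) = (\<Sum>j<n. ennreal (\<phi> (h j))) + ennreal e"
      using e by (simp add: sum_nonneg phi_nonneg[OF hc(1) hc(2)])
    also have "(\<Sum>j<n. ennreal (\<phi> (h j))) \<le> (\<Sum>j. ennreal (\<phi> (h j)))" by (rule sum_le_suminf) auto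
    finally show "ennreal (\<phi> g) \<le> (\<Sum>j. ennreal (\<phi> (h j))) + ennreal e" by (simp add: add_right_mono)
  qed
qed

end

context pos_functional begin

lemma finite_riesz_measure: "finite_measure riesz_measure"
  by (rule finite_measureI) (use om_finite[of UNIV] in \<open>simp add: riesz_measure less_top\<close>)

lemma measure_riesz: "S \<in> sets borel \<Longrightarrow> ennreal (measure riesz_measure S) = om S"
  using finite_measure.emeasure_eq_measure[OF finite_riesz_measure] riesz_measure(3) by metis

lemma measure_riesz_UNIV: "measure riesz_measure UNIV = \<phi> (\<lambda>t. 1)"
proof -
  have "om UNIV = ennreal (\<phi> (\<lambda>t. 1))"
    by (intro antisym om_le_phi phi_le_om) auto
  moreover have "0 \<le> \<phi> (\<lambda>t. 1)" by (rule phi_nonneg) auto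
  ultimately show ?thesis using measure_riesz[of UNIV] by simp
qed

text \<open>The distance to \<open>K\<close> has value 0 under \<open>\<phi>\<close>, yet infinitely
  many copies of it cover the complement, since there its constant series diverges.\<close>

lemma emeasure_riesz_Compl: "emeasure riesz_measure (- K) = 0"
proof -
  have cK: "closed K" using K by (rule compact_imp_closed)
  define h where "h = (\<lambda>j::nat. \<lambda>t. if K = {} then 1 else infdist t K)"
  have ch: "continuous_on UNIV (h j)" for j
    by (cases "K = {}") (auto simp: h_def intro!: continuous_intros)
  have "\<phi> (h j) = \<phi> (\<lambda>t. 0)" for j
    by (rule phi_cong[OF ch continuous_on_const]) (auto simp: h_def)
  then have ph: "\<phi> (h j) = 0" for j by (simp add: phi_zero)
  have "cover (- K) h"
    unfolding cover_def
  proof (intro conjI allI ballI)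
    fix j t show "continuous_on UNIV (h j)" "0 \<le> h j t" using ch by (auto simp: h_def infdist_nonneg)
  next
    fix t assume t: "t \<in> - K"
    have "0 < h 0 t" using infdist_pos_not_in_closed[OF cK, of t] t by (auto simp: h_def)
    then have pos: "0 < ennreal (h 0 t)" by simp
    have "(\<Sum>j. ennreal (h j t)) = (\<Sum>j::nat. ennreal (h 0 t))" by (simp add: h_def)
    also have "\<dots> = top"
    proof (rule ccontr)
      assume "(\<Sum>j::nat. ennreal (h 0 t)) \<noteq> top"
      then have "summable (\<lambda>j::nat. h 0 t)" by (intro summable_suminf_not_top) (auto simp: h_def infdist_nonneg)
      then show False using \<open>0 < h 0 t\<close> by (simp add: summable_const_iff)
    qed
    finally show "1 \<le> (\<Sum>j. ennreal (h j t))" by simp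
  qed
  from om_le[OF this] show ?thesis using cK by (simp add: ph riesz_measure(3))
qed

lemma borel_measurable_riesz: "continuous_on UNIV f \<Longrightarrow> f \<in> borel_measurable riesz_measure"
  by (simp add: measurable_cong_sets[OF riesz_measure(1) refl] borel_measurable_continuous_onI)

text \<open>Layer-cake comparison. The layer \<open>F i\<close> has height at most
  \<open>1/(n+1)\<close>, vanishes off \<open>S i\<close> and is full on \<open>S (Suc i)\<close>.
  So \<open>\<phi>\<close> sees it as at most the measure of \<open>S i\<close>, and the integral as
  at least that of \<open>S (Suc i)\<close>; the index shift leaves the bottom layer as
  error.\<close>

lemma phi_le_integral_aux:
  assumes f: "continuous_on UNIV f" and f01: "\<And>t. 0 \<le> f t" "\<And>t. f t \<le> 1"
  shows "\<phi> f \<le> integral\<^sup>L riesz_measure f + \<phi> (\<lambda>t. 1) / real (Suc n)"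
proof -
  interpret finite_measure riesz_measure by (rule finite_riesz_measure)
  let ?M = riesz_measure and ?N = "real (Suc n)"
  define S where "S i = {t. real i / ?N \<le> f t}" for i :: nat
  have bS: "S i \<in> sets borel" for i
    unfolding S_def by (intro borel_closed closed_Collect_le continuous_intros f)
  define F where "F i t = min (f t) (real (Suc i) / ?N) - min (f t) (real i / ?N)" for i t
  have cF: "continuous_on UNIV (F i)" for i unfolding F_def by (intro continuous_intros f)
  have mono: "real i / ?N \<le> real (Suc i) / ?N" for i by (simp add: divide_right_mono)
  have step: "real (Suc i) / ?N = real i / ?N + 1 / ?N" for i by (simp add: add_divide_distrib[symmetric])
  have d0: "0 \<le> 1 / ?N" by simp
  have F0: "0 \<le> F i t" for i t using mono[of i] by (auto simp: F_def min_def)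
  have "0 \<le> d \<Longrightarrow> min y (a + d) - min y a \<le> d" for y a d :: real by (simp add: min_def)
  from this[OF d0] have F1: "F i t \<le> 1 / ?N" for i t unfolding F_def step .
  have Fz: "t \<notin> S i \<Longrightarrow> F i t = 0" for i t using mono[of i] by (auto simp: F_def S_def min_def)
  have "0 \<le> d \<Longrightarrow> a + d \<le> y \<Longrightarrow> min y (a + d) - min y a = d" for y a d :: real by (simp add: min_def)
  from this[OF d0] have Fi: "t \<in> S (Suc i) \<Longrightarrow> F i t = 1 / ?N" for i t unfolding F_def S_def step by blast
  have Fsum: "(\<Sum>i<k. F i t) = min (f t) (real k / ?N)" for k t
    using f01(1)[of t] by (induction k) (auto simp: F_def)
  have a: "?N * \<phi> (F i) \<le> measure ?M (S i)" for i
  proof -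
    have "ennreal (\<phi> (\<lambda>t. ?N * F i t)) \<le> om (S i)"
    proof (rule phi_le_om)
      show "continuous_on UNIV (\<lambda>t. ?N * F i t)" by (intro continuous_intros cF)
      show "?N * F i t \<le> 1" for t using F1[of i t] by (simp add: field_simps)
    qed (simp add: Fz)
    then show ?thesis using measure_riesz[OF bS[of i]] by (metis ennreal_le_iff measure_nonneg phi_cmult[OF cF])
  qed
  have "\<phi> f = \<phi> (\<lambda>t. \<Sum>i<Suc n. F i t)"
    using f01(2) by (intro arg_cong[of _ _ \<phi>] ext) (simp only: Fsum, simp)
  also have "\<dots> = (\<Sum>i<Suc n. \<phi> (F i))" by (rule phi_sum[OF cF])
  also have "\<dots> \<le> (\<Sum>i<Suc n. measure ?M (S i) / ?N)"
    using a by (intro sum_mono) (simp add: field_simps)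
  also have "\<dots> = measure ?M (S 0) / ?N + (\<Sum>i<n. measure ?M (S (Suc i)) / ?N)" by (rule sum.lessThan_Suc_shift)
  also have "S 0 = UNIV" using f01 by (auto simp: S_def)
  finally have 1: "\<phi> f \<le> \<phi> (\<lambda>t. 1) / ?N + (\<Sum>i<n. measure ?M (S (Suc i)) / ?N)" by (simp only: measure_riesz_UNIV)
  have mS: "S i \<in> sets ?M" for i using bS riesz_measure(1) by simp
  have "(\<Sum>i<n. measure ?M (S (Suc i)) / ?N) = integral\<^sup>L ?M (\<lambda>t. \<Sum>i<n. indicator (S (Suc i)) t / ?N)"
    using mS riesz_measure(2) by (subst Bochner_Integration.integral_sum)
      (auto intro!: integrable_real_indicator simp: emeasure_eq_measure)
  also have "\<dots> \<le> integral\<^sup>L ?M f"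
  proof (rule integral_mono)
    show "integrable ?M (\<lambda>t. \<Sum>i<n. indicator (S (Suc i)) t / ?N)"
      using mS by (intro Bochner_Integration.integrable_sum integrable_divide integrable_real_indicator) (auto simp: emeasure_eq_measure)
    show "integrable ?M f"
      by (rule integrable_const_bound[where B = 1]) (use f01 borel_measurable_riesz[OF f] in auto)
    fix t
    have "(\<Sum>i<n. indicator (S (Suc i)) t / ?N) \<le> (\<Sum>i<n. F i t)"
      by (rule sum_mono) (use Fi F0 in \<open>auto simp: indicator_def\<close>)
    also have "\<dots> \<le> f t" by (simp add: Fsum del: of_nat_Suc)
    finally show "(\<Sum>i<n. indicator (S (Suc i)) t / ?N) \<le> f t" .
  qed
  finally show ?thesis using 1 by simp
qed

text \<open>The one-sided estimate is applied to \<open>f\<close> and to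
  \<open>1 - f\<close>.\<close>

lemma integral_riesz_unit:
  assumes f: "continuous_on UNIV f" and f01: "\<And>t. 0 \<le> f t" "\<And>t. f t \<le> 1"
  shows "integral\<^sup>L riesz_measure f = \<phi> f"
proof -
  interpret finite_measure riesz_measure by (rule finite_riesz_measure)
  have int: "integrable riesz_measure f"
    by (rule integrable_const_bound[where B = 1]) (use f01 borel_measurable_riesz[OF f] in auto)
  have le: "\<phi> g \<le> integral\<^sup>L riesz_measure g"
    if g: "continuous_on UNIV g" "\<And>t. 0 \<le> g t" "\<And>t. g t \<le> 1" for g
  proof (rule LIMSEQ_le_const)
    show "(\<lambda>n. integral\<^sup>L riesz_measure g + \<phi> (\<lambda>t. 1) / real (Suc n)) \<longlonglongrightarrow> integral\<^sup>L riesz_measure g"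
      using tendsto_add[OF tendsto_const LIMSEQ_Suc[OF lim_const_over_n[of "\<phi> (\<lambda>t. 1)"]], of "integral\<^sup>L riesz_measure g"] by simp
    show "\<exists>N. \<forall>n\<ge>N. \<phi> g \<le> integral\<^sup>L riesz_measure g + \<phi> (\<lambda>t. 1) / real (Suc n)"
      using phi_le_integral_aux[OF g] by blast
  qed
  have "\<phi> (\<lambda>t. 1 - f t) \<le> integral\<^sup>L riesz_measure (\<lambda>t. 1 - f t)"
    by (rule le) (use f01 in \<open>auto intro!: continuous_intros f\<close>)
  also have "\<dots> = \<phi> (\<lambda>t. 1) - integral\<^sup>L riesz_measure f"
    using int by (subst Bochner_Integration.integral_diff) (auto simp: riesz_measure(2) measure_riesz_UNIV)
  also have "\<phi> (\<lambda>t. 1 - f t) = \<phi> (\<lambda>t. 1) - \<phi> f" by (rule phi_diff) (auto intro!: continuous_intros f)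
  finally show ?thesis using le[OF f f01] by linarith
qed

lemma integral_riesz:
  assumes f: "continuous_on UNIV f"
  shows "integrable riesz_measure f" "integral\<^sup>L riesz_measure f = \<phi> f"
proof -
  interpret finite_measure riesz_measure by (rule finite_riesz_measure)
  let ?M = riesz_measure
  have "bounded (f ` K)"
    by (intro compact_imp_bounded compact_continuous_image K continuous_on_subset[OF f]) auto
  then obtain B where B: "\<And>t. t \<in> K \<Longrightarrow> \<bar>f t\<bar> \<le> B" by (auto simp: bounded_iff)
  define C where "C = max B 1"
  have C: "0 < C" "\<And>t. t \<in> K \<Longrightarrow> \<bar>f t\<bar> \<le> C" using B by (auto simp: C_def max_def intro: order_trans)
  \<comment> \<open>Truncation changes nothing on \<open>K\<close>, which carries the measure, and
    permits an affine rescaling of the values into the unit interval.\<close>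
  define g where "g t = max (- C) (min C (f t))" for t
  have cg: "continuous_on UNIV g" unfolding g_def by (intro continuous_intros f)
  have gf: "g t = f t" if "t \<in> K" for t using C(2)[OF that] by (auto simp: g_def)
  have gb: "\<bar>g t\<bar> \<le> C" for t using C(1) by (auto simp: g_def)
  have ig: "integrable ?M g"
    by (rule integrable_const_bound[where B = C]) (use gb borel_measurable_riesz[OF cg] in auto)
  have null: "- K \<in> null_sets ?M"
    using emeasure_riesz_Compl compact_imp_closed[OF K] by (auto simp: riesz_measure(1))
  have ae: "AE t in ?M. g t = f t"
    by (rule AE_I'[OF null]) (use gf in auto)
  show "integrable ?M f"
    using integrable_cong_AE[OF borel_measurable_riesz[OF cg] borel_measurable_riesz[OF f] ae] ig by simp
  have "integral\<^sup>L ?M f = integral\<^sup>L ?M g"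
    by (rule integral_cong_AE[OF borel_measurable_riesz[OF f] borel_measurable_riesz[OF cg]]) (use ae in auto)
  also have "\<dots> = integral\<^sup>L ?M (\<lambda>t. 2 * C * ((g t + C) / (2 * C)) - C)"
    using C(1) by simp
  also have "\<dots> = 2 * C * integral\<^sup>L ?M (\<lambda>t. (g t + C) / (2 * C)) - C * \<phi> (\<lambda>t. 1)"
  proof -
    have "integrable ?M (\<lambda>t. (g t + C) / (2 * C))" using ig by (intro integrable_divide Bochner_Integration.integrable_add) auto
    then have "integrable ?M (\<lambda>t. 2 * C * ((g t + C) / (2 * C)))" by (rule integrable_mult_right)
    then show ?thesis
      by (subst Bochner_Integration.integral_diff)
        (simp_all only: integral_mult_right_zero integrable_const lebesgue_integral_const riesz_measure(2) measure_riesz_UNIV real_scaleR_def, simp)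
  qed
  also have "integral\<^sup>L ?M (\<lambda>t. (g t + C) / (2 * C)) = \<phi> (\<lambda>t. (g t + C) / (2 * C))"
  proof (rule integral_riesz_unit)
    show "continuous_on UNIV (\<lambda>t. (g t + C) / (2 * C))" using C(1) by (intro continuous_intros cg) auto
    show "0 \<le> (g t + C) / (2 * C)" "(g t + C) / (2 * C) \<le> 1" for t
      using gb[of t] C(1) by (auto simp: field_simps abs_le_iff)
  qed
  also have "\<phi> (\<lambda>t. (g t + C) / (2 * C)) = (1 / (2*C)) * (\<phi> g + C * \<phi> (\<lambda>t. 1))"
  proof -
    have "\<phi> (\<lambda>t. (1 / (2*C)) * (g t + C * 1)) = (1 / (2*C)) * (\<phi> g + C * \<phi> (\<lambda>t. 1))"
      by (subst phi_cmult, intro continuous_intros cg, subst phi_add[OF cg], intro continuous_intros, subst phi_cmult) auto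
    then show ?thesis by simp
  qed
  also have "2 * C * ((1 / (2*C)) * (\<phi> g + C * \<phi> (\<lambda>t. 1))) - C * \<phi> (\<lambda>t. 1) = \<phi> g" using C(1) by (simp add: field_simps)
  also have "\<phi> g = \<phi> f" by (rule phi_cong[OF cg f gf])
  finally show "integral\<^sup>L ?M f = \<phi> f" .
qed

end

lemma integral_urysohn_tendsto:
  fixes M :: "'a::metric_space measure" and g :: "'a \<Rightarrow> real"
  assumes M: "sets M = sets borel" and C: "closed C" and g: "integrable M g"
  shows "(\<lambda>k. integral\<^sup>L M (\<lambda>t. urysohn C k t * g t)) \<longlonglongrightarrow> integral\<^sup>L M (\<lambda>t. indicator C t * g t)"
proof (rule integral_dominated_convergence[where w = "\<lambda>t. norm (g t)"])
  have [measurable]: "urysohn C k \<in> borel_measurable M" for k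
    by (simp add: measurable_cong_sets[OF M refl] borel_measurable_continuous_onI urysohn)
  have [measurable]: "g \<in> borel_measurable M" using g by auto
  have [measurable]: "C \<in> sets M" using C M by auto
  show "(\<lambda>t. indicator C t * g t) \<in> borel_measurable M" by measurable
  show "(\<lambda>t. urysohn C k t * g t) \<in> borel_measurable M" for k by measurable
  show "integrable M (\<lambda>t. norm (g t))" using g by auto
  show "AE t in M. (\<lambda>k. urysohn C k t * g t) \<longlonglongrightarrow> indicator C t * g t"
    by (intro AE_I2 tendsto_intros urysohn_tendsto C)
  show "AE t in M. norm (urysohn C k t * g t) \<le> norm (g t)" for k
    using urysohn(2,3)[of C k] by (auto simp: abs_mult mult_left_le_one_le)
qed

lemma measure_eqI_continuous:
  fixes M N :: "'a::metric_space measure"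
  assumes M: "finite_measure M" "sets M = sets borel" and N: "finite_measure N" "sets N = sets borel"
    and eq: "\<And>f::'a\<Rightarrow>real. continuous_on UNIV f \<Longrightarrow> (\<And>t. 0 \<le> f t \<and> f t \<le> 1) \<Longrightarrow> integral\<^sup>L M f = integral\<^sup>L N f"
  shows "M = N"
proof -
  interpret M: finite_measure M by fact
  interpret N: finite_measure N by fact
  have sM: "space M = UNIV" "space N = UNIV" using M(2) N(2) by (metis sets_eq_imp_space_eq space_borel)+
  have cl: "emeasure M C = emeasure N C" if C: "closed C" for C
  proof -
    have "(\<lambda>k. integral\<^sup>L M (\<lambda>t. urysohn C k t * 1)) \<longlonglongrightarrow> integral\<^sup>L M (\<lambda>t. indicator C t * 1)"
      by (rule integral_urysohn_tendsto[OF M(2) C]) auto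
    moreover have "(\<lambda>k. integral\<^sup>L N (\<lambda>t. urysohn C k t * 1)) \<longlonglongrightarrow> integral\<^sup>L N (\<lambda>t. indicator C t * 1)"
      by (rule integral_urysohn_tendsto[OF N(2) C]) auto
    moreover have "integral\<^sup>L M (\<lambda>t. urysohn C k t * 1) = integral\<^sup>L N (\<lambda>t. urysohn C k t * 1)" for k
      using eq[of "urysohn C k"] by (simp add: urysohn)
    ultimately have "measure M C = measure N C" using LIMSEQ_unique by (fastforce simp: sM)
    then show ?thesis by (simp add: M.emeasure_eq_measure N.emeasure_eq_measure)
  qed
  have gen: "sets borel = sigma_sets UNIV (Collect closed :: 'a set set)"
    unfolding borel_eq_closed by simp
  show ?thesis
  proof (rule measure_eqI_generator_eq[where E = "Collect closed" and \<Omega> = UNIV and A = "\<lambda>i. UNIV"])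
    show "Int_stable (Collect closed :: 'a set set)" by (auto simp: Int_stable_def)
  qed (use cl gen M N in auto)
qed

section \<open>Joint spectral measures\<close>

lemma proj_measureD:
  assumes "proj_measure E" "S \<in> sets borel"
  shows "selfadjoint (E S)" "E S (E S v) = E S v" "T \<in> sets borel \<Longrightarrow> E (S \<inter> T) v = E S (E T v)"
proof -
  note 0 = assms(1)[unfolded proj_measure_def, THEN conjunct2]
  note 1 = 0[THEN conjunct1] and 2 = 0[THEN conjunct2, THEN conjunct2, THEN conjunct1]
  show "selfadjoint (E S)" using 1 assms(2) by simp
  have "E S v = (E S o\<^sub>L E S) v" using 1 assms(2) by simp
  then show "E S (E S v) = E S v" by simp
  show "E (S \<inter> T) v = E S (E T v)" if "T \<in> sets borel" using 2 assms(2) that by simp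
qed

lemma proj_measure_sums:
  assumes E: "proj_measure E" and F: "range F \<subseteq> sets borel" "disjoint_family F"
  shows "(\<lambda>k::nat. E (F k) v) sums E (\<Union>k. F k) v"
proof -
  have "\<forall>F::nat \<Rightarrow> _. range F \<subseteq> sets borel \<longrightarrow> disjoint_family F \<longrightarrow> (\<forall>v. (\<lambda>k. E (F k) v) sums E (\<Union>k. F k) v)"
    using E unfolding proj_measure_def by (elim conjE)
  with F show ?thesis by simp
qed

lemma inner_proj_measure:
  assumes E: "proj_measure E" "S \<in> sets borel"
  shows "inner (E S v) v = (norm (E S v))^2"
proof -
  have "inner (E S v) v = inner (E S (E S v)) v" by (simp only: proj_measureD(2)[OF E])
  also have "\<dots> = inner (E S v) (E S v)" by (rule selfadjointD(2)[OF proj_measureD(1)[OF E]])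
  finally show ?thesis by (simp add: power2_norm_eq_inner)
qed

lemma scalar_measure:
  fixes E :: "'a::topological_space set \<Rightarrow> 'h::complex_hilbert_space op"
  assumes E: "proj_measure E"
  shows sets_scalar_measure: "sets (scalar_measure E v) = sets borel"
    and space_scalar_measure: "space (scalar_measure E v) = UNIV"
    and emeasure_scalar_measure: "S \<in> sets borel \<Longrightarrow> emeasure (scalar_measure E v) S = ennreal (inner (E S v) v)"
    and finite_scalar_measure: "finite_measure (scalar_measure E v)"
    and measure_scalar_measure: "S \<in> sets borel \<Longrightarrow> measure (scalar_measure E v) S = inner (E S v) v"
proof -
  let ?f = "\<lambda>S. ennreal (Re (cinner (E S v) v))"
  show s: "sets (scalar_measure E v) = sets borel" and sp: "space (scalar_measure E v) = UNIV"
    using sets.sigma_sets_eq[of borel] by (simp_all add: scalar_measure_def)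
  have e: "emeasure (scalar_measure E v) S = ennreal (inner (E S v) v)" if S: "S \<in> sets borel" for S
  proof -
    have "emeasure (scalar_measure E v) S = ?f S"
    proof (rule emeasure_measure_of[OF scalar_measure_def])
      have "(\<lambda>k::nat. E {} v) sums E (\<Union>k::nat. {}) v"
        by (rule proj_measure_sums[OF E]) (auto simp: disjoint_family_on_def)
      then have "(\<lambda>k::nat. E {} v) \<longlonglongrightarrow> 0" by (intro summable_LIMSEQ_zero sums_summable)
      then have z: "inner (E {} v) v = 0" by (simp add: LIMSEQ_const_iff)
      show "positive (sets (scalar_measure E v)) ?f"
        using z by (auto simp: positive_def inner_eq_Re_cinner)
      show "countably_additive (sets (scalar_measure E v)) ?f"
      proof (rule countably_additiveI)
        fix A :: "nat \<Rightarrow> 'a set"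
        assume A: "range A \<subseteq> sets (scalar_measure E v)" "disjoint_family A" "(\<Union>i. A i) \<in> sets (scalar_measure E v)"
        have "(\<lambda>k. E (A k) v) sums E (\<Union>k. A k) v"
          by (rule proj_measure_sums[OF E]) (use A s in auto)
        then have "(\<lambda>k. inner (E (A k) v) v) sums inner (E (\<Union>k. A k) v) v"
          by (rule bounded_linear.sums[OF bounded_linear_inner_left])
        moreover have "0 \<le> inner (E (A k) v) v" for k
          using A(1) s inner_proj_measure[OF E, of "A k"] by auto
        ultimately show "(\<Sum>k. ?f (A k)) = ?f (\<Union>k. A k)"
          unfolding inner_eq_Re_cinner[symmetric] by (intro suminf_ennreal_eq)
      qed
    qed (use S s sets.space_closed in auto)
    then show ?thesis by (simp add: inner_eq_Re_cinner)
  qed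
  then show "S \<in> sets borel \<Longrightarrow> emeasure (scalar_measure E v) S = ennreal (inner (E S v) v)" .
  show "finite_measure (scalar_measure E v)" by (rule finite_measureI) (simp add: sp e)
  show "S \<in> sets borel \<Longrightarrow> measure (scalar_measure E v) S = inner (E S v) v"
    unfolding measure_def by (simp add: e inner_proj_measure[OF E])
qed

text \<open>The limiting quadratic form is polarised into a bilinear form, bounded because all
  \<open>T n\<close> have norm at most 1, and the form is then represented by an operator.\<close>

lemma weak_limit_operator:
  fixes T :: "nat \<Rightarrow> 'h::complex_hilbert_space op"
  assumes sa: "\<And>n. selfadjoint (T n)"
    and b: "\<And>n v. 0 \<le> inner (T n v) v" "\<And>n v. inner (T n v) v \<le> (norm v)^2"
    and Q: "\<And>v. (\<lambda>n. inner (T n v) v) \<longlonglongrightarrow> Q v"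
  shows "\<exists>P. selfadjoint P \<and> (\<forall>v. inner (P v) v = Q v)"
proof -
  define B where "B u v = (Q (u + v) - Q (u - v)) / 4" for u v
  have B: "(\<lambda>n. inner (T n u) v) \<longlonglongrightarrow> B u v" for u v
    unfolding B_def inner_polarization[OF sa, where u = u and v = v] by (intro tendsto_intros Q) simp
  have nT: "norm (T n) \<le> 1" for n
    by (rule norm_selfadjoint_le[OF sa]) (use b in \<open>auto simp: abs_of_nonneg\<close>)
  have bil: "bounded_bilinear B"
  proof
    fix u u' v v' :: 'h and r :: real
    have "(\<lambda>n. inner (T n (u + u')) v) \<longlonglongrightarrow> B u v + B u' v"
      using tendsto_add[OF B B] by (simp add: blinfun_linear inner_add)
    then show "B (u + u') v = B u v + B u' v" by (rule LIMSEQ_unique[OF B])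
    have "(\<lambda>n. inner (T n u) (v + v')) \<longlonglongrightarrow> B u v + B u v'"
      using tendsto_add[OF B B] by (simp add: inner_add)
    then show "B u (v + v') = B u v + B u v'" by (rule LIMSEQ_unique[OF B])
    have "(\<lambda>n. inner (T n (r *\<^sub>R u)) v) \<longlonglongrightarrow> r * B u v"
      using tendsto_mult_left[OF B] by (simp add: blinfun_linear)
    then show "B (r *\<^sub>R u) v = r *\<^sub>R B u v" unfolding real_scaleR_def by (rule LIMSEQ_unique[OF B])
    have "(\<lambda>n. inner (T n u) (r *\<^sub>R v)) \<longlonglongrightarrow> r * B u v"
      using tendsto_mult_left[OF B] by simp
    then show "B u (r *\<^sub>R v) = r *\<^sub>R B u v" unfolding real_scaleR_def by (rule LIMSEQ_unique[OF B])
    show "\<exists>K. \<forall>a b. norm (B a b) \<le> norm a * norm b * K"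
    proof (intro exI[of _ 1] allI)
      fix a b
      have "norm (inner (T n a) b) \<le> norm a * norm b * 1" for n
      proof -
        have "norm (inner (T n a) b) \<le> norm (T n a) * norm b" by (rule Cauchy_Schwarz_ineq2[folded real_norm_def])
        also have "norm (T n a) \<le> norm (T n) * norm a" by (rule norm_blinfun)
        also have "\<dots> \<le> 1 * norm a" by (intro mult_right_mono nT) auto
        finally show ?thesis by (simp add: mult_right_mono)
      qed
      then show "norm (B a b) \<le> norm a * norm b * 1"
        by (intro LIMSEQ_le_const2[OF tendsto_norm[OF B]]) auto
    qed
  qed
  obtain P :: "'h op" where P: "\<And>u v. B u v = inner u (P v)" using bilinear_form_representation[OF bil] by blast
  have sym: "B u v = B v u" for u v
  proof (rule LIMSEQ_unique[OF B])
    show "(\<lambda>n. inner (T n u) v) \<longlonglongrightarrow> B v u"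
      using B[of v u] by (simp add: selfadjointD(2)[OF sa, of _ u v] inner_commute[of u])
  qed
  have "clinear_op P"
    unfolding clinear_op_def
  proof (intro allI, rule inner_ext)
    fix c v w
    have "(\<lambda>n. inner (T n (c *\<^sub>C v)) w) \<longlonglongrightarrow> B v (cnj c *\<^sub>C w)"
      using B[of v "cnj c *\<^sub>C w"] by (simp add: clinear_op_scaleC[OF selfadjointD(1)[OF sa]] inner_scaleC_left)
    then have "B (c *\<^sub>C v) w = B v (cnj c *\<^sub>C w)" by (rule LIMSEQ_unique[OF B])
    then have "inner w (P (c *\<^sub>C v)) = inner (cnj c *\<^sub>C w) (P v)" by (metis P sym)
    then show "inner (P (c *\<^sub>C v)) w = inner (c *\<^sub>C P v) w"
      by (simp add: inner_scaleC_left[of "cnj c"] inner_commute[of _ w])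
  qed
  moreover have "inner (P u) v = inner u (P v)" for u v
    using sym[of u v] P[of u v] P[of v u] by (simp add: inner_commute)
  ultimately have "selfadjoint P" by (simp add: selfadjoint_iff)
  moreover have "inner (P v) v = Q v" for v
    using LIMSEQ_unique[OF B Q, of v] P[of v v] by (simp add: inner_commute)
  ultimately show ?thesis by blast
qed

context comm_tuple begin

lemma continuous_on_K: "continuous_on UNIV f \<Longrightarrow> continuous_on K f"
  by (rule continuous_on_subset) auto

lemma pos_functional: "pos_functional K (\<lambda>f. inner (cfc f v) v)"
proof
  fix f g :: "real^'n \<Rightarrow> real" and c :: real
  assume f: "continuous_on UNIV f"
  show "inner (cfc (\<lambda>t. c * f t) v) v = c * inner (cfc f v) v"
    by (simp add: cfc_cmult continuous_on_K[OF f] blinfun_linear)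
  show "0 \<le> inner (cfc f v) v" if "\<And>t. t \<in> K \<Longrightarrow> 0 \<le> f t"
    using cfc_positive[OF continuous_on_K[OF f] that] by (simp add: positive_op_iff)
  assume g: "continuous_on UNIV g"
  show "inner (cfc (\<lambda>t. f t + g t) v) v = inner (cfc f v) v + inner (cfc g v) v"
    by (simp add: cfc_add continuous_on_K f g blinfun_linear inner_add)
qed (rule compact_cbox)

definition mu :: "'h \<Rightarrow> (real^'n) measure" where
  "mu v = pos_functional.riesz_measure (\<lambda>f. inner (cfc f v) v)"

lemma sets_mu [simp]: "sets (mu v) = sets borel" and space_mu [simp]: "space (mu v) = UNIV"
  and finite_mu: "finite_measure (mu v)" and measure_mu_UNIV: "measure (mu v) UNIV = (norm v)^2"
  and emeasure_mu_Compl: "emeasure (mu v) (- K) = 0"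
  and integral_mu: "continuous_on UNIV f \<Longrightarrow> integrable (mu v) f"
     "continuous_on UNIV f \<Longrightarrow> integral\<^sup>L (mu v) f = inner (cfc f v) v"
proof -
  interpret p: pos_functional K "\<lambda>f. inner (cfc f v) v" by (rule pos_functional)
  show "sets (mu v) = sets borel" "space (mu v) = UNIV" by (simp_all add: mu_def p.riesz_measure)
  show "finite_measure (mu v)" unfolding mu_def by (rule p.finite_riesz_measure)
  show "measure (mu v) UNIV = (norm v)^2"
    unfolding mu_def p.measure_riesz_UNIV by (simp add: blinfun_linear power2_norm_eq_inner)
  show "emeasure (mu v) (- K) = 0" unfolding mu_def by (rule p.emeasure_riesz_Compl)
  show "integrable (mu v) f" "integral\<^sup>L (mu v) f = inner (cfc f v) v" if "continuous_on UNIV f"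
    unfolding mu_def using p.integral_riesz[OF that] by auto
qed

lemma measure_mu_le: "measure (mu v) S \<le> (norm v)^2"
  using finite_measure.bounded_measure[OF finite_mu, of v S] measure_mu_UNIV by simp

text \<open>Dynkin argument over the sets for which \<open>mu v S\<close> is the quadratic form of
  an operator in \<open>v\<close>. Closed sets arise as weak limits of Urysohn functions of the
  tuple, countable disjoint unions as weak limits of partial sums.\<close>

lemma proj_exists:
  assumes "S \<in> sets borel"
  shows "\<exists>P. selfadjoint P \<and> (\<forall>v. inner (P v) v = measure (mu v) S)"
proof -
  have gen: "sets borel = sigma_sets UNIV (Collect closed :: (real^'n) set set)"
    unfolding borel_eq_closed by simp
  have ist: "Int_stable (Collect closed :: (real^'n) set set)" by (auto simp: Int_stable_def)
  have "S \<in> sigma_sets UNIV (Collect closed)" using assms gen by simp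
  have sub: "Collect closed \<subseteq> Pow (UNIV :: (real^'n) set)" by simp
  from ist sub \<open>S \<in> sigma_sets _ _\<close> show ?thesis
  proof (induction rule: sigma_sets_induct_disjoint)
    case (basic C)
    then have C: "closed C" by simp
    have c: "continuous_on UNIV (urysohn C n)" for n by (rule urysohn)
    show ?case
    proof (rule weak_limit_operator[where T = "\<lambda>n. cfc (urysohn C n)"])
      fix n v
      show "selfadjoint (cfc (urysohn C n))" by (simp add: continuous_on_K c)
      show "0 \<le> inner (cfc (urysohn C n) v) v"
        using cfc_positive[OF continuous_on_K[OF c[of n]] urysohn(2)] by (simp add: positive_op_iff)
      have c1: "continuous_on K (\<lambda>t. 1 - urysohn C n t)" by (intro continuous_on_K continuous_intros c)
      have "0 \<le> inner (cfc (\<lambda>t. 1 - urysohn C n t) v) v"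
        using cfc_positive[OF c1] by (simp add: urysohn positive_op_iff)
      then show "inner (cfc (urysohn C n) v) v \<le> (norm v)^2"
        by (simp add: cfc_diff continuous_on_K c blinfun_linear inner_diff power2_norm_eq_inner)
      have "(\<lambda>n. integral\<^sup>L (mu v) (\<lambda>t. urysohn C n t * 1)) \<longlonglongrightarrow> integral\<^sup>L (mu v) (\<lambda>t. indicator C t * 1)"
        by (rule integral_urysohn_tendsto[OF sets_mu C]) (simp add: integral_mu)
      then show "(\<lambda>n. inner (cfc (urysohn C n) v) v) \<longlonglongrightarrow> measure (mu v) C"
        by (simp add: integral_mu(2)[OF c])
    qed
  next
    case empty
    show ?case by (rule exI[of _ 0]) simp
  next
    case (compl A)
    then obtain P where P: "selfadjoint P" "\<And>v. inner (P v) v = measure (mu v) A" by blast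
    have "measure (mu v) (UNIV - A) = (norm v)^2 - measure (mu v) A" for v
      using finite_measure.finite_measure_compl[OF finite_mu, of A v] compl(1) gen by (simp add: measure_mu_UNIV)
    then show ?case using P by (intro exI[of _ "id_blinfun - P"]) (simp add: blinfun_linear inner_diff power2_norm_eq_inner)
  next
    case (union A)
    then obtain P where P: "\<And>i. selfadjoint (P i)" "\<And>i v. inner (P i v) v = measure (mu v) (A i)" by metis
    have A: "range A \<subseteq> sets (mu v)" for v using union(2) gen by simp
    have s: "(\<lambda>i. measure (mu v) (A i)) sums measure (mu v) (\<Union>i. A i)" for v
      using finite_measure.finite_measure_UNION[OF finite_mu A union(1)] .
    have e: "inner ((\<Sum>i<n. P i) v) v = (\<Sum>i<n. measure (mu v) (A i))" for n v
      by (simp add: blinfun.sum_left inner_sum_left P)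
    show ?case
    proof (rule weak_limit_operator[where T = "\<lambda>n. \<Sum>i<n. P i"])
      fix n v
      show "selfadjoint (\<Sum>i<n. P i)" using P(1) by simp
      show "0 \<le> inner ((\<Sum>i<n. P i) v) v" unfolding e by (intro sum_nonneg) simp
      have "(\<Sum>i<n. measure (mu v) (A i)) \<le> measure (mu v) (\<Union>i. A i)"
        unfolding sums_unique[OF s[of v]] by (rule sum_le_suminf[OF sums_summable[OF s[of v]]]) auto
      then show "inner ((\<Sum>i<n. P i) v) v \<le> (norm v)^2" unfolding e using measure_mu_le order_trans by blast
      show "(\<lambda>n. inner ((\<Sum>i<n. P i) v) v) \<longlonglongrightarrow> measure (mu v) (\<Union>i. A i)"
        unfolding e using s by (simp add: sums_def)
    qed
  qed
qed

definition E :: "(real^'n) set \<Rightarrow> 'h op" where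
  "E S = (if S \<in> sets borel then SOME P. selfadjoint P \<and> (\<forall>v. inner (P v) v = measure (mu v) S) else 0)"

lemma E: "S \<in> sets borel \<Longrightarrow> selfadjoint (E S)" "S \<in> sets borel \<Longrightarrow> inner (E S v) v = measure (mu v) S"
proof -
  have "selfadjoint (E S) \<and> (\<forall>v. inner (E S v) v = measure (mu v) S)" if S: "S \<in> sets borel"
    using someI_ex[OF proj_exists[OF S]] unfolding E_def if_P[OF S] .
  then show "S \<in> sets borel \<Longrightarrow> selfadjoint (E S)" "S \<in> sets borel \<Longrightarrow> inner (E S v) v = measure (mu v) S"
    by blast+
qed

lemma inner_E:
  assumes S: "S \<in> sets borel"
  shows "inner (E S u) w = (measure (mu (u + w)) S - measure (mu (u - w)) S) / 4"
  by (subst inner_polarization[OF E(1)[OF S]]) (simp add: E(2)[OF S])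

lemma inner_E_sums:
  assumes A: "range A \<subseteq> sets borel" "disjoint_family A"
  shows "(\<lambda>i::nat. inner (E (A i) u) w) sums inner (E (\<Union>i. A i) u) w"
proof -
  have s: "(\<lambda>i. measure (mu v) (A i)) sums measure (mu v) (\<Union>i. A i)" for v
    using finite_measure.finite_measure_UNION[OF finite_mu, of A v] A by simp
  have "A i \<in> sets borel" "(\<Union>i. A i) \<in> sets borel" for i using A(1) by auto
  then show ?thesis by (simp only: inner_E) (intro sums_divide sums_diff s)
qed

lemma E_Compl:
  assumes S: "S \<in> sets borel"
  shows "E (UNIV - S) = id_blinfun - E S"
proof (rule selfadjoint_eqI)
  fix v
  have "measure (mu v) (UNIV - S) = (norm v)^2 - measure (mu v) S"
    using finite_measure.finite_measure_compl[OF finite_mu, of S v] S by (simp add: measure_mu_UNIV)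
  then show "inner (E (UNIV - S) v) v = inner ((id_blinfun - E S) v) v"
    using S by (simp add: E blinfun_linear inner_diff power2_norm_eq_inner)
qed (use S in \<open>simp_all add: E\<close>)

lemma E_Un:
  assumes S: "S \<in> sets borel" and T: "T \<in> sets borel" and "S \<inter> T = {}"
  shows "E (S \<union> T) = E S + E T"
proof (rule selfadjoint_eqI)
  fix v
  have "measure (mu v) (S \<union> T) = measure (mu v) S + measure (mu v) T"
    by (rule finite_measure.finite_measure_Union[OF finite_mu]) (use assms in auto)
  then show "inner (E (S \<union> T) v) v = inner ((E S + E T) v) v"
    using S T by (simp add: E blinfun_linear inner_add)
qed (use S T in \<open>simp_all add: E\<close>)

lemma cfc_urysohn_tendsto:
  assumes C: "closed C" and f: "continuous_on UNIV f"
  shows "(\<lambda>k. inner (cfc (\<lambda>t. urysohn C k t * f t) u) w) \<longlonglongrightarrow>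
    (integral\<^sup>L (mu (u + w)) (\<lambda>t. indicator C t * f t) - integral\<^sup>L (mu (u - w)) (\<lambda>t. indicator C t * f t)) / 4"
proof -
  have c: "continuous_on UNIV (\<lambda>t. urysohn C k t * f t)" for k by (intro continuous_intros f urysohn)
  show ?thesis
    unfolding inner_polarization[OF cfc_selfadjoint[OF continuous_on_K[OF c]], where u = u and v = w]
    unfolding integral_mu(2)[OF c, symmetric]
    by (intro tendsto_intros integral_urysohn_tendsto[OF sets_mu C] integral_mu f) simp
qed

lemma cfc_urysohn_tendsto_E:
  assumes C: "closed C"
  shows "(\<lambda>k. inner (cfc (urysohn C k) u) w) \<longlonglongrightarrow> inner (E C u) w"
  using cfc_urysohn_tendsto[OF C continuous_on_const[of _ 1]] unfolding inner_E[OF borel_closed[OF C]] by simp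

text \<open>Multiplicativity of the functional calculus survives two successive limits, in
  \<open>k\<close> for \<open>C\<close> with \<open>j\<close> fixed and afterwards in
  \<open>j\<close> for \<open>D\<close>.\<close>

lemma E_mult_closed:
  assumes C: "closed C" and D: "closed D"
  shows "inner (E D u) (E C w) = inner (E (C \<inter> D) u) w"
proof (rule LIMSEQ_unique)
  show "(\<lambda>j. inner (cfc (urysohn D j) u) (E C w)) \<longlonglongrightarrow> inner (E D u) (E C w)" by (rule cfc_urysohn_tendsto_E[OF D])
  have "inner (cfc (urysohn D j) u) (E C w) =
    (integral\<^sup>L (mu (u + w)) (\<lambda>t. indicator C t * urysohn D j t) - integral\<^sup>L (mu (u - w)) (\<lambda>t. indicator C t * urysohn D j t)) / 4" for j
  proof (rule LIMSEQ_unique)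
    have "(\<lambda>k. inner (cfc (urysohn C k) (cfc (urysohn D j) u)) w) \<longlonglongrightarrow> inner (E C (cfc (urysohn D j) u)) w"
      by (rule cfc_urysohn_tendsto_E[OF C])
    moreover have "inner (E C (cfc (urysohn D j) u)) w = inner (cfc (urysohn D j) u) (E C w)"
      using C by (intro selfadjointD(2) E) auto
    moreover have "inner (cfc (urysohn C k) (cfc (urysohn D j) u)) w = inner (cfc (\<lambda>t. urysohn C k t * urysohn D j t) u) w" for k
      by (simp add: cfc_mult continuous_on_K urysohn)
    ultimately show "(\<lambda>k. inner (cfc (\<lambda>t. urysohn C k t * urysohn D j t) u) w) \<longlonglongrightarrow> inner (cfc (urysohn D j) u) (E C w)"
      by simp
  qed (rule cfc_urysohn_tendsto[OF C urysohn(1)])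
  moreover have "(\<lambda>j. integral\<^sup>L (mu v) (\<lambda>t. indicator C t * urysohn D j t)) \<longlonglongrightarrow> measure (mu v) (C \<inter> D)" for v
  proof -
    have "(\<lambda>j. integral\<^sup>L (mu v) (\<lambda>t. urysohn D j t * indicator C t)) \<longlonglongrightarrow> integral\<^sup>L (mu v) (\<lambda>t. indicator D t * indicator C t)"
      using C by (intro integral_urysohn_tendsto[OF sets_mu D] integrable_real_indicator)
        (simp_all add: finite_measure.emeasure_eq_measure[OF finite_mu])
    moreover have "(\<lambda>t. indicator D t * indicator C t) = (indicator (C \<inter> D) :: _ \<Rightarrow> real)"
      by (auto simp: indicator_def)
    ultimately show ?thesis by (simp add: mult.commute)
  qed
  ultimately show "(\<lambda>j. inner (cfc (urysohn D j) u) (E C w)) \<longlonglongrightarrow> inner (E (C \<inter> D) u) w"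
    using C D by (simp only: inner_E[of "C \<inter> D"] borel_closed closed_Int) (intro tendsto_intros, auto)
qed

text \<open>Dynkin argument in one factor only. It serves twice: once with the other factor closed,
  and, after an exchange of roles, with the other factor an arbitrary Borel set.\<close>

lemma E_mult_extend:
  assumes T: "T \<in> sets borel" and cl: "\<And>C u w. closed C \<Longrightarrow> inner (E T u) (E C w) = inner (E (C \<inter> T) u) w"
    and S: "S \<in> sets borel"
  shows "inner (E T u) (E S w) = inner (E (S \<inter> T) u) w"
proof -
  have gen: "sets borel = sigma_sets UNIV (Collect closed :: (real^'n) set set)"
    unfolding borel_eq_closed by simp
  have ist: "Int_stable (Collect closed :: (real^'n) set set)" by (auto simp: Int_stable_def)
  have "S \<in> sigma_sets UNIV (Collect closed)" using S gen by simp
  have sub: "Collect closed \<subseteq> Pow (UNIV :: (real^'n) set)" by simp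
  from ist sub \<open>S \<in> sigma_sets _ _\<close> show ?thesis
  proof (induction arbitrary: u w rule: sigma_sets_induct_disjoint)
    case (basic A)
    then show ?case using cl by simp
  next
    case empty
    show ?case using cl[of "{}"] by simp
  next
    case (compl A)
    then have A: "A \<in> sets borel" using gen by simp
    have "(UNIV - A) \<inter> T \<union> A \<inter> T = T" "((UNIV - A) \<inter> T) \<inter> (A \<inter> T) = {}" by auto
    then have "E T = E ((UNIV - A) \<inter> T) + E (A \<inter> T)" using E_Un[of "(UNIV - A) \<inter> T" "A \<inter> T"] A T by auto
    then have "inner (E ((UNIV - A) \<inter> T) u) w = inner (E T u) w - inner (E (A \<inter> T) u) w"
      by (simp add: blinfun_linear inner_add)
    then show ?case using compl(2) by (simp add: E_Compl[OF A] blinfun_linear inner_diff)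
  next
    case (union A)
    then have A: "range A \<subseteq> sets borel" using gen by simp
    have "(\<lambda>i. inner (E (A i) w) (E T u)) sums inner (E (\<Union>i. A i) w) (E T u)"
      by (rule inner_E_sums[OF A union(1)])
    moreover have "(\<lambda>i. inner (E (A i \<inter> T) u) w) sums inner (E (\<Union>i. A i \<inter> T) u) w"
      by (rule inner_E_sums) (use A T union(1) in \<open>auto simp: disjoint_family_on_def\<close>)
    moreover have "inner (E (A i) w) (E T u) = inner (E (A i \<inter> T) u) w" for i
      by (subst inner_commute) (rule union(3))
    ultimately have "inner (E (\<Union>i. A i) w) (E T u) = inner (E (\<Union>i. A i \<inter> T) u) w"
      by (simp add: sums_unique2)
    then show ?case by (simp add: inner_commute)
  qed
qed

lemma E_mult:
  assumes S: "S \<in> sets borel" and T: "T \<in> sets borel"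
  shows "E (S \<inter> T) = (E S o\<^sub>L E T)"
proof -
  have 1: "inner (E T u) (E S w) = inner (E (S \<inter> T) u) w" if "closed T" "S \<in> sets borel" for S T u w
    by (rule E_mult_extend) (use that E_mult_closed in auto)
  have "inner (E T u) (E S w) = inner (E (S \<inter> T) u) w" for u w
  proof (rule E_mult_extend[OF T _ S])
    fix C u w assume C: "closed (C :: (real^'n) set)"
    have "inner (E T u) (E C w) = inner (E C w) (E T u)" by (rule inner_commute)
    also have "\<dots> = inner (E (T \<inter> C) w) u" by (rule 1[OF C T])
    also have "\<dots> = inner w (E (T \<inter> C) u)" using C T by (intro selfadjointD(2) E) auto
    finally show "inner (E T u) (E C w) = inner (E (C \<inter> T) u) w" by (simp add: inner_commute Int_commute)
  qed
  then have eq: "inner (E (S \<inter> T) u) w = inner (E S (E T u)) w" for u w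
    by (simp add: selfadjointD(2)[OF E(1)[OF S]])
  show ?thesis by (rule blinfun_eqI, rule inner_ext) (simp add: eq)
qed

lemma E_UNIV: "E UNIV = id_blinfun"
  by (rule selfadjoint_eqI) (simp_all add: E measure_mu_UNIV power2_norm_eq_inner)

lemma E_K: "E K = id_blinfun"
proof (rule selfadjoint_eqI)
  fix v
  interpret finite_measure "mu v" by (rule finite_mu)
  have "measure (mu v) (UNIV - K) = 0" using emeasure_mu_Compl[of v] by (simp add: measure_def Compl_eq_Diff_UNIV)
  then have "measure (mu v) K = (norm v)^2" using finite_measure_compl[of K] by (simp add: measure_mu_UNIV)
  then show "inner (E K v) v = inner (id_blinfun v) v" by (simp add: E power2_norm_eq_inner)
qed (simp_all add: E)

lemma proj_measure_E: "proj_measure E"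
  unfolding proj_measure_def
proof (intro conjI allI ballI impI)
  fix S :: "(real^'n) set" assume "S \<notin> sets borel" then show "E S = 0" by (simp add: E_def)
next
  fix S :: "(real^'n) set" assume S: "S \<in> sets borel"
  show "selfadjoint (E S)" by (rule E[OF S])
  show "E S o\<^sub>L E S = E S" using E_mult[OF S S] by simp
next
  fix F :: "nat \<Rightarrow> (real^'n) set" and v assume F: "range F \<subseteq> sets borel" "disjoint_family F"
  have bF: "F i \<in> sets borel" for i using F(1) by auto
  let ?U = "\<Union>k. F k"
  have fin: "(\<Sum>k<n. E (F k)) = E (\<Union>k<n. F k)" for n
  proof (induction n)
    case 0
    have "E {} = 0" by (rule selfadjoint_eqI) (simp_all add: E)
    then show ?case by simp
  next
    case (Suc n)
    have "F k \<inter> F n = {}" if "k < n" for k using F(2) that by (auto simp: disjoint_family_on_def)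
    then have "(\<Union>k<n. F k) \<inter> F n = {}" by blast
    then have "E ((\<Union>k<n. F k) \<union> F n) = E (\<Union>k<n. F k) + E (F n)" using bF by (intro E_Un) auto
    then show ?case using Suc by (simp add: lessThan_Suc Un_commute add.commute)
  qed
  define R where "R n = ?U - (\<Union>k<n. F k)" for n
  have bR: "R n \<in> sets borel" for n unfolding R_def using bF by auto
  have "(\<lambda>n. measure (mu v) (R n)) \<longlonglongrightarrow> measure (mu v) (\<Inter>n. R n)"
    by (rule finite_measure.finite_Lim_measure_decseq[OF finite_mu])
      (use bR in \<open>auto simp: decseq_def R_def\<close>)
  moreover have "(\<Inter>n. R n) = {}" by (auto simp: R_def)
  ultimately have lim: "(\<lambda>n. measure (mu v) (R n)) \<longlonglongrightarrow> 0" by simp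
  have eq: "E ?U v - (\<Sum>k<n. E (F k) v) = E (R n) v" for n
  proof -
    have "E ((\<Union>k<n. F k) \<union> R n) = E (\<Union>k<n. F k) + E (R n)"
      using bF bR by (intro E_Un) (auto simp: R_def)
    moreover have "(\<Union>k<n. F k) \<union> R n = ?U" by (auto simp: R_def)
    moreover have "(\<Sum>k<n. E (F k) v) = E (\<Union>k<n. F k) v" unfolding fin[symmetric] by (simp add: blinfun.sum_left)
    ultimately show ?thesis by (simp add: blinfun_linear)
  qed
  \<comment> \<open>The remainder is a projection, so its norm at \<open>v\<close> is given by its
    quadratic form. This upgrades the convergence of measures to norm convergence of the
    vectors.\<close>
  have "(norm (E ?U v - (\<Sum>k<n. E (F k) v)))^2 = measure (mu v) (R n)" for n
  proof -
    have "(norm (E (R n) v))^2 = inner (E (R n) (E (R n) v)) v"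
      by (simp add: power2_norm_eq_inner selfadjointD(2)[OF E(1)[OF bR]] inner_commute)
    also have "\<dots> = inner ((E (R n) o\<^sub>L E (R n)) v) v" by simp
    also have "\<dots> = measure (mu v) (R n)" using E_mult[OF bR bR, of n n] by (simp add: E bR)
    finally show ?thesis by (simp add: eq)
  qed
  with lim have "(\<lambda>n. sqrt ((norm (E ?U v - (\<Sum>k<n. E (F k) v)))^2)) \<longlonglongrightarrow> sqrt 0"
    by (intro tendsto_real_sqrt) simp
  then have "(\<lambda>n. E ?U v - (\<Sum>k<n. E (F k) v)) \<longlonglongrightarrow> 0" by (simp add: tendsto_norm_zero_iff)
  from tendsto_diff[OF tendsto_const[of "E ?U v"] this]
  show "(\<lambda>k. E (F k) v) sums E ?U v" by (simp add: sums_def)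
qed (simp_all add: E_UNIV E_mult)

lemma scalar_measure_E: "scalar_measure E v = mu v"
proof (rule measure_eqI)
  show "sets (scalar_measure E v) = sets (mu v)" by (simp add: sets_scalar_measure[OF proj_measure_E])
  fix S assume "S \<in> sets (scalar_measure E v)"
  then have S: "S \<in> sets borel" by (simp add: sets_scalar_measure[OF proj_measure_E])
  show "emeasure (scalar_measure E v) S = emeasure (mu v) S"
    by (simp add: emeasure_scalar_measure[OF proj_measure_E S] E(2)[OF S] finite_measure.emeasure_eq_measure[OF finite_mu])
qed

end

section \<open>Uniqueness of the spectral measure through its moments\<close>

lemma small_multiple_le_zero:
  fixes a c :: real
  assumes "\<And>d. 0 < d \<Longrightarrow> a \<le> d * c"
  shows "a \<le> 0"
proof (rule LIMSEQ_le_const)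
  show "(\<lambda>n. inverse (real (Suc n)) * c) \<longlonglongrightarrow> 0"
    using tendsto_mult_left_zero[OF LIMSEQ_inverse_real_of_nat] .
  show "\<exists>N. \<forall>n\<ge>N. a \<le> inverse (real (Suc n)) * c" using assms by simp
qed

lemma integral_norm_bound_AE:
  fixes f :: "'a \<Rightarrow> real"
  assumes f: "integrable M f" and g: "integrable M g" and le: "AE t in M. norm (f t) \<le> g t"
  shows "norm (integral\<^sup>L M f) \<le> integral\<^sup>L M g"
  by (rule order_trans[OF integral_norm_bound integral_mono_AE[OF integrable_norm[OF f] g le]])

lemma proj_measure_empty: "proj_measure E \<Longrightarrow> E {} = 0"
proof -
  assume E: "proj_measure E"
  have "(\<lambda>k::nat. E {} v) \<longlonglongrightarrow> 0" for v
    using proj_measure_sums[OF E, of "\<lambda>_. {}" v]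
    by (intro summable_LIMSEQ_zero sums_summable) (auto simp: disjoint_family_on_def)
  then have "E {} v = 0" for v by (simp add: LIMSEQ_const_iff)
  then show ?thesis by (intro blinfun_eqI) simp
qed

lemma proj_measure_mono_id:
  assumes E: "proj_measure E" and S: "S \<in> sets borel" "T \<in> sets borel" "S \<subseteq> T" and id: "E S = id_blinfun"
  shows "E T = id_blinfun"
proof (rule blinfun_eqI)
  fix v
  have "E (T \<inter> S) v = E T (E S v)" by (rule proj_measureD(3)[OF E S(2,1)])
  moreover have "T \<inter> S = S" using S(3) by blast
  ultimately show "E T v = id_blinfun v" by (simp add: id)
qed

lemma AE_scalar_measure:
  assumes E: "proj_measure E" and S: "S \<in> sets borel" and id: "E S = id_blinfun"
  shows "AE t in scalar_measure E v. t \<in> S"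
proof -
  have "E (S \<inter> (UNIV - S)) v = E S (E (UNIV - S) v)" by (rule proj_measureD(3)[OF E S]) (use S in auto)
  then have "E (UNIV - S) v = 0" by (simp add: id proj_measure_empty[OF E])
  then have "emeasure (scalar_measure E v) (UNIV - S) = 0" using S by (subst emeasure_scalar_measure[OF E]) auto
  then show ?thesis
    by (intro AE_I'[of "UNIV - S"]) (use S in \<open>auto simp: null_sets_def sets_scalar_measure[OF E]\<close>)
qed

lemma proj_measure_eqI:
  assumes E: "proj_measure E" and E': "proj_measure E'" and eq: "\<And>v. scalar_measure E v = scalar_measure E' v"
  shows "E = E'"
proof
  fix S
  show "E S = E' S"
  proof (cases "S \<in> sets borel")
    case True
    show ?thesis
      by (rule selfadjoint_eqI)
        (simp_all add: proj_measureD(1)[OF E True] proj_measureD(1)[OF E' True]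
          measure_scalar_measure[OF E True, symmetric] measure_scalar_measure[OF E' True, symmetric] eq)
  next
    case False
    then show ?thesis using E E' by (simp add: proj_measure_def)
  qed
qed

lemma opow_tendsto:
  assumes "a \<longlonglongrightarrow> (b :: 'h::real_normed_vector \<Rightarrow>\<^sub>L 'h)"
  shows "(\<lambda>n. opow (a n) j) \<longlonglongrightarrow> opow b j"
  by (induction j) (auto intro!: bounded_bilinear.tendsto[OF bounded_bilinear_blinfun_compose] assms)

text \<open>The integral representation fixes the first moment only. Rounding \<open>t\<close> down
  to multiples of \<open>1 / N n\<close> turns \<open>x\<close> into a finite combination
  \<open>s n\<close> of mutually orthogonal projections, whose powers are computed termwise. Since
  the forms of \<open>x\<close> and \<open>s n\<close> differ by at most
  \<open>(norm v)^2 / N n\<close>, the powers converge in norm to those of \<open>x\<close>.\<close>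

lemma spectral_moments:
  fixes E :: "real set \<Rightarrow> 'h::complex_hilbert_space op"
  assumes E: "proj_measure E" and R: "E {-R..R} = id_blinfun" and x: "selfadjoint x"
    and int: "has_proj_integral E UNIV (\<lambda>t. t) x"
  shows "integral\<^sup>L (scalar_measure E v) (\<lambda>t. t^j) = inner (opow x j v) v"
    "integrable (scalar_measure E v) (\<lambda>t. t^j)"
proof -
  let ?M = "scalar_measure E"
  have sM [simp]: "sets (?M v) = sets borel" "space (?M v) = UNIV" for v
    by (simp_all add: sets_scalar_measure[OF E] space_scalar_measure[OF E])
  have mM: "f \<in> borel_measurable (?M v)" if "f \<in> borel_measurable borel" for f :: "real \<Rightarrow> real" and v
    using that by (simp add: measurable_cong_sets[OF sM(1) refl])
  have fM: "finite_measure (?M v)" for v by (rule finite_scalar_measure[OF E])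
  have ae: "AE t in ?M v. t \<in> {-R..R}" for v by (rule AE_scalar_measure[OF E _ R]) simp
  have mU: "measure (?M v) UNIV = (norm v)^2" for v
    using measure_scalar_measure[OF E, of UNIV v] E by (simp add: proj_measure_def power2_norm_eq_inner)
  have intM: "integrable (?M v) (\<lambda>t. t^j)" for v j
  proof (rule finite_measure.integrable_const_bound[OF fM])
    show "AE t in ?M v. norm (t^j) \<le> \<bar>R\<bar>^j"
      using ae by eventually_elim (simp only: real_norm_def power_abs, intro power_mono, auto)
  qed (auto intro!: mM)
  show "integrable (?M v) (\<lambda>t. t^j)" by (rule intM)
  define N where "N n = real (Suc n)" for n
  have N: "0 < N n" for n by (simp add: N_def)
  define I where "I n k = {t. \<lfloor>N n * t\<rfloor> = k}" for n and k :: int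
  have bI: "I n k \<in> sets borel" for n k unfolding I_def by measurable
  \<comment> \<open>The spare unit on either side absorbs rounding by the floor function; the
    absolute value avoids an assumption on the sign of \<open>R\<close>.\<close>
  define J where "J n = {- (\<lceil>N n * \<bar>R\<bar>\<rceil> + 1) .. \<lceil>N n * \<bar>R\<bar>\<rceil> + 1}" for n
  have Jt: "\<lfloor>N n * t\<rfloor> \<in> J n" if t: "t \<in> {-R..R}" for n t
  proof -
    have "\<bar>N n * t\<bar> \<le> N n * \<bar>R\<bar>" using t N[of n] by (auto simp: abs_mult intro!: mult_left_mono)
    then show ?thesis unfolding J_def by (simp add: abs_le_iff) linarith
  qed
  have EI: "(E (I n k) o\<^sub>L E (I n l)) = (if k = l then E (I n k) else 0)" for n k l
  proof (rule blinfun_eqI)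
    fix u
    have "E (I n k \<inter> I n l) u = E (I n k) (E (I n l) u)" by (rule proj_measureD(3)[OF E bI bI])
    moreover have "I n k \<inter> I n l = (if k = l then I n k else {})" by (auto simp: I_def)
    ultimately show "(E (I n k) o\<^sub>L E (I n l)) u = (if k = l then E (I n k) else 0) u"
      by (simp add: proj_measure_empty[OF E] split: if_splits)
  qed
  define s where "s n = (\<Sum>k\<in>J n. (of_int k / N n) *\<^sub>R E (I n k))" for n
  define G where "G n j t = (\<Sum>k\<in>J n. (of_int k / N n)^j * indicator (I n k) t)" for n j t
  have Gval: "G n j t = (of_int \<lfloor>N n * t\<rfloor> / N n)^j" if "t \<in> {-R..R}" for n j t
  proof -
    have "G n j t = (\<Sum>k\<in>J n. if k = \<lfloor>N n * t\<rfloor> then (of_int k / N n)^j else 0)"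
      unfolding G_def by (rule sum.cong) (auto simp: I_def indicator_def)
    then show ?thesis using Jt[OF that, of n] by (simp add: J_def)
  qed
  have near: "\<bar>of_int \<lfloor>N n * t\<rfloor> / N n - t\<bar> \<le> 1 / N n" for n t
  proof -
    have "\<bar>of_int \<lfloor>N n * t\<rfloor> - N n * t\<bar> \<le> 1" by linarith
    then have "\<bar>of_int \<lfloor>N n * t\<rfloor> - N n * t\<bar> / N n \<le> 1 / N n" using N[of n] by (simp add: divide_right_mono)
    moreover have "of_int \<lfloor>N n * t\<rfloor> / N n - t = (of_int \<lfloor>N n * t\<rfloor> - N n * t) / N n"
      using N[of n] by (simp add: diff_divide_distrib)
    then have "\<bar>of_int \<lfloor>N n * t\<rfloor> / N n - t\<bar> = \<bar>of_int \<lfloor>N n * t\<rfloor> - N n * t\<bar> / N n"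
      using N[of n] by (simp add: abs_divide)
    ultimately show ?thesis by simp
  qed
  have sumE: "inner ((\<Sum>k\<in>J n. (of_int k / N n)^j *\<^sub>R E (I n k)) v) v = integral\<^sup>L (?M v) (G n j)" for n j v
  proof -
    have "integral\<^sup>L (?M v) (G n j) = (\<Sum>k\<in>J n. (of_int k / N n)^j * measure (?M v) (I n k))"
      unfolding G_def using bI
      by (subst Bochner_Integration.integral_sum)
        (auto intro!: integrable_mult_right integrable_real_indicator simp: finite_measure.emeasure_eq_measure[OF fM])
    then show ?thesis
      by (simp add: blinfun.sum_left blinfun_linear inner_sum_left measure_scalar_measure[OF E bI])
  qed
  have intG: "integrable (?M v) (G n j)" for v n j
    unfolding G_def using bI
    by (intro Bochner_Integration.integrable_sum integrable_mult_right integrable_real_indicator)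
      (auto simp: finite_measure.emeasure_eq_measure[OF fM])
  have saE: "selfadjoint (E (I n k))" for n k by (rule proj_measureD(1)[OF E bI])
  have s0: "(\<Sum>k\<in>J n. (of_int k / N n)^0 *\<^sub>R E (I n k)) = id_blinfun" for n
  proof (rule selfadjoint_eqI)
    fix v
    have "integral\<^sup>L (?M v) (G n 0) = integral\<^sup>L (?M v) (\<lambda>t. 1)"
    proof (rule integral_cong_AE)
      show "AE t in ?M v. G n 0 t = 1" using ae by eventually_elim (simp add: Gval)
    qed (use intG in auto)
    then show "inner ((\<Sum>k\<in>J n. (of_int k / N n)^0 *\<^sub>R E (I n k)) v) v = inner (id_blinfun v) v"
      unfolding sumE by (simp add: mU power2_norm_eq_inner)
  qed (use saE in auto)
  have sj: "opow (s n) j = (\<Sum>k\<in>J n. (of_int k / N n)^j *\<^sub>R E (I n k))" for n j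
  proof (induction j)
    case 0
    show ?case using s0 by simp
  next
    case (Suc j)
    have "opow (s n) (Suc j) = (s n o\<^sub>L (\<Sum>k\<in>J n. (of_int k / N n)^j *\<^sub>R E (I n k)))"
      by (simp only: opow.simps Suc)
    also have "\<dots> = (\<Sum>k\<in>J n. \<Sum>l\<in>J n. (of_int k / N n) *\<^sub>R (of_int l / N n)^j *\<^sub>R (E (I n k) o\<^sub>L E (I n l)))"
      by (simp add: s_def[of n] blinfun_compose_linear scaleR_sum_right mult.commute) (rule sum.swap)
    also have "\<dots> = (\<Sum>k\<in>J n. \<Sum>l\<in>J n. if l = k then (of_int k / N n)^Suc j *\<^sub>R E (I n k) else 0)"
      by (intro sum.cong refl) (auto simp: EI)
    also have "\<dots> = (\<Sum>k\<in>J n. (of_int k / N n)^Suc j *\<^sub>R E (I n k))"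
      by (intro sum.cong refl) (simp add: J_def)
    finally show ?case .
  qed
  have lim0: "(\<lambda>n. 1 / N n) \<longlonglongrightarrow> 0" unfolding N_def using LIMSEQ_inverse_real_of_nat by (simp add: inverse_eq_divide)
  have "s \<longlonglongrightarrow> x"
  proof (rule LIM_zero_cancel, rule Lim_null_comparison[OF _ lim0], rule always_eventually, rule allI)
    fix n
    have "norm (x - s n) \<le> 1 / N n"
    proof (rule norm_selfadjoint_le)
      show "selfadjoint (x - s n)" using x saE by (simp add: s_def)
      fix v
      have "cinner (x v) v = complex_of_real (integral\<^sup>L (?M v) (\<lambda>t. t))"
        using int by (simp add: has_proj_integral_def set_lebesgue_integral_def)
      then have "inner (x v) v = integral\<^sup>L (?M v) (\<lambda>t. t)" by (simp add: inner_eq_Re_cinner)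
      moreover have "inner (s n v) v = integral\<^sup>L (?M v) (G n 1)" using sumE[of n 1 v] by (simp add: s_def)
      ultimately have "inner ((x - s n) v) v = integral\<^sup>L (?M v) (\<lambda>t. t - G n 1 t)"
        using intM[of v 1] intG by (simp add: blinfun_linear inner_diff)
      also have "norm \<dots> \<le> integral\<^sup>L (?M v) (\<lambda>t. 1 / N n)"
      proof (rule integral_norm_bound_AE)
        show "integrable (?M v) (\<lambda>t. t - G n 1 t)" using intM[of v 1] intG by auto
        show "integrable (?M v) (\<lambda>t. 1 / N n)" by (rule finite_measure.integrable_const[OF fM])
        show "AE t in ?M v. norm (t - G n 1 t) \<le> 1 / N n"
          using ae
        proof eventually_elim
          case (elim t)
          then show ?case using near[of n t] Gval[of t n 1] by (simp add: abs_minus_commute)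
        qed
      qed
      also have "\<dots> = 1 / N n * (norm v)^2" by (simp add: mU)
      finally show "\<bar>inner ((x - s n) v) v\<bar> \<le> 1 / N n * (norm v)^2" by simp
    qed (use N[of n] in simp)
    then show "norm (s n - x) \<le> 1 / N n" by (simp add: norm_minus_commute)
  qed
  then have "(\<lambda>n. inner (opow (s n) j v) v) \<longlonglongrightarrow> inner (opow x j v) v"
    by (intro tendsto_intros blinfun.tendsto opow_tendsto)
  moreover have "(\<lambda>n. inner (opow (s n) j v) v) \<longlonglongrightarrow> integral\<^sup>L (?M v) (\<lambda>t. t^j)"
    unfolding sj sumE
  proof (rule integral_dominated_convergence)
    show "integrable (?M v) (\<lambda>t. (\<bar>R\<bar> + 1)^j)" by (rule finite_measure.integrable_const[OF fM])
    show "AE t in ?M v. (\<lambda>n. G n j t) \<longlonglongrightarrow> t^j"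
      using ae
    proof eventually_elim
      case (elim t)
      have "(\<lambda>n. of_int \<lfloor>N n * t\<rfloor> / N n) \<longlonglongrightarrow> t"
        by (rule LIM_zero_cancel, rule Lim_null_comparison[OF _ lim0]) (use near in auto)
      then show ?case unfolding Gval[OF elim] by (rule tendsto_power)
    qed
    show "AE t in ?M v. norm (G n j t) \<le> (\<bar>R\<bar> + 1)^j" for n
      using ae
    proof eventually_elim
      case (elim t)
      have "1 / N n \<le> 1" by (simp add: N_def)
      then have "\<bar>of_int \<lfloor>N n * t\<rfloor> / N n\<bar> \<le> \<bar>R\<bar> + 1" using near[of n t] elim by auto
      then show ?case unfolding Gval[OF elim] by (simp only: real_norm_def power_abs power_mono abs_ge_zero)
    qed
  qed (use intM intG in auto)
  ultimately show "integral\<^sup>L (?M v) (\<lambda>t. t^j) = inner (opow x j v) v" by (rule LIMSEQ_unique[symmetric])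
qed

text \<open>Both scalar measures live on one bounded interval and have the same moments, so
  Weierstrass approximation makes them agree on continuous functions.\<close>

lemma spectral_measure_unique:
  fixes E E' :: "real set \<Rightarrow> 'h::complex_hilbert_space op"
  assumes x: "selfadjoint x"
    and E: "proj_measure E" "E {-r..r} = id_blinfun" "has_proj_integral E UNIV (\<lambda>t. t) x"
    and E': "proj_measure E'" "E' {-r'..r'} = id_blinfun" "has_proj_integral E' UNIV (\<lambda>t. t) x"
  shows "E = E'"
proof (rule proj_measure_eqI[OF E(1) E'(1)])
  fix v
  define R where "R = max r r'"
  let ?M = "scalar_measure E v" and ?M' = "scalar_measure E' v"
  have R: "E {-R..R} = id_blinfun" "E' {-R..R} = id_blinfun"
    by (rule proj_measure_mono_id[OF E(1) _ _ _ E(2)], auto simp: R_def)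
      (rule proj_measure_mono_id[OF E'(1) _ _ _ E'(2)], auto simp: R_def)
  note sM = sets_scalar_measure[OF E(1), of v] sets_scalar_measure[OF E'(1), of v]
  have bnd: "\<bar>integral\<^sup>L (scalar_measure F v) f - integral\<^sup>L (scalar_measure F v) p\<bar> \<le> d * (norm v)^2"
    if F: "proj_measure F" "F {-R..R} = id_blinfun" and f: "continuous_on UNIV f" "\<And>t. 0 \<le> f t \<and> f t \<le> 1"
      and p: "integrable (scalar_measure F v) p" "\<And>t. t \<in> {-R..R} \<Longrightarrow> \<bar>f t - p t\<bar> \<le> d" for F and f p :: "real \<Rightarrow> real" and d
  proof -
    have fM: "finite_measure (scalar_measure F v)" by (rule finite_scalar_measure[OF F(1)])
    have intf: "integrable (scalar_measure F v) f"
      by (rule finite_measure.integrable_const_bound[OF fM, of _ 1])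
        (use f borel_measurable_continuous_onI[OF f(1)] in \<open>auto simp: measurable_cong_sets[OF sets_scalar_measure[OF F(1)] refl]\<close>)
    have "norm (integral\<^sup>L (scalar_measure F v) (\<lambda>t. f t - p t)) \<le> integral\<^sup>L (scalar_measure F v) (\<lambda>t. d)"
    proof (rule integral_norm_bound_AE)
      show "integrable (scalar_measure F v) (\<lambda>t. f t - p t)" using intf p(1) by auto
      show "integrable (scalar_measure F v) (\<lambda>t. d)" by (rule finite_measure.integrable_const[OF fM])
      have "AE t in scalar_measure F v. t \<in> {-R..R}" by (rule AE_scalar_measure[OF F(1) _ F(2)]) simp
      then show "AE t in scalar_measure F v. norm (f t - p t) \<le> d" by eventually_elim (use p(2) in simp)
    qed
    moreover have "measure (scalar_measure F v) UNIV = (norm v)^2"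
      using measure_scalar_measure[OF F(1), of UNIV v] F(1) by (simp add: proj_measure_def power2_norm_eq_inner)
    ultimately show ?thesis
      using intf p(1) by (simp add: space_scalar_measure[OF F(1)] mult.commute)
  qed
  show "?M = ?M'"
  proof (rule measure_eqI_continuous)
    fix f :: "real \<Rightarrow> real" assume f: "continuous_on UNIV f" "\<And>t. 0 \<le> f t \<and> f t \<le> 1"
    have "\<bar>integral\<^sup>L ?M f - integral\<^sup>L ?M' f\<bar> \<le> d * (2 * (norm v)^2)" if d: "0 < d" for d
    proof -
      obtain p where p: "real_polynomial_function p" "\<And>t. t \<in> {-R..R} \<Longrightarrow> \<bar>f t - p t\<bar> < d"
        using Stone_Weierstrass_real_polynomial_function[of "{-R..R}" f d] d continuous_on_subset[OF f(1)] by auto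
      obtain a n where a: "p = (\<lambda>t. \<Sum>i\<le>n. a i * t^i)" using p(1) real_polynomial_function_iff_sum by blast
      have ip: "integrable (scalar_measure F v) p" "integral\<^sup>L (scalar_measure F v) p = (\<Sum>i\<le>n. a i * inner (opow x i v) v)"
        if F: "proj_measure F" "F {-R..R} = id_blinfun" "has_proj_integral F UNIV (\<lambda>t. t) x" for F
        unfolding a using spectral_moments[OF F(1,2) x F(3)] by simp_all
      have "\<bar>integral\<^sup>L ?M f - integral\<^sup>L ?M p\<bar> \<le> d * (norm v)^2"
        by (rule bnd[OF E(1) R(1) f ip(1)[OF E(1) R(1) E(3)]]) (use p(2) less_imp_le in blast)+
      moreover have "\<bar>integral\<^sup>L ?M' f - integral\<^sup>L ?M' p\<bar> \<le> d * (norm v)^2"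
        by (rule bnd[OF E'(1) R(2) f ip(1)[OF E'(1) R(2) E'(3)]]) (use p(2) less_imp_le in blast)+
      moreover have "integral\<^sup>L ?M p = integral\<^sup>L ?M' p"
        using ip(2)[OF E(1) R(1) E(3)] ip(2)[OF E'(1) R(2) E'(3)] by simp
      ultimately show ?thesis by linarith
    qed
    then have "\<bar>integral\<^sup>L ?M f - integral\<^sup>L ?M' f\<bar> \<le> 0"
      by (rule small_multiple_le_zero)
    then show "integral\<^sup>L ?M f = integral\<^sup>L ?M' f" by simp
  qed (use sM finite_scalar_measure E E' in auto)
qed

lemma spectral_measure_eqI:
  fixes E :: "real set \<Rightarrow> 'h::complex_hilbert_space op"
  assumes x: "selfadjoint x"
    and E: "proj_measure E" "E {-r..r} = id_blinfun" "has_proj_integral E UNIV (\<lambda>t. t) x"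
  shows "spectral_measure x = E"
  unfolding spectral_measure_def
  by (rule the_equality) (use E spectral_measure_unique[OF x E, symmetric] in blast)+

text \<open>Polarisation gives only \<open>cinner (a u) w = - cinner (a w) u\<close>; replacing
  \<open>u\<close> by \<open>\<i> *\<^sub>C u\<close> gives the same equation with the opposite
  sign.\<close>

lemma clinear_op_zeroI:
  fixes a :: "'h::complex_hilbert_space op"
  assumes a: "clinear_op a" and z: "\<And>v. cinner (a v) v = 0"
  shows "a = 0"
proof (rule blinfun_eqI, rule cinner_ext)
  fix u w
  have ar: "cinner p (q + r) = cinner p q + cinner p r" for p q r :: 'h
    by (metis cinner_add_left cinner_commute complex_cnj_add)
  have sr: "cinner p (c *\<^sub>C q) = cnj c * cinner p q" for c and p q :: 'h
    by (metis cinner_scaleC_left cinner_commute complex_cnj_mult)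
  have s: "cinner (a u) w + cinner (a w) u = 0" for u w
    using z[of "u + w"] z[of u] z[of w] by (simp add: blinfun_linear cinner_add_left ar add.commute)
  have "\<i> * cinner (a u) w - \<i> * cinner (a w) u = 0"
    using s[of "\<i> *\<^sub>C u" w] by (simp add: clinear_op_scaleC[OF a] cinner_scaleC_left sr)
  then have "cinner (a u) w = cinner (a w) u" by simp
  with s[of u w] have "cinner (a u) w = 0" by simp
  then show "cinner w (a u) = cinner w (blinfun_apply 0 u)"
    by (subst cinner_commute) (use sr[of w 0 0] ar[of w 0 0] in simp)
qed

lemma has_proj_integral_unique:
  assumes "has_proj_integral E S f T" "has_proj_integral E S f T'"
  shows "T = T'"
proof -
  have "cinner ((T - T') v) v = 0" for v
  proof -
    have "cinner ((T - T') v) v + cinner (T' v) v = cinner (T v) v"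
      by (simp add: blinfun_linear flip: cinner_add_left)
    then show ?thesis using assms by (simp add: has_proj_integral_def)
  qed
  then have "T - T' = 0" using assms by (intro clinear_op_zeroI) (auto simp: has_proj_integral_def)
  then show ?thesis by simp
qed

section \<open>Marginals, the product property of the joint measure, and operators as spectral
  integrals\<close>

lemma borel_coordinate [measurable]: "(\<lambda>t::real^'n::finite. t $ i) \<in> borel_measurable borel"
  by (intro borel_measurable_continuous_onI continuous_intros)

lemma borel_coordinate_set:
  assumes "S \<in> sets borel" shows "{t::real^'n::finite. t $ i \<in> S} \<in> sets borel"
  using measurable_sets[OF borel_coordinate assms, of i] by (simp add: vimage_def)

lemma borel_cube:
  assumes S: "\<And>i. S i \<in> sets borel"
  shows "{t::real^'n::finite. \<forall>i. t $ i \<in> S i} \<in> sets borel"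
proof -
  have "{t::real^'n. \<forall>i. t $ i \<in> S i} = (\<Inter>i\<in>UNIV. {t. t $ i \<in> S i})" by auto
  also have "\<dots> \<in> sets borel" by (rule sets.finite_INT) (use S borel_coordinate_set in auto)
  finally show ?thesis .
qed

context comm_tuple begin

definition marginal :: "'n \<Rightarrow> real set \<Rightarrow> 'h op" where
  "marginal i S = (if S \<in> sets borel then E {t. t $ i \<in> S} else 0)"

lemma proj_measure_marginal: "proj_measure (marginal i)"
  unfolding proj_measure_def
proof (intro conjI allI ballI impI)
  note b = borel_coordinate_set[of _ i]
  show "marginal i S = 0" if "S \<notin> sets borel" for S using that by (simp add: marginal_def)
  show "marginal i UNIV = id_blinfun" by (simp add: marginal_def E_UNIV)
  fix S :: "real set" assume S: "S \<in> sets borel"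
  show "selfadjoint (marginal i S)" using S b by (simp add: marginal_def E)
  show "marginal i S o\<^sub>L marginal i S = marginal i S" using E_mult[OF b[OF S] b[OF S]] S by (simp add: marginal_def)
  fix T :: "real set" assume T: "T \<in> sets borel"
  have "{t::real^'n. t $ i \<in> S \<inter> T} = {t. t $ i \<in> S} \<inter> {t. t $ i \<in> T}" by auto
  then show "marginal i (S \<inter> T) = marginal i S o\<^sub>L marginal i T"
    using E_mult[OF b[OF S] b[OF T]] S T by (simp add: marginal_def)
next
  fix F :: "nat \<Rightarrow> real set" and v assume F: "range F \<subseteq> sets borel" "disjoint_family F"
  have bF: "F k \<in> sets borel" for k using F(1) by auto
  have "(\<lambda>k. E {t. t $ i \<in> F k} v) sums E (\<Union>k. {t. t $ i \<in> F k}) v"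
  proof (rule proj_measure_sums[OF proj_measure_E])
    show "range (\<lambda>k. {t::real^'n. t $ i \<in> F k}) \<subseteq> sets borel" using borel_coordinate_set[OF bF] by auto
    show "disjoint_family (\<lambda>k. {t::real^'n. t $ i \<in> F k})" using F(2) by (auto simp: disjoint_family_on_def)
  qed
  moreover have "(\<Union>k. {t::real^'n. t $ i \<in> F k}) = {t. t $ i \<in> (\<Union>k. F k)}" by auto
  ultimately show "(\<lambda>k. marginal i (F k) v) sums marginal i (\<Union>k. F k) v" using bF by (simp add: marginal_def)
qed

lemma measurable_mu: "f \<in> measurable borel N \<Longrightarrow> f \<in> measurable (mu v) N"
  by (simp add: measurable_cong_sets[OF sets_mu refl])

lemma scalar_measure_marginal: "scalar_measure (marginal i) v = distr (mu v) borel (\<lambda>t. t $ i)"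
proof (rule measure_eqI)
  fix S assume "S \<in> sets (scalar_measure (marginal i) v)"
  then have S: "S \<in> sets borel" by (simp add: sets_scalar_measure[OF proj_measure_marginal])
  have "emeasure (distr (mu v) borel (\<lambda>t. t $ i)) S = emeasure (mu v) {t. t $ i \<in> S}"
    using S by (subst emeasure_distr) (auto intro: measurable_mu simp: vimage_def)
  then show "emeasure (scalar_measure (marginal i) v) S = emeasure (distr (mu v) borel (\<lambda>t. t $ i)) S"
    using S by (simp add: emeasure_scalar_measure[OF proj_measure_marginal S] marginal_def E borel_coordinate_set
      finite_measure.emeasure_eq_measure[OF finite_mu])
qed (simp add: sets_scalar_measure[OF proj_measure_marginal])

text \<open>The marginal is supported in a bounded interval because \<open>E K\<close> is the
  identity, and its first moment is the integral of a coordinate under \<open>mu v\<close>;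
  uniqueness does the rest.\<close>

lemma spectral_measure_marginal: "spectral_measure (x i) = marginal i"
proof (rule spectral_measure_eqI[OF sa proj_measure_marginal])
  define r where "r = max (- m $ i) (M $ i)"
  have "K \<subseteq> {t. t $ i \<in> {-r..r}}"
  proof
    fix t assume "t \<in> K"
    then have "m $ i \<le> t $ i \<and> t $ i \<le> M $ i" by (simp add: mem_box_cart)
    then show "t \<in> {t. t $ i \<in> {-r..r}}" by (simp add: r_def max_def)
  qed
  then have "E {t. t $ i \<in> {-r..r}} = id_blinfun"
    by (intro proj_measure_mono_id[OF proj_measure_E _ _ _ E_K] borel_coordinate_set) auto
  then show "marginal i {-r..r} = id_blinfun" by (simp add: marginal_def)
  show "has_proj_integral (marginal i) UNIV (\<lambda>t. t) (x i)"
    unfolding has_proj_integral_def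
  proof (intro conjI allI)
    show "clinear_op (x i)" by (rule selfadjointD[OF sa])
    fix v
    have c: "continuous_on UNIV (\<lambda>t::real^'n. t $ i)" by (intro continuous_intros)
    show "set_integrable (scalar_measure (marginal i) v) UNIV (\<lambda>t. t)"
      unfolding scalar_measure_marginal set_integrable_def
      by (simp add: integrable_distr_eq measurable_mu integral_mu(1)[OF c])
    show "cinner (x i v) v = complex_of_real (LINT t:UNIV|scalar_measure (marginal i) v. t)"
      unfolding scalar_measure_marginal set_lebesgue_integral_def
      by (simp add: integral_distr measurable_mu integral_mu(2)[OF c] cinner_selfadjoint[OF sa])
  qed
qed

lemma E_rectangle:
  assumes S: "\<And>i. S i \<in> sets borel"
  shows "E {t. \<forall>i\<in>set ks. t $ i \<in> S i} = foldr (o\<^sub>L) (map (\<lambda>i. marginal i (S i)) ks) id_blinfun"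
proof (induction ks)
  case Nil
  show ?case by (simp add: E_UNIV)
next
  case (Cons k ks)
  have "{t::real^'n. \<forall>i\<in>set ks. t $ i \<in> S i} = {t. \<forall>i. t $ i \<in> (if i \<in> set ks then S i else UNIV)}" by auto
  also have "\<dots> \<in> sets borel" by (rule borel_cube) (use S in auto)
  finally have b: "{t::real^'n. \<forall>i\<in>set ks. t $ i \<in> S i} \<in> sets borel" .
  have "{t::real^'n. \<forall>i\<in>set (k # ks). t $ i \<in> S i} = {t. t $ k \<in> S k} \<inter> {t. \<forall>i\<in>set ks. t $ i \<in> S i}" by auto
  then have "E {t. \<forall>i\<in>set (k # ks). t $ i \<in> S i} = (E {t. t $ k \<in> S k} o\<^sub>L E {t. \<forall>i\<in>set ks. t $ i \<in> S i})"
    using E_mult[OF borel_coordinate_set[OF S] b] by simp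
  then show ?case using S by (simp add: Cons marginal_def)
qed

lemma is_product_measure_E: "is_product_measure (\<lambda>i. spectral_measure (x i)) E"
  unfolding is_product_measure_def spectral_measure_marginal
proof (intro conjI allI impI)
  fix S :: "'n \<Rightarrow> real set" and ks :: "'n list"
  assume S: "\<forall>i. S i \<in> sets borel" and ks: "set ks = UNIV"
  show "E {t. \<forall>i. t $ i \<in> S i} = foldr (o\<^sub>L) (map (\<lambda>i. marginal i (S i)) ks) id_blinfun"
    using E_rectangle[of S ks] S ks by simp
qed (rule proj_measure_E)

lemma joint_unique:
  assumes F: "is_product_measure (\<lambda>i. spectral_measure (x i)) F"
  shows "F = E"
proof -
  have pF: "proj_measure F" using F by (simp add: is_product_measure_def)
  obtain ks :: "'n list" where ks: "set ks = UNIV" "distinct ks" using finite_distinct_list[of "UNIV :: 'n set"] by auto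
  have eq: "F {t. \<forall>i. t $ i \<in> S i} = E {t. \<forall>i. t $ i \<in> S i}" if "\<And>i. S i \<in> sets borel" for S
  proof -
    have "G {t. \<forall>i. t $ i \<in> S i} = foldr (o\<^sub>L) (map (\<lambda>i. spectral_measure (x i) (S i)) ks) id_blinfun"
      if "is_product_measure (\<lambda>i. spectral_measure (x i)) G" for G
      using that \<open>\<And>i. S i \<in> sets borel\<close> ks unfolding is_product_measure_def by blast
    from this[OF F] this[OF is_product_measure_E] show ?thesis by simp
  qed
  have box: "F (box a b) = E (box a b)" for a b
  proof -
    have "box a b = {t. \<forall>i. t $ i \<in> {a $ i<..<b $ i}}" by (auto simp: mem_box_cart)
    then show ?thesis using eq[of "\<lambda>i. {a $ i<..<b $ i}"] by simp
  qed
  show ?thesis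
  proof (rule proj_measure_eqI[OF pF proj_measure_E])
    fix v
    show "scalar_measure F v = scalar_measure E v"
    proof (rule measure_eqI_generator_eq[where E = "range (\<lambda>(a, b). box a b)" and \<Omega> = UNIV
        and A = "\<lambda>i::nat. box (- (real i *\<^sub>R One)) (real i *\<^sub>R One)"])
      show "Int_stable (range (\<lambda>(a, b). box a b :: (real^'n) set))"
        by (auto simp: Int_stable_def box_Int_box)
      show "emeasure (scalar_measure F v) X = emeasure (scalar_measure E v) X" if "X \<in> range (\<lambda>(a, b). box a b)" for X
        using that by (auto simp: emeasure_scalar_measure[OF pF] emeasure_scalar_measure[OF proj_measure_E] box)
      show "sets (scalar_measure F v) = sigma_sets UNIV (range (\<lambda>(a, b). box a b))"
        "sets (scalar_measure E v) = sigma_sets UNIV (range (\<lambda>(a, b). box a b))"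
        using arg_cong[OF borel_eq_box[where 'a = "real^'n"], of sets]
        by (simp_all add: sets_scalar_measure[OF pF] sets_scalar_measure[OF proj_measure_E])
      show "(\<Union>i::nat. box (- (real i *\<^sub>R One)) (real i *\<^sub>R One)) = (UNIV :: (real^'n) set)" by (rule UN_box_eq_UNIV)
      show "emeasure (scalar_measure F v) (box (- (real i *\<^sub>R One)) (real i *\<^sub>R One)) \<noteq> \<infinity>" for i :: nat
        by (simp add: emeasure_scalar_measure[OF pF])
    qed auto
  qed
qed

lemma has_proj_integral_cfc:
  assumes "\<And>i. Is i \<in> sets borel" and K: "K \<subseteq> cube Is" and f: "continuous_on (cube Is) f"
  shows "has_proj_integral E (cube Is) f (cfc f)"
  unfolding has_proj_integral_def scalar_measure_E
proof (intro conjI allI)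
  have fK: "continuous_on K f" using f K by (rule continuous_on_subset)
  show "clinear_op (cfc f)" using selfadjointD(1)[OF cfc_selfadjoint[OF fK]] .
  fix v
  \<comment> \<open>Composition with the retraction onto the box extends \<open>f\<close>
    continuously from \<open>K\<close> to the whole space, where integrals under \<open>mu v\<close>
    are known.\<close>
  define F where "F t = f (clamp m M t)" for t
  have cF: "continuous_on UNIV F" unfolding F_def by (rule clamp_continuous_on[OF fK])
  have FK: "F t = f t" if "t \<in> K" for t using that by (simp add: F_def clamp_cancel_cbox)
  have bc: "cube Is \<in> sets borel" unfolding cube_def by (rule borel_cube) (rule assms(1))
  have m1: "(\<lambda>t. indicator (cube Is) t *\<^sub>R f t) \<in> borel_measurable (mu v)"
    by (rule measurable_mu[OF borel_measurable_continuous_on_indicator[OF bc f]])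
  have m2: "F \<in> borel_measurable (mu v)" by (rule measurable_mu[OF borel_measurable_continuous_onI[OF cF]])
  have ae: "AE t in mu v. indicator (cube Is) t *\<^sub>R f t = F t"
    by (rule AE_I'[of "- K"]) (use emeasure_mu_Compl[of v] FK K in \<open>auto simp: null_sets_def indicator_def\<close>)
  show "set_integrable (mu v) (cube Is) f"
    unfolding set_integrable_def using integrable_cong_AE[OF m1 m2 ae] integral_mu(1)[OF cF] by simp
  have "(LINT t:cube Is|mu v. f t) = integral\<^sup>L (mu v) F"
    unfolding set_lebesgue_integral_def by (rule integral_cong_AE[OF m1 m2 ae])
  also have "\<dots> = inner (cfc F v) v" by (rule integral_mu(2)[OF cF])
  also have "cfc F = cfc f" by (rule cfc_cong[OF FK])
  finally show "cinner (cfc f v) v = complex_of_real (LINT t:cube Is|mu v. f t)"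
    by (simp add: cinner_selfadjoint[OF cfc_selfadjoint[OF fK]])
qed

end

lemma fun_op_eq_cfc:
  assumes "comm_tuple (($) X) m M" and Is: "\<And>i. is_interval (Is i)"
    and K: "cbox m M \<subseteq> cube Is" and f: "continuous_on (cube Is) f"
  shows "fun_op Is f X = comm_tuple.cfc (($) X) m M f"
proof -
  interpret comm_tuple "($) X" m M by fact
  have "joint_spectral_measure X = E"
    unfolding joint_spectral_measure_def by (rule the_equality) (rule is_product_measure_E, rule joint_unique)
  moreover note h = has_proj_integral_cfc[OF real_interval_borel_measurable[OF Is] K f]
  ultimately show ?thesis
    unfolding fun_op_def by (simp only:) (rule the_equality, rule h, rule has_proj_integral_unique[OF _ h])
qed

section \<open>Tuples with spectrum in a cube\<close>

text \<open>This is \<open>p^2 \<le> norm p * p\<close>, the product of the commuting positive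
  operators \<open>norm p - p\<close> and \<open>p\<close> being positive.\<close>

lemma norm_positive_le:
  fixes p :: "'h::complex_hilbert_space op"
  assumes p: "positive_op p"
  shows "(norm (p v))^2 \<le> norm p * inner (p v) v"
proof -
  have "positive_op (norm p *\<^sub>R id_blinfun - p)"
  proof -
    have "inner (p v) v \<le> norm p * (norm v)^2" for v using inner_op_le_norm[of p v] by linarith
    then show ?thesis using p by (simp add: positive_op_iff blinfun_linear inner_diff power2_norm_eq_inner)
  qed
  then have "positive_op ((norm p *\<^sub>R id_blinfun - p) o\<^sub>L p)"
    by (rule positive_op_compose[OF _ p]) (simp add: comm_iff blinfun_linear)
  then have "0 \<le> inner ((norm p *\<^sub>R p v) - p (p v)) v" by (simp add: positive_op_iff blinfun_linear)
  moreover have "inner (p (p v)) v = (norm (p v))^2"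
    using p by (simp add: positive_op_iff selfadjointD(2) power2_norm_eq_inner)
  ultimately show ?thesis by (simp add: inner_diff)
qed

text \<open>A bounded left inverse keeps \<open>norm (p v)\<close> away from 0, and
  \<open>norm_positive_le\<close> transfers this to the quadratic form. The summand 1 keeps the
  denominator positive.\<close>

lemma positive_left_inverse_bound:
  fixes p b :: "'h::complex_hilbert_space op"
  assumes p: "positive_op p" and b: "(b o\<^sub>L p) = id_blinfun"
  shows "\<exists>\<delta>>0. \<forall>v. norm v = 1 \<longrightarrow> \<delta> \<le> inner (p v) v"
proof (intro exI[of _ "1 / ((norm b)^2 * norm p + 1)"] conjI allI impI)
  have c: "0 < (norm b)^2 * norm p + 1" by (simp add: add_nonneg_pos)
  then show "0 < 1 / ((norm b)^2 * norm p + 1)" by simp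
  fix v :: 'h assume v: "norm v = 1"
  have "v = b (p v)" using b by (metis blinfun_apply_blinfun_compose blinfun_apply_id_blinfun)
  then have "1 \<le> norm b * norm (p v)" using norm_blinfun[of b "p v"] v by metis
  then have "1 \<le> (norm b * norm (p v))^2" by simp
  also have "\<dots> \<le> (norm b)^2 * (norm p * inner (p v) v)"
    unfolding power_mult_distrib by (intro mult_left_mono norm_positive_le p) simp
  also have "\<dots> \<le> ((norm b)^2 * norm p + 1) * inner (p v) v"
    using p by (simp add: positive_op_iff algebra_simps)
  finally show "1 / ((norm b)^2 * norm p + 1) \<le> inner (p v) v" using c by (simp add: field_simps)
qed

lemma scaleC_op_of_real: "scaleC_op (complex_of_real r) id_blinfun = r *\<^sub>R (id_blinfun :: 'h::complex_hilbert_space op)"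
  by (rule blinfun_eqI) (simp add: scaleC_op_apply scaleC_of_real blinfun_linear)

text \<open>If an endpoint of the numerical range were outside the spectrum, the difference of
  \<open>a\<close> and that endpoint would have a form bounded away from 0 on unit vectors,
  contradicting the infimum or supremum. The zero space is excluded because all spectra there are
  empty.\<close>

lemma spectrum_numerical_range:
  fixes a :: "'h::complex_hilbert_space op"
  assumes a: "selfadjoint a" and ne: "\<exists>v::'h. v \<noteq> 0"
  shows "\<exists>m M. m \<le> M \<and> complex_of_real m \<in> spectrum a \<and> complex_of_real M \<in> spectrum a \<and>
    (\<forall>v. m * (norm v)^2 \<le> inner (a v) v \<and> inner (a v) v \<le> M * (norm v)^2)"
proof -
  define S where "S = {inner (a v) v | v. norm v = 1}"
  obtain v0 :: 'h where "v0 \<noteq> 0" using ne by blast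
  then have v1: "norm (v0 /\<^sub>R norm v0) = 1" by simp
  then have Sne: "S \<noteq> {}" unfolding S_def by blast
  have Sb: "\<bar>y\<bar> \<le> norm a" if "y \<in> S" for y using that inner_op_le_norm[of a] by (auto simp: S_def) (metis mult.right_neutral power_one)
  have bb: "bdd_below S" "bdd_above S" using Sb by (auto intro!: bdd_belowI[of _ "- norm a"] bdd_aboveI[of _ "norm a"] simp: abs_le_iff) force
  define m where "m = Inf S"
  define M where "M = Sup S"
  have mv: "m \<le> inner (a v) v" "inner (a v) v \<le> M" if "norm v = 1" for v
    using that bb by (auto simp: m_def M_def S_def intro!: cInf_lower cSup_upper)
  have bnd: "m * (norm v)^2 \<le> inner (a v) v \<and> inner (a v) v \<le> M * (norm v)^2" for v
  proof (cases "v = 0")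
    case False
    let ?w = "v /\<^sub>R norm v"
    have w: "norm ?w = 1" using False by simp
    have e: "inner (a ?w) ?w = inner (a v) v / (norm v)^2"
      by (simp add: blinfun_linear power2_eq_square divide_inverse)
    have "0 < (norm v)^2" using False by simp
    then show ?thesis using mv[OF w] unfolding e by (simp only: pos_le_divide_eq pos_divide_le_eq)
  qed simp
  have pm: "positive_op (a - m *\<^sub>R id_blinfun)" "positive_op (M *\<^sub>R id_blinfun - a)"
    using a bnd by (auto simp: positive_op_iff blinfun_linear inner_diff power2_norm_eq_inner)
  have "complex_of_real m \<in> spectrum a"
  proof (rule ccontr)
    assume "complex_of_real m \<notin> spectrum a"
    then obtain b where "(b o\<^sub>L (a - m *\<^sub>R id_blinfun)) = id_blinfun" by (auto simp: spectrum_def scaleC_op_of_real)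
    from positive_left_inverse_bound[OF pm(1) this] obtain d where
      d: "0 < d" "\<And>v. norm v = 1 \<Longrightarrow> d \<le> inner ((a - m *\<^sub>R id_blinfun) v) v" by blast
    have "m + d \<le> y" if "y \<in> S" for y
    proof -
      from that obtain v where v: "norm v = 1" "y = inner (a v) v" by (auto simp: S_def)
      show ?thesis using d(2)[OF v(1)] v by (simp add: blinfun_linear inner_diff dot_square_norm)
    qed
    then have "m + d \<le> m" unfolding m_def[symmetric] by (subst (2) m_def) (rule cInf_greatest[OF Sne])
    then show False using d(1) by simp
  qed
  moreover have "complex_of_real M \<in> spectrum a"
  proof (rule ccontr)
    assume "complex_of_real M \<notin> spectrum a"
    then obtain b where "(b o\<^sub>L (a - M *\<^sub>R id_blinfun)) = id_blinfun" by (auto simp: spectrum_def scaleC_op_of_real)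
    then have "((- b) o\<^sub>L (M *\<^sub>R id_blinfun - a)) = id_blinfun"
      by (metis blinfun_compose_linear(9,10) minus_diff_eq minus_minus)
    from positive_left_inverse_bound[OF pm(2) this] obtain d where
      d: "0 < d" "\<And>v. norm v = 1 \<Longrightarrow> d \<le> inner ((M *\<^sub>R id_blinfun - a) v) v" by blast
    have "y \<le> M - d" if "y \<in> S" for y
    proof -
      from that obtain v where v: "norm v = 1" "y = inner (a v) v" by (auto simp: S_def)
      show ?thesis using d(2)[OF v(1)] v by (simp add: blinfun_linear inner_diff dot_square_norm)
    qed
    then have "M \<le> M - d" by (subst (1) M_def) (rule cSup_least[OF Sne])
    then show False using d(1) by simp
  qed
  moreover have "m \<le> M" using mv[OF v1] by linarith
  ultimately show ?thesis using bnd by blast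
qed

text \<open>For \<open>z\<close> off the interval the real quadratic
  \<open>(t - z)(t - cnj z)\<close> has no zero on it, so a calculus for real functions suffices:
  its reciprocal at \<open>a\<close>, multiplied by \<open>a - cnj z\<close>, inverts
  \<open>a - z\<close>.\<close>

lemma spectrum_subset_interval:
  fixes a :: "'h::complex_hilbert_space op"
  assumes a: "selfadjoint a" and mM: "m \<le> M"
    and bnd: "\<And>v. m * (norm v)^2 \<le> inner (a v) v" "\<And>v. inner (a v) v \<le> M * (norm v)^2"
  shows "spectrum a \<subseteq> complex_of_real ` {m..M}"
proof
  fix z assume z: "z \<in> spectrum a"
  show "z \<in> complex_of_real ` {m..M}"
  proof (rule ccontr)
    assume nz: "z \<notin> complex_of_real ` {m..M}"
    \<comment> \<open>The calculus of a single operator is that of a tuple indexed by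
      \<open>unit\<close>.\<close>
    interpret comm_tuple "\<lambda>_::unit. a" "\<chi> i. m" "\<chi> i. M"
      by unfold_locales (use a mM bnd in auto)
    let ?T = "\<lambda>t::real^unit. t $ ()"
    define g where "g t = ?T t * ?T t + (- (2 * Re z)) * ?T t + (cmod z)^2" for t
    have gz: "g t = (?T t - Re z)^2 + (Im z)^2" for t
      unfolding g_def cmod_power2 by (simp add: power2_eq_square algebra_simps)
    have g0: "g t \<noteq> 0" if t: "t \<in> K" for t
    proof
      assume "g t = 0"
      then have "?T t = Re z \<and> Im z = 0" by (simp add: gz sum_power2_eq_zero_iff)
      then have "z = complex_of_real (?T t)" by (simp add: complex_eq_iff)
      moreover have "?T t \<in> {m..M}" using t by (simp add: mem_box_cart)
      ultimately show False using nz by blast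
    qed
    have cg: "continuous_on K g" unfolding g_def by (intro continuous_intros)
    have ci: "continuous_on K (\<lambda>t. inverse (g t))" by (rule continuous_on_inverse[OF cg]) (use g0 in blast)
    have "cfc (\<lambda>t. inverse (g t) * g t) = cfc (\<lambda>t. 1)" by (rule cfc_cong) (use g0 in simp)
    then have inv: "(cfc (\<lambda>t. inverse (g t)) o\<^sub>L cfc g) = id_blinfun" by (simp add: cfc_mult[OF ci cg])
    define c where "c = cfc (\<lambda>t. inverse (g t))"
    have cT: "continuous_on K ?T" by (intro continuous_intros)
    have cg_eq: "cfc g = (a o\<^sub>L a) + (- (2 * Re z)) *\<^sub>R a + ((cmod z)^2) *\<^sub>R id_blinfun"
      unfolding g_def
      by (simp only: cfc_add[OF continuous_on_add[OF continuous_on_mult[OF cT cT] continuous_on_mult_left[OF cT]] continuous_on_const]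
        cfc_add[OF continuous_on_mult[OF cT cT] continuous_on_mult_left[OF cT]] cfc_mult[OF cT cT] cfc_cmult[OF cT] cfc_var cfc_const)
    have ca: "c o\<^sub>L a = a o\<^sub>L c" using cfc_comm[OF ci cT] by (simp add: c_def)
    have clc: "clinear_op c" using selfadjointD(1)[OF cfc_selfadjoint[OF ci]] by (simp add: c_def)
    have cla: "clinear_op a" by (rule selfadjointD[OF a])
    have cg_c: "c (cfc g v) = v" for v using inv unfolding c_def by (metis blinfun_apply_blinfun_compose blinfun_apply_id_blinfun)
    let ?az = "\<lambda>w. a - scaleC_op w id_blinfun"
    have az: "?az w v = a v - w *\<^sub>C v" for w v by (simp add: blinfun_linear scaleC_op_apply)
    have cl: "clinear_op (scaleC_op w id_blinfun :: 'h op)" for w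
      by (simp add: clinear_op_def scaleC_op_apply scaleC_scaleC mult.commute)
    have m: "w *\<^sub>C (p - q) = w *\<^sub>C p - w *\<^sub>C q" for w and p q :: 'h
      using scaleC_add_right[of w "p - q" q] by (simp add: eq_diff_eq)
    have prod: "?az w1 (?az w2 v) = cfc g v" if w: "{w1, w2} = {z, cnj z}" for w1 w2 v
    proof -
      have ww: "w1 + w2 = complex_of_real (2 * Re z)" "w1 * w2 = complex_of_real ((cmod z)^2)"
      proof -
        have "(w1 = z \<and> w2 = cnj z) \<or> (w1 = cnj z \<and> w2 = z)" using w by (auto simp: doubleton_eq_iff)
        then have "w1 + w2 = z + cnj z \<and> w1 * w2 = z * cnj z" by (auto simp: mult.commute)
        then show "w1 + w2 = complex_of_real (2 * Re z)" "w1 * w2 = complex_of_real ((cmod z)^2)"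
          by (simp_all only: complex_add_cnj complex_norm_square)
      qed
      have "?az w1 (?az w2 v) = a (a v) - (w1 *\<^sub>C a v + w2 *\<^sub>C a v) + (w1 * w2) *\<^sub>C v"
        by (simp add: scaleC_op_apply blinfun_linear clinear_op_scaleC[OF cla] m scaleC_scaleC algebra_simps)
      also have "w1 *\<^sub>C a v + w2 *\<^sub>C a v = (2 * Re z) *\<^sub>R a v"
        by (simp only: scaleC_add_left[symmetric] ww scaleC_of_real)
      also have "(w1 * w2) *\<^sub>C v = ((cmod z)^2) *\<^sub>R v" by (simp only: ww scaleC_of_real)
      finally show ?thesis by (simp add: cg_eq blinfun_linear)
    qed
    define b where "b = (c o\<^sub>L ?az (cnj z))"
    have "clinear_op b" unfolding b_def using clc cla cl by simp
    moreover have "(b o\<^sub>L ?az z) = id_blinfun"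
      by (rule blinfun_eqI) (simp only: b_def blinfun_apply_blinfun_compose prod[of "cnj z" z] insert_commute cg_c blinfun_apply_id_blinfun)
    moreover have "(?az z o\<^sub>L b) = id_blinfun"
    proof (rule blinfun_eqI)
      fix v
      have "?az z (c w) = c (?az z w)" for w
        using comm_apply[OF ca] by (simp add: scaleC_op_apply blinfun_linear clinear_op_scaleC[OF clc])
      then show "(?az z o\<^sub>L b) v = id_blinfun v" by (simp only: b_def blinfun_apply_blinfun_compose prod[of z "cnj z"] cg_c blinfun_apply_id_blinfun)
    qed
    ultimately show False using z by (auto simp: spectrum_def)
  qed
qed

text \<open>The bounds are spectral values and hence lie in \<open>Is i\<close>. This places a
  compact box inside the cube even when the intervals are not closed.\<close>

lemma sa_tuples_bounds:
  fixes X :: "('h::complex_hilbert_space op)^'n::finite"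
  assumes X: "X \<in> sa_tuples As Is" and ne: "\<exists>v::'h. v \<noteq> 0"
  shows "\<exists>m M. (\<forall>i. m $ i \<in> Is i \<and> M $ i \<in> Is i \<and> m $ i \<le> M $ i) \<and>
    (\<forall>i v. m $ i * (norm v)^2 \<le> inner ((X $ i) v) v \<and> inner ((X $ i) v) v \<le> M $ i * (norm v)^2)"
proof -
  have "\<forall>i. \<exists>m M. m \<in> Is i \<and> M \<in> Is i \<and> m \<le> M \<and> (\<forall>v. m * (norm v)^2 \<le> inner ((X $ i) v) v \<and> inner ((X $ i) v) v \<le> M * (norm v)^2)"
  proof
    fix i
    have sa: "selfadjoint (X $ i)" and sp: "spectrum (X $ i) \<subseteq> complex_of_real ` Is i"
      using X by (auto simp: sa_tuples_def)
    from spectrum_numerical_range[OF sa ne] obtain m M where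
      mM: "m \<le> M" "complex_of_real m \<in> spectrum (X $ i)" "complex_of_real M \<in> spectrum (X $ i)"
      "\<forall>v. m * (norm v)^2 \<le> inner ((X $ i) v) v \<and> inner ((X $ i) v) v \<le> M * (norm v)^2" by blast
    have "m \<in> Is i" "M \<in> Is i" using mM sp by auto
    with mM show "\<exists>m M. m \<in> Is i \<and> M \<in> Is i \<and> m \<le> M \<and> (\<forall>v. m * (norm v)^2 \<le> inner ((X $ i) v) v \<and> inner ((X $ i) v) v \<le> M * (norm v)^2)"
      by blast
  qed
  then obtain m M where "\<And>i. m i \<in> Is i \<and> M i \<in> Is i \<and> m i \<le> M i \<and> (\<forall>v. m i * (norm v)^2 \<le> inner ((X $ i) v) v \<and> inner ((X $ i) v) v \<le> M i * (norm v)^2)"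
    by metis
  then show ?thesis by (intro exI[of _ "\<chi> i. m i"] exI[of _ "\<chi> i. M i"]) simp
qed

text \<open>Minima and maxima of the individual bounds stay in the intervals and bound the forms of
  both tuples. Forms are affine in the tuple, so convex combinations obey the same bounds, and their
  spectra are controlled through the forms.\<close>

lemma sa_tuples_pair:
  fixes X Y :: "('h::complex_hilbert_space op)^'n::finite"
  assumes As: "\<And>i. cstar_algebra (As i)" and Is: "\<And>i. is_interval (Is i)"
    and comm: "\<And>i j a b. i \<noteq> j \<Longrightarrow> a \<in> As i \<Longrightarrow> b \<in> As j \<Longrightarrow> a o\<^sub>L b = b o\<^sub>L a"
    and X: "X \<in> sa_tuples As Is" and Y: "Y \<in> sa_tuples As Is" and ne: "\<exists>v::'h. v \<noteq> 0"
  shows "\<exists>m M. cbox m M \<subseteq> cube Is \<and> comm_tuple (($) X) m M \<and> comm_tuple (($) Y) m M \<and>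
    (\<forall>u v. 0 \<le> u \<longrightarrow> 0 \<le> v \<longrightarrow> u + v = 1 \<longrightarrow> comm_tuple (($) (u *\<^sub>R X + v *\<^sub>R Y)) m M \<and>
       u *\<^sub>R X + v *\<^sub>R Y \<in> sa_tuples As Is)"
proof -
  obtain m1 M1 where 1: "\<And>i. m1 $ i \<in> Is i \<and> M1 $ i \<in> Is i \<and> m1 $ i \<le> M1 $ i"
    "\<And>i v. m1 $ i * (norm v)^2 \<le> inner ((X $ i) v) v \<and> inner ((X $ i) v) v \<le> M1 $ i * (norm v)^2"
    using sa_tuples_bounds[OF X ne] by blast
  obtain m2 M2 where 2: "\<And>i. m2 $ i \<in> Is i \<and> M2 $ i \<in> Is i \<and> m2 $ i \<le> M2 $ i"
    "\<And>i v. m2 $ i * (norm v)^2 \<le> inner ((Y $ i) v) v \<and> inner ((Y $ i) v) v \<le> M2 $ i * (norm v)^2"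
    using sa_tuples_bounds[OF Y ne] by blast
  define m where "m = (\<chi> i. min (m1 $ i) (m2 $ i))"
  define M where "M = (\<chi> i. max (M1 $ i) (M2 $ i))"
  have mI: "m $ i \<in> Is i" "M $ i \<in> Is i" and mM: "m $ i \<le> M $ i" for i
    using 1(1)[of i] 2(1)[of i] by (auto simp: m_def M_def min_def max_def)
  have IsI: "t \<in> Is i" if "m $ i \<le> t" "t \<le> M $ i" for t i
    using Is[of i] mI[of i] that unfolding is_interval_1 by blast
  have sub: "cbox m M \<subseteq> cube Is" using IsI by (auto simp: cube_def mem_box_cart)
  have ms: "m $ i * (norm v)^2 \<le> m1 $ i * (norm v)^2" "m $ i * (norm v)^2 \<le> m2 $ i * (norm v)^2"
    "M1 $ i * (norm v)^2 \<le> M $ i * (norm v)^2" "M2 $ i * (norm v)^2 \<le> M $ i * (norm v)^2" for i and v :: 'h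
    by (auto simp: m_def M_def intro!: mult_right_mono)
  have bX: "m $ i * (norm v)^2 \<le> inner ((X $ i) v) v" "inner ((X $ i) v) v \<le> M $ i * (norm v)^2" for i v
    using 1(2)[where i = i and v = v] ms[of i v] by linarith+
  have bY: "m $ i * (norm v)^2 \<le> inner ((Y $ i) v) v" "inner ((Y $ i) v) v \<le> M $ i * (norm v)^2" for i v
    using 2(2)[where i = i and v = v] ms[of i v] by linarith+
  have XA: "X $ i \<in> As i" "selfadjoint (X $ i)" and YA: "Y $ i \<in> As i" "selfadjoint (Y $ i)" for i
    using X Y by (auto simp: sa_tuples_def)
  have ct: "comm_tuple (($) Z) m M"
    if Z: "\<And>i. Z $ i \<in> As i" "\<And>i. selfadjoint (Z $ i)"
      "\<And>i v. m $ i * (norm v)^2 \<le> inner ((Z $ i) v) v" "\<And>i v. inner ((Z $ i) v) v \<le> M $ i * (norm v)^2" for Z :: "('h op)^'n"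
  proof
    fix i j show "Z $ i o\<^sub>L Z $ j = Z $ j o\<^sub>L Z $ i" using comm[of i j] Z(1) by (cases "i = j") auto
  qed (use Z mM in auto)
  have "comm_tuple (($) (u *\<^sub>R X + v *\<^sub>R Y)) m M \<and> u *\<^sub>R X + v *\<^sub>R Y \<in> sa_tuples As Is"
    if uv: "0 \<le> u" "0 \<le> v" "u + v = 1" for u v
  proof -
    let ?Z = "u *\<^sub>R X + v *\<^sub>R Y"
    have ZA: "?Z $ i \<in> As i" "selfadjoint (?Z $ i)" for i
      using XA YA cstar_algebraD[OF As] by auto
    have v1: "v = 1 - u" using uv by simp
    have bZ: "m $ i * (norm w)^2 \<le> inner ((?Z $ i) w) w" "inner ((?Z $ i) w) w \<le> M $ i * (norm w)^2" for i w
    proof -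
      have e: "inner ((?Z $ i) w) w = u * inner ((X $ i) w) w + v * inner ((Y $ i) w) w"
        by (simp add: blinfun_linear inner_add)
      have "u * (m $ i * (norm w)^2) + v * (m $ i * (norm w)^2) \<le> inner ((?Z $ i) w) w"
        unfolding e by (intro add_mono mult_left_mono bX bY uv)
      moreover have "u * (m $ i * (norm w)^2) + v * (m $ i * (norm w)^2) = m $ i * (norm w)^2"
        using uv by (simp add: distrib_right[symmetric])
      moreover have "inner ((?Z $ i) w) w \<le> u * (M $ i * (norm w)^2) + v * (M $ i * (norm w)^2)"
        unfolding e by (intro add_mono mult_left_mono bX bY uv)
      moreover have "u * (M $ i * (norm w)^2) + v * (M $ i * (norm w)^2) = M $ i * (norm w)^2"
        using uv by (simp add: distrib_right[symmetric])
      ultimately show "m $ i * (norm w)^2 \<le> inner ((?Z $ i) w) w" "inner ((?Z $ i) w) w \<le> M $ i * (norm w)^2" by linarith+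
    qed
    have "spectrum (?Z $ i) \<subseteq> complex_of_real ` Is i" for i
    proof -
      have "{m $ i..M $ i} \<subseteq> Is i" using IsI[of i] by auto
      then show ?thesis using spectrum_subset_interval[OF ZA(2) mM bZ, of i] by blast
    qed
    then show ?thesis using ct[OF ZA bZ] ZA by (simp add: sa_tuples_def)
  qed
  then show ?thesis using sub ct[OF XA bX] ct[OF YA bY] by blast
qed

lemma convex_sa_tuples:
  fixes As :: "'n::finite \<Rightarrow> 'h::complex_hilbert_space op set"
  assumes As: "\<And>i. cstar_algebra (As i)" and Is: "\<And>i. is_interval (Is i)"
    and comm: "\<And>i j a b. i \<noteq> j \<Longrightarrow> a \<in> As i \<Longrightarrow> b \<in> As j \<Longrightarrow> a o\<^sub>L b = b o\<^sub>L a"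
    and ne: "\<exists>v::'h. v \<noteq> 0"
  shows "convex (sa_tuples As Is)"
  unfolding convex_def
proof (intro ballI allI impI)
  fix X Y and u v :: real assume X: "X \<in> sa_tuples As Is" and Y: "Y \<in> sa_tuples As Is" and uv: "0 \<le> u" "0 \<le> v" "u + v = 1"
  have "\<exists>m M. cbox m M \<subseteq> cube Is \<and> comm_tuple (($) X) m M \<and> comm_tuple (($) Y) m M \<and>
    (\<forall>u v. 0 \<le> u \<longrightarrow> 0 \<le> v \<longrightarrow> u + v = 1 \<longrightarrow> comm_tuple (($) (u *\<^sub>R X + v *\<^sub>R Y)) m M \<and>
       u *\<^sub>R X + v *\<^sub>R Y \<in> sa_tuples As Is)"
    by (rule sa_tuples_pair[where As = As and Is = Is]) (fact As Is comm X Y ne)+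
  then show "u *\<^sub>R X + v *\<^sub>R Y \<in> sa_tuples As Is" using uv by blast
qed

section \<open>The scalar convexity inequality\<close>

locale ell_fun =
  fixes I :: "real set" and e e' e'' l :: "real \<Rightarrow> real"
  assumes I: "is_interval I" and cont_e: "continuous_on I e" and mono_e: "strict_mono_on I e"
    and e': "t \<in> interior I \<Longrightarrow> (e has_real_derivative e' t) (at t)"
    and e'': "t \<in> interior I \<Longrightarrow> (e' has_real_derivative e'' t) (at t)"
    and e''_pos: "t \<in> interior I \<Longrightarrow> e'' t > 0"
    and l_e: "t \<in> I \<Longrightarrow> l (e t) = t"
begin

abbreviation "J \<equiv> e ` I"
abbreviation "D \<equiv> interior J"
abbreviation "q \<equiv> (\<lambda>t. deriv l t / deriv (deriv l) t)"

lemma e_less_iff: "s \<in> I \<Longrightarrow> t \<in> I \<Longrightarrow> e s < e t \<longleftrightarrow> s < t"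
  using mono_e by (metis less_asym' linorder_neqE strict_mono_onD)

lemma e_le_iff: "s \<in> I \<Longrightarrow> t \<in> I \<Longrightarrow> e s \<le> e t \<longleftrightarrow> s \<le> t"
  using e_less_iff by (meson linorder_not_less)

lemma e_l: "y \<in> J \<Longrightarrow> e (l y) = y" and l_in: "y \<in> J \<Longrightarrow> l y \<in> I"
  using l_e by auto

lemma l_le_iff: "x \<in> J \<Longrightarrow> y \<in> J \<Longrightarrow> l x \<le> l y \<longleftrightarrow> x \<le> y"
  using e_le_iff l_e by auto

lemma interval_J: "is_interval J"
  using connected_continuous_image[OF cont_e] I by (simp add: is_interval_connected_1)

lemma convex_I: "convex I" and convex_J: "convex J"
  using I interval_J by (auto intro: is_interval_convex)

lemma J_mem: "a \<in> J \<Longrightarrow> b \<in> J \<Longrightarrow> a \<le> y \<Longrightarrow> y \<le> b \<Longrightarrow> y \<in> J"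
  using interval_J unfolding is_interval_1 by blast

lemma I_mem: "a \<in> I \<Longrightarrow> b \<in> I \<Longrightarrow> a \<le> y \<Longrightarrow> y \<le> b \<Longrightarrow> y \<in> I"
  using I unfolding is_interval_1 by blast

lemma continuous_l: "continuous_on J l"
proof -
  have inj: "inj_on e I" using l_e by (metis inj_onI)
  have "path_connected I" using convex_I by (rule convex_imp_path_connected)
  then obtain g where g: "homeomorphism I J e g" using homeomorphism_into_1d[OF _ cont_e refl inj] by blast
  then have "continuous_on J g" by (simp add: homeomorphism_def)
  moreover have "g y = l y" if "y \<in> J" for y using that g l_e by (auto simp: homeomorphism_def)
  ultimately show ?thesis by (simp cong: continuous_on_cong)
qed

lemma int_I: "t \<in> interior I \<Longrightarrow> t \<in> I"
  using interior_subset by blast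

lemma interior_I_less:
  assumes t: "t \<in> interior I"
  obtains a b where "a < t" "t < b" "{a..b} \<subseteq> interior I"
proof -
  obtain d where d: "0 < d" "cball t d \<subseteq> interior I"
    using open_contains_cball[of "interior I"] t by blast
  then show ?thesis using that[of "t - d" "t + d"] by (simp add: cball_eq_atLeastAtMost)
qed

text \<open>Strict monotonicity of \<open>e\<close> yields only \<open>0 \<le> e'\<close>; as
  \<open>e'' > 0\<close> makes \<open>e'\<close> strictly increasing, comparison with a smaller
  interior point gives strictness.\<close>

lemma e'_pos:
  assumes t: "t \<in> interior I"
  shows "0 < e' t"
proof -
  have nonneg: "0 \<le> e' s" if s: "s \<in> interior I" for s
  proof (rule ccontr)
    assume "\<not> 0 \<le> e' s"
    then obtain d where d: "0 < d" "\<And>h. 0 < h \<Longrightarrow> h < d \<Longrightarrow> e (s + h) < e s"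
      using DERIV_neg_dec_right[OF e'[OF s]] by force
    obtain a b where ab: "a < s" "s < b" "{a..b} \<subseteq> interior I" using interior_I_less[OF s] .
    define h where "h = min (d / 2) (b - s)"
    have h: "0 < h" "h < d" "s + h \<le> b" using d ab by (auto simp: h_def min_def)
    then have "s + h \<in> I" "s \<in> I" using ab by (auto intro!: int_I)
    then have "e s < e (s + h)" using h by (simp add: e_less_iff)
    then show False using d(2)[OF h(1,2)] by simp
  qed
  obtain a b where ab: "a < t" "t < b" "{a..b} \<subseteq> interior I" using interior_I_less[OF t] .
  have "e' a < e' t"
  proof (rule DERIV_pos_imp_increasing[OF ab(1)])
    fix x assume "a \<le> x" "x \<le> t"
    then have "x \<in> interior I" using ab by auto
    then show "\<exists>y. DERIV e' x :> y \<and> 0 < y" using e'' e''_pos by blast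
  qed
  moreover have "a \<in> {a..b}" using ab by simp
  then have "0 \<le> e' a" using nonneg[of a] ab(3) by blast
  ultimately show ?thesis by linarith
qed

lemma D_eq: "D = e ` interior I"
proof
  show "D \<subseteq> e ` interior I"
  proof
    fix y assume "y \<in> D"
    then obtain d where d: "0 < d" "cball y d \<subseteq> J" by (meson mem_interior_cball)
    then have yJ: "y - d \<in> J" "y + d \<in> J" "y \<in> J" by (auto simp: subset_iff dist_real_def)
    have "l (y - d) < l y" "l y < l (y + d)" using l_le_iff yJ d(1) by (meson linorder_not_less less_add_same_cancel1 diff_less_eq)+
    then have "l y \<in> {l (y - d)<..<l (y + d)}" by simp
    moreover have "{l (y - d)<..<l (y + d)} \<subseteq> I"
    proof
      fix z assume "z \<in> {l (y - d)<..<l (y + d)}"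
      then show "z \<in> I" by (auto intro: I_mem[OF l_in[OF yJ(1)] l_in[OF yJ(2)]])
    qed
    ultimately have "l y \<in> interior I" by (meson interior_maximal open_greaterThanLessThan subsetD)
    then show "y \<in> e ` interior I" using e_l[OF yJ(3)] by (metis imageI)
  qed
  show "e ` interior I \<subseteq> D"
  proof
    fix y assume "y \<in> e ` interior I"
    then obtain t where t: "t \<in> interior I" "y = e t" by blast
    obtain a b where ab: "a < t" "t < b" "{a..b} \<subseteq> interior I" using interior_I_less[OF t(1)] .
    have abI: "a \<in> I" "b \<in> I" "t \<in> I" using ab by (auto intro!: int_I)
    have "y \<in> {e a<..<e b}" using ab abI t by (simp add: e_less_iff)
    moreover have "{e a<..<e b} \<subseteq> J"
    proof
      fix z assume z: "z \<in> {e a<..<e b}"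
      show "z \<in> J" by (rule J_mem[of "e a" "e b"]) (use abI z in auto)
    qed
    ultimately show "y \<in> D" by (meson interior_maximal open_greaterThanLessThan subsetD)
  qed
qed

lemma l_D: "y \<in> D \<Longrightarrow> l y \<in> interior I" "y \<in> D \<Longrightarrow> e (l y) = y"
  using D_eq l_e by (auto simp: int_I)

lemma DERIV_l:
  assumes y: "y \<in> D"
  shows "(l has_real_derivative 1 / e' (l y)) (at y)"
proof -
  obtain d where d: "0 < d" "ball y d \<subseteq> D" by (meson y open_contains_ball open_interior)
  have "DERIV l y :> inverse (e' (l y))"
  proof (rule DERIV_inverse_function[where f = e])
    show "DERIV e (l y) :> e' (l y)" "e' (l y) \<noteq> 0" using e'[OF l_D(1)[OF y]] e'_pos[OF l_D(1)[OF y]] by auto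
    show "y - d < y" "y < y + d" using d by auto
    show "e (l z) = z" if "y - d < z" "z < y + d" for z
      using l_D(2)[of z] d that by (auto simp: subset_iff dist_real_def)
    show "isCont l y"
      using continuous_l y by (meson continuous_on_interior)
  qed
  then show ?thesis by (simp add: inverse_eq_divide)
qed

text \<open>At the point \<open>e t\<close> one has \<open>l' = 1 / e'\<close> and
  \<open>l'' = - e'' / e'^3\<close>.\<close>

lemma q_e:
  assumes t: "t \<in> interior I"
  shows "- q (e t) = (e' t)^2 / e'' t"
proof -
  let ?y = "e t"
  have y: "?y \<in> D" using t D_eq by blast
  have ly: "l ?y = t" using l_e[OF int_I[OF t]] .
  have d1: "deriv l z = 1 / e' (l z)" if "z \<in> D" for z by (rule DERIV_imp_deriv[OF DERIV_l[OF that]])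
  have "((\<lambda>z. 1 / e' (l z)) has_real_derivative - (e'' t * (1 / e' t)) / (e' t)^2) (at ?y)"
    using e'_pos[OF t] e''[OF t] DERIV_l[OF y]
    by (auto intro!: derivative_eq_intros DERIV_chain2[of e' _ l] simp: ly power2_eq_square)
  then have "(deriv l has_real_derivative - (e'' t * (1 / e' t)) / (e' t)^2) (at ?y)"
    by (rule has_field_derivative_transform_within_open[OF _ open_interior y]) (simp add: d1)
  then have "deriv (deriv l) ?y = - (e'' t * (1 / e' t)) / (e' t)^2" by (rule DERIV_imp_deriv)
  then show ?thesis using e'_pos[OF t] e''_pos[OF t] by (simp add: d1[OF y] ly power2_eq_square)
qed

text \<open>With \<open>\<Phi> = l o \<phi>\<close> along the segment, nonnegativity of the second
  derivative is \<open>\<phi>1^2 * e''(\<Phi>) \<le> \<phi>2 * e'(\<Phi>)^2\<close>, that is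
  \<open>\<phi>1^2 \<le> \<phi>2 * (- q(\<phi>))\<close>. The weights enter only through
  \<open>H1\<close> and \<open>H2\<close>, so probability weights and the homogeneous case are
  covered together.\<close>

lemma ell_convex_interior:
  fixes w s t :: "'k \<Rightarrow> real"
  assumes fin: "finite S" and w: "\<And>k. k \<in> S \<Longrightarrow> 0 < w k"
    and H1: "\<And>y. (\<And>k. k \<in> S \<Longrightarrow> y k \<in> D) \<Longrightarrow> (\<Sum>k\<in>S. w k * y k) \<in> D"
    and H2: "\<And>y. (\<And>k. k \<in> S \<Longrightarrow> y k \<in> D) \<Longrightarrow> q (\<Sum>k\<in>S. w k * y k) \<le> (\<Sum>k\<in>S. w k * q (y k))"
    and s: "\<And>k. k \<in> S \<Longrightarrow> s k \<in> interior I" and t: "\<And>k. k \<in> S \<Longrightarrow> t k \<in> interior I"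
    and uv: "0 \<le> u" "0 \<le> v" "u + v = 1"
  shows "l (\<Sum>k\<in>S. w k * e (u * s k + v * t k)) \<le> u * l (\<Sum>k\<in>S. w k * e (s k)) + v * l (\<Sum>k\<in>S. w k * e (t k))"
proof -
  define p where "p k \<theta> = s k + \<theta> * (t k - s k)" for k and \<theta> :: real
  define \<phi> where "\<phi> \<theta> = (\<Sum>k\<in>S. w k * e (p k \<theta>))" for \<theta>
  define \<phi>1 where "\<phi>1 \<theta> = (\<Sum>k\<in>S. w k * (e' (p k \<theta>) * (t k - s k)))" for \<theta>
  define \<phi>2 where "\<phi>2 \<theta> = (\<Sum>k\<in>S. w k * (e'' (p k \<theta>) * (t k - s k) * (t k - s k)))" for \<theta>
  have pI: "p k \<theta> \<in> interior I" if "k \<in> S" "\<theta> \<in> {0..1}" for k \<theta>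
  proof -
    have "(1 - \<theta>) *\<^sub>R s k + \<theta> *\<^sub>R t k \<in> interior I"
      by (rule convexD[OF convex_interior[OF convex_I] s[OF that(1)] t[OF that(1)]]) (use that in auto)
    then show ?thesis by (simp add: p_def algebra_simps)
  qed
  have dp: "(p k has_real_derivative t k - s k) (at \<theta>)" for k \<theta>
    unfolding p_def by (auto intro!: derivative_eq_intros)
  have d\<phi>: "(\<phi> has_real_derivative \<phi>1 \<theta>) (at \<theta>)" if "\<theta> \<in> {0..1}" for \<theta>
    unfolding \<phi>_def \<phi>1_def by (intro DERIV_sum DERIV_cmult DERIV_chain2[OF e'[OF pI] dp] that)
  have d\<phi>1: "(\<phi>1 has_real_derivative \<phi>2 \<theta>) (at \<theta>)" if "\<theta> \<in> {0..1}" for \<theta>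
    unfolding \<phi>1_def \<phi>2_def by (intro DERIV_sum DERIV_cmult DERIV_cmult_right DERIV_chain2[OF e''[OF pI] dp] that)
  have \<phi>D: "\<phi> \<theta> \<in> D" if "\<theta> \<in> {0..1}" for \<theta>
    unfolding \<phi>_def by (rule H1) (use pI that D_eq in auto)
  define \<Phi> where "\<Phi> \<theta> = l (\<phi> \<theta>)" for \<theta>
  define \<Phi>1 where "\<Phi>1 \<theta> = \<phi>1 \<theta> / e' (\<Phi> \<theta>)" for \<theta>
  define \<Phi>2 where "\<Phi>2 \<theta> = (\<phi>2 \<theta> * e' (\<Phi> \<theta>) - \<phi>1 \<theta> * (e'' (\<Phi> \<theta>) * \<Phi>1 \<theta>)) / (e' (\<Phi> \<theta>) * e' (\<Phi> \<theta>))" for \<theta>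
  have \<Phi>I: "\<Phi> \<theta> \<in> interior I" if "\<theta> \<in> {0..1}" for \<theta>
    unfolding \<Phi>_def by (rule l_D(1)[OF \<phi>D[OF that]])
  have d\<Phi>: "(\<Phi> has_real_derivative \<Phi>1 \<theta>) (at \<theta>)" if "\<theta> \<in> {0..1}" for \<theta>
    using DERIV_chain2[OF DERIV_l[OF \<phi>D[OF that]] d\<phi>[OF that]]
    by (simp add: \<Phi>_def[abs_def] \<Phi>1_def)
  have d\<Phi>1: "(\<Phi>1 has_real_derivative \<Phi>2 \<theta>) (at \<theta>)" if th: "\<theta> \<in> {0..1}" for \<theta>
  proof -
    have "((\<lambda>\<theta>. \<phi>1 \<theta> / e' (\<Phi> \<theta>)) has_real_derivative \<Phi>2 \<theta>) (at \<theta>)"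
      unfolding \<Phi>2_def
      by (rule DERIV_divide[OF d\<phi>1[OF th] DERIV_chain2[OF e''[OF \<Phi>I[OF th]] d\<Phi>[OF th]]])
        (use e'_pos[OF \<Phi>I[OF th]] in simp)
    moreover have "\<Phi>1 = (\<lambda>\<theta>. \<phi>1 \<theta> / e' (\<Phi> \<theta>))" by (simp add: fun_eq_iff \<Phi>1_def)
    ultimately show ?thesis by simp
  qed
  have pos: "0 \<le> \<Phi>2 \<theta>" if th: "\<theta> \<in> {0..1}" for \<theta>
  proof -
    let ?E1 = "e' (\<Phi> \<theta>)" and ?E2 = "e'' (\<Phi> \<theta>)"
    have E: "0 < ?E1" "0 < ?E2" using e'_pos e''_pos \<Phi>I[OF th] by auto
    have \<phi>2: "0 \<le> \<phi>2 \<theta>"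
      unfolding \<phi>2_def using w pI[OF _ th] e''_pos
      by (intro sum_nonneg) (simp add: mult.assoc less_imp_le mult_nonneg_nonneg)
    \<comment> \<open>The splitting of \<open>w k\<close> is dictated by the two sums wanted from
      Cauchy-Schwarz: the squares of \<open>?a\<close> add up to \<open>\<phi>2 \<theta>\<close>,
      those of \<open>?b\<close> to the weighted sum of the values of \<open>- q\<close>.\<close>
    let ?a = "\<lambda>k. sqrt (w k * e'' (p k \<theta>)) * (t k - s k)" and ?b = "\<lambda>k. sqrt (w k / e'' (p k \<theta>)) * e' (p k \<theta>)"
    have "\<phi>1 \<theta> = (\<Sum>k\<in>S. ?a k * ?b k)"
      unfolding \<phi>1_def
    proof (rule sum.cong[OF refl])
      fix k assume k: "k \<in> S"
      have p: "0 < e'' (p k \<theta>)" "0 < w k" using e''_pos pI[OF k th] w[OF k] by auto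
      have "sqrt (w k * e'' (p k \<theta>)) * sqrt (w k / e'' (p k \<theta>)) = sqrt ((w k)^2)"
        using p by (simp add: real_sqrt_mult[symmetric] power2_eq_square)
      then have "sqrt (w k * e'' (p k \<theta>)) * sqrt (w k / e'' (p k \<theta>)) = w k" using p by simp
      then show "w k * (e' (p k \<theta>) * (t k - s k)) = ?a k * ?b k" by (simp add: mult_ac)
    qed
    then have "(\<phi>1 \<theta>)^2 \<le> (\<Sum>k\<in>S. (?a k)^2) * (\<Sum>k\<in>S. (?b k)^2)" by (simp add: Cauchy_Schwarz_ineq_sum)
    also have "(\<Sum>k\<in>S. (?a k)^2) = \<phi>2 \<theta>"
      unfolding \<phi>2_def using w pI[OF _ th] e''_pos
      by (intro sum.cong refl) (simp add: power_mult_distrib less_imp_le power2_eq_square)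
    also have "(\<Sum>k\<in>S. (?b k)^2) = - (\<Sum>k\<in>S. w k * q (e (p k \<theta>)))"
      unfolding sum_negf[symmetric]
    proof (rule sum.cong[OF refl])
      fix k assume k: "k \<in> S"
      have p: "0 < e'' (p k \<theta>)" "0 < w k" using e''_pos pI[OF k th] w[OF k] by auto
      have "(?b k)^2 = w k * ((e' (p k \<theta>))^2 / e'' (p k \<theta>))" using p by (simp add: power_mult_distrib)
      also have "\<dots> = w k * (- q (e (p k \<theta>)))" by (simp only: q_e[OF pI[OF k th]])
      finally show "(?b k)^2 = - (w k * q (e (p k \<theta>)))" by simp
    qed
    also have "- (\<Sum>k\<in>S. w k * q (e (p k \<theta>))) \<le> - q (\<phi> \<theta>)"
      unfolding \<phi>_def using H2[of "\<lambda>k. e (p k \<theta>)"] pI[OF _ th] D_eq by auto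
    also have "- q (\<phi> \<theta>) = ?E1^2 / ?E2"
      using q_e[OF \<Phi>I[OF th]] l_D(2)[OF \<phi>D[OF th]] by (simp only: \<Phi>_def)
    finally have "(\<phi>1 \<theta>)^2 \<le> \<phi>2 \<theta> * (?E1^2 / ?E2)" using \<phi>2 by (simp add: mult_left_mono)
    then have "(\<phi>1 \<theta>)^2 * ?E2 \<le> \<phi>2 \<theta> * ?E1^2" using E by (simp add: pos_le_divide_eq)
    then have "\<phi>1 \<theta> * (?E2 * \<phi>1 \<theta>) / ?E1 \<le> \<phi>2 \<theta> * ?E1" using E by (simp add: pos_divide_le_eq power2_eq_square mult_ac)
    then have "0 \<le> \<phi>2 \<theta> * ?E1 - \<phi>1 \<theta> * (?E2 * \<Phi>1 \<theta>)" by (simp add: \<Phi>1_def)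
    then show ?thesis unfolding \<Phi>2_def using E by simp
  qed
  have "convex_on {0..1} \<Phi>"
    by (rule f''_ge0_imp_convex[where f' = \<Phi>1 and f'' = \<Phi>2]) (use d\<Phi> d\<Phi>1 pos in auto)
  then have "\<Phi> (u *\<^sub>R 0 + v *\<^sub>R 1) \<le> u * \<Phi> 0 + v * \<Phi> 1"
    by (rule convex_on_def[THEN iffD1, THEN conjunct2, rule_format]) (use uv in auto)
  moreover have "p k v = u * s k + v * t k" for k
  proof -
    have u: "u = 1 - v" using uv by simp
    show ?thesis unfolding p_def u by (simp add: algebra_simps)
  qed
  ultimately show ?thesis by (simp add: \<Phi>_def \<phi>_def p_def[of _ 0] p_def[of _ 1])
qed

text \<open>Derivatives exist in the interior only, so all points are moved towards an interior
  point \<open>c\<close> and a limit is taken; \<open>H3\<close> keeps the limit in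
  \<open>J\<close>, where \<open>l\<close> is continuous. If the interior is empty, \<open>I\<close>
  has at most one point.\<close>

lemma ell_convex:
  fixes w s t :: "'k \<Rightarrow> real"
  assumes fin: "finite S" and w: "\<And>k. k \<in> S \<Longrightarrow> 0 < w k"
    and H1: "\<And>y. (\<And>k. k \<in> S \<Longrightarrow> y k \<in> D) \<Longrightarrow> (\<Sum>k\<in>S. w k * y k) \<in> D"
    and H2: "\<And>y. (\<And>k. k \<in> S \<Longrightarrow> y k \<in> D) \<Longrightarrow> q (\<Sum>k\<in>S. w k * y k) \<le> (\<Sum>k\<in>S. w k * q (y k))"
    and H3: "\<And>y. (\<And>k. k \<in> S \<Longrightarrow> y k \<in> J) \<Longrightarrow> (\<Sum>k\<in>S. w k * y k) \<in> J"
    and s: "\<And>k. k \<in> S \<Longrightarrow> s k \<in> I" and t: "\<And>k. k \<in> S \<Longrightarrow> t k \<in> I"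
    and uv: "0 \<le> u" "0 \<le> v" "u + v = 1"
  shows "l (\<Sum>k\<in>S. w k * e (u * s k + v * t k)) \<le> u * l (\<Sum>k\<in>S. w k * e (s k)) + v * l (\<Sum>k\<in>S. w k * e (t k))"
proof (cases "interior I = {}")
  case True
  have "s k = t k" if k: "k \<in> S" for k
  proof (rule ccontr)
    assume "s k \<noteq> t k"
    then have "{min (s k) (t k)<..<max (s k) (t k)} \<noteq> {}" by (simp add: min_def max_def)
    moreover have "{min (s k) (t k)<..<max (s k) (t k)} \<subseteq> I"
    proof
      fix z assume z: "z \<in> {min (s k) (t k)<..<max (s k) (t k)}"
      show "z \<in> I" by (rule I_mem[of "min (s k) (t k)" "max (s k) (t k)"]) (use s[OF k] t[OF k] z in \<open>auto simp: min_def max_def\<close>)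
    qed
    ultimately show False using True interior_maximal[OF _ open_greaterThanLessThan, of "min (s k) (t k)" "max (s k) (t k)" I] by simp
  qed
  then have st: "s k = t k" if "k \<in> S" for k using that .
  have ut: "u * y + v * y = y" for y using uv by (simp add: distrib_right[symmetric])
  have "(\<Sum>k\<in>S. w k * e (u * s k + v * t k)) = (\<Sum>k\<in>S. w k * e (t k))"
    by (rule sum.cong[OF refl]) (simp only: st ut)
  moreover have "(\<Sum>k\<in>S. w k * e (s k)) = (\<Sum>k\<in>S. w k * e (t k))"
    by (rule sum.cong[OF refl]) (simp only: st)
  ultimately show ?thesis by (simp only: ut)
next
  case False
  then obtain c where c: "c \<in> interior I" by blast
  define \<epsilon> where "\<epsilon> n = inverse (real (Suc n))" for n
  have eps: "0 < \<epsilon> n" "\<epsilon> n \<le> 1" for n by (auto simp: \<epsilon>_def inverse_le_1_iff)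
  have eps0: "\<epsilon> \<longlonglongrightarrow> 0" unfolding \<epsilon>_def[abs_def] by (rule LIMSEQ_inverse_real_of_nat)
  \<comment> \<open>The same affine map for all points, so it commutes with convex
    combinations.\<close>
  define sh where "sh y n = y - \<epsilon> n * (y - c)" for y n
  have shI: "sh y n \<in> interior I" if "y \<in> I" for y n
    using mem_interior_convex_shrink[OF convex_I c that eps, of n] by (simp add: sh_def)
  have shI': "sh y n \<in> I" if "y \<in> I" for y n using shI[OF that] interior_subset by blast
  have shlim: "(\<lambda>n. sh y n) \<longlonglongrightarrow> y" for y
  proof -
    have "(\<lambda>n. y - \<epsilon> n * (y - c)) \<longlonglongrightarrow> y - 0 * (y - c)" by (intro tendsto_intros eps0)
    then show ?thesis by (simp add: sh_def)
  qed
  have sh_comb: "u * sh a n + v * sh b n = sh (u * a + v * b) n" for a b n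
  proof -
    have u: "u = 1 - v" using uv by simp
    show ?thesis unfolding sh_def u by (simp add: algebra_simps)
  qed
  have lim: "(\<lambda>n. l (\<Sum>k\<in>S. w k * e (sh (y k) n))) \<longlonglongrightarrow> l (\<Sum>k\<in>S. w k * e (y k))"
    if y: "\<And>k. k \<in> S \<Longrightarrow> y k \<in> I" for y
  proof (rule continuous_on_tendsto_compose[OF continuous_l])
    have "(\<lambda>n. e (sh (y k) n)) \<longlonglongrightarrow> e (y k)" if "k \<in> S" for k
      by (rule continuous_on_tendsto_compose[OF cont_e shlim]) (use y that shI' in auto)
    then show "(\<lambda>n. \<Sum>k\<in>S. w k * e (sh (y k) n)) \<longlonglongrightarrow> (\<Sum>k\<in>S. w k * e (y k))"
      by (intro tendsto_sum tendsto_mult tendsto_const)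
    show "(\<Sum>k\<in>S. w k * e (y k)) \<in> J" by (rule H3) (use y in auto)
    show "\<forall>\<^sub>F n in sequentially. (\<Sum>k\<in>S. w k * e (sh (y k) n)) \<in> J"
      by (rule always_eventually, rule allI, rule H3) (use y shI' in auto)
  qed
  have comb: "u * s k + v * t k \<in> I" if "k \<in> S" for k
    using convexD[OF convex_I s[OF that] t[OF that] uv] by simp
  show ?thesis
  proof (rule LIMSEQ_le)
    show "(\<lambda>n. l (\<Sum>k\<in>S. w k * e (sh (u * s k + v * t k) n))) \<longlonglongrightarrow> l (\<Sum>k\<in>S. w k * e (u * s k + v * t k))"
      by (rule lim[OF comb])
    show "(\<lambda>n. u * l (\<Sum>k\<in>S. w k * e (sh (s k) n)) + v * l (\<Sum>k\<in>S. w k * e (sh (t k) n)))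
      \<longlonglongrightarrow> u * l (\<Sum>k\<in>S. w k * e (s k)) + v * l (\<Sum>k\<in>S. w k * e (t k))"
      by (intro tendsto_intros lim s t)
    show "\<exists>N. \<forall>n\<ge>N. l (\<Sum>k\<in>S. w k * e (sh (u * s k + v * t k) n))
      \<le> u * l (\<Sum>k\<in>S. w k * e (sh (s k) n)) + v * l (\<Sum>k\<in>S. w k * e (sh (t k) n))"
      unfolding sh_comb[symmetric]
      by (intro exI allI impI ell_convex_interior fin w H1 H2 shI s t uv) auto
  qed
qed

end

section \<open>Traces and barycentres\<close>

text \<open>A point strictly below the graph is separated from the closed epigraph. The margin
  \<open>\<epsilon>\<close> excludes vertical hyperplanes also at boundary points of
  \<open>K\<close>, where an exact supporting affine function may fail to exist.\<close>

lemma affine_minorant: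
  fixes f :: "'a::euclidean_space \<Rightarrow> real"
  assumes K: "closed K" and f: "convex_on K f" "continuous_on K f" and a: "a \<in> K" and \<epsilon>: "0 < \<epsilon>"
  shows "\<exists>\<alpha>0 \<alpha>. (\<forall>t\<in>K. \<alpha>0 + inner \<alpha> t \<le> f t) \<and> f a - \<epsilon> < \<alpha>0 + inner \<alpha> a"
proof -
  define Ep where "Ep = {p \<in> K \<times> (UNIV::real set). f (fst p) \<le> snd p}"
  have cv: "convex Ep"
  proof (rule convexI)
    fix p q :: "'a \<times> real" and u v :: real
    assume pq: "p \<in> Ep" "q \<in> Ep" and uv: "0 \<le> u" "0 \<le> v" "u + v = 1"
    have "f (u *\<^sub>R fst p + v *\<^sub>R fst q) \<le> u * f (fst p) + v * f (fst q)"
      using f(1) pq uv unfolding convex_on_def Ep_def by auto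
    also have "\<dots> \<le> u * snd p + v * snd q" using pq uv by (intro add_mono mult_left_mono) (auto simp: Ep_def)
    finally have "f (u *\<^sub>R fst p + v *\<^sub>R fst q) \<le> u * snd p + v * snd q" .
    moreover have "u *\<^sub>R fst p + v *\<^sub>R fst q \<in> K"
      using convexD[of K "fst p" "fst q" u v] f(1) pq uv by (auto simp: convex_on_def Ep_def)
    ultimately show "u *\<^sub>R p + v *\<^sub>R q \<in> Ep" by (simp add: Ep_def mem_Times_iff)
  qed
  have cl: "closed Ep"
    unfolding Ep_def
    by (intro continuous_on_closed_Collect_le closed_Times K closed_UNIV continuous_intros continuous_on_compose2[OF f(2)]) auto
  have "(a, f a - \<epsilon>) \<notin> Ep" using \<epsilon> by (simp add: Ep_def)
  from separating_hyperplane_closed_point[OF cv cl this] obtain P b where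
    P: "inner P (a, f a - \<epsilon>) < b" "\<And>p. p \<in> Ep \<Longrightarrow> b < inner P p" by blast
  obtain p s where ps: "P = (p, s)" by (cases P)
  have Pt: "b < inner p t + s * f t" if "t \<in> K" for t using P(2)[of "(t, f t)"] that by (simp add: ps Ep_def)
  have Pa: "inner p a + s * (f a - \<epsilon>) < b" using P(1) by (simp add: ps)
  have "0 < s * \<epsilon>" using Pt[OF a] Pa by (simp add: algebra_simps)
  then have s: "0 < s" using \<epsilon> by (simp add: zero_less_mult_iff)
  have e: "b / s + inner (- (1 / s) *\<^sub>R p) t = (b - inner p t) / s" for t using s by (simp add: field_simps)
  show ?thesis
  proof (intro exI conjI ballI)
    show "b / s + inner (- (1 / s) *\<^sub>R p) t \<le> f t" if "t \<in> K" for t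
      unfolding e using Pt[OF that] s by (simp add: field_simps)
    show "f a - \<epsilon> < b / s + inner (- (1 / s) *\<^sub>R p) a"
      unfolding e using Pa s by (simp add: field_simps)
  qed
qed

context comm_tuple begin

lemma cfc_affine:
  "cfc (\<lambda>t. \<alpha>0 + inner \<alpha> t) = \<alpha>0 *\<^sub>R id_blinfun + (\<Sum>i\<in>UNIV. (\<alpha> $ i) *\<^sub>R x i)"
proof -
  have c: "continuous_on K (\<lambda>t. t $ i)" for i by (intro continuous_intros)
  have "cfc (\<lambda>t. \<alpha>0 + (\<Sum>i\<in>UNIV. \<alpha> $ i * t $ i)) = \<alpha>0 *\<^sub>R id_blinfun + cfc (\<lambda>t. \<Sum>i\<in>UNIV. \<alpha> $ i * t $ i)"
    by (subst cfc_add) (auto intro!: continuous_intros)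
  also have "cfc (\<lambda>t. \<Sum>i\<in>UNIV. \<alpha> $ i * t $ i) = (\<Sum>i\<in>UNIV. (\<alpha> $ i) *\<^sub>R x i)"
    by (subst cfc_sum) (auto intro!: continuous_intros sum.cong simp: cfc_cmult[OF c])
  finally show ?thesis by (simp add: inner_vec_def)
qed

text \<open>The functions \<open>f / sqrt (f + d)\<close> converge uniformly to
  \<open>sqrt f\<close>, with error at most \<open>sqrt d\<close>, and each is a multiple of
  \<open>f\<close>; hence membership in \<open>A\<close> follows without a unit.\<close>

lemma cfc_sqrt_mem:
  assumes A: "cstar_algebra A" and x: "\<And>i. x i \<in> A" and f: "continuous_on K f" and f0: "\<And>t. t \<in> K \<Longrightarrow> 0 \<le> f t"
    and fA: "cfc f \<in> A"
  shows "cfc (\<lambda>t. sqrt (f t)) \<in> A"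
proof -
  define d where "d n = inverse (real (Suc n))" for n
  have d: "0 < d n" for n by (simp add: d_def)
  define g where "g n t = inverse (sqrt (f t + d n))" for n t
  have cg: "continuous_on K (g n)" for n
  proof -
    have "0 < f t + d n" if "t \<in> K" for t using f0[OF that] d[of n] by (rule add_nonneg_pos)
    then show ?thesis unfolding g_def by (intro continuous_intros f) force
  qed
  have cs: "continuous_on K (\<lambda>t. sqrt (f t))" by (intro continuous_intros f)
  have mem: "(cfc (g n) o\<^sub>L cfc f) \<in> A" for n by (rule cfc_ideal[OF A x cg fA])
  have "(\<lambda>n. cfc (g n) o\<^sub>L cfc f) \<longlonglongrightarrow> cfc (\<lambda>t. sqrt (f t))"
  proof (rule LIM_zero_cancel, rule Lim_null_comparison, rule always_eventually, rule allI)
    show "(\<lambda>n. sqrt (d n)) \<longlonglongrightarrow> 0"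
      using tendsto_real_sqrt[OF LIMSEQ_inverse_real_of_nat] by (simp add: d_def)
    fix n
    have "(cfc (g n) o\<^sub>L cfc f) - cfc (\<lambda>t. sqrt (f t)) = cfc (\<lambda>t. g n t * f t - sqrt (f t))"
      by (simp add: cfc_diff[OF continuous_on_mult[OF cg f] cs] cfc_mult[OF cg f])
    also have "norm \<dots> \<le> sqrt (d n)"
    proof (rule norm_cfc_le)
      show "continuous_on K (\<lambda>t. g n t * f t - sqrt (f t))" by (intro continuous_intros cg f)
      fix t assume t: "t \<in> K"
      define a where "a = sqrt (f t)"
      define b where "b = sqrt (f t + d n)"
      have a: "0 \<le> a" "a^2 = f t" using f0[OF t] by (auto simp: a_def)
      have b: "0 < b" "a \<le> b" "b \<le> a + sqrt (d n)"
        using f0[OF t] d[of n] sqrt_add_le_add_sqrt[of "f t" "d n"] by (auto simp: a_def b_def add_nonneg_pos)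
      have "g n t * f t - sqrt (f t) = a * (a - b) / b"
      proof -
        have 1: "g n t = inverse b" "sqrt (f t) = a" by (simp_all add: g_def b_def a_def)
        have 2: "f t = a * a" using a(2) by (simp add: power2_eq_square)
        show ?thesis unfolding 1 unfolding 2 using b(1) by (simp add: field_simps)
      qed
      then have "\<bar>g n t * f t - sqrt (f t)\<bar> = (a / b) * (b - a)" using a b by (simp add: abs_mult)
      also have "\<dots> \<le> 1 * (b - a)" using a b by (intro mult_right_mono) auto
      finally show "\<bar>g n t * f t - sqrt (f t)\<bar> \<le> sqrt (d n)" using b(3) by simp
    qed
    finally show "norm ((cfc (g n) o\<^sub>L cfc f) - cfc (\<lambda>t. sqrt (f t))) \<le> sqrt (d n)" .
  qed
  then show ?thesis by (rule closed_sequentially[OF cstar_algebraD(5)[OF A] mem])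
qed

end

lemma positive_sqrt_exists:
  assumes A: "cstar_algebra A" and b: "b \<in> A" "positive_op (b :: 'h::complex_hilbert_space op)"
  shows "\<exists>d\<in>A. selfadjoint d \<and> (d o\<^sub>L d) = b"
proof -
  have bd: "inner (b v) v \<le> norm b * (norm v)^2" for v using inner_op_le_norm[of b v] by linarith
  interpret comm_tuple "\<lambda>_::unit. b" 0 "\<chi> i. norm b"
    by unfold_locales (use b bd in \<open>auto simp: positive_op_iff\<close>)
  have c: "continuous_on K (\<lambda>t. t $ ())" by (intro continuous_intros)
  have cs: "continuous_on K (\<lambda>t. sqrt (t $ ()))" by (intro continuous_intros)
  have p: "t \<in> K \<Longrightarrow> 0 \<le> t $ ()" for t by (simp add: mem_box_cart)
  have "cfc (\<lambda>t. sqrt (t $ ())) \<in> A" by (rule cfc_sqrt_mem[OF A _ c p]) (use b in auto)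
  moreover have "(cfc (\<lambda>t. sqrt (t $ ())) o\<^sub>L cfc (\<lambda>t. sqrt (t $ ()))) = cfc (\<lambda>t. t $ ())"
    unfolding cfc_mult[OF cs cs, symmetric] by (rule cfc_cong) (use p in auto)
  ultimately show ?thesis using cfc_selfadjoint[OF cs] by auto
qed

lemma positive_sandwich:
  fixes a c :: "'h::complex_hilbert_space op"
  assumes "selfadjoint c" "positive_op a"
  shows "positive_op (c o\<^sub>L (a o\<^sub>L c))"
proof -
  have "inner ((c o\<^sub>L (a o\<^sub>L c)) v) v = inner (a (c v)) (c v)" for v
    using selfadjointD(2)[OF assms(1)] by simp
  moreover have "selfadjoint (c o\<^sub>L (a o\<^sub>L c))"
    using assms by (auto simp: positive_op_iff selfadjoint_iff)
  ultimately show ?thesis using assms(2) by (simp add: positive_op_iff)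
qed

lemma adj_compose:
  fixes a c :: "'h::complex_hilbert_space op"
  assumes "selfadjoint a" "selfadjoint c"
  shows "adj (a o\<^sub>L c) = (c o\<^sub>L a)"
  by (rule adj_eqI) (use assms in \<open>auto simp: selfadjoint_iff\<close>)

section \<open>Traces: elements of finite trace, multipliers and compressions\<close>

locale trace_alg =
  fixes A :: "'h::complex_hilbert_space op set" and \<tau> :: "'h op \<Rightarrow> ennreal"
  assumes A: "cstar_algebra A" and tau: "trace_on A \<tau>"
begin

abbreviation "P \<equiv> positive_part A"

lemma P_iff: "a \<in> P \<longleftrightarrow> a \<in> A \<and> positive_op a" by (simp add: positive_part_def)

lemma P_add: "a \<in> P \<Longrightarrow> b \<in> P \<Longrightarrow> a + b \<in> P"
  by (auto simp: P_iff positive_op_iff blinfun_linear inner_add intro: cstar_algebraD[OF A])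

lemma P_scaleR: "a \<in> P \<Longrightarrow> 0 \<le> r \<Longrightarrow> r *\<^sub>R a \<in> P"
  by (auto simp: P_iff positive_op_iff blinfun_linear intro: cstar_algebraD[OF A])

lemma P_0: "0 \<in> P" by (simp add: P_iff positive_op_iff cstar_algebraD[OF A])

lemma tau_add: "a \<in> P \<Longrightarrow> b \<in> P \<Longrightarrow> \<tau> (a + b) = \<tau> a + \<tau> b"
  and tau_scaleR: "a \<in> P \<Longrightarrow> 0 \<le> r \<Longrightarrow> \<tau> (r *\<^sub>R a) = ennreal r * \<tau> a"
  and tau_adj: "a \<in> A \<Longrightarrow> \<tau> (adj a o\<^sub>L a) = \<tau> (a o\<^sub>L adj a)"
  using tau by (auto simp: trace_on_def)

lemma tau_0: "\<tau> 0 = 0" using tau_scaleR[OF P_0, of 0] by simp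

lemma P_sum: "(\<And>i. i \<in> J \<Longrightarrow> a i \<in> P) \<Longrightarrow> (\<Sum>i\<in>J. a i) \<in> P"
  by (induction J rule: infinite_finite_induct) (auto simp: P_0 intro: P_add)

lemma tau_sum:
  assumes "finite J" "\<And>i. i \<in> J \<Longrightarrow> a i \<in> P"
  shows "\<tau> (\<Sum>i\<in>J. a i) = (\<Sum>i\<in>J. \<tau> (a i))"
  using assms by (induction J rule: finite_induct) (auto simp: tau_0 tau_add P_sum)

lemma tau_mono:
  assumes a: "a \<in> P" and b: "b \<in> A" and ab: "positive_op (b - a)"
  shows "\<tau> a \<le> \<tau> b"
proof -
  have "b - a \<in> P" using a b ab by (auto simp: P_iff intro: cstar_algebraD[OF A])
  then have "\<tau> (a + (b - a)) = \<tau> a + \<tau> (b - a)" by (rule tau_add[OF a])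
  then show ?thesis by simp
qed

text \<open>The trace property for the element \<open>d c\<close>, whose adjoint is
  \<open>c d\<close>. It is the only form in which traciality enters.\<close>

lemma tau_swap:
  assumes c: "selfadjoint c" and d: "selfadjoint d" and m: "(d o\<^sub>L c) \<in> A"
  shows "\<tau> (c o\<^sub>L ((d o\<^sub>L d) o\<^sub>L c)) = \<tau> (d o\<^sub>L ((c o\<^sub>L c) o\<^sub>L d))"
proof -
  have "(c o\<^sub>L ((d o\<^sub>L d) o\<^sub>L c)) = ((c o\<^sub>L d) o\<^sub>L (d o\<^sub>L c))"
    "(d o\<^sub>L ((c o\<^sub>L c) o\<^sub>L d)) = ((d o\<^sub>L c) o\<^sub>L (c o\<^sub>L d))" by (rule blinfun_eqI, simp)+
  then show ?thesis using tau_adj[OF m] unfolding adj_compose[OF d c] by simp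
qed

text \<open>The set on which the description in \<open>trace_sa\<close> has a witness.\<close>

definition fd :: "'h op set" where
  "fd = {b - c | b c. b \<in> P \<and> c \<in> P \<and> \<tau> b < \<infinity> \<and> \<tau> c < \<infinity>}"

abbreviation "tr \<equiv> trace_sa A \<tau>"

lemma tr_diff:
  assumes "b \<in> P" "c \<in> P" "\<tau> b < \<infinity>" "\<tau> c < \<infinity>"
  shows "tr (b - c) = enn2real (\<tau> b) - enn2real (\<tau> c)"
  unfolding trace_sa_def
proof (rule the_equality)
  fix r assume "\<exists>b'\<in>P. \<exists>c'\<in>P. b - c = b' - c' \<and> \<tau> b' < \<infinity> \<and> \<tau> c' < \<infinity> \<and> r = enn2real (\<tau> b') - enn2real (\<tau> c')"
  then obtain b' c' where bc: "b' \<in> P" "c' \<in> P" "b - c = b' - c'" "\<tau> b' < \<infinity>" "\<tau> c' < \<infinity>"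
    and r: "r = enn2real (\<tau> b') - enn2real (\<tau> c')" by blast
  have "b + c' = b' + c" using bc(3) by (simp add: algebra_simps)
  then have "\<tau> b + \<tau> c' = \<tau> b' + \<tau> c" using assms bc by (metis tau_add)
  then have "enn2real (\<tau> b + \<tau> c') = enn2real (\<tau> b' + \<tau> c)" by simp
  then have "enn2real (\<tau> b) + enn2real (\<tau> c') = enn2real (\<tau> b') + enn2real (\<tau> c)"
    using assms bc by (simp add: enn2real_plus less_top)
  then show "r = enn2real (\<tau> b) - enn2real (\<tau> c)" by (simp add: r)
qed (use assms in blast)

lemma fdI: "b \<in> P \<Longrightarrow> c \<in> P \<Longrightarrow> \<tau> b < \<infinity> \<Longrightarrow> \<tau> c < \<infinity> \<Longrightarrow> b - c \<in> fd"
  unfolding fd_def by blast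

lemma fd_finite: "a \<in> P \<Longrightarrow> \<tau> a < \<infinity> \<Longrightarrow> a \<in> fd" "a \<in> P \<Longrightarrow> \<tau> a < \<infinity> \<Longrightarrow> tr a = enn2real (\<tau> a)"
  using fdI[of a 0] tr_diff[of a 0] P_0 tau_0 by auto

lemma fd_add:
  assumes "a \<in> fd" "a' \<in> fd"
  shows "a + a' \<in> fd" "tr (a + a') = tr a + tr a'"
proof -
  obtain b c b' c' where a: "a = b - c" "b \<in> P" "c \<in> P" "\<tau> b < \<infinity>" "\<tau> c < \<infinity>"
    and a': "a' = b' - c'" "b' \<in> P" "c' \<in> P" "\<tau> b' < \<infinity>" "\<tau> c' < \<infinity>"
    using assms unfolding fd_def by blast
  have e: "a + a' = (b + b') - (c + c')" by (simp add: a a')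
  have f: "\<tau> (b + b') < \<infinity>" "\<tau> (c + c') < \<infinity>" using a a' by (simp_all add: tau_add)
  show "a + a' \<in> fd" unfolding e by (rule fdI) (use a a' f in \<open>auto intro: P_add\<close>)
  show "tr (a + a') = tr a + tr a'"
    unfolding e tr_diff[OF P_add[OF a(2) a'(2)] P_add[OF a(3) a'(3)] f]
    using a a' by (simp add: tr_diff tau_add enn2real_plus less_top)
qed

lemma fd_scaleR:
  assumes "a \<in> fd"
  shows "r *\<^sub>R a \<in> fd" "tr (r *\<^sub>R a) = r * tr a"
proof -
  obtain b c where a: "a = b - c" "b \<in> P" "c \<in> P" "\<tau> b < \<infinity>" "\<tau> c < \<infinity>"
    using assms unfolding fd_def by blast
  have *: "s *\<^sub>R b \<in> P" "s *\<^sub>R c \<in> P" "\<tau> (s *\<^sub>R b) < \<infinity>" "\<tau> (s *\<^sub>R c) < \<infinity>" if "0 \<le> s" for s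
    using that a by (auto simp: P_scaleR tau_scaleR ennreal_mult_less_top)
  have "r *\<^sub>R a \<in> fd \<and> tr (r *\<^sub>R a) = r * tr a"
  proof (cases "0 \<le> r")
    case True
    have e: "r *\<^sub>R a = r *\<^sub>R b - r *\<^sub>R c" by (simp add: a scaleR_diff_right)
    show ?thesis unfolding e using fdI[OF *[OF True]] tr_diff[OF *[OF True]] tr_diff[OF a(2-5)] True a
      by (simp add: tau_scaleR enn2real_mult right_diff_distrib)
  next
    case False
    then have s: "0 \<le> - r" by simp
    have e: "r *\<^sub>R a = (- r) *\<^sub>R c - (- r) *\<^sub>R b" by (simp add: a scaleR_diff_right)
    show ?thesis unfolding e using fdI[OF *(2,1,4,3)[OF s]] tr_diff[OF *(2,1,4,3)[OF s]] tr_diff[OF a(2-5)] s a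
      by (simp add: tau_scaleR enn2real_mult right_diff_distrib del: scaleR_minus_left)
  qed
  then show "r *\<^sub>R a \<in> fd" "tr (r *\<^sub>R a) = r * tr a" by auto
qed

lemma fd_sum:
  assumes "finite J" "\<And>i. i \<in> J \<Longrightarrow> a i \<in> fd"
  shows "(\<Sum>i\<in>J. a i) \<in> fd \<and> tr (\<Sum>i\<in>J. a i) = (\<Sum>i\<in>J. tr (a i))"
  using assms by (induction J rule: finite_induct) (auto simp: fd_add fd_finite P_0 tau_0)

text \<open>
  Self-adjoint multipliers of \<open>A\<close>; they allow for the identity operator when \<open>A\<close> has no unit.
\<close>

definition mult :: "'h op \<Rightarrow> bool" where
  "mult T \<longleftrightarrow> selfadjoint T \<and> (\<forall>a\<in>A. (T o\<^sub>L a) \<in> A \<and> (a o\<^sub>L T) \<in> A)"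

lemma mult_mem: "T \<in> A \<Longrightarrow> selfadjoint T \<Longrightarrow> mult T"
  by (auto simp: mult_def intro: cstar_algebraD[OF A])

lemma mult_id: "mult id_blinfun"
proof -
  have "(id_blinfun o\<^sub>L a) = a" "(a o\<^sub>L id_blinfun) = a" for a :: "'h op" by (rule blinfun_eqI, simp)+
  then show ?thesis by (simp add: mult_def)
qed

lemma mult_add: "mult T \<Longrightarrow> mult U \<Longrightarrow> mult (T + U)"
  by (auto simp: mult_def blinfun_compose_linear intro: cstar_algebraD[OF A])

lemma mult_scaleR: "mult T \<Longrightarrow> mult (r *\<^sub>R T)"
  by (auto simp: mult_def blinfun_compose_linear intro: cstar_algebraD[OF A])

lemma mult_sum: "(\<And>i. i \<in> J \<Longrightarrow> mult (a i)) \<Longrightarrow> mult (\<Sum>i\<in>J. a i)"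
proof (induction J rule: infinite_finite_induct)
  case (insert i J) then show ?case by (simp add: mult_add)
qed (auto simp: mult_mem cstar_algebraD[OF A])

definition sand :: "'h op \<Rightarrow> 'h op \<Rightarrow> 'h op" where
  "sand c T = (c o\<^sub>L (T o\<^sub>L c))"

lemma sand_linear: "sand c (T + U) = sand c T + sand c U" "sand c (T - U) = sand c T - sand c U"
    "sand c (r *\<^sub>R T) = r *\<^sub>R sand c T"
    "sand c (\<Sum>i\<in>J. a i) = (\<Sum>i\<in>J. sand c (a i))" "sand c id_blinfun = (c o\<^sub>L c)"
  by (simp_all add: sand_def blinfun_compose_linear blinfun_eqI)

lemma sand_P: "c \<in> A \<Longrightarrow> selfadjoint c \<Longrightarrow> mult T \<Longrightarrow> positive_op T \<Longrightarrow> sand c T \<in> P"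
  using positive_sandwich[of c T] cstar_algebraD(4)[OF A, of c "T o\<^sub>L c"] by (simp add: sand_def P_iff mult_def)

text \<open>Adding \<open>N = norm T\<close> makes \<open>T\<close> positive, and the compression of
  \<open>T + N\<close> lies below \<open>2 N c c\<close>. This exhibits the compression of
  \<open>T\<close> as a difference of positive elements of finite trace.\<close>

lemma sand_fd:
  assumes c: "c \<in> A" "selfadjoint c" "\<tau> (c o\<^sub>L c) < \<infinity>" and T: "mult T"
  shows "sand c T \<in> fd"
proof -
  define N where "N = norm T"
  have sT: "selfadjoint T" using T by (simp add: mult_def)
  have N: "0 \<le> N" "\<bar>inner (T v) v\<bar> \<le> N * (norm v)^2" for v using inner_op_le_norm[of T v] by (auto simp: N_def)
  have p: "positive_op (T + N *\<^sub>R id_blinfun)" "positive_op (N *\<^sub>R id_blinfun - T)"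
    using N sT by (auto simp: positive_op_iff blinfun_linear inner_add inner_diff power2_norm_eq_inner abs_le_iff)
      (smt (verit) N(2) power2_norm_eq_inner)+
  have cc: "(c o\<^sub>L c) \<in> P" using sand_P[OF c(1,2) mult_id] by (simp add: sand_linear positive_op_iff)
  have 1: "sand c (T + N *\<^sub>R id_blinfun) \<in> P" by (rule sand_P[OF c(1,2) mult_add[OF T mult_scaleR[OF mult_id]] p(1)])
  have "\<tau> (sand c (T + N *\<^sub>R id_blinfun)) \<le> \<tau> ((2 * N) *\<^sub>R (c o\<^sub>L c))"
  proof (rule tau_mono[OF 1])
    show "(2 * N) *\<^sub>R (c o\<^sub>L c) \<in> A" using cc by (auto simp: P_iff intro: cstar_algebraD[OF A])
    have "(2 * N) *\<^sub>R (c o\<^sub>L c) - sand c (T + N *\<^sub>R id_blinfun) = sand c (N *\<^sub>R id_blinfun - T)"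
      by (simp add: sand_linear algebra_simps flip: scaleR_add_left)
    then show "positive_op ((2 * N) *\<^sub>R (c o\<^sub>L c) - sand c (T + N *\<^sub>R id_blinfun))"
      using positive_sandwich[OF c(2) p(2)] by (simp add: sand_def)
  qed
  also have "\<dots> < \<infinity>" using cc N(1) c(3) by (simp add: tau_scaleR ennreal_mult_less_top)
  finally have 2: "\<tau> (sand c (T + N *\<^sub>R id_blinfun)) < \<infinity>" .
  have 3: "\<tau> (N *\<^sub>R (c o\<^sub>L c)) < \<infinity>" using cc N(1) c(3) by (simp add: tau_scaleR ennreal_mult_less_top)
  have "sand c T = sand c (T + N *\<^sub>R id_blinfun) - N *\<^sub>R (c o\<^sub>L c)" by (simp add: sand_linear)
  then show ?thesis using fdI[OF 1 P_scaleR[OF cc N(1)] 2 3] by simp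
qed

lemma tau_finite_of_fd: "a \<in> P \<Longrightarrow> a \<in> fd \<Longrightarrow> \<tau> a < \<infinity>"
proof -
  assume a: "a \<in> P" "a \<in> fd"
  then obtain b c where bc: "a = b - c" "b \<in> P" "c \<in> P" "\<tau> b < \<infinity>" "\<tau> c < \<infinity>"
    unfolding fd_def by blast
  have "\<tau> (a + c) = \<tau> a + \<tau> c" by (rule tau_add[OF a(1) bc(3)])
  then have "\<tau> a + \<tau> c < \<infinity>" using bc by simp
  then show "\<tau> a < \<infinity>" by simp
qed

lemma tr_nonneg: "a \<in> P \<Longrightarrow> a \<in> fd \<Longrightarrow> 0 \<le> tr a"
  using fd_finite(2) tau_finite_of_fd by simp

end

section \<open>Barycentres and Jensen's inequality\<close>

context trace_alg begin

definition mass :: "'h op \<Rightarrow> real" where "mass c = enn2real (\<tau> (c o\<^sub>L c))"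

text \<open>For vanishing mass the quotient is 0 by convention; such \<open>c\<close> are discarded
  before barycentres are used.\<close>

definition centroid :: "'h op \<Rightarrow> ('h op)^'n \<Rightarrow> real^'n" where
  "centroid c X = (\<chi> i. tr (sand c (X $ i)) / mass c)"

lemma tr_sand_nonneg:
  assumes c: "c \<in> A" "selfadjoint c" "\<tau> (c o\<^sub>L c) < \<infinity>" and T: "mult T" "positive_op T"
  shows "0 \<le> tr (sand c T)"
  by (rule tr_nonneg[OF sand_P[OF c(1,2) T] sand_fd[OF c T(1)]])

lemma tr_sand_linear:
  assumes c: "c \<in> A" "selfadjoint c" "\<tau> (c o\<^sub>L c) < \<infinity>" and T: "mult T" and U: "mult U"
  shows "tr (sand c (T + U)) = tr (sand c T) + tr (sand c U)" "tr (sand c (r *\<^sub>R T)) = r * tr (sand c T)"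
    "tr (sand c (T - U)) = tr (sand c T) - tr (sand c U)"
proof -
  note fd = sand_fd[OF c]
  show 1: "tr (sand c (r *\<^sub>R T)) = r * tr (sand c T)" using fd_scaleR[OF fd[OF T]] by (simp add: sand_linear)
  show "tr (sand c (T + U)) = tr (sand c T) + tr (sand c U)" using fd_add[OF fd[OF T] fd[OF U]] by (simp add: sand_linear)
  have "tr (sand c (T + (-1) *\<^sub>R U)) = tr (sand c T) + tr (sand c ((-1) *\<^sub>R U))"
    using fd_add[OF fd[OF T] fd[OF mult_scaleR[OF U, of "-1"]]] by (simp only: sand_linear(1))
  also have "tr (sand c ((-1) *\<^sub>R U)) = - 1 * tr (sand c U)" using fd_scaleR[OF fd[OF U], of "-1"] by (simp only: sand_linear)
  finally show "tr (sand c (T - U)) = tr (sand c T) - tr (sand c U)" by simp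
qed

lemma cc_P: "c \<in> A \<Longrightarrow> selfadjoint c \<Longrightarrow> (c o\<^sub>L c) \<in> P"
  using sand_P[OF _ _ mult_id, of c] by (simp add: sand_linear positive_op_iff)

lemma tr_sand_id:
  assumes c: "c \<in> A" "selfadjoint c" "\<tau> (c o\<^sub>L c) < \<infinity>"
  shows "tr (sand c id_blinfun) = mass c"
  using fd_finite(2)[OF cc_P[OF c(1,2)] c(3)] by (simp add: sand_linear mass_def)

lemma tr_sand_scale_id:
  assumes c: "c \<in> A" "selfadjoint c" "\<tau> (c o\<^sub>L c) < \<infinity>"
  shows "tr (sand c (r *\<^sub>R id_blinfun)) = r * mass c"
  using tr_sand_linear(2)[OF c mult_id mult_id] tr_sand_id[OF c] by simp

lemma centroid_mem:
  assumes X: "comm_tuple (($) X) m M" and XA: "\<And>i. X $ i \<in> A"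
    and c: "c \<in> A" "selfadjoint c" "\<tau> (c o\<^sub>L c) < \<infinity>" and pos: "0 < mass c"
  shows "centroid c X \<in> cbox m M"
proof -
  interpret comm_tuple "($) X" m M by fact
  have mX: "mult (X $ i)" for i by (rule mult_mem[OF XA sa])
  note mid = mult_scaleR[OF mult_id]
  have "m $ i \<le> tr (sand c (X $ i)) / mass c \<and> tr (sand c (X $ i)) / mass c \<le> M $ i" for i
  proof -
    have p: "positive_op (X $ i - m $ i *\<^sub>R id_blinfun)" "positive_op (M $ i *\<^sub>R id_blinfun - X $ i)"
      using sa[of i] lower[where i = i] upper[where i = i] by (auto simp: positive_op_iff blinfun_linear inner_diff power2_norm_eq_inner)
    have d: "mult (X $ i - m $ i *\<^sub>R id_blinfun)" "mult (M $ i *\<^sub>R id_blinfun - X $ i)"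
      using mult_add[OF mX mid, of i "- m $ i"] mult_add[OF mid mult_scaleR[OF mX], of "M $ i" "-1" i] by simp_all
    have "0 \<le> tr (sand c (X $ i)) - m $ i * mass c" "0 \<le> M $ i * mass c - tr (sand c (X $ i))"
      using tr_sand_nonneg[OF c d(1) p(1)] tr_sand_nonneg[OF c d(2) p(2)]
      by (simp_all only: tr_sand_linear(3)[OF c mX mid] tr_sand_linear(3)[OF c mid mX] tr_sand_scale_id[OF c])
    then show ?thesis using pos by (simp add: pos_le_divide_eq pos_divide_le_eq)
  qed
  then show ?thesis by (simp add: mem_box_cart centroid_def)
qed

text \<open>The barycentre determines the functional on affine functions of \<open>X\<close> only,
  so \<open>f\<close> is replaced by an affine minorant that is within \<open>\<epsilon>\<close> of
  it at the barycentre.\<close>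

lemma jensen_centroid:
  assumes X: "comm_tuple (($) X) m M" and XA: "\<And>i. X $ i \<in> A"
    and f: "convex_on (cbox m M) f" "continuous_on (cbox m M) f"
    and fA: "comm_tuple.cfc (($) X) m M f \<in> A"
    and c: "c \<in> A" "selfadjoint c" "\<tau> (c o\<^sub>L c) < \<infinity>" and pos: "0 < mass c"
  shows "mass c * f (centroid c X) \<le> tr (sand c (comm_tuple.cfc (($) X) m M f))"
proof -
  interpret comm_tuple "($) X" m M by fact
  have mX: "mult (X $ i)" for i by (rule mult_mem[OF XA sa])
  have mf: "mult (cfc f)" by (rule mult_mem[OF fA cfc_selfadjoint[OF f(2)]])
  have aK: "centroid c X \<in> K" by (rule centroid_mem[OF X XA c pos])
  have "mass c * (f (centroid c X) - \<epsilon>) \<le> tr (sand c (cfc f))" if e: "0 < \<epsilon>" for \<epsilon>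
  proof -
    obtain \<alpha>0 \<alpha> where al: "\<And>t. t \<in> K \<Longrightarrow> \<alpha>0 + inner \<alpha> t \<le> f t" "f (centroid c X) - \<epsilon> < \<alpha>0 + inner \<alpha> (centroid c X)"
      using affine_minorant[OF closed_cbox f aK e] by blast
    let ?U = "cfc (\<lambda>t. \<alpha>0 + inner \<alpha> t)"
    have cU: "continuous_on K (\<lambda>t. \<alpha>0 + inner \<alpha> t)" by (intro continuous_intros)
    have mS: "mult (\<Sum>i\<in>UNIV. (\<alpha> $ i) *\<^sub>R X $ i)" by (intro mult_sum mult_scaleR mX)
    have mU: "mult ?U" unfolding cfc_affine by (intro mult_add mult_scaleR mult_id mS)
    have p: "positive_op (cfc f - ?U)"
      unfolding cfc_diff[OF f(2) cU, symmetric] by (rule cfc_positive[OF continuous_on_diff[OF f(2) cU]]) (simp add: al)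
    have "mult (cfc f - ?U)" using mult_add[OF mf mult_scaleR[OF mU, of "-1"]] by simp
    from tr_sand_nonneg[OF c this p] have "tr (sand c ?U) \<le> tr (sand c (cfc f))"
      by (simp add: tr_sand_linear(3)[OF c mf mU])
    moreover have "tr (sand c ?U) = mass c * (\<alpha>0 + inner \<alpha> (centroid c X))"
    proof -
      have "tr (sand c (\<Sum>i\<in>UNIV. (\<alpha> $ i) *\<^sub>R X $ i)) = (\<Sum>i\<in>UNIV. tr (sand c ((\<alpha> $ i) *\<^sub>R X $ i)))"
        unfolding sand_linear(4) by (rule conjunct2[OF fd_sum]) (auto intro: sand_fd[OF c] mult_scaleR mX)
      also have "\<dots> = (\<Sum>i\<in>UNIV. \<alpha> $ i * tr (sand c (X $ i)))" by (simp only: tr_sand_linear(2)[OF c mX mX])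
      also have "\<dots> = mass c * inner \<alpha> (centroid c X)"
        using pos by (simp add: inner_vec_def centroid_def sum_distrib_left)
      finally show ?thesis
        unfolding cfc_affine tr_sand_linear(1)[OF c mult_scaleR[OF mult_id] mS] tr_sand_scale_id[OF c] by (simp add: algebra_simps)
    qed
    moreover have "mass c * (f (centroid c X) - \<epsilon>) \<le> mass c * (\<alpha>0 + inner \<alpha> (centroid c X))"
      using al(2) pos by (intro mult_left_mono) auto
    ultimately show ?thesis by linarith
  qed
  then have "mass c * f (centroid c X) - tr (sand c (cfc f)) \<le> \<epsilon> * mass c" if "0 < \<epsilon>" for \<epsilon>
    using that by (simp add: algebra_simps)
  then have "mass c * f (centroid c X) - tr (sand c (cfc f)) \<le> 0" by (rule small_multiple_le_zero)
  then show ?thesis by simp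
qed

text \<open>The operators \<open>c p\<close> need not commute with \<open>X\<close>, so the
  compressions of \<open>f(X)\<close> cannot be summed as functions of \<open>X\<close>. With
  \<open>r\<close> the square root of \<open>f(X)\<close>, the trace property rewrites each
  \<open>\<tau> (c r r c)\<close> as \<open>\<tau> (r c c r)\<close>; now the sum is taken inside,
  and the bound of the sum of all \<open>c c\<close> by the identity leaves at most
  \<open>\<tau> (r r)\<close>.\<close>

lemma jensen_sum:
  assumes X: "comm_tuple (($) X) m M" and XA: "\<And>i. X $ i \<in> A"
    and f: "convex_on (cbox m M) f" "continuous_on (cbox m M) f" "\<And>t. t \<in> cbox m M \<Longrightarrow> 0 \<le> f t"
    and fA: "comm_tuple.cfc (($) X) m M f \<in> A"
    and F: "finite F" and c: "\<And>p. p \<in> F \<Longrightarrow> c p \<in> A" "\<And>p. p \<in> F \<Longrightarrow> selfadjoint (c p)" "\<And>p. p \<in> F \<Longrightarrow> \<tau> (c p o\<^sub>L c p) < \<infinity>"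
    and C: "positive_op (id_blinfun - (\<Sum>p\<in>F. c p o\<^sub>L c p))"
  shows "ennreal (\<Sum>p\<in>{p\<in>F. 0 < mass (c p)}. mass (c p) * f (centroid (c p) X)) \<le> \<tau> (comm_tuple.cfc (($) X) m M f)"
proof -
  interpret comm_tuple "($) X" m M by fact
  let ?T = "cfc f" and ?r = "cfc (\<lambda>t. sqrt (f t))"
  have cs: "continuous_on K (\<lambda>t. sqrt (f t))" by (intro continuous_intros f)
  have rA: "?r \<in> A" by (rule cfc_sqrt_mem[OF A XA f(2,3) fA])
  have sr: "selfadjoint ?r" by (rule cfc_selfadjoint[OF cs])
  have rr: "(?r o\<^sub>L ?r) = ?T"
    unfolding cfc_mult[OF cs cs, symmetric] by (rule cfc_cong) (use f(3) in simp)
  have mT: "mult ?T" by (rule mult_mem[OF fA cfc_selfadjoint[OF f(2)]])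
  have pT: "positive_op ?T" by (rule cfc_positive[OF f(2,3)])
  have sP: "sand (c p) ?T \<in> P" and sf: "sand (c p) ?T \<in> fd" if "p \<in> F" for p
    by (rule sand_P[OF c(1,2)[OF that] mT pT], rule sand_fd[OF c(1,2,3)[OF that] mT])
  have ft: "\<tau> (sand (c p) ?T) < \<infinity>" if "p \<in> F" for p by (rule tau_finite_of_fd[OF sP[OF that] sf[OF that]])
  let ?S = "{p\<in>F. 0 < mass (c p)}"
  have "(\<Sum>p\<in>?S. mass (c p) * f (centroid (c p) X)) \<le> (\<Sum>p\<in>?S. enn2real (\<tau> (sand (c p) ?T)))"
  proof (rule sum_mono)
    fix p assume p: "p \<in> ?S"
    then have "mass (c p) * f (centroid (c p) X) \<le> tr (sand (c p) ?T)"
      by (intro jensen_centroid[OF X XA f(1,2) fA] c) auto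
    then show "mass (c p) * f (centroid (c p) X) \<le> enn2real (\<tau> (sand (c p) ?T))"
      using fd_finite(2)[OF sP ft, of p] p by simp
  qed
  also have "\<dots> \<le> (\<Sum>p\<in>F. enn2real (\<tau> (sand (c p) ?T)))" by (rule sum_mono2) (use F in auto)
  finally have "ennreal (\<Sum>p\<in>?S. mass (c p) * f (centroid (c p) X)) \<le> ennreal (\<Sum>p\<in>F. enn2real (\<tau> (sand (c p) ?T)))"
    by (rule ennreal_leI)
  also have "\<dots> = (\<Sum>p\<in>F. ennreal (enn2real (\<tau> (sand (c p) ?T))))" by (rule sum_ennreal[symmetric]) simp
  also have "\<dots> = (\<Sum>p\<in>F. \<tau> (sand (c p) ?T))" by (rule sum.cong[OF refl]) (use ft in \<open>simp add: less_top\<close>)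
  also have "\<dots> = (\<Sum>p\<in>F. \<tau> (sand ?r (c p o\<^sub>L c p)))"
  proof (rule sum.cong[OF refl])
    fix p assume p: "p \<in> F"
    have "(?r o\<^sub>L c p) \<in> A" by (rule cstar_algebraD(4)[OF A rA c(1)[OF p]])
    from tau_swap[OF c(2)[OF p] sr this] show "\<tau> (sand (c p) ?T) = \<tau> (sand ?r (c p o\<^sub>L c p))"
      by (simp only: sand_def rr)
  qed
  also have "\<dots> = \<tau> (\<Sum>p\<in>F. sand ?r (c p o\<^sub>L c p))"
  proof (rule tau_sum[symmetric, OF F])
    fix p assume "p \<in> F"
    then have "(c p o\<^sub>L c p) \<in> P" by (intro cc_P c)
    then show "sand ?r (c p o\<^sub>L c p) \<in> P" by (intro sand_P[OF rA sr] mult_mem) (auto simp: P_iff positive_op_iff)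
  qed
  also have "\<dots> \<le> \<tau> ?T"
  proof (rule tau_mono)
    show "(\<Sum>p\<in>F. sand ?r (c p o\<^sub>L c p)) \<in> P"
    proof (rule P_sum)
      fix p assume "p \<in> F"
      then have "(c p o\<^sub>L c p) \<in> P" by (intro cc_P c)
      then show "sand ?r (c p o\<^sub>L c p) \<in> P" by (intro sand_P[OF rA sr] mult_mem) (auto simp: P_iff positive_op_iff)
    qed
    have "?T - (\<Sum>p\<in>F. sand ?r (c p o\<^sub>L c p)) = sand ?r (id_blinfun - (\<Sum>p\<in>F. c p o\<^sub>L c p))"
      by (simp only: sand_linear rr)
    then show "positive_op (?T - (\<Sum>p\<in>F. sand ?r (c p o\<^sub>L c p)))"
      using positive_sandwich[OF sr C] by (simp add: sand_def)
  qed (rule fA)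
  finally show ?thesis .
qed

end

text \<open>Normalised tent functions. Square roots are taken because the functions enter
  quadratically in the compressions.\<close>

lemma partition_of_unity_sqrt:
  fixes K :: "'a::metric_space set"
  assumes K: "compact K" and \<eta>: "0 < (\<eta>::real)"
  obtains F :: "'a set" and g :: "'a \<Rightarrow> 'a \<Rightarrow> real"
  where "finite F" "\<And>p. p \<in> F \<Longrightarrow> continuous_on K (g p)" "\<And>t. t \<in> K \<Longrightarrow> (\<Sum>p\<in>F. (g p t)^2) = 1"
    "\<And>p t. p \<in> F \<Longrightarrow> t \<in> K \<Longrightarrow> g p t \<noteq> 0 \<Longrightarrow> dist t p < \<eta>"
proof -
  have "K \<subseteq> (\<Union>p\<in>K. ball p \<eta>)" using \<eta> by force
  then obtain F where F: "F \<subseteq> K" "finite F" "K \<subseteq> (\<Union>p\<in>F. ball p \<eta>)"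
    using compactE_image[OF K, of K "\<lambda>p. ball p \<eta>"] by (metis open_ball)
  define h where "h p t = max 0 (\<eta> - dist t p)" for p t :: 'a
  define H where "H t = (\<Sum>p\<in>F. h p t)" for t
  have h0: "0 \<le> h p t" for p t by (simp add: h_def)
  have ch: "continuous_on K (h p)" for p unfolding h_def by (intro continuous_intros)
  have cH: "continuous_on K H" unfolding H_def by (intro continuous_intros ch)
  have H: "0 < H t" if t: "t \<in> K" for t
  proof -
    obtain p where p: "p \<in> F" "dist t p < \<eta>" using F(3) t by (auto simp: dist_commute)
    show ?thesis unfolding H_def by (rule sum_pos2[OF F(2) p(1)]) (use p(2) h0 in \<open>auto simp: h_def\<close>)
  qed
  show ?thesis
  proof (rule that[of F "\<lambda>p t. sqrt (h p t / H t)"])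
    show "continuous_on K (\<lambda>t. sqrt (h p t / H t))" for p
      by (intro continuous_intros ch cH) (use H in force)
    show "(\<Sum>p\<in>F. (sqrt (h p t / H t))^2) = 1" if t: "t \<in> K" for t
    proof -
      have "(\<Sum>p\<in>F. (sqrt (h p t / H t))^2) = (\<Sum>p\<in>F. h p t / H t)"
        by (rule sum.cong[OF refl]) (use h0 H[OF t] in \<open>simp add: less_imp_le\<close>)
      also have "\<dots> = H t / H t" by (simp only: H_def sum_divide_distrib)
      finally show ?thesis using H[OF t] by simp
    qed
    show "dist t p < \<eta>" if "sqrt (h p t / H t) \<noteq> 0" for p t
      using that by (auto simp: h_def max_def split: if_splits)
  qed (rule F(2))
qed

context trace_alg begin

lemma trace_discretization:
  fixes X Y Z :: "('h op)^'n::finite"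
  assumes X: "comm_tuple (($) X) m M" and Y: "comm_tuple (($) Y) m M" and Z: "comm_tuple (($) Z) m M"
    and ZXY: "Z = u *\<^sub>R X + v *\<^sub>R Y"
    and XA: "\<And>i. X $ i \<in> A" and YA: "\<And>i. Y $ i \<in> A"
    and f: "convex_on (cbox m M) f" "continuous_on (cbox m M) f" "\<And>t. t \<in> cbox m M \<Longrightarrow> 0 \<le> f t"
    and fX: "comm_tuple.cfc (($) X) m M f \<in> A" and fY: "comm_tuple.cfc (($) Y) m M f \<in> A"
    and fZ: "comm_tuple.cfc (($) Z) m M f \<in> A"
    and om: "continuous_on (cbox m M) \<omega>" "\<And>t. t \<in> cbox m M \<Longrightarrow> \<bar>\<omega> t\<bar> \<le> 1"
    and omA: "comm_tuple.cfc (($) Z) m M \<omega> \<in> A"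
    and fin: "\<tau> (comm_tuple.cfc (($) Z) m M \<omega> o\<^sub>L comm_tuple.cfc (($) Z) m M \<omega>) < \<infinity>"
    and \<delta>: "0 < \<delta>"
  shows "\<exists>(S::(real^'n) set) w a b. finite S \<and> (\<forall>k\<in>S. 0 < w k \<and> a k \<in> cbox m M \<and> b k \<in> cbox m M) \<and>
    (\<Sum>k\<in>S. w k) = mass (comm_tuple.cfc (($) Z) m M \<omega>) \<and>
    \<tau> (comm_tuple.cfc (($) Z) m M (\<lambda>t. (\<omega> t)^2 * f t)) \<le> ennreal (\<delta> + (\<Sum>k\<in>S. w k * f (u *\<^sub>R a k + v *\<^sub>R b k))) \<and>
    ennreal (\<Sum>k\<in>S. w k * f (a k)) \<le> \<tau> (comm_tuple.cfc (($) X) m M f) \<and>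
    ennreal (\<Sum>k\<in>S. w k * f (b k)) \<le> \<tau> (comm_tuple.cfc (($) Y) m M f)"
proof -
  interpret X: comm_tuple "($) X" m M by fact
  interpret Y: comm_tuple "($) Y" m M by fact
  interpret Z: comm_tuple "($) Z" m M by fact
  let ?K = "cbox m M"
  have ZA: "Z $ i \<in> A" for i using XA YA by (auto simp: ZXY intro: cstar_algebraD[OF A])
  let ?c0 = "Z.cfc \<omega>"
  have sc0: "selfadjoint ?c0" by (rule Z.cfc_selfadjoint[OF om(1)])
  have c0P: "(?c0 o\<^sub>L ?c0) \<in> P" by (rule cc_P[OF omA sc0])
  define Q where "Q = mass ?c0"
  have Q: "0 \<le> Q" "\<tau> (?c0 o\<^sub>L ?c0) = ennreal Q" using fin by (simp_all add: Q_def mass_def less_top)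
  \<comment> \<open>Error allowed per unit of mass, the total mass being \<open>Q\<close>; the
    summand 1 covers \<open>Q = 0\<close>.\<close>
  define \<delta>' where "\<delta>' = \<delta> / (Q + 1)"
  have d': "0 < \<delta>'" "\<delta>' * Q \<le> \<delta>" using \<delta> Q by (auto simp: \<delta>'_def field_simps)
  have "uniformly_continuous_on ?K f" by (rule compact_uniformly_continuous[OF f(2) compact_cbox])
  then obtain \<eta>0 where eta0: "0 < \<eta>0" "\<And>s t. s \<in> ?K \<Longrightarrow> t \<in> ?K \<Longrightarrow> dist s t < \<eta>0 \<Longrightarrow> dist (f s) (f t) < \<delta>'"
    using d'(1) unfolding uniformly_continuous_on_def by metis
  \<comment> \<open>Each coordinate of \<open>t\<close> and of the barycentre is within
    \<open>\<eta>\<close> of that of \<open>p\<close>, so their distance is at most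
    \<open>2 * \<eta>\<close> times the dimension, which this choice puts below
    \<open>\<eta>0\<close>.\<close>
  define \<eta> where "\<eta> = \<eta>0 / (2 * real CARD('n) + 1)"
  have n0: "0 < 2 * real CARD('n) + 1" by (simp add: add_nonneg_pos)
  have eta: "0 < \<eta>" using eta0 n0 by (simp add: \<eta>_def)
  have eta': "real CARD('n) * (2 * \<eta>) < \<eta>0"
  proof -
    have "real CARD('n) * (2 * \<eta>) < (2 * real CARD('n) + 1) * \<eta>" using eta by (simp add: algebra_simps)
    also have "\<dots> = \<eta>0" using n0 by (simp add: \<eta>_def)
    finally show ?thesis .
  qed
  obtain F and g :: "real^'n \<Rightarrow> real^'n \<Rightarrow> real" where F: "finite F" and g: "\<And>p. p \<in> F \<Longrightarrow> continuous_on ?K (g p)"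
    "\<And>t. t \<in> ?K \<Longrightarrow> (\<Sum>p\<in>F. (g p t)^2) = 1" "\<And>p t. p \<in> F \<Longrightarrow> t \<in> ?K \<Longrightarrow> g p t \<noteq> 0 \<Longrightarrow> dist t p < \<eta>"
    by (rule partition_of_unity_sqrt[OF compact_cbox eta, of m M]) blast
  define \<gamma> where "\<gamma> p t = g p t * \<omega> t" for p t
  define c where "c p = Z.cfc (\<gamma> p)" for p
  have cga: "continuous_on ?K (\<gamma> p)" if "p \<in> F" for p unfolding \<gamma>_def by (intro continuous_intros g(1) om(1) that)
  have cA: "c p \<in> A" if "p \<in> F" for p
    using Z.cfc_ideal(1)[OF A ZA g(1)[OF that] omA] unfolding c_def \<gamma>_def Z.cfc_mult[OF g(1)[OF that] om(1)] .
  have sc: "selfadjoint (c p)" if "p \<in> F" for p unfolding c_def by (rule Z.cfc_selfadjoint[OF cga[OF that]])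
  have cc: "(c p o\<^sub>L c p) = Z.cfc (\<lambda>t. \<gamma> p t * \<gamma> p t)" if "p \<in> F" for p
    unfolding c_def by (rule Z.cfc_mult[OF cga[OF that] cga[OF that], symmetric])
  have sandZ: "sand (c p) (Z.cfc h) = Z.cfc (\<lambda>t. \<gamma> p t * (h t * \<gamma> p t))" if "p \<in> F" "continuous_on ?K h" for p h
    unfolding sand_def c_def
    by (simp only: Z.cfc_mult[OF that(2) cga[OF that(1)]] Z.cfc_mult[OF cga[OF that(1)] continuous_on_mult[OF that(2) cga[OF that(1)]]])
  have sum_ga: "(\<Sum>p\<in>F. \<gamma> p t * (h t * \<gamma> p t)) = \<omega> t * \<omega> t * h t" if "t \<in> ?K" for t and h :: "real^'n \<Rightarrow> real"
  proof -
    have "(\<Sum>p\<in>F. \<gamma> p t * (h t * \<gamma> p t)) = (\<Sum>p\<in>F. (g p t)^2) * (\<omega> t * \<omega> t * h t)"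
      unfolding sum_distrib_right by (rule sum.cong[OF refl]) (simp add: \<gamma>_def power2_eq_square mult_ac)
    then show ?thesis by (simp add: g(2)[OF that])
  qed
  have sum_sand: "(\<Sum>p\<in>F. sand (c p) (Z.cfc h)) = Z.cfc (\<lambda>t. \<omega> t * \<omega> t * h t)" if h: "continuous_on ?K h" for h
  proof -
    have "(\<Sum>p\<in>F. sand (c p) (Z.cfc h)) = (\<Sum>p\<in>F. Z.cfc (\<lambda>t. \<gamma> p t * (h t * \<gamma> p t)))"
      by (rule sum.cong[OF refl]) (rule sandZ[OF _ h])
    also have "\<dots> = Z.cfc (\<lambda>t. \<Sum>p\<in>F. \<gamma> p t * (h t * \<gamma> p t))"
      by (rule Z.cfc_sum[symmetric, OF F]) (intro continuous_intros cga h)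
    also have "\<dots> = Z.cfc (\<lambda>t. \<omega> t * \<omega> t * h t)" by (rule Z.cfc_cong) (rule sum_ga)
    finally show ?thesis .
  qed
  have sumcc: "(\<Sum>p\<in>F. c p o\<^sub>L c p) = (?c0 o\<^sub>L ?c0)"
    using sum_sand[OF continuous_on_const[of _ 1]]
    by (simp add: sand_linear Z.cfc_mult[OF om(1) om(1)])
  have ccP: "(c p o\<^sub>L c p) \<in> P" if "p \<in> F" for p by (rule cc_P[OF cA sc]) (rule that)+
  have sumtau: "(\<Sum>p\<in>F. \<tau> (c p o\<^sub>L c p)) = ennreal Q"
    using tau_sum[OF F, of "\<lambda>p. c p o\<^sub>L c p"] ccP by (simp add: sumcc Q(2))
  have fc: "\<tau> (c p o\<^sub>L c p) < \<infinity>" if "p \<in> F" for p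
  proof -
    have "\<tau> (c p o\<^sub>L c p) \<le> (\<Sum>p\<in>F. \<tau> (c p o\<^sub>L c p))" by (rule member_le_sum[OF that _ F]) simp
    then show ?thesis by (simp add: sumtau le_less_trans)
  qed
  have ctau: "\<tau> (c p o\<^sub>L c p) = ennreal (mass (c p))" if "p \<in> F" for p
    using fc[OF that] by (simp add: mass_def less_top)
  have m0: "0 \<le> mass (c p)" for p by (simp add: mass_def)
  \<comment> \<open>Pieces of mass 0 have no barycentre; \<open>bound0\<close> shows that they
    contribute nothing to the trace.\<close>
  define S where "S = {p\<in>F. 0 < mass (c p)}"
  have SF: "S \<subseteq> F" "finite S" using F by (auto simp: S_def)
  have sumF: "(\<Sum>p\<in>F. mass (c p)) = Q"
  proof -
    have "ennreal (\<Sum>p\<in>F. mass (c p)) = (\<Sum>p\<in>F. ennreal (mass (c p)))"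
      by (rule sum_ennreal[symmetric]) (rule m0)
    also have "\<dots> = (\<Sum>p\<in>F. \<tau> (c p o\<^sub>L c p))" by (rule sum.cong[OF refl]) (simp only: ctau)
    also have "\<dots> = ennreal Q" by (rule sumtau)
    finally show ?thesis using Q(1) sum_nonneg[of F "\<lambda>p. mass (c p)"] m0 by simp
  qed
  have sumS: "(\<Sum>p\<in>S. mass (c p)) = Q"
    unfolding sumF[symmetric] by (rule sum.mono_neutral_left) (use F m0 in \<open>auto simp: S_def less_le\<close>)
  have C: "positive_op (id_blinfun - (\<Sum>p\<in>F. c p o\<^sub>L c p))"
  proof -
    have "positive_op (Z.cfc (\<lambda>t. 1 - \<omega> t * \<omega> t))"
    proof (rule Z.cfc_positive)
      show "continuous_on ?K (\<lambda>t. 1 - \<omega> t * \<omega> t)" by (intro continuous_intros om(1))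
      fix t assume "t \<in> ?K"
      then have "\<bar>\<omega> t\<bar> * \<bar>\<omega> t\<bar> \<le> 1" using om(2) by (intro mult_le_one) auto
      then show "0 \<le> 1 - \<omega> t * \<omega> t" by (simp add: abs_mult_self_eq)
    qed
    also have "Z.cfc (\<lambda>t. 1 - \<omega> t * \<omega> t) = id_blinfun - (\<Sum>p\<in>F. c p o\<^sub>L c p)"
      unfolding sumcc Z.cfc_diff[OF continuous_on_const continuous_on_mult[OF om(1) om(1)]] Z.cfc_mult[OF om(1) om(1)] by simp
    finally show ?thesis .
  qed
  define a where "a p = centroid (c p) X" for p
  define b where "b p = centroid (c p) Y" for p
  define \<zeta> where "\<zeta> p = centroid (c p) Z" for p
  have S: "p \<in> F" "0 < mass (c p)" if "p \<in> S" for p using that by (auto simp: S_def)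
  have mem: "a p \<in> ?K" "b p \<in> ?K" "\<zeta> p \<in> ?K" if p: "p \<in> S" for p
    using centroid_mem[OF X XA cA sc fc S(2)] centroid_mem[OF Y YA cA sc fc S(2)] centroid_mem[OF Z ZA cA sc fc S(2)] p S(1)
    by (auto simp: a_def b_def \<zeta>_def)
  have mX: "mult (X $ i)" "mult (Y $ i)" "mult (Z $ i)" for i using mult_mem XA YA ZA X.sa Y.sa Z.sa by blast+
  \<comment> \<open>Linearity of the trace alone links the barycentres, with no commutation between
    \<open>X\<close>, \<open>Y\<close> and \<open>Z\<close>.\<close>
  have zeta: "\<zeta> p = u *\<^sub>R a p + v *\<^sub>R b p" if p: "p \<in> S" for p
  proof -
    note cp = cA[OF S(1)[OF p]] sc[OF S(1)[OF p]] fc[OF S(1)[OF p]]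
    have "tr (sand (c p) (Z $ i)) = u * tr (sand (c p) (X $ i)) + v * tr (sand (c p) (Y $ i))" for i
      using tr_sand_linear(1)[OF cp mult_scaleR[OF mX(1)] mult_scaleR[OF mX(2)], of u i v i]
        tr_sand_linear(2)[OF cp mX(1) mX(1), of u i] tr_sand_linear(2)[OF cp mX(2) mX(2), of v i]
      by (simp add: ZXY)
    then show ?thesis
      using S(2)[OF p] by (simp add: vec_eq_iff \<zeta>_def a_def b_def centroid_def add_divide_distrib)
  qed
  have near: "\<bar>\<zeta> p $ i - p $ i\<bar> \<le> \<eta>" if p: "p \<in> S" for p i
  proof -
    note pF = S(1)[OF p] and w = S(2)[OF p]
    note cp = cA[OF pF] sc[OF pF] fc[OF pF]
    \<comment> \<open>The affine function \<open>\<eta> + s * (t $ i - p $ i)\<close> is nonnegative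
      on the support of \<open>g p\<close>; the two signs of \<open>s\<close> give the upper and the
      lower bound for the barycentre of \<open>Z\<close>.\<close>
    have key: "0 \<le> \<eta> * mass (c p) + s * (tr (sand (c p) (Z $ i)) - p $ i * mass (c p))" if s: "\<bar>s\<bar> = 1" for s
    proof -
      have ch: "continuous_on ?K (\<lambda>t. \<eta> + s * (t $ i - p $ i))" by (intro continuous_intros)
      have pp: "positive_op (sand (c p) (Z.cfc (\<lambda>t. \<eta> + s * (t $ i - p $ i))))"
        unfolding sandZ[OF pF ch]
      proof (rule Z.cfc_positive)
        show "continuous_on ?K (\<lambda>t. \<gamma> p t * ((\<eta> + s * (t $ i - p $ i)) * \<gamma> p t))" by (intro continuous_intros cga[OF pF])
        fix t assume t: "t \<in> ?K"
        show "0 \<le> \<gamma> p t * ((\<eta> + s * (t $ i - p $ i)) * \<gamma> p t)"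
        proof (cases "g p t = 0")
          case False
          have "\<bar>t $ i - p $ i\<bar> < \<eta>"
            using g(3)[OF pF t False] component_le_norm_cart[of "t - p" i] by (simp add: dist_norm)
          then have "0 \<le> \<eta> + s * (t $ i - p $ i)" using s by (auto simp: abs_if split: if_splits)
          then have "0 \<le> (\<eta> + s * (t $ i - p $ i)) * (\<gamma> p t * \<gamma> p t)" by (rule mult_nonneg_nonneg[OF _ zero_le_square])
          then show ?thesis by (simp add: mult_ac)
        qed (simp add: \<gamma>_def)
      qed
      have eq: "Z.cfc (\<lambda>t. \<eta> + s * (t $ i - p $ i)) = (\<eta> - s * p $ i) *\<^sub>R id_blinfun + s *\<^sub>R Z $ i"
      proof -
        have "Z.cfc (\<lambda>t. \<eta> + s * (t $ i - p $ i)) = Z.cfc (\<lambda>t. (\<eta> - s * p $ i) + s * t $ i)"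
          by (rule Z.cfc_cong) (simp add: algebra_simps)
        also have "\<dots> = (\<eta> - s * p $ i) *\<^sub>R id_blinfun + s *\<^sub>R Z $ i"
          by (subst Z.cfc_add) (auto intro!: continuous_intros simp: Z.cfc_cmult[OF continuous_on_component[OF continuous_on_id]])
        finally show ?thesis .
      qed
      have mU: "mult ((\<eta> - s * p $ i) *\<^sub>R id_blinfun + s *\<^sub>R Z $ i)" by (intro mult_add mult_scaleR mult_id mX)
      have "sand (c p) ((\<eta> - s * p $ i) *\<^sub>R id_blinfun + s *\<^sub>R Z $ i) \<in> A"
        using mU cp(1) cstar_algebraD(4)[OF A cp(1)] by (simp add: sand_def mult_def)
      then have "0 \<le> tr (sand (c p) ((\<eta> - s * p $ i) *\<^sub>R id_blinfun + s *\<^sub>R Z $ i))"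
        using pp unfolding eq by (intro tr_nonneg sand_fd[OF cp mU]) (simp add: P_iff)
      also have "\<dots> = (\<eta> - s * p $ i) * mass (c p) + s * tr (sand (c p) (Z $ i))"
        unfolding tr_sand_linear(1)[OF cp mult_scaleR[OF mult_id] mult_scaleR[OF mX(3)]] tr_sand_linear(2)[OF cp mX(3) mX(3)]
          tr_sand_scale_id[OF cp] ..
      finally show ?thesis by (simp add: algebra_simps)
    qed
    have "tr (sand (c p) (Z $ i)) = \<zeta> p $ i * mass (c p)" using w by (simp add: \<zeta>_def centroid_def)
    then have "0 \<le> (\<eta> + s * (\<zeta> p $ i - p $ i)) * mass (c p)" if "\<bar>s\<bar> = 1" for s
      using key[OF that] by (simp add: algebra_simps)
    then have "0 \<le> \<eta> + s * (\<zeta> p $ i - p $ i)" if "\<bar>s\<bar> = 1" for s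
      using w that by (metis mult_neg_pos not_le)
    from this[of 1] this[of "-1"] show ?thesis by simp
  qed
  have mf: "mult (Z.cfc f)" by (rule mult_mem[OF fZ Z.cfc_selfadjoint[OF f(2)]])
  have pf: "positive_op (Z.cfc f)" by (rule Z.cfc_positive[OF f(2,3)])
  have bound: "\<tau> (sand (c p) (Z.cfc f)) \<le> ennreal (r * mass (c p))"
    if p: "p \<in> F" and r: "0 \<le> r" "\<And>t. t \<in> ?K \<Longrightarrow> g p t \<noteq> 0 \<Longrightarrow> f t \<le> r" for p r
  proof -
    have "\<tau> (sand (c p) (Z.cfc f)) \<le> \<tau> (r *\<^sub>R (c p o\<^sub>L c p))"
    proof (rule tau_mono)
      show "sand (c p) (Z.cfc f) \<in> P" by (rule sand_P[OF cA[OF p] sc[OF p] mf pf])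
      show "r *\<^sub>R (c p o\<^sub>L c p) \<in> A" using P_scaleR[OF ccP[OF p] r(1)] by (simp add: P_iff)
      have ch: "continuous_on ?K (\<lambda>t. r - f t)" by (intro continuous_intros f)
      have "r *\<^sub>R (c p o\<^sub>L c p) - sand (c p) (Z.cfc f) = sand (c p) (Z.cfc (\<lambda>t. r - f t))"
        unfolding Z.cfc_diff[OF continuous_on_const f(2)] by (simp add: sand_linear)
      also have "\<dots> = Z.cfc (\<lambda>t. \<gamma> p t * ((r - f t) * \<gamma> p t))" by (rule sandZ[OF p ch])
      also have "positive_op \<dots>"
      proof (rule Z.cfc_positive)
        show "continuous_on ?K (\<lambda>t. \<gamma> p t * ((r - f t) * \<gamma> p t))" by (intro continuous_intros cga[OF p] f)
        fix t assume t: "t \<in> ?K"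
        show "0 \<le> \<gamma> p t * ((r - f t) * \<gamma> p t)"
        proof (cases "g p t = 0")
          case False
          then have "0 \<le> (r - f t) * (\<gamma> p t * \<gamma> p t)" using r(2)[OF t] by (intro mult_nonneg_nonneg[OF _ zero_le_square]) simp
          then show ?thesis by (simp add: mult_ac)
        qed (simp add: \<gamma>_def)
      qed
      finally show "positive_op (r *\<^sub>R (c p o\<^sub>L c p) - sand (c p) (Z.cfc f))" .
    qed
    also have "\<dots> = ennreal (r * mass (c p))"
      using tau_scaleR[OF ccP[OF p] r(1)] by (simp add: ctau[OF p] ennreal_mult r(1) m0)
    finally show ?thesis .
  qed
  have boundS: "\<tau> (sand (c p) (Z.cfc f)) \<le> ennreal ((f (\<zeta> p) + \<delta>') * mass (c p))" if p: "p \<in> S" for p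
  proof (rule bound[OF S(1)[OF p]])
    show "0 \<le> f (\<zeta> p) + \<delta>'" using f(3)[OF mem(3)[OF p]] d'(1) by simp
    fix t assume t: "t \<in> ?K" "g p t \<noteq> 0"
    have "\<bar>(t - \<zeta> p) $ i\<bar> \<le> 2 * \<eta>" for i
    proof -
      have "\<bar>t $ i - p $ i\<bar> < \<eta>"
        using g(3)[OF S(1)[OF p] t] component_le_norm_cart[of "t - p" i] by (simp add: dist_norm)
      then show ?thesis using near[OF p, of i] by simp
    qed
    then have "(\<Sum>i\<in>UNIV. \<bar>(t - \<zeta> p) $ i\<bar>) \<le> real CARD('n) * (2 * \<eta>)" by (intro sum_bounded_above) auto
    then have "dist t (\<zeta> p) < \<eta>0" using norm_le_l1_cart[of "t - \<zeta> p"] eta' by (simp add: dist_norm)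
    from eta0(2)[OF t(1) mem(3)[OF p] this] show "f t \<le> f (\<zeta> p) + \<delta>'" by (simp add: dist_real_def)
  qed
  have bound0: "\<tau> (sand (c p) (Z.cfc f)) = 0" if p: "p \<in> F - S" for p
  proof -
    have "bounded (f ` ?K)" by (intro compact_imp_bounded compact_continuous_image f compact_cbox)
    then obtain B where B: "\<And>t. t \<in> ?K \<Longrightarrow> \<bar>f t\<bar> \<le> B" by (auto simp: bounded_iff)
    have "f t \<le> \<bar>B\<bar>" if "t \<in> ?K" for t using B[OF that] by simp
    then have "\<tau> (sand (c p) (Z.cfc f)) \<le> ennreal (\<bar>B\<bar> * mass (c p))" using p by (intro bound) auto
    moreover have "mass (c p) = 0" using p m0[of p] by (simp add: S_def)
    ultimately show ?thesis by simp
  qed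
  have "\<tau> (Z.cfc (\<lambda>t. (\<omega> t)^2 * f t)) = \<tau> (\<Sum>p\<in>F. sand (c p) (Z.cfc f))"
    by (simp only: sum_sand[OF f(2)] power2_eq_square)
  also have "\<dots> = (\<Sum>p\<in>F. \<tau> (sand (c p) (Z.cfc f)))"
    by (rule tau_sum[OF F]) (rule sand_P[OF cA sc mf pf])
  also have "\<dots> = (\<Sum>p\<in>S. \<tau> (sand (c p) (Z.cfc f)))"
    by (rule sum.mono_neutral_right[OF F SF(1)]) (use bound0 in blast)
  also have "\<dots> \<le> (\<Sum>p\<in>S. ennreal ((f (\<zeta> p) + \<delta>') * mass (c p)))" by (rule sum_mono) (rule boundS)
  also have "\<dots> = ennreal (\<Sum>p\<in>S. (f (\<zeta> p) + \<delta>') * mass (c p))"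
    by (rule sum_ennreal) (use f(3) mem(3) d'(1) m0 in \<open>auto intro!: mult_nonneg_nonneg add_nonneg_nonneg less_imp_le\<close>)
  also have "(\<Sum>p\<in>S. (f (\<zeta> p) + \<delta>') * mass (c p)) = \<delta>' * Q + (\<Sum>p\<in>S. mass (c p) * f (\<zeta> p))"
    unfolding sumS[symmetric] by (simp add: sum_distrib_left sum.distrib[symmetric] algebra_simps)
  also have "\<dots> \<le> \<delta> + (\<Sum>p\<in>S. mass (c p) * f (u *\<^sub>R a p + v *\<^sub>R b p))"
    using d'(2) zeta by simp
  finally have r1: "\<tau> (Z.cfc (\<lambda>t. (\<omega> t)^2 * f t)) \<le> ennreal (\<delta> + (\<Sum>p\<in>S. mass (c p) * f (u *\<^sub>R a p + v *\<^sub>R b p)))"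
    by (simp add: ennreal_leI)
  have r2: "ennreal (\<Sum>p\<in>S. mass (c p) * f (a p)) \<le> \<tau> (X.cfc f)"
    unfolding S_def a_def by (rule jensen_sum[OF X XA f fX F cA sc fc C])
  have r3: "ennreal (\<Sum>p\<in>S. mass (c p) * f (b p)) \<le> \<tau> (Y.cfc f)"
    unfolding S_def b_def by (rule jensen_sum[OF Y YA f fY F cA sc fc C])
  have r4: "(\<Sum>p\<in>S. mass (c p)) = mass ?c0" using sumS by (simp only: Q_def)
  have r5: "\<forall>p\<in>S. 0 < mass (c p) \<and> a p \<in> ?K \<and> b p \<in> ?K" using S(2) mem by simp
  show ?thesis
    by (rule exI[of _ S], rule exI[of _ "\<lambda>p. mass (c p)"], rule exI[of _ a], rule exI[of _ b])
      (intro conjI SF(2) r1 r2 r3 r4 r5)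
qed

end

section \<open>Convexity of the trace functions\<close>

context ell_fun begin

text \<open>\<open>W\<close> replaces \<open>g\<close> at a convex combination by the combination of
  its values, which increases the sum because \<open>e\<close> is increasing; to \<open>W\<close>
  the scalar inequality applies.\<close>

lemma ell_convex_comp:
  fixes w :: "'k \<Rightarrow> real" and a b :: "'k \<Rightarrow> 'a::real_vector"
  assumes fin: "finite S" and w: "\<And>k. k \<in> S \<Longrightarrow> 0 < w k"
    and H1: "\<And>y. (\<And>k. k \<in> S \<Longrightarrow> y k \<in> D) \<Longrightarrow> (\<Sum>k\<in>S. w k * y k) \<in> D"
    and H2: "\<And>y. (\<And>k. k \<in> S \<Longrightarrow> y k \<in> D) \<Longrightarrow> q (\<Sum>k\<in>S. w k * y k) \<le> (\<Sum>k\<in>S. w k * q (y k))"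
    and H3: "\<And>y. (\<And>k. k \<in> S \<Longrightarrow> y k \<in> J) \<Longrightarrow> (\<Sum>k\<in>S. w k * y k) \<in> J"
    and g: "convex_on C g" "\<And>x. x \<in> C \<Longrightarrow> g x \<in> I"
    and ab: "\<And>k. k \<in> S \<Longrightarrow> a k \<in> C" "\<And>k. k \<in> S \<Longrightarrow> b k \<in> C"
    and uv: "0 \<le> u" "0 \<le> v" "u + v = 1"
  shows "\<exists>W\<in>J. (\<Sum>k\<in>S. w k * e (g (u *\<^sub>R a k + v *\<^sub>R b k))) \<le> W \<and>
    l W \<le> u * l (\<Sum>k\<in>S. w k * e (g (a k))) + v * l (\<Sum>k\<in>S. w k * e (g (b k)))"
proof (intro bexI conjI)
  let ?W = "\<Sum>k\<in>S. w k * e (u * g (a k) + v * g (b k))"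
  have gI: "u * g (a k) + v * g (b k) \<in> I" if "k \<in> S" for k
    using convexD[OF convex_I g(2)[OF ab(1)[OF that]] g(2)[OF ab(2)[OF that]] uv] by simp
  show "?W \<in> J" by (rule H3) (use gI in auto)
  show "l ?W \<le> u * l (\<Sum>k\<in>S. w k * e (g (a k))) + v * l (\<Sum>k\<in>S. w k * e (g (b k)))"
    by (rule ell_convex[OF fin w H1 H2 H3 _ _ uv]) (use g(2) ab in auto)
  show "(\<Sum>k\<in>S. w k * e (g (u *\<^sub>R a k + v *\<^sub>R b k))) \<le> ?W"
  proof (rule sum_mono)
    fix k assume k: "k \<in> S"
    have cC: "u *\<^sub>R a k + v *\<^sub>R b k \<in> C"
      using convexD[of C "a k" "b k" u v] g(1) ab k uv by (auto simp: convex_on_def)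
    have "g (u *\<^sub>R a k + v *\<^sub>R b k) \<le> u * g (a k) + v * g (b k)"
      by (rule g(1)[unfolded convex_on_def, THEN conjunct2, rule_format]) (use ab k uv in auto)
    then have "e (g (u *\<^sub>R a k + v *\<^sub>R b k)) \<le> e (u * g (a k) + v * g (b k))"
      using e_le_iff[OF g(2)[OF cC] gI[OF k]] by simp
    then show "w k * e (g (u *\<^sub>R a k + v *\<^sub>R b k)) \<le> w k * e (u * g (a k) + v * g (b k))"
      using w[OF k] by simp
  qed
qed

text \<open>Discharges \<open>H1\<close>, \<open>H2\<close> and \<open>H3\<close> of the scalar
  inequality for weights of sum one.\<close>

lemma probability_weights:
  fixes w :: "'k \<Rightarrow> real"
  assumes fin: "finite S" and w: "\<And>k. k \<in> S \<Longrightarrow> 0 < w k" and w1: "(\<Sum>k\<in>S. w k) = 1" and q: "convex_on D q"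
  shows "(\<And>k. k \<in> S \<Longrightarrow> y k \<in> D) \<Longrightarrow> (\<Sum>k\<in>S. w k * y k) \<in> D"
    "(\<And>k. k \<in> S \<Longrightarrow> y k \<in> D) \<Longrightarrow> q (\<Sum>k\<in>S. w k * y k) \<le> (\<Sum>k\<in>S. w k * q (y k))"
    "(\<And>k. k \<in> S \<Longrightarrow> y k \<in> J) \<Longrightarrow> (\<Sum>k\<in>S. w k * y k) \<in> J"
proof -
  have ne: "S \<noteq> {}" using w1 by auto
  have w0: "k \<in> S \<Longrightarrow> 0 \<le> w k" for k using w less_imp_le by blast
  show "(\<Sum>k\<in>S. w k * y k) \<in> D" if "\<And>k. k \<in> S \<Longrightarrow> y k \<in> D"
    using convex_sum[OF fin convex_interior[OF convex_J] w1 w0 that] by simp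
  show "(\<Sum>k\<in>S. w k * y k) \<in> J" if "\<And>k. k \<in> S \<Longrightarrow> y k \<in> J"
    using convex_sum[OF fin convex_J w1 w0 that] by simp
  show "q (\<Sum>k\<in>S. w k * y k) \<le> (\<Sum>k\<in>S. w k * q (y k))" if "\<And>k. k \<in> S \<Longrightarrow> y k \<in> D"
    using convex_on_sum[OF fin ne q w1 w0 that] by simp
qed

section \<open>Homogeneous \<open>q\<close>: its half-axis, and weights of arbitrary total
  mass\<close>

lemma q_neg: "y \<in> D \<Longrightarrow> q y < 0"
proof -
  assume y: "y \<in> D"
  then obtain t where t: "t \<in> interior I" "y = e t" using D_eq by blast
  have "0 < - q y" unfolding t(2) q_e[OF t(1)] using e'_pos[OF t(1)] e''_pos[OF t(1)] by simp
  then show ?thesis by simp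
qed

lemma homogeneous_0_notin:
  assumes h: "homogeneous_on D q"
  shows "0 \<notin> D"
proof
  assume z: "0 \<in> D"
  have "q (2 * 0) = 2 * q 0" using h z unfolding homogeneous_on_def by (metis zero_less_numeral)
  then have "q 0 = 2 * q 0" by (simp only: mult_zero_right)
  then show False using q_neg[OF z] by linarith
qed

lemma homogeneous_no_sign_change:
  assumes h: "homogeneous_on D q" and "y1 \<in> J" "y2 \<in> J" "y1 < 0" "0 < y2"
  shows False
proof -
  have "{y1<..<y2} \<subseteq> J"
  proof
    fix z assume "z \<in> {y1<..<y2}" then show "z \<in> J" by (auto intro: J_mem[OF assms(2,3)])
  qed
  then have "0 \<in> D" using assms(4,5) interior_maximal[of "{y1<..<y2}" J] by auto
  then show False using homogeneous_0_notin[OF h] by blast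
qed

text \<open>\<open>D\<close> is invariant under positive factors and misses 0, since
  \<open>q 0 = 2 * q 0\<close> contradicts \<open>q < 0\<close>. An interval \<open>J\<close> with
  points of both signs would have 0 in its interior.\<close>

lemma homogeneous_cases:
  assumes h: "homogeneous_on D q"
  obtains (pos) "{0<..} \<subseteq> D" "J \<subseteq> {0..}" | (neg) "{..<0} \<subseteq> D" "J \<subseteq> {..0}"
proof -
  obtain t where t: "t \<in> D" using h by (auto simp: homogeneous_on_def)
  have sc: "s * t \<in> D" if "0 < s" for s using h t that by (auto simp: homogeneous_on_def)
  have DJ: "y \<in> D \<Longrightarrow> y \<in> J" for y using interior_subset by blast
  have "t \<noteq> 0" using t homogeneous_0_notin[OF h] by blast
  then consider "0 < t" | "t < 0" by linarith
  then show ?thesis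
  proof cases
    case 1
    have "z \<in> D" if "0 < z" for z using sc[of "z / t"] 1 that by simp
    moreover have "0 \<le> y" if "y \<in> J" for y using homogeneous_no_sign_change[OF h that DJ[OF t]] 1 by (meson not_less)
    ultimately show ?thesis by (intro pos) auto
  next
    case 2
    have "z \<in> D" if "z < 0" for z using sc[of "z / t"] 2 that by (simp add: divide_neg_neg)
    moreover have "y \<le> 0" if "y \<in> J" for y using homogeneous_no_sign_change[OF h DJ[OF t] that] 2 by (meson not_less)
    ultimately show ?thesis by (intro neg) auto
  qed
qed

text \<open>On the positive half-axis \<open>q y = y * q 1\<close>, so the inequality for
  \<open>q\<close> is an equality for all positive weights, and no normalisation of the total mass
  is required.\<close>

lemma homogeneous_weights:
  fixes w :: "'k \<Rightarrow> real"
  assumes fin: "finite S" and ne: "S \<noteq> {}" and w: "\<And>k. k \<in> S \<Longrightarrow> 0 < w k"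
    and h: "homogeneous_on D q" and pos: "{0<..} \<subseteq> D" "J \<subseteq> {0..}"
  shows "(\<And>k. k \<in> S \<Longrightarrow> y k \<in> D) \<Longrightarrow> (\<Sum>k\<in>S. w k * y k) \<in> D"
    "(\<And>k. k \<in> S \<Longrightarrow> y k \<in> D) \<Longrightarrow> q (\<Sum>k\<in>S. w k * y k) \<le> (\<Sum>k\<in>S. w k * q (y k))"
    "(\<And>k. k \<in> S \<Longrightarrow> y k \<in> J) \<Longrightarrow> (\<Sum>k\<in>S. w k * y k) \<in> J"
proof -
  have DJ: "y \<in> D \<Longrightarrow> y \<in> J" for y using interior_subset by blast
  have Dpos: "0 < y" if "y \<in> D" for y
  proof -
    have "0 \<le> y" using DJ[OF that] pos(2) by auto
    moreover have "y \<noteq> 0" using that homogeneous_0_notin[OF h] by blast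
    ultimately show ?thesis by simp
  qed
  have sump: "0 < (\<Sum>k\<in>S. w k * y k)" if "\<And>k. k \<in> S \<Longrightarrow> y k \<in> D" for y
    by (rule sum_pos[OF fin ne]) (use w Dpos that in simp)
  show "(\<Sum>k\<in>S. w k * y k) \<in> D" if "\<And>k. k \<in> S \<Longrightarrow> y k \<in> D" using sump[OF that] pos(1) by auto
  have q1: "q y = y * q 1" if "0 < y" for y
  proof -
    have "1 \<in> D" using pos(1) by auto
    then have "q (y * 1) = y * q 1" using h that unfolding homogeneous_on_def by blast
    then show ?thesis by simp
  qed
  show "q (\<Sum>k\<in>S. w k * y k) \<le> (\<Sum>k\<in>S. w k * q (y k))" if y: "\<And>k. k \<in> S \<Longrightarrow> y k \<in> D"
  proof -
    have "(\<Sum>k\<in>S. w k * q (y k)) = (\<Sum>k\<in>S. w k * (y k * q 1))"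
      by (rule sum.cong[OF refl]) (simp only: q1[OF Dpos[OF y]])
    also have "\<dots> = (\<Sum>k\<in>S. w k * y k) * q 1" by (simp only: sum_distrib_right mult.assoc)
    also have "\<dots> = q (\<Sum>k\<in>S. w k * y k)" by (rule q1[OF sump[OF y], symmetric])
    finally show ?thesis by (simp only: order_refl)
  qed
  show "(\<Sum>k\<in>S. w k * y k) \<in> J" if y: "\<And>k. k \<in> S \<Longrightarrow> y k \<in> J"
  proof (cases "(\<Sum>k\<in>S. w k * y k) = 0")
    case False
    have "0 \<le> (\<Sum>k\<in>S. w k * y k)" using w y pos(2) by (intro sum_nonneg mult_nonneg_nonneg) (auto intro: less_imp_le)
    then have "(\<Sum>k\<in>S. w k * y k) \<in> D" using False pos(1) by auto
    then show ?thesis by (rule DJ)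
  next
    \<comment> \<open>Whether 0 belongs to \<open>J\<close> is not known in advance. A vanishing sum
      forces all \<open>y k = 0\<close>, and one of them exists because \<open>S\<close> is
      nonempty.\<close>
    case True
    have "\<forall>k\<in>S. w k * y k = 0"
      using True by (subst (asm) sum_nonneg_eq_0_iff[OF fin]) (rule mult_nonneg_nonneg[OF less_imp_le[OF w]], assumption, use y pos(2) in auto)
    moreover obtain k where k: "k \<in> S" using ne by blast
    ultimately have "y k = 0" using w[OF k] by auto
    then show ?thesis using y[OF k] True by simp
  qed
qed

lemma convex_on_e_comp:
  assumes e: "convex_on I e" and g: "convex_on C g" "\<And>x. x \<in> C \<Longrightarrow> g x \<in> I" and K: "K \<subseteq> C" "convex K"
    and f: "\<And>x. x \<in> C \<Longrightarrow> f x = e (g x)"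
  shows "convex_on K f"
  unfolding convex_on_def
proof (intro conjI K ballI allI impI)
  fix x y and u v :: real
  assume xy: "x \<in> K" "y \<in> K" and uv: "0 \<le> u" "0 \<le> v" "u + v = 1"
  have C: "x \<in> C" "y \<in> C" "u *\<^sub>R x + v *\<^sub>R y \<in> C" using xy K convexD[OF K(2) xy uv] by auto
  have gI: "u * g x + v * g y \<in> I" using convexD[OF convex_I g(2)[OF C(1)] g(2)[OF C(2)] uv] by simp
  have "g (u *\<^sub>R x + v *\<^sub>R y) \<le> u * g x + v * g y"
    by (rule g(1)[unfolded convex_on_def, THEN conjunct2, rule_format]) (use C uv in auto)
  then have "e (g (u *\<^sub>R x + v *\<^sub>R y)) \<le> e (u * g x + v * g y)" using e_le_iff[OF g(2)[OF C(3)] gI] by simp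
  also have "\<dots> \<le> u * e (g x) + v * e (g y)"
    using e[unfolded convex_on_def, THEN conjunct2, rule_format, OF g(2)[OF C(1)] g(2)[OF C(2)] uv] by simp
  finally show "f (u *\<^sub>R x + v *\<^sub>R y) \<le> u * f x + v * f y" using C f by simp
qed

end

context trace_alg begin

text \<open>
  Since \<open>\<omega>\<close> vanishes where \<open>f \<le> \<epsilon>\<close>, the operator \<open>c = \<omega>(Z)\<close> is a multiple of \<open>a = f(Z)\<close> and satisfies
  \<open>\<epsilon> c c \<le> c a c\<close>. For \<open>b\<close> of finite trace with distance less than \<open>\<epsilon> / 2\<close> to \<open>a\<close> this gives
  \<open>(\<epsilon> / 2) c c \<le> c b c\<close>, whose trace is at most that of \<open>b\<close>.
\<close>

lemma finite_cut:
  assumes Z: "comm_tuple (($) Z) m M" and ZA: "\<And>i. Z $ i \<in> A"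
    and f: "continuous_on (cbox m M) f" "\<And>t. t \<in> cbox m M \<Longrightarrow> 0 \<le> f t" and fA: "comm_tuple.cfc (($) Z) m M f \<in> A"
    and dd: "densely_defined A \<tau>" and e: "0 < \<epsilon>"
  defines "\<omega> \<equiv> (\<lambda>t. min 1 (max 0 (f t / \<epsilon> - 1)))"
  shows "comm_tuple.cfc (($) Z) m M \<omega> \<in> A"
    "\<tau> (comm_tuple.cfc (($) Z) m M \<omega> o\<^sub>L comm_tuple.cfc (($) Z) m M \<omega>) < \<infinity>"
proof -
  interpret comm_tuple "($) Z" m M by fact
  have com: "continuous_on K \<omega>" unfolding \<omega>_def using e by (intro continuous_intros f) auto
  have om: "0 \<le> \<omega> t" "\<omega> t \<le> 1" "f t \<le> \<epsilon> \<Longrightarrow> \<omega> t = 0" for t using e by (auto simp: \<omega>_def divide_le_eq_1)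
  define h where "h t = \<omega> t / max (f t) \<epsilon>" for t
  have ch: "continuous_on K h" unfolding h_def using e by (intro continuous_intros com f) auto
  have "h t * f t = \<omega> t" for t using e om(3)[of t] by (cases "f t \<le> \<epsilon>") (auto simp: h_def)
  then have eq: "cfc \<omega> = (cfc h o\<^sub>L cfc f)" unfolding cfc_mult[OF ch f(1), symmetric] by (intro cfc_cong) simp
  show cA: "cfc \<omega> \<in> A" unfolding eq by (rule cfc_ideal[OF A ZA ch fA])
  let ?c = "cfc \<omega>" and ?a = "cfc f"
  have sc: "selfadjoint ?c" by (rule cfc_selfadjoint[OF com])
  have pa: "positive_op ?a" by (rule cfc_positive[OF f])
  have "?a \<in> P" using fA pa by (simp add: P_iff)
  then have "?a \<in> closure {a \<in> P. \<tau> a < \<infinity>}" using dd by (auto simp: densely_defined_def)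
  moreover have "0 < \<epsilon> / 2" using e by simp
  ultimately obtain b where b: "b \<in> P" "\<tau> b < \<infinity>" "dist b ?a < \<epsilon> / 2"
    unfolding closure_approachable by blast
  have bp: "b \<in> A" "positive_op b" using b(1) by (auto simp: P_iff)
  obtain d where d: "d \<in> A" "selfadjoint d" "(d o\<^sub>L d) = b" using positive_sqrt_exists[OF A bp] by blast
  have ccP: "(?c o\<^sub>L ?c) \<in> P" by (rule cc_P[OF cA sc])
  have mb: "mult b" using bp by (intro mult_mem) (auto simp: positive_op_iff)
  have sbP: "sand ?c b \<in> P" by (rule sand_P[OF cA sc mb bp(2)])
  have low: "\<epsilon> * (norm (?c v))^2 \<le> inner (?a (?c v)) (?c v)" for v
  proof -
    have c1: "continuous_on K (\<lambda>t. f t - \<epsilon>)" by (intro continuous_intros f)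
    have "positive_op (cfc (\<lambda>t. \<omega> t * ((f t - \<epsilon>) * \<omega> t)))"
    proof (rule cfc_positive)
      show "continuous_on K (\<lambda>t. \<omega> t * ((f t - \<epsilon>) * \<omega> t))" by (intro continuous_intros com f)
      show "0 \<le> \<omega> t * ((f t - \<epsilon>) * \<omega> t)" for t
        using om(1)[of t] om(3)[of t] by (cases "f t \<le> \<epsilon>") auto
    qed
    moreover have "cfc (\<lambda>t. \<omega> t * ((f t - \<epsilon>) * \<omega> t)) = (?c o\<^sub>L ((?a - \<epsilon> *\<^sub>R id_blinfun) o\<^sub>L ?c))"
      by (simp only: cfc_mult[OF com continuous_on_mult[OF c1 com]] cfc_mult[OF c1 com] cfc_diff[OF f(1) continuous_on_const] cfc_const)
    ultimately have "0 \<le> inner (?c ((?a - \<epsilon> *\<^sub>R id_blinfun) (?c v))) v" by (simp add: positive_op_iff)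
    also have "\<dots> = inner ((?a - \<epsilon> *\<^sub>R id_blinfun) (?c v)) (?c v)" by (rule selfadjointD(2)[OF sc])
    finally show ?thesis by (simp add: blinfun_linear inner_diff power2_norm_eq_inner)
  qed
  have "\<tau> ((\<epsilon>/2) *\<^sub>R (?c o\<^sub>L ?c)) \<le> \<tau> (sand ?c b)"
  proof (rule tau_mono)
    show "(\<epsilon>/2) *\<^sub>R (?c o\<^sub>L ?c) \<in> P" using e by (intro P_scaleR ccP) simp
    show "sand ?c b \<in> A" using sbP by (simp add: P_iff)
    have "0 \<le> inner ((sand ?c b - (\<epsilon>/2) *\<^sub>R (?c o\<^sub>L ?c)) v) v" for v
    proof -
      let ?w = "?c v"
      have "\<bar>inner ((b - ?a) ?w) ?w\<bar> \<le> norm (b - ?a) * (norm ?w)^2" by (rule inner_op_le_norm)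
      also have "\<dots> \<le> (\<epsilon>/2) * (norm ?w)^2" using b(3) by (intro mult_right_mono) (auto simp: dist_norm)
      finally have "- ((\<epsilon>/2) * (norm ?w)^2) \<le> inner ((b - ?a) ?w) ?w" by linarith
      moreover have "inner ((b - ?a) ?w) ?w = inner (b ?w) ?w - inner (?a ?w) ?w"
        by (simp add: blinfun_linear inner_diff)
      ultimately have "inner (?a ?w) ?w - (\<epsilon>/2) * (norm ?w)^2 \<le> inner (b ?w) ?w" by linarith
      then have "\<epsilon> * (norm ?w)^2 - (\<epsilon>/2) * (norm ?w)^2 \<le> inner (b ?w) ?w" using low[of v] by linarith
      then have "(\<epsilon>/2) * (norm ?w)^2 \<le> inner (b ?w) ?w" by (simp add: field_simps)
      then show ?thesis
        by (simp add: sand_def blinfun_linear inner_diff selfadjointD(2)[OF sc, of _ v] power2_norm_eq_inner)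
    qed
    moreover have "selfadjoint (sand ?c b - (\<epsilon>/2) *\<^sub>R (?c o\<^sub>L ?c))"
      using sbP ccP by (auto simp: P_iff positive_op_iff)
    ultimately show "positive_op (sand ?c b - (\<epsilon>/2) *\<^sub>R (?c o\<^sub>L ?c))" by (simp add: positive_op_iff)
  qed
  also have "\<tau> (sand ?c b) = \<tau> (sand d (?c o\<^sub>L ?c))"
    using tau_swap[OF sc d(2) cstar_algebraD(4)[OF A d(1) cA]] by (simp only: sand_def d(3))
  also have "\<dots> \<le> \<tau> (d o\<^sub>L d)"
  proof (rule tau_mono)
    have mcc: "mult (?c o\<^sub>L ?c)" using ccP by (intro mult_mem) (auto simp: P_iff positive_op_iff)
    show "sand d (?c o\<^sub>L ?c) \<in> P" by (rule sand_P[OF d(1,2) mcc]) (use ccP in \<open>simp add: P_iff\<close>)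
    show "(d o\<^sub>L d) \<in> A" using bp d(3) by simp
    have "positive_op (cfc (\<lambda>t. 1 - \<omega> t * \<omega> t))"
    proof (rule cfc_positive)
      show "continuous_on K (\<lambda>t. 1 - \<omega> t * \<omega> t)" by (intro continuous_intros com)
      show "0 \<le> 1 - \<omega> t * \<omega> t" for t using mult_le_one[OF om(2) om(1) om(2), of t t] by simp
    qed
    then have "positive_op (id_blinfun - (?c o\<^sub>L ?c))"
      by (simp add: cfc_diff[OF continuous_on_const continuous_on_mult[OF com com]] cfc_mult[OF com com])
    then have "positive_op (sand d (id_blinfun - (?c o\<^sub>L ?c)))" unfolding sand_def by (rule positive_sandwich[OF d(2)])
    then show "positive_op ((d o\<^sub>L d) - sand d (?c o\<^sub>L ?c))" by (simp only: sand_linear)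
  qed
  also have "\<dots> < \<infinity>" using b(2) d(3) by simp
  finally have fin: "\<tau> ((\<epsilon>/2) *\<^sub>R (?c o\<^sub>L ?c)) < \<infinity>" .
  have "(?c o\<^sub>L ?c) = (2/\<epsilon>) *\<^sub>R ((\<epsilon>/2) *\<^sub>R (?c o\<^sub>L ?c))" using e by simp
  then have "\<tau> (?c o\<^sub>L ?c) = ennreal (2/\<epsilon>) * \<tau> ((\<epsilon>/2) *\<^sub>R (?c o\<^sub>L ?c))"
    using tau_scaleR[OF P_scaleR[OF ccP], of "\<epsilon>/2" "2/\<epsilon>"] e by simp
  then show "\<tau> (?c o\<^sub>L ?c) < \<infinity>" using fin by (simp add: ennreal_mult_less_top)
qed

end

section \<open>Tracial states\<close>

context trace_alg begin

lemma state_tau_le: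
  assumes id: "id_blinfun \<in> A" "\<tau> id_blinfun = 1" and a: "a \<in> P"
  shows "\<tau> a \<le> ennreal (norm a)"
proof -
  have sa: "selfadjoint a" using a by (simp add: P_iff positive_op_iff)
  have "positive_op (norm a *\<^sub>R id_blinfun - a)"
    using sa inner_op_le_norm[of a] by (auto simp: positive_op_iff blinfun_linear inner_diff power2_norm_eq_inner abs_le_iff)
  then have "\<tau> a \<le> \<tau> (norm a *\<^sub>R id_blinfun)" using a id by (intro tau_mono) (auto intro: cstar_algebraD[OF A])
  also have "\<dots> = ennreal (norm a)" using tau_scaleR[of id_blinfun "norm a"] id by (simp add: P_iff positive_op_iff)
  finally show ?thesis .
qed

text \<open>\<open>\<tau>\<close> has additive values on positive elements only, so \<open>f\<close>
  is raised by a constant \<open>N\<close>; normalisation makes the trace change by exactly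
  \<open>N\<close>.\<close>

lemma state_cfc:
  assumes id: "id_blinfun \<in> A" "\<tau> id_blinfun = 1" and X: "comm_tuple (($) X) m M" and XA: "\<And>i. X $ i \<in> A"
    and f: "continuous_on (cbox m M) f"
  shows "comm_tuple.cfc (($) X) m M f \<in> A"
    and "(\<And>t. t \<in> cbox m M \<Longrightarrow> 0 \<le> f t + N) \<Longrightarrow> 0 \<le> N \<Longrightarrow>
      \<tau> (comm_tuple.cfc (($) X) m M (\<lambda>t. f t + N)) = ennreal (tr (comm_tuple.cfc (($) X) m M f) + N)"
    and "(\<And>t. t \<in> cbox m M \<Longrightarrow> 0 \<le> f t + N) \<Longrightarrow> 0 \<le> N \<Longrightarrow> 0 \<le> tr (comm_tuple.cfc (($) X) m M f) + N"
proof -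
  interpret comm_tuple "($) X" m M by fact
  have mem: "cfc h \<in> A" if h: "continuous_on K h" for h
  proof -
    have "(cfc h o\<^sub>L id_blinfun) = cfc h" by (rule blinfun_eqI) simp
    then show ?thesis using cfc_ideal(1)[OF A XA h id(1)] by simp
  qed
  show "cfc f \<in> A" by (rule mem[OF f])
  assume p: "\<And>t. t \<in> K \<Longrightarrow> 0 \<le> f t + N" and N: "0 \<le> N"
  let ?b = "cfc (\<lambda>t. f t + N)" and ?c = "N *\<^sub>R (id_blinfun :: 'h op)"
  have c: "continuous_on K (\<lambda>t. f t + N)" by (intro continuous_intros f)
  have b: "?b \<in> P" using mem[OF c] cfc_positive[OF c p] by (simp add: P_iff)
  have idP: "id_blinfun \<in> P" using id by (simp add: P_iff positive_op_iff)
  have cP: "?c \<in> P" "\<tau> ?c = ennreal N" using P_scaleR[OF idP N] tau_scaleR[OF idP N] id by simp_all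
  have bf: "\<tau> ?b < \<infinity>" using state_tau_le[OF id b] by (rule le_less_trans) simp
  have "cfc f = ?b - ?c" by (simp add: cfc_add[OF f continuous_on_const])
  then have t: "tr (cfc f) = enn2real (\<tau> ?b) - N" using tr_diff[OF b cP(1) bf] cP(2) N by simp
  show "\<tau> ?b = ennreal (tr (cfc f) + N)" unfolding t using bf by (simp add: less_top)
  show "0 \<le> tr (cfc f) + N" unfolding t by simp
qed

lemma state_cfc_bounds:
  assumes id: "id_blinfun \<in> A" "\<tau> id_blinfun = 1" and X: "comm_tuple (($) X) m M" and XA: "\<And>i. X $ i \<in> A"
    and f: "continuous_on (cbox m M) f" and bd: "\<And>t. t \<in> cbox m M \<Longrightarrow> \<alpha> \<le> f t" "\<And>t. t \<in> cbox m M \<Longrightarrow> f t \<le> \<beta>"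
  shows "\<alpha> \<le> tr (comm_tuple.cfc (($) X) m M f)" "tr (comm_tuple.cfc (($) X) m M f) \<le> \<beta>"
proof -
  interpret comm_tuple "($) X" m M by fact
  note S = state_cfc[OF id X XA]
  have idP: "id_blinfun \<in> P" using id by (simp add: P_iff positive_op_iff)
  have ts: "\<tau> (r *\<^sub>R id_blinfun) = ennreal r" "r *\<^sub>R id_blinfun \<in> P" if "0 \<le> r" for r
    using tau_scaleR[OF idP that] P_scaleR[OF idP that] id by simp_all
  define N where "N = \<bar>\<alpha>\<bar> + \<bar>\<beta>\<bar>"
  have N: "0 \<le> N" "0 \<le> \<alpha> + N" "0 \<le> \<beta> + N" unfolding N_def by linarith+
  have fN: "0 \<le> f t + N" if "t \<in> K" for t using bd(1)[OF that] N by linarith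
  have c: "continuous_on K (\<lambda>t. f t + N)" by (intro continuous_intros f)
  have eq: "\<tau> (cfc (\<lambda>t. f t + N)) = ennreal (tr (cfc f) + N)" and nn: "0 \<le> tr (cfc f) + N"
    using S(2,3)[OF f fN N(1)] by blast+
  have P: "cfc (\<lambda>t. f t + N) \<in> P" using S(1)[OF c] cfc_positive[OF c fN] by (simp add: P_iff)
  have "positive_op (cfc (\<lambda>t. (f t + N) - (\<alpha> + N)))" "positive_op (cfc (\<lambda>t. (\<beta> + N) - (f t + N)))"
    by (rule cfc_positive, intro continuous_intros f, use bd in simp)+
  then have p: "positive_op (cfc (\<lambda>t. f t + N) - (\<alpha> + N) *\<^sub>R id_blinfun)"
    "positive_op ((\<beta> + N) *\<^sub>R id_blinfun - cfc (\<lambda>t. f t + N))"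
    by (simp_all only: cfc_diff[OF c continuous_on_const] cfc_diff[OF continuous_on_const c] cfc_const)
  have "ennreal (\<alpha> + N) \<le> ennreal (tr (cfc f) + N)"
    using tau_mono[OF ts(2)[OF N(2)] _ p(1)] P ts(1)[OF N(2)] eq by (simp add: P_iff)
  then show "\<alpha> \<le> tr (cfc f)" using nn by (simp add: ennreal_le_iff)
  have "ennreal (tr (cfc f) + N) \<le> ennreal (\<beta> + N)"
    using tau_mono[OF P _ p(2)] ts[OF N(3)] eq by (simp add: P_iff)
  then show "tr (cfc f) \<le> \<beta>" using N(3) by (simp add: ennreal_le_iff)
qed

end

context ell_fun begin

text \<open>\<open>J\<close> may fail to be closed, but a continuous \<open>f\<close> attains its
  extrema on the compact box, and the trace lies between these two elements of
  \<open>J\<close>.\<close>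

lemma state_trace_mem:
  assumes ta: "trace_alg A \<tau>" and id: "id_blinfun \<in> A" "\<tau> id_blinfun = 1"
    and X: "comm_tuple (($) X) m M" and XA: "\<And>i. X $ i \<in> A"
    and f: "continuous_on (cbox m M) f" "f ` cbox m M \<subseteq> J"
  shows "trace_sa A \<tau> (comm_tuple.cfc (($) X) m M f) \<in> J"
proof -
  interpret trace_alg A \<tau> by fact
  interpret comm_tuple "($) X" m M by fact
  have ne: "K \<noteq> {}" using K_ne by blast
  obtain s where s: "s \<in> K" "\<And>t. t \<in> K \<Longrightarrow> f s \<le> f t" using continuous_attains_inf[OF compact_cbox ne f(1)] by blast
  obtain r where r: "r \<in> K" "\<And>t. t \<in> K \<Longrightarrow> f t \<le> f r" using continuous_attains_sup[OF compact_cbox ne f(1)] by blast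
  note b = state_cfc_bounds[OF id X XA f(1) s(2) r(2)]
  show ?thesis by (rule J_mem[of "f s" "f r"]) (use f(2) s(1) r(1) b in auto)
qed

lemma state_trace_ell_convex:
  fixes X Y Z :: "('h::complex_hilbert_space op)^'n::finite"
  assumes ta: "trace_alg A \<tau>" and id: "id_blinfun \<in> A" "\<tau> id_blinfun = 1"
    and X: "comm_tuple (($) X) m M" and Y: "comm_tuple (($) Y) m M" and Z: "comm_tuple (($) Z) m M"
    and ZXY: "Z = u *\<^sub>R X + v *\<^sub>R Y" and uv: "0 \<le> u" "0 \<le> v" "u + v = 1"
    and XA: "\<And>i. X $ i \<in> A" and YA: "\<And>i. Y $ i \<in> A"
    and e: "convex_on I e" and q: "convex_on D q"
    and f: "continuous_on (cbox m M) f" "\<And>t. t \<in> cbox m M \<Longrightarrow> f t = e (g t)"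
    and g: "convex_on (cbox m M) g" "\<And>t. t \<in> cbox m M \<Longrightarrow> g t \<in> I"
  shows "l (trace_sa A \<tau> (comm_tuple.cfc (($) Z) m M f)) \<le>
    u * l (trace_sa A \<tau> (comm_tuple.cfc (($) X) m M f)) + v * l (trace_sa A \<tau> (comm_tuple.cfc (($) Y) m M f))"
proof -
  interpret trace_alg A \<tau> by fact
  interpret X: comm_tuple "($) X" m M by fact
  interpret Y: comm_tuple "($) Y" m M by fact
  interpret Z: comm_tuple "($) Z" m M by fact
  let ?K = "cbox m M"
  have ZA: "Z $ i \<in> A" for i using XA YA by (simp add: ZXY cstar_algebraD[OF A])
  have fJ: "f ` ?K \<subseteq> J" using f(2) g(2) by auto
  note mem = state_trace_mem[OF ta id _ _ f(1) fJ]
  have TX: "tr (X.cfc f) \<in> J" and TY: "tr (Y.cfc f) \<in> J" and TZ: "tr (Z.cfc f) \<in> J"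
    by (rule mem[OF X XA] mem[OF Y YA] mem[OF Z ZA])+
  define R where "R = u * l (tr (X.cfc f)) + v * l (tr (Y.cfc f))"
  have R: "R \<in> I" using convexD[OF convex_I l_in[OF TX] l_in[OF TY] uv] by (simp add: R_def)
  obtain N where N: "0 < N" "\<And>t. t \<in> ?K \<Longrightarrow> \<bar>f t\<bar> \<le> N"
    using compact_imp_bounded[OF compact_continuous_image[OF f(1) compact_cbox]] by (auto simp: bounded_pos)
  have fN: "0 \<le> f t + N" if "t \<in> ?K" for t using N(2)[OF that] by linarith
  have cN: "continuous_on ?K (\<lambda>t. f t + N)" by (intro continuous_intros f)
  have fc: "convex_on ?K f" by (rule convex_on_e_comp[OF e g subset_refl convex_box(1) f(2)])
  have fNc: "convex_on ?K (\<lambda>t. f t + N)" by (rule convex_on_add[OF fc]) (simp add: convex_on_def convex_box distrib_right[symmetric])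
  note SX = state_cfc[OF id X XA] and SY = state_cfc[OF id Y YA] and SZ = state_cfc[OF id Z ZA]
  have shift: "\<tau> (comm_tuple.cfc (($) V) m M (\<lambda>t. f t + N)) = ennreal (tr (comm_tuple.cfc (($) V) m M f) + N)"
    "0 \<le> tr (comm_tuple.cfc (($) V) m M f) + N" if "comm_tuple (($) V) m M" "\<And>i. V $ i \<in> A" for V
    by (rule state_cfc(2,3)[OF id that f(1) fN less_imp_le[OF N(1)]]; assumption)+
  have idid: "(id_blinfun o\<^sub>L id_blinfun) = (id_blinfun :: 'h op)" by (rule blinfun_eqI) simp
  have one: "Z.cfc (\<lambda>t. 1) = id_blinfun" by simp
  have m1: "mass (id_blinfun :: 'h op) = 1" by (simp add: mass_def idid id)
  \<comment> \<open>The error is kept outside \<open>l\<close>: the number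
    \<open>e R + \<delta>\<close> may lie outside \<open>J\<close>, so \<open>l\<close> is applied
    only after \<open>\<delta>\<close> has been removed.\<close>
  have "tr (Z.cfc f) \<le> e R + \<delta>" if \<delta>: "0 < \<delta>" for \<delta>
  proof -
    have "\<exists>(S::(real^'n) set) w a b. finite S \<and> (\<forall>k\<in>S. 0 < w k \<and> a k \<in> ?K \<and> b k \<in> ?K) \<and>
      (\<Sum>k\<in>S. w k) = mass (Z.cfc (\<lambda>t. 1)) \<and>
      \<tau> (Z.cfc (\<lambda>t. 1^2 * (f t + N))) \<le> ennreal (\<delta> + (\<Sum>k\<in>S. w k * (f (u *\<^sub>R a k + v *\<^sub>R b k) + N))) \<and>
      ennreal (\<Sum>k\<in>S. w k * (f (a k) + N)) \<le> \<tau> (X.cfc (\<lambda>t. f t + N)) \<and>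
      ennreal (\<Sum>k\<in>S. w k * (f (b k) + N)) \<le> \<tau> (Y.cfc (\<lambda>t. f t + N))"
      by (rule trace_discretization[OF X Y Z ZXY XA YA fNc cN fN SX(1)[OF cN] SY(1)[OF cN] SZ(1)[OF cN] continuous_on_const _ _ _ \<delta>])
        (simp_all add: idid id)
    then obtain S :: "(real^'n) set" and w a b where fin: "finite S"
      and wab: "\<And>k. k \<in> S \<Longrightarrow> 0 < w k" "\<And>k. k \<in> S \<Longrightarrow> a k \<in> ?K" "\<And>k. k \<in> S \<Longrightarrow> b k \<in> ?K"
      and w1: "(\<Sum>k\<in>S. w k) = 1"
      and tz: "\<tau> (Z.cfc (\<lambda>t. f t + N)) \<le> ennreal (\<delta> + (\<Sum>k\<in>S. w k * (f (u *\<^sub>R a k + v *\<^sub>R b k) + N)))"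
      and tx: "ennreal (\<Sum>k\<in>S. w k * (f (a k) + N)) \<le> \<tau> (X.cfc (\<lambda>t. f t + N))"
      and ty: "ennreal (\<Sum>k\<in>S. w k * (f (b k) + N)) \<le> \<tau> (Y.cfc (\<lambda>t. f t + N))"
      unfolding one m1 power_one mult_1_left by blast
    \<comment> \<open>Weights of sum one turn the shift by \<open>N\<close> into the same constant
      on both sides.\<close>
    have sN: "(\<Sum>k\<in>S. w k * (f (c k) + N)) = (\<Sum>k\<in>S. w k * f (c k)) + N" for c
      by (simp only: distrib_left sum.distrib sum_distrib_right[symmetric] w1 mult_1_left)
    have abK: "u *\<^sub>R a k + v *\<^sub>R b k \<in> ?K" if "k \<in> S" for k
      using convexD[OF convex_box(1) wab(2)[OF that] wab(3)[OF that] uv] .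
    have fg: "(\<Sum>k\<in>S. w k * f (c k)) = (\<Sum>k\<in>S. w k * e (g (c k)))" if "\<And>k. k \<in> S \<Longrightarrow> c k \<in> ?K" for c
      by (rule sum.cong[OF refl]) (simp only: f(2)[OF that])
    have "0 \<le> (\<Sum>k\<in>S. w k * (f (u *\<^sub>R a k + v *\<^sub>R b k) + N))"
      by (intro sum_nonneg mult_nonneg_nonneg less_imp_le[OF wab(1)] fN abK)
    then have "0 \<le> \<delta> + (\<Sum>k\<in>S. w k * (f (u *\<^sub>R a k + v *\<^sub>R b k) + N))" using \<delta> by simp
    then have 1: "tr (Z.cfc f) \<le> \<delta> + (\<Sum>k\<in>S. w k * e (g (u *\<^sub>R a k + v *\<^sub>R b k)))"
      using tz unfolding shift(1)[OF Z ZA] by (simp add: ennreal_le_iff sN fg abK)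
    have 2: "(\<Sum>k\<in>S. w k * e (g (a k))) \<le> tr (X.cfc f)"
      using tx shift(2)[OF X XA] unfolding shift(1)[OF X XA]
      by (simp add: ennreal_le_iff sN fg wab)
    have 3: "(\<Sum>k\<in>S. w k * e (g (b k))) \<le> tr (Y.cfc f)"
      using ty shift(2)[OF Y YA] unfolding shift(1)[OF Y YA]
      by (simp add: ennreal_le_iff sN fg wab)
    note pw = probability_weights[OF fin wab(1) w1 q]
    have "\<exists>W\<in>J. (\<Sum>k\<in>S. w k * e (g (u *\<^sub>R a k + v *\<^sub>R b k))) \<le> W \<and>
      l W \<le> u * l (\<Sum>k\<in>S. w k * e (g (a k))) + v * l (\<Sum>k\<in>S. w k * e (g (b k)))"
      by (rule ell_convex_comp[OF fin wab(1) _ _ _ g wab(2,3) uv]) (assumption | rule pw)+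
    then obtain W where W: "W \<in> J" "(\<Sum>k\<in>S. w k * e (g (u *\<^sub>R a k + v *\<^sub>R b k))) \<le> W"
      "l W \<le> u * l (\<Sum>k\<in>S. w k * e (g (a k))) + v * l (\<Sum>k\<in>S. w k * e (g (b k)))"
      by blast
    have wJ: "(\<Sum>k\<in>S. w k * e (g (c k))) \<in> J" if "\<And>k. k \<in> S \<Longrightarrow> c k \<in> ?K" for c
    proof (rule pw(3))
      fix k assume "k \<in> S"
      then show "e (g (c k)) \<in> J" using g(2)[OF that] by blast
    qed
    have "l (\<Sum>k\<in>S. w k * e (g (a k))) \<le> l (tr (X.cfc f))" "l (\<Sum>k\<in>S. w k * e (g (b k))) \<le> l (tr (Y.cfc f))"
      using l_le_iff[OF wJ TX, of a] l_le_iff[OF wJ TY, of b] wab 2 3 by simp_all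
    then have "u * l (\<Sum>k\<in>S. w k * e (g (a k))) + v * l (\<Sum>k\<in>S. w k * e (g (b k))) \<le> R"
      unfolding R_def by (intro add_mono mult_left_mono uv)
    with W(3) have "l W \<le> R" by (rule order_trans)
    then have "e (l W) \<le> e R" using e_le_iff[OF l_in[OF W(1)] R] by simp
    then show ?thesis using 1 W(2) e_l[OF W(1)] by linarith
  qed
  then have "tr (Z.cfc f) \<le> e R" by (rule field_le_epsilon)
  moreover have "e R \<in> J" using R by blast
  ultimately have "l (tr (Z.cfc f)) \<le> l (e R)" using l_le_iff[OF TZ] by blast
  then show ?thesis using l_e[OF R] by (simp add: R_def)
qed

end

lemma ereal_convex_on_const:
  assumes "convex S" "\<And>x. x \<in> S \<Longrightarrow> F x = c"
  shows "ereal_convex_on S F"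
  unfolding ereal_convex_on_def
proof (intro conjI assms(1) ballI allI impI)
  fix x y and u v :: real assume xy: "x \<in> S" "y \<in> S" and uv: "0 \<le> u" "0 \<le> v" "u + v = 1"
  have "c \<le> ereal u * c + ereal v * c"
  proof (cases c)
    case (real r)
    then show ?thesis using uv by (simp add: distrib_right[symmetric])
  next
    case PInf
    have "0 < u \<or> 0 < v" using uv by linarith
    then show ?thesis using PInf uv by (cases "u = 0"; cases "v = 0") auto
  qed simp
  then show "F (u *\<^sub>R x + v *\<^sub>R y) \<le> ereal u * F x + ereal v * F y"
    using assms(2)[OF xy(1)] assms(2)[OF xy(2)] assms(2)[OF convexD[OF assms(1) xy uv]] by simp
qed

section \<open>Endpoint values of \<open>l\<close> on a positive half-axis\<close>

context ell_fun begin

context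
  assumes pos: "{0<..} \<subseteq> J" and nonneg: "J \<subseteq> {0..}"
begin

abbreviation "L \<equiv> ext_endpoints J l"

lemma J_pos: "0 < y \<Longrightarrow> y \<in> J" and J_nonneg: "y \<in> J \<Longrightarrow> 0 \<le> y"
  using subsetD[OF pos, of y] subsetD[OF nonneg, of y] by (simp_all only: greaterThan_iff atLeast_iff)

lemma L_J: "y \<in> J \<Longrightarrow> L (ereal y) = ereal (l y)"
  unfolding ext_endpoints_def using imageI[of y J ereal] by simp

lemma islimpt_PInf: "\<infinity> islimpt ereal ` J"
proof (rule islimptI)
  fix T :: "ereal set" assume T: "\<infinity> \<in> T" "open T"
  then obtain x where "{ereal x<..} \<subseteq> T" by (meson open_PInfty)
  then have "ereal (max x 0 + 1) \<in> T" by auto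
  then show "\<exists>y\<in>ereal ` J. y \<in> T \<and> y \<noteq> \<infinity>" using J_pos[of "max x 0 + 1"] by force
qed

lemma islimpt_0: "0 islimpt ereal ` J"
proof (rule islimptI)
  fix T :: "ereal set" assume T: "0 \<in> T" "open T"
  then obtain b where b: "0 < b" "{0..<b} \<subseteq> T" using open_right[of T 0 1] by auto
  then obtain z where z: "0 < ereal z" "ereal z < b" using ereal_dense2 by blast
  then have "ereal z \<in> T" "z \<in> J" using b J_pos by auto
  then show "\<exists>y\<in>ereal ` J. y \<in> T \<and> y \<noteq> 0" using z by force
qed

lemma closure_J: "0 \<le> t \<Longrightarrow> t \<in> closure (ereal ` J)"
proof -
  assume t: "0 \<le> t"
  show ?thesis
  proof (cases "t = 0 \<or> t = \<infinity>")
    case True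
    then show ?thesis using islimpt_PInf islimpt_0 by (auto simp: closure_def)
  next
    case False
    then obtain r where r: "t = ereal r" "0 < r" using t by (cases t) auto
    then have "t \<in> ereal ` J" using J_pos[of r] by (metis imageI)
    then show ?thesis by (rule subsetD[OF closure_subset])
  qed
qed

lemma L_PInf: "L \<infinity> = (SUP y\<in>J. ereal (l y))"
proof -
  have "((\<lambda>s. ereal (l (real_of_ereal s))) \<longlongrightarrow> (SUP y\<in>J. ereal (l y))) (at \<infinity> within ereal ` J)"
  proof (rule order_tendstoI)
    fix a assume "a < (SUP y\<in>J. ereal (l y))"
    then obtain y where y: "y \<in> J" "a < ereal (l y)" by (auto simp: less_SUP_iff)
    have "a < ereal (l z)" if "z \<in> J" "y < z" for z
    proof -
      have "ereal (l y) \<le> ereal (l z)" using l_le_iff[OF y(1) that(1)] that by simp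
      with y(2) show ?thesis by (rule less_le_trans)
    qed
    then show "\<forall>\<^sub>F s in at \<infinity> within ereal ` J. a < ereal (l (real_of_ereal s))"
      unfolding eventually_at_topological by (intro exI[of _ "{ereal y<..}"]) auto
  next
    fix a assume a: "(SUP y\<in>J. ereal (l y)) < a"
    have "ereal (l z) < a" if "z \<in> J" for z
      using SUP_upper[OF that, of "\<lambda>y. ereal (l y)"] a by (rule le_less_trans)
    then show "\<forall>\<^sub>F s in at \<infinity> within ereal ` J. ereal (l (real_of_ereal s)) < a"
      unfolding eventually_at_topological by (intro exI[of _ UNIV]) auto
  qed
  then have "Lim (at \<infinity> within ereal ` J) (\<lambda>s. ereal (l (real_of_ereal s))) = (SUP y\<in>J. ereal (l y))"
    using islimpt_PInf by (intro tendsto_Lim) (simp_all add: trivial_limit_within)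
  then show ?thesis by (auto simp: ext_endpoints_def)
qed

lemma L_0_notin:
  assumes "0 \<notin> J"
  shows "L 0 = (INF y\<in>J. ereal (l y))"
proof -
  have "((\<lambda>s. ereal (l (real_of_ereal s))) \<longlongrightarrow> (INF y\<in>J. ereal (l y))) (at 0 within ereal ` J)"
  proof (rule order_tendstoI)
    fix a assume a: "(INF y\<in>J. ereal (l y)) < a"
    then obtain y where y: "y \<in> J" "ereal (l y) < a" by (auto simp: INF_less_iff)
    have "0 < y" using J_nonneg[OF y(1)] y(1) assms by (cases "y = 0") auto
    moreover have "ereal (l z) < a" if "z \<in> J" "z < y" for z
    proof -
      have "ereal (l z) \<le> ereal (l y)" using l_le_iff[OF that(1) y(1)] that by simp
      then show ?thesis using y(2) by (rule le_less_trans)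
    qed
    ultimately show "\<forall>\<^sub>F s in at 0 within ereal ` J. ereal (l (real_of_ereal s)) < a"
      unfolding eventually_at_topological by (intro exI[of _ "{..<ereal y}"]) auto
  next
    fix a assume a: "a < (INF y\<in>J. ereal (l y))"
    have "a < ereal (l z)" if "z \<in> J" for z
      using a INF_lower[OF that, of "\<lambda>y. ereal (l y)"] by (rule less_le_trans)
    then show "\<forall>\<^sub>F s in at 0 within ereal ` J. a < ereal (l (real_of_ereal s))"
      unfolding eventually_at_topological by (intro exI[of _ UNIV]) auto
  qed
  then have "Lim (at 0 within ereal ` J) (\<lambda>s. ereal (l (real_of_ereal s))) = (INF y\<in>J. ereal (l y))"
    using islimpt_0 by (intro tendsto_Lim) (simp_all add: trivial_limit_within)
  moreover have "0 \<notin> ereal ` J" using assms by (auto simp: zero_ereal_def)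
  ultimately show ?thesis by (simp add: ext_endpoints_def)
qed

lemma L_ge:
  assumes y: "y \<in> J" and t: "ereal y \<le> t"
  shows "ereal (l y) \<le> L t"
proof (cases t)
  case (real r)
  have "r \<in> J" using J_pos[of r] J_nonneg[OF y] t y real by (cases "r = y") auto
  then show ?thesis using l_le_iff[OF y] t real by (simp add: L_J)
next
  case PInf
  then show ?thesis using SUP_upper[OF y, of "\<lambda>y. ereal (l y)"] by (simp add: L_PInf)
qed (use t in simp)

lemma L_0_le:
  assumes t: "0 \<le> t"
  shows "L 0 \<le> L t"
proof (cases "0 \<in> J")
  case True
  then show ?thesis using L_ge[OF True] t L_J[OF True] by (simp add: zero_ereal_def)
next
  case False
  have I: "(INF y\<in>J. ereal (l y)) \<le> ereal (l y)" if "y \<in> J" for y by (rule INF_lower[OF that])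
  show ?thesis
  proof (cases "t = 0")
    case False
    then obtain y where y: "0 < ereal y" "ereal y < t" using t ereal_dense2[of 0 t] by (auto simp: le_less)
    then have "y \<in> J" using J_pos by simp
    then have "L 0 \<le> ereal (l y)" using I[of y] \<open>0 \<notin> J\<close> by (simp add: L_0_notin)
    also have "\<dots> \<le> L t" using L_ge[OF \<open>y \<in> J\<close>] y by simp
    finally show ?thesis .
  qed simp
qed

text \<open>Left continuity of the extended \<open>l\<close>. Lower semicontinuity gives access to
  the trace of \<open>f(Z)\<close> through smaller values only, and this lemma recovers the value
  itself.\<close>

lemma L_le:
  assumes t: "0 < t" and R: "\<And>s. 0 < s \<Longrightarrow> ereal s < t \<Longrightarrow> ereal (l s) \<le> R"
  shows "L t \<le> R"
proof (cases t)
  case (real r)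
  \<comment> \<open>The point \<open>r / 2\<close> of \<open>J\<close> bounds the search from below:
    a number \<open>z\<close> between \<open>l (r / 2)\<close> and \<open>l r\<close> lies in
    \<open>I\<close>, and \<open>e z\<close> is then an admissible \<open>s\<close>.\<close>
  have r: "0 < r" "r \<in> J" "r / 2 \<in> J" "r / 2 < r" using t real J_pos by auto
  have lr: "l (r / 2) < l r" using l_le_iff[OF r(2,3)] r(4) by (simp add: not_le[symmetric])
  have "ereal (l r) \<le> R"
  proof (rule ccontr)
    assume "\<not> ereal (l r) \<le> R"
    then have "max R (ereal (l (r / 2))) < ereal (l r)" using lr by simp
    then obtain z where z: "max R (ereal (l (r / 2))) < ereal z" "ereal z < ereal (l r)" using ereal_dense2 by blast
    then have z': "R < ereal z" "l (r / 2) < z" "z < l r" by auto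
    have zI: "z \<in> I" using I_mem[OF l_in[OF r(3)] l_in[OF r(2)], of z] z' by simp
    have "e (l (r / 2)) < e z" "e z < e (l r)" using e_less_iff zI l_in[OF r(2)] l_in[OF r(3)] z' by blast+
    then have "0 < e z" "e z < r" using e_l[OF r(2)] e_l[OF r(3)] r(1) by linarith+
    then have "ereal (l (e z)) \<le> R" using R real by simp
    then show False using z'(1) l_e[OF zI] by simp
  qed
  then show ?thesis using real r by (simp add: L_J)
next
  case PInf
  have "ereal (l y) \<le> R" if y: "y \<in> J" for y
  proof -
    have 0: "0 < y + 1" using J_nonneg[OF y] by simp
    have "ereal (l y) \<le> ereal (l (y + 1))" using l_le_iff[OF y J_pos[OF 0]] by simp
    also have "\<dots> \<le> R" using R[OF 0] PInf by simp
    finally show ?thesis .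
  qed
  then show ?thesis using PInf by (simp add: L_PInf SUP_least)
qed (use t in simp)

end

end

section \<open>Removal of the cut-off and lower semicontinuous traces\<close>

context trace_alg begin

text \<open>The cut-off equals 1 where \<open>2 * \<epsilon> \<le> f\<close>, so the cut function
  differs from \<open>f\<close> by at most \<open>2 * \<epsilon>\<close> everywhere. The cut
  operators thus converge in norm, and a sublevel set of \<open>\<tau>\<close> containing all of
  them would contain their limit.\<close>

lemma lsc_cut:
  assumes lsc: "lower_semicontinuous A \<tau>"
    and Z: "comm_tuple (($) Z) m M" and ZA: "\<And>i. Z $ i \<in> A"
    and f: "continuous_on (cbox m M) f" "\<And>t. t \<in> cbox m M \<Longrightarrow> 0 \<le> f t" and fA: "comm_tuple.cfc (($) Z) m M f \<in> A"
    and r: "r < \<tau> (comm_tuple.cfc (($) Z) m M f)"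
  shows "\<exists>\<epsilon>>0. r < \<tau> (comm_tuple.cfc (($) Z) m M (\<lambda>t. (min 1 (max 0 (f t / \<epsilon> - 1)))^2 * f t))"
proof -
  interpret comm_tuple "($) Z" m M by fact
  define \<omega> where "\<omega> \<epsilon> t = min 1 (max 0 (f t / \<epsilon> - 1))" for \<epsilon> t
  let ?F = "\<lambda>\<epsilon> t. (\<omega> \<epsilon> t)^2 * f t"
  have om: "0 \<le> \<omega> \<epsilon> t" "\<omega> \<epsilon> t \<le> 1" for \<epsilon> t by (auto simp: \<omega>_def)
  have om1: "\<omega> \<epsilon> t = 1" if "0 < \<epsilon>" "2 * \<epsilon> \<le> f t" for \<epsilon> t using that by (simp add: \<omega>_def field_simps)
  have com: "continuous_on K (\<omega> \<epsilon>)" if "0 < \<epsilon>" for \<epsilon> unfolding \<omega>_def using that by (intro continuous_intros f) auto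
  have cF: "continuous_on K (?F \<epsilon>)" if "0 < \<epsilon>" for \<epsilon> by (intro continuous_intros com[OF that] f)
  have PF: "cfc (?F \<epsilon>) \<in> P" if e: "0 < \<epsilon>" for \<epsilon>
  proof -
    have c2: "continuous_on K (\<lambda>t. (\<omega> \<epsilon> t)^2)" by (intro continuous_intros com[OF e])
    have "positive_op (cfc (?F \<epsilon>))" by (rule cfc_positive[OF cF[OF e]]) (use f(2) in simp)
    then show ?thesis using cfc_ideal(1)[OF A ZA c2 fA] by (simp add: P_iff cfc_mult[OF c2 f(1)])
  qed
  have near: "norm (cfc (?F \<epsilon>) - cfc f) \<le> 2 * \<epsilon>" if e: "0 < \<epsilon>" for \<epsilon>
    unfolding cfc_diff[OF cF[OF e] f(1), symmetric]
  proof (rule norm_cfc_le)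
    show "continuous_on K (\<lambda>t. ?F \<epsilon> t - f t)" by (intro continuous_intros cF[OF e] f)
    fix t assume t: "t \<in> K"
    show "\<bar>?F \<epsilon> t - f t\<bar> \<le> 2 * \<epsilon>"
    proof (cases "2 * \<epsilon> \<le> f t")
      case True then show ?thesis using om1[OF e True] e by simp
    next
      case False
      have "0 \<le> ?F \<epsilon> t" "?F \<epsilon> t \<le> f t" using f(2)[OF t] om[of \<epsilon> t] by (auto intro!: mult_left_le_one_le simp: power_le_one)
      then show ?thesis using False f(2)[OF t] by linarith
    qed
  qed
  have "\<exists>\<epsilon>>0. r < \<tau> (cfc (?F \<epsilon>))"
  proof (rule ccontr)
    assume "\<not> ?thesis"
    then have le: "\<tau> (cfc (?F \<epsilon>)) \<le> r" if "0 < \<epsilon>" for \<epsilon> using that by (meson not_less)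
    define \<eta> where "\<eta> n = inverse (real (Suc n))" for n
    have \<eta>: "0 < \<eta> n" for n by (simp add: \<eta>_def)
    have "(\<lambda>n. 2 * \<eta> n) \<longlonglongrightarrow> 2 * 0" unfolding \<eta>_def by (rule tendsto_mult[OF tendsto_const LIMSEQ_inverse_real_of_nat])
    then have e0: "(\<lambda>n. 2 * \<eta> n) \<longlonglongrightarrow> 0" by (simp only: mult_zero_right)
    have "(\<lambda>n. cfc (?F (\<eta> n)) - cfc f) \<longlonglongrightarrow> 0"
      by (rule Lim_null_comparison[OF always_eventually e0]) (intro allI near \<eta>)
    then have lim: "(\<lambda>n. cfc (?F (\<eta> n))) \<longlonglongrightarrow> cfc f" by (rule LIM_zero_cancel)
    obtain T where T: "closed T" "{a \<in> P. \<tau> a \<le> r} = P \<inter> T"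
      using lsc unfolding lower_semicontinuous_def closedin_closed by blast
    have "cfc (?F (\<eta> n)) \<in> T" for n using PF[OF \<eta>] le[OF \<eta>] T(2) by blast
    then have "cfc f \<in> T" using closed_sequentially[OF T(1) _ lim] by blast
    moreover have "cfc f \<in> P" using fA cfc_positive[OF f] by (simp add: P_iff)
    ultimately have "\<tau> (cfc f) \<le> r" using T(2) by blast
    then show False using r by simp
  qed
  then show ?thesis unfolding \<omega>_def .
qed

end

context ell_fun begin

text \<open>Any \<open>s\<close> below the trace of \<open>f(Z)\<close> survives the cut-off with
  room to spare, and that room pays for the discretisation error. Bounding \<open>l s\<close> for
  every such \<open>s\<close> is enough by left continuity, and the right-hand side may be
  infinite.\<close>

lemma trace_ell_convex:
  fixes X Y Z :: "('h::complex_hilbert_space op)^'n::finite"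
  assumes ta: "trace_alg A \<tau>" and dd: "densely_defined A \<tau>" and lsc: "lower_semicontinuous A \<tau>"
    and X: "comm_tuple (($) X) m M" and Y: "comm_tuple (($) Y) m M" and Z: "comm_tuple (($) Z) m M"
    and ZXY: "Z = u *\<^sub>R X + v *\<^sub>R Y" and uv: "0 \<le> u" "0 \<le> v" "u + v = 1"
    and XA: "\<And>i. X $ i \<in> A" and YA: "\<And>i. Y $ i \<in> A"
    and e: "convex_on I e" and h: "homogeneous_on D q" and pos: "{0<..} \<subseteq> D" and nonneg: "J \<subseteq> {0..}"
    and f: "continuous_on (cbox m M) f" "\<And>t. t \<in> cbox m M \<Longrightarrow> f t = e (g t)"
    and g: "convex_on (cbox m M) g" "\<And>t. t \<in> cbox m M \<Longrightarrow> g t \<in> I"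
    and fX: "comm_tuple.cfc (($) X) m M f \<in> A" and fY: "comm_tuple.cfc (($) Y) m M f \<in> A"
    and fZ: "comm_tuple.cfc (($) Z) m M f \<in> A"
  shows "ext_endpoints J l (enn2ereal (\<tau> (comm_tuple.cfc (($) Z) m M f))) \<le>
    ereal u * ext_endpoints J l (enn2ereal (\<tau> (comm_tuple.cfc (($) X) m M f))) +
    ereal v * ext_endpoints J l (enn2ereal (\<tau> (comm_tuple.cfc (($) Y) m M f)))"
proof -
  interpret trace_alg A \<tau> by fact
  interpret X: comm_tuple "($) X" m M by fact
  interpret Y: comm_tuple "($) Y" m M by fact
  interpret Z: comm_tuple "($) Z" m M by fact
  let ?K = "cbox m M" and ?L = "ext_endpoints J l"
  let ?tX = "enn2ereal (\<tau> (X.cfc f))" and ?tY = "enn2ereal (\<tau> (Y.cfc f))" and ?tZ = "enn2ereal (\<tau> (Z.cfc f))"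
  have posJ: "{0<..} \<subseteq> J" using pos interior_subset by (rule subset_trans)
  note J0 = J_nonneg[OF posJ nonneg]
  have ZA: "Z $ i \<in> A" for i using XA YA by (simp add: ZXY cstar_algebraD[OF A])
  have f0: "0 \<le> f t" if "t \<in> ?K" for t using J0[of "f t"] f(2)[OF that] g(2)[OF that] by simp
  have fc: "convex_on ?K f" by (rule convex_on_e_comp[OF e g subset_refl convex_box(1) f(2)])
  define R where "R = ereal u * ?L ?tX + ereal v * ?L ?tY"
  have up: "ereal (u * a + v * b) \<le> R" if "ereal a \<le> ?L ?tX" "ereal b \<le> ?L ?tY" for a b
  proof -
    have "ereal (u * a + v * b) = ereal u * ereal a + ereal v * ereal b" by simp
    also have "\<dots> \<le> R" unfolding R_def by (intro add_mono ereal_mult_left_mono that) (use uv in auto)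
    finally show ?thesis .
  qed
  have below: "ereal (l s) \<le> R" if s: "0 < s" "ereal s < ?tZ" for s
  proof -
    have sl: "ennreal s < \<tau> (Z.cfc f)" using s by (simp add: less_ennreal.rep_eq enn2ereal_ennreal)
    have "\<exists>\<epsilon>>0. ennreal s < \<tau> (Z.cfc (\<lambda>t. (min 1 (max 0 (f t / \<epsilon> - 1)))^2 * f t))"
      by (rule lsc_cut[OF lsc Z ZA f(1) f0 fZ sl])
    then obtain \<epsilon> where eps: "0 < \<epsilon>"
      and T: "ennreal s < \<tau> (Z.cfc (\<lambda>t. (min 1 (max 0 (f t / \<epsilon> - 1)))^2 * f t))" by blast
    define \<omega> where "\<omega> t = min 1 (max 0 (f t / \<epsilon> - 1))" for t
    have om: "continuous_on ?K \<omega>" "\<bar>\<omega> t\<bar> \<le> 1" for t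
      unfolding \<omega>_def using eps by (intro continuous_intros f) auto
    have omA: "Z.cfc \<omega> \<in> A" "\<tau> (Z.cfc \<omega> o\<^sub>L Z.cfc \<omega>) < \<infinity>"
      using finite_cut[OF Z ZA f(1) f0 fZ dd eps] unfolding \<omega>_def by blast+
    \<comment> \<open>The gap between \<open>s\<close> and a real number below the cut trace becomes
      the admissible error \<open>c' - s\<close>, so that the discretised sum still exceeds
      \<open>s\<close>.\<close>
    obtain c where c: "ennreal s < c" "c < \<tau> (Z.cfc (\<lambda>t. (\<omega> t)^2 * f t))"
      using T dense unfolding \<omega>_def by blast
    obtain c' where c': "c = ennreal c'" "0 \<le> c'" using c(2) by (cases c) auto
    have sc: "s < c'" using c(1) s unfolding c'(1) by (simp add: ennreal_less_iff)
    have "\<exists>(S::(real^'n) set) w a b. finite S \<and> (\<forall>k\<in>S. 0 < w k \<and> a k \<in> ?K \<and> b k \<in> ?K) \<and>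
      (\<Sum>k\<in>S. w k) = mass (Z.cfc \<omega>) \<and>
      \<tau> (Z.cfc (\<lambda>t. (\<omega> t)^2 * f t)) \<le> ennreal ((c' - s) + (\<Sum>k\<in>S. w k * f (u *\<^sub>R a k + v *\<^sub>R b k))) \<and>
      ennreal (\<Sum>k\<in>S. w k * f (a k)) \<le> \<tau> (X.cfc f) \<and>
      ennreal (\<Sum>k\<in>S. w k * f (b k)) \<le> \<tau> (Y.cfc f)"
      by (rule trace_discretization[OF X Y Z ZXY XA YA fc f(1) f0 fX fY fZ om omA]) (use sc in auto)
    then obtain S :: "(real^'n) set" and w a b where fin: "finite S"
      and wab: "\<And>k. k \<in> S \<Longrightarrow> 0 < w k" "\<And>k. k \<in> S \<Longrightarrow> a k \<in> ?K" "\<And>k. k \<in> S \<Longrightarrow> b k \<in> ?K"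
      and tz: "\<tau> (Z.cfc (\<lambda>t. (\<omega> t)^2 * f t)) \<le> ennreal ((c' - s) + (\<Sum>k\<in>S. w k * f (u *\<^sub>R a k + v *\<^sub>R b k)))"
      and tx: "ennreal (\<Sum>k\<in>S. w k * f (a k)) \<le> \<tau> (X.cfc f)"
      and ty: "ennreal (\<Sum>k\<in>S. w k * f (b k)) \<le> \<tau> (Y.cfc f)" by blast
    have abK: "u *\<^sub>R a k + v *\<^sub>R b k \<in> ?K" if "k \<in> S" for k
      using convexD[OF convex_box(1) wab(2)[OF that] wab(3)[OF that] uv] .
    have fg: "(\<Sum>k\<in>S. w k * f (c k)) = (\<Sum>k\<in>S. w k * e (g (c k)))" if "\<And>k. k \<in> S \<Longrightarrow> c k \<in> ?K" for c
      by (rule sum.cong[OF refl]) (simp only: f(2)[OF that])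
    have "ennreal c' < ennreal ((c' - s) + (\<Sum>k\<in>S. w k * f (u *\<^sub>R a k + v *\<^sub>R b k)))"
      using c(2) tz unfolding c'(1) by (rule less_le_trans)
    then have sW: "s < (\<Sum>k\<in>S. w k * e (g (u *\<^sub>R a k + v *\<^sub>R b k)))"
      unfolding ennreal_less_iff[OF c'(2)] by (simp add: fg abK)
    \<comment> \<open>Positivity of \<open>s\<close> rules out an empty sum; with homogeneous
      weights an empty sum could fall outside \<open>J\<close>.\<close>
    then have ne: "S \<noteq> {}" using s by auto
    note hw = homogeneous_weights[OF fin ne wab(1) h pos nonneg]
    have "\<exists>W\<in>J. (\<Sum>k\<in>S. w k * e (g (u *\<^sub>R a k + v *\<^sub>R b k))) \<le> W \<and>
      l W \<le> u * l (\<Sum>k\<in>S. w k * e (g (a k))) + v * l (\<Sum>k\<in>S. w k * e (g (b k)))"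
      by (rule ell_convex_comp[OF fin wab(1) _ _ _ g wab(2,3) uv]) (assumption | rule hw)+
    then obtain W where W: "W \<in> J" "(\<Sum>k\<in>S. w k * e (g (u *\<^sub>R a k + v *\<^sub>R b k))) \<le> W"
      "l W \<le> u * l (\<Sum>k\<in>S. w k * e (g (a k))) + v * l (\<Sum>k\<in>S. w k * e (g (b k)))"
      by blast
    have wJ: "(\<Sum>k\<in>S. w k * e (g (c k))) \<in> J" if "\<And>k. k \<in> S \<Longrightarrow> c k \<in> ?K" for c
    proof (rule hw(3))
      fix k assume "k \<in> S"
      then show "e (g (c k)) \<in> J" using g(2)[OF that] by blast
    qed
    have ge: "ereal (l (\<Sum>k\<in>S. w k * e (g (c k)))) \<le> ?L (enn2ereal T)"
      if cK: "\<And>k. k \<in> S \<Longrightarrow> c k \<in> ?K" and le: "ennreal (\<Sum>k\<in>S. w k * f (c k)) \<le> T" for c T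
    proof (rule L_ge[OF posJ nonneg])
      show "(\<Sum>k\<in>S. w k * e (g (c k))) \<in> J" by (rule wJ, rule cK)
      have "0 \<le> (\<Sum>k\<in>S. w k * e (g (c k)))" by (rule J0, rule wJ, rule cK)
      then show "ereal (\<Sum>k\<in>S. w k * e (g (c k))) \<le> enn2ereal T"
        using le by (simp add: fg cK less_eq_ennreal.rep_eq enn2ereal_ennreal)
    qed
    have "ereal (l s) \<le> ereal (l W)"
      using l_le_iff[OF J_pos[OF posJ nonneg s(1)] W(1)] sW W(2) by simp
    also have "\<dots> \<le> ereal (u * l (\<Sum>k\<in>S. w k * e (g (a k))) + v * l (\<Sum>k\<in>S. w k * e (g (b k))))" using W(3) by simp
    also have "\<dots> \<le> R" by (rule up[OF ge[OF wab(2) tx] ge[OF wab(3) ty]])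
    finally show ?thesis .
  qed
  have "?L ?tZ \<le> R"
  proof (cases "?tZ = 0")
    case False
    then have "0 < ?tZ" using enn2ereal_nonneg[of "\<tau> (Z.cfc f)"] by (simp add: less_le)
    then show ?thesis using below by (rule L_le[OF posJ nonneg])
  next
    \<comment> \<open>No positive \<open>s\<close> lies below a vanishing trace. Monotonicity is
      used instead: \<open>?L 0\<close> is below both terms on the right and is not
      \<open>\<infinity>\<close>, being at most \<open>?L 1\<close>.\<close>
    case True
    have "1 \<in> J" by (rule J_pos[OF posJ nonneg]) simp
    then have "?L 1 = ereal (l 1)" using L_J[OF posJ nonneg] by (simp add: one_ereal_def)
    moreover have "?L 0 \<le> ?L 1" by (rule L_0_le[OF posJ nonneg]) simp
    ultimately have "?L 0 \<noteq> \<infinity>" by auto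
    have le: "?L 0 \<le> ?L ?tX" "?L 0 \<le> ?L ?tY" by (rule L_0_le[OF posJ nonneg enn2ereal_nonneg])+
    show ?thesis
    proof (cases "?L 0")
      case (real r)
      have "r = u * r + v * r" using uv by (simp add: distrib_right[symmetric])
      then show ?thesis using up[of r r] le True real by simp
    qed (use True \<open>?L 0 \<noteq> \<infinity>\<close> in auto)
  qed
  then show ?thesis by (simp only: R_def)
qed

end

theorem theorem3:
  fixes I :: "real set" and e e' e'' l :: "real \<Rightarrow> real"
    and Is :: "'n::finite \<Rightarrow> real set" and f :: "real^'n \<Rightarrow> real"
    and A :: "'h::complex_hilbert_space op set" and As :: "'n \<Rightarrow> 'h op set"
  assumes "is_interval I"
    and "continuous_on I e" and "strict_mono_on I e" and "convex_on I e"
    and "\<And>t. t \<in> interior I \<Longrightarrow> (e has_real_derivative e' t) (at t)"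
    and "\<And>t. t \<in> interior I \<Longrightarrow> (e' has_real_derivative e'' t) (at t)"
    and "continuous_on (interior I) e''"
    and "\<And>t. t \<in> interior I \<Longrightarrow> e'' t > 0"
    and "\<And>t. t \<in> I \<Longrightarrow> l (e t) = t"
    and "convex_on (interior (e ` I)) (\<lambda>t. deriv l t / deriv (deriv l) t)"
    and "\<And>i. is_interval (Is i)"
    and "continuous_on (cube Is) f"
    and "l_convex_on I e (cube Is) f"
    and "cstar_algebra A"
    and "\<And>i. cstar_algebra (As i)" and "\<And>i. As i \<subseteq> A"
    and "\<And>i j a b. i \<noteq> j \<Longrightarrow> a \<in> As i \<Longrightarrow> b \<in> As j \<Longrightarrow> a o\<^sub>L b = b o\<^sub>L a"
  shows "(\<forall>\<tau>. tracial_state A \<tau> \<longrightarrow>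
            l_convex_on I e (sa_tuples As Is) (\<lambda>x. trace_sa A \<tau> (fun_op Is f x))) \<and>
         (homogeneous_on (interior (e ` I)) (\<lambda>t. deriv l t / deriv (deriv l) t) \<longrightarrow>
          (\<forall>t\<in>cube Is. f t \<ge> 0) \<longrightarrow>
          (\<forall>x\<in>sa_tuples As Is. fun_op Is f x \<in> A) \<longrightarrow>
          (\<forall>\<tau>. trace_on A \<tau> \<longrightarrow> densely_defined A \<tau> \<longrightarrow> lower_semicontinuous A \<tau> \<longrightarrow>
            ereal_l_convex_on (e ` I) l (sa_tuples As Is)
              (\<lambda>x. enn2ereal (\<tau> (fun_op Is f x)))))"
proof -
  interpret ell_fun I e e' e'' l by unfold_locales (fact assms)+
  obtain g where gc: "convex_on (cube Is) g" and gI: "g ` cube Is \<subseteq> I" and fg: "\<And>t. t \<in> cube Is \<Longrightarrow> f t = e (g t)"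
    using assms(13) unfolding l_convex_on_def by blast
  have XA: "X $ i \<in> A" if "X \<in> sa_tuples As Is" for X i
    using that assms(16) by (auto simp: sa_tuples_def)
  have conv: "convex (sa_tuples As Is)" if "\<exists>v::'h. v \<noteq> 0"
    by (rule convex_sa_tuples) (fact assms that)+
  have pair: "\<exists>m M. cbox m M \<subseteq> cube Is \<and> comm_tuple (($) X) m M \<and> comm_tuple (($) Y) m M \<and>
    (\<forall>u v. 0 \<le> u \<longrightarrow> 0 \<le> v \<longrightarrow> u + v = 1 \<longrightarrow> comm_tuple (($) (u *\<^sub>R X + v *\<^sub>R Y)) m M \<and>
       u *\<^sub>R X + v *\<^sub>R Y \<in> sa_tuples As Is)"
    if "X \<in> sa_tuples As Is" "Y \<in> sa_tuples As Is" "\<exists>v::'h. v \<noteq> 0" for X Y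
    by (rule sa_tuples_pair[where As = As and Is = Is]) (fact assms that)+
  have fop: "fun_op Is f X = comm_tuple.cfc (($) X) m M f" if "comm_tuple (($) X) m M" "cbox m M \<subseteq> cube Is"
    for X :: "('h op)^'n" and m M
    by (rule fun_op_eq_cfc[OF that(1) assms(11) that(2) assms(12)])
  have box: "continuous_on (cbox m M) f" "\<And>t. t \<in> cbox m M \<Longrightarrow> f t = e (g t)"
    "convex_on (cbox m M) g" "\<And>t. t \<in> cbox m M \<Longrightarrow> g t \<in> I" if K: "cbox m M \<subseteq> cube Is" for m M
    using continuous_on_subset[OF assms(12) K] convex_on_subset[OF gc K] fg gI K by (auto simp: convex_box)
  show ?thesis
  proof (intro conjI allI impI)
    fix \<tau> assume "tracial_state A \<tau>"
    then have ta: "trace_alg A \<tau>" and id: "id_blinfun \<in> A" "\<tau> id_blinfun = 1"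
      using assms(14) by (auto simp: tracial_state_def trace_alg_def)
    interpret trace_alg A \<tau> by fact
    \<comment> \<open>On the zero space the identity is 0 and its trace would be 0, which
      normalisation forbids.\<close>
    have ne: "\<exists>v::'h. v \<noteq> 0"
    proof (rule ccontr)
      assume "\<nexists>v::'h. v \<noteq> 0"
      then have "(id_blinfun :: 'h op) = 0" by (intro blinfun_eqI) auto
      then show False using id(2) tau_0 by simp
    qed
    let ?T = "\<lambda>X. tr (fun_op Is f X)"
    have TJ: "?T X \<in> J" if X: "X \<in> sa_tuples As Is" for X
    proof -
      obtain m M where K: "cbox m M \<subseteq> cube Is" and cX: "comm_tuple (($) X) m M" using pair[OF X X ne] by blast
      have "f ` cbox m M \<subseteq> J" using box(2,4)[OF K] by auto
      then show ?thesis unfolding fop[OF cX K] by (rule state_trace_mem[OF ta id cX XA[OF X] box(1)[OF K]])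
    qed
    have "convex_on (sa_tuples As Is) (\<lambda>X. l (?T X))"
      unfolding convex_on_def
    proof (intro conjI conv[OF ne] ballI allI impI)
      fix X Y and u v :: real
      assume X: "X \<in> sa_tuples As Is" and Y: "Y \<in> sa_tuples As Is" and uv: "0 \<le> u" "0 \<le> v" "u + v = 1"
      obtain m M where K: "cbox m M \<subseteq> cube Is" and cX: "comm_tuple (($) X) m M" and cY: "comm_tuple (($) Y) m M"
        and cZ: "comm_tuple (($) (u *\<^sub>R X + v *\<^sub>R Y)) m M"
        using pair[OF X Y ne] uv by blast
      show "l (?T (u *\<^sub>R X + v *\<^sub>R Y)) \<le> u * l (?T X) + v * l (?T Y)"
        unfolding fop[OF cX K] fop[OF cY K] fop[OF cZ K]
        by (rule state_trace_ell_convex[OF ta id cX cY cZ refl uv XA[OF X] XA[OF Y] assms(4,10) box[OF K]])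
    qed
    moreover have "(\<lambda>X. l (?T X)) ` sa_tuples As Is \<subseteq> I" using l_in[OF TJ] by blast
    moreover have "?T X = e (l (?T X))" if "X \<in> sa_tuples As Is" for X using e_l[OF TJ[OF that]] by simp
    ultimately show "l_convex_on I e (sa_tuples As Is) ?T" unfolding l_convex_on_def by blast
  next
    fix \<tau>
    assume h: "homogeneous_on D q" and f0: "\<forall>t\<in>cube Is. 0 \<le> f t"
      and fA: "\<forall>X\<in>sa_tuples As Is. fun_op Is f X \<in> A"
      and "trace_on A \<tau>" and dd: "densely_defined A \<tau>" and lsc: "lower_semicontinuous A \<tau>"
    then have ta: "trace_alg A \<tau>" using assms(14) by (simp add: trace_alg_def)
    interpret trace_alg A \<tau> by fact
    let ?T = "\<lambda>X. enn2ereal (\<tau> (fun_op Is f X))"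
    \<comment> \<open>Covers the zero space and the negative half-axis, where every
      \<open>fun_op Is f X\<close> is 0 and the function to be tested is constant.\<close>
    have trivial: "ereal_l_convex_on J l (sa_tuples As Is) ?T"
      if cS: "convex (sa_tuples As Is)" and z: "\<And>X. X \<in> sa_tuples As Is \<Longrightarrow> fun_op Is f X = 0" and cl: "0 \<in> closure (ereal ` J)"
    proof -
      have T0: "?T X = 0" if "X \<in> sa_tuples As Is" for X using z[OF that] tau_0 by (simp add: zero_ennreal.rep_eq)
      then have "ereal_convex_on (sa_tuples As Is) (\<lambda>X. ext_endpoints J l (?T X))"
        by (intro ereal_convex_on_const[OF cS, where c = "ext_endpoints J l 0"]) simp
      then show ?thesis using T0 cl by (auto simp: ereal_l_convex_on_def)
    qed
    have ops: "(a :: 'h op) = 0" if "\<nexists>v::'h. v \<noteq> 0" for a using that by (intro blinfun_eqI) auto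
    have convS: "convex (sa_tuples As Is)"
    proof (cases "\<exists>v::'h. v \<noteq> 0")
      case False
      have "X = Y" for X Y :: "('h op)^'n"
        unfolding vec_eq_iff using ops[OF False, of "X $ _"] ops[OF False, of "Y $ _"] by simp
      then show ?thesis unfolding convex_def by metis
    qed (rule conv)
    from h show "ereal_l_convex_on J l (sa_tuples As Is) ?T"
    proof (cases rule: homogeneous_cases)
      \<comment> \<open>The values of \<open>f\<close> lie in \<open>J\<close>, hence are at most 0,
        and they are nonnegative by assumption; so \<open>f\<close> vanishes on the box.\<close>
      case neg
      have J0: "y \<in> J" if "y < 0" for y using neg(1) that interior_subset by blast
      have "fun_op Is f X = 0" if X: "X \<in> sa_tuples As Is" for X
      proof (cases "\<exists>v::'h. v \<noteq> 0")
        case True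
        obtain m M where K: "cbox m M \<subseteq> cube Is" and cX: "comm_tuple (($) X) m M" using pair[OF X X True] by blast
        interpret comm_tuple "($) X" m M by fact
        have "f t = 0" if t: "t \<in> cbox m M" for t
        proof (rule antisym)
          have "e (g t) \<in> J" using box(4)[OF K t] by blast
          then show "f t \<le> 0" using box(2)[OF K t] neg(2) by auto
          show "0 \<le> f t" using f0 K t by blast
        qed
        then have "cfc f = cfc (\<lambda>t. 0)" by (rule cfc_cong)
        then show ?thesis unfolding fop[OF cX K] by simp
      qed (rule ops)
      moreover have "0 \<in> closure (ereal ` J)"
        unfolding closure_iff_nhds_not_empty
      proof (intro allI impI)
        fix B V :: "ereal set" assume B: "V \<subseteq> B" "open V" "0 \<in> V"
        then obtain b where b: "b < 0" "{b<..0} \<subseteq> V" using open_left[of V 0 "- 1"] by auto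
        then obtain y where y: "b < ereal y" "ereal y < 0" using ereal_dense2 by blast
        then have "ereal y \<in> V" "y \<in> J" using b(2) J0[of y] by auto
        then show "ereal ` J \<inter> B \<noteq> {}" using B(1) by blast
      qed
      ultimately show ?thesis using trivial[OF convS] by blast
    next
      case pos
      have posJ: "{0<..} \<subseteq> J" using pos(1) interior_subset by (rule subset_trans)
      have cl: "?T X \<in> closure (ereal ` J)" for X by (rule closure_J[OF posJ pos(2) enn2ereal_nonneg])
      show ?thesis
      proof (cases "\<exists>v::'h. v \<noteq> 0")
        case False
        show ?thesis
          by (rule trivial[OF convS _ closure_J[OF posJ pos(2) order_refl]]) (rule ops[OF False])
      next
        case True
        have "ereal_convex_on (sa_tuples As Is) (\<lambda>X. ext_endpoints J l (?T X))"
          unfolding ereal_convex_on_def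
        proof (intro conjI convS ballI allI impI)
          fix X Y and u v :: real
          assume X: "X \<in> sa_tuples As Is" and Y: "Y \<in> sa_tuples As Is" and uv: "0 \<le> u" "0 \<le> v" "u + v = 1"
          obtain m M where K: "cbox m M \<subseteq> cube Is" and cX: "comm_tuple (($) X) m M" and cY: "comm_tuple (($) Y) m M"
            and cZ: "comm_tuple (($) (u *\<^sub>R X + v *\<^sub>R Y)) m M"
            using pair[OF X Y True] uv by blast
          have Z: "u *\<^sub>R X + v *\<^sub>R Y \<in> sa_tuples As Is" by (rule convexD[OF convS X Y uv])
          note fA' = fA[rule_format, OF X, unfolded fop[OF cX K]] fA[rule_format, OF Y, unfolded fop[OF cY K]]
            fA[rule_format, OF Z, unfolded fop[OF cZ K]]
          show "ext_endpoints J l (?T (u *\<^sub>R X + v *\<^sub>R Y))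
            \<le> ereal u * ext_endpoints J l (?T X) + ereal v * ext_endpoints J l (?T Y)"
            unfolding fop[OF cX K] fop[OF cY K] fop[OF cZ K]
            by (rule trace_ell_convex[OF ta dd lsc cX cY cZ refl uv XA[OF X] XA[OF Y] assms(4) h pos box[OF K] fA'])
        qed
        then show ?thesis using cl by (auto simp: ereal_l_convex_on_def)
      qed
    qed
  qed
qed

end
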